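(* Let $S$ be a left cancellative monoid. Then $$\ker(q\circ\rho_{\chi_e})=\ker\rho_{\chi_e}+C_r^*(\mathcal G_P(S)\setminus\partial\mathcal G_P(S)).$$ In particular there exists a $*$-homomorphism $\theta:C^*_e(\partial\mathcal G_P(S))\to C_r^*(S)/I$ such that $\theta\circ\phi=q\circ\rho_{\chi_e}$.
   Context: $S$ is a left cancellative monoid with identity $e$ ($st=st'\Rightarrow t=t'$). Identify $s\in S$ with the injection $S\to S$, $t\mapsto st$, and let $s^{-1}$ be the inverse partial bijection $sS\to S$. $I_\ell(S)$ is the inverse semigroup of partial bijections of $S$ generated by the left translations; its elements are the compositions $s_{2n}^{-1}s_{2n-1}\cdots s_2^{-1}s_1$. $\mathcal J(S)=\{\operatorname{dom} g: g\in I_\ell(S)\}$ is the set of constructible right ideals, a semigroup under intersection. $p_S$ is the identity map of $S$. For $m\ge1$, $\{X_1,\dots,X_m\}\subseteq\mathcal J(S)$ is a foundation set for $X\in\mathcal J(S)$ if $X_i\subseteq X$ for all $i$ and every nonempty $Y\in\mathcal J(S)$ with $Y\subseteq X$ meets some $X_i$. **Groupoids.** Characters are nonzero semigroup homomorphisms $\chi:\mathcal J(S)\to\{0,1\}$, with the topology of pointwise convergence. $\chi_s(X)=1$ iff $s\in X$. $\Omega(S)=\overline{\{\chi_s:s\in S\}}$. $\mathcal G_P(S)$ is the set of classes $[g,\chi]$ of pairs $(g,\chi)\in I_\ell(S)\times\Omega(S)$ with $\chi(\operatorname{dom}g)=1$, where $(g_1,\chi_1)\sim(g_2,\chi_2)$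 iff $\chi_1=\chi_2$ and $g_1|_A=g_2|_A$ for some $A\in\mathcal J(S)$ with $\chi_1(A)=1$. Product: $[g,\chi][h,\psi]=[gh,\psi]$ if $\chi=\psi(h^{-1}(\cdot))$; source $\chi$, range $\chi(g^{-1}(\cdot))$; unit space $\Omega(S)$ via $\chi\mapsto[p_S,\chi]$; a basis of topology consists of the sets $D(g,U)=\{[g,\chi]:\chi\in U\}$, $U\subseteq\{\chi\in\Omega(S):\chi(\operatorname{dom}g)=1\}$ open. This is a locally compact, possibly non-Hausdorff, étale groupoid. A filter on $\mathcal J(S)$ is a nonempty family of nonempty members of $\mathcal J(S)$ closed under finite intersections and upward inclusion; $\Omega_{\max}(S)\subseteq\Omega(S)$ is the set of characters $\chi$ such that $\chi^{-1}(1)$ is a maximal filter. $\partial\Omega(S)=\overline{\Omega_{\max}(S)}$ is a closed invariant subset, and $\partial\mathcal G_P(S)$ is the reduction of $\mathcal G_P(S)$ to $\partial\Omega(S)$. **C$^*$-algebras.** For an étale groupoid $\mathcal G$, $C_c(\mathcal G)$ is the span of the functions in $C_c(V)$ ($V\subseteq\mathcal G$ open Hausdorff) extended by $0$, a convolution $*$-algebra; $\rho_x$ ($x\in\mathcal G^{(0)}$) is its left regular representation on $\ell^2(\mathcal G_x)$, $\mathcal G_x=s^{-1}(x)$, $(\rho_x(f)\xi)(g)=\sum_{h\in \mathcal G^{r(g)}}f(h)\xi(h^{-1}g)$; $\|f\|_r=\sup_x\|\rho_x(f)\|$, and $C^*_r(\mathcal G)$ is the completion. $C_r^*(\mathcal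 G_P(S)\setminus\partial\mathcal G_P(S))$ is a closed ideal of $C^*_r(\mathcal G_P(S))$, and $\|\cdot\|_e$ is the unique C$^*$-norm on $C_c(\partial\mathcal G_P(S))$ for which restriction of functions induces a short exact sequence $0\to C_r^*(\mathcal G_P(S)\setminus\partial\mathcal G_P(S))\to C_r^*(\mathcal G_P(S))\xrightarrow{\phi}C^*_e(\partial\mathcal G_P(S))\to0$, where $C^*_e$ is the completion in $\|\cdot\|_e$. $C^*_r(S)\subseteq B(\ell^2(S))$ is generated by the isometries $\lambda_s\delta_t=\delta_{st}$. For $X\subseteq S$, $1_X$ is the projection onto $\overline{\mathrm{span}}\{\delta_s:s\in X\}$. $I$ is the closed two-sided ideal of $C_r^*(S)$ generated by the projections $1_{X\setminus\bigcup_{i=1}^mX_i}$ with $m\ge1$, $X,X_i\in\mathcal J(S)$, $\{X_1,\dots,X_m\}$ a foundation set for $X$. $q:C^*_r(S)\to C_r^*(S)/I$ is the quotient map. Identifying $\mathcal G_P(S)_{\chi_e}$ with $S$ via $[s,\chi_e]\leftrightarrow s$, $\rho_{\chi_e}$ becomes a surjective $*$-homomorphism $C_r^*(\mathcal G_P(S))\to C_r^*(S)$ with $\rho_{\chi_e}(1_{D(s,\Omega(S))})=\lambda_s$. *)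

theory Defs
  imports "HOL-Analysis.Analysis"
begin

section \<open>The Hilbert spaces of square-summable families\<close>

typedef 'i ell2 = "{f :: 'i \<Rightarrow> complex. (\<lambda>i. (cmod (f i))\<^sup>2) summable_on UNIV}"
  morphisms ell2_apply Abs_ell2
  by (rule exI[of _ "\<lambda>_. 0"]) simp

setup_lifting type_definition_ell2

lemma ell2_L2_set_bound:
  assumes "(\<lambda>i. (cmod (f i))\<^sup>2) summable_on UNIV" "finite F"
  shows "L2_set (\<lambda>i. cmod (f i)) F \<le> sqrt (\<Sum>\<^sub>\<infinity>i. (cmod (f i))\<^sup>2)"
  unfolding L2_set_def
  by (intro real_sqrt_le_mono finite_sum_le_infsum assms) auto

lemma ell2_add_bound:
  assumes f: "(\<lambda>i. (cmod (f i))\<^sup>2) summable_on UNIV"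
    and g: "(\<lambda>i. (cmod (g i))\<^sup>2) summable_on UNIV"
  shows "(\<lambda>i. (cmod (f i + g i))\<^sup>2) summable_on UNIV"
    and "sqrt (\<Sum>\<^sub>\<infinity>i. (cmod (f i + g i))\<^sup>2)
      \<le> sqrt (\<Sum>\<^sub>\<infinity>i. (cmod (f i))\<^sup>2) + sqrt (\<Sum>\<^sub>\<infinity>i. (cmod (g i))\<^sup>2)"
proof -
  let ?b = "sqrt (\<Sum>\<^sub>\<infinity>i. (cmod (f i))\<^sup>2) + sqrt (\<Sum>\<^sub>\<infinity>i. (cmod (g i))\<^sup>2)"
  have b0: "0 \<le> ?b" by (intro add_nonneg_nonneg real_sqrt_ge_zero infsum_nonneg) auto
  have bound: "(\<Sum>i\<in>F. (cmod (f i + g i))\<^sup>2) \<le> ?b\<^sup>2" if "finite F" for F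
  proof -
    have "L2_set (\<lambda>i. cmod (f i + g i)) F \<le> L2_set (\<lambda>i. cmod (f i) + cmod (g i)) F"
      by (intro L2_set_mono norm_triangle_ineq) auto
    also have "\<dots> \<le> L2_set (\<lambda>i. cmod (f i)) F + L2_set (\<lambda>i. cmod (g i)) F"
      by (rule L2_set_triangle_ineq)
    also have "\<dots> \<le> ?b"
      by (intro add_mono ell2_L2_set_bound f g that)
    finally show ?thesis
      unfolding L2_set_def by (rule sqrt_le_D)
  qed
  show summ: "(\<lambda>i. (cmod (f i + g i))\<^sup>2) summable_on UNIV"
    by (intro nonneg_bdd_above_summable_on bdd_aboveI[of _ "?b\<^sup>2"]) (auto intro: bound)
  have "(\<Sum>\<^sub>\<infinity>i. (cmod (f i + g i))\<^sup>2) \<le> ?b\<^sup>2"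
    by (intro infsum_le_finite_sums summ bound) auto
  then show "sqrt (\<Sum>\<^sub>\<infinity>i. (cmod (f i + g i))\<^sup>2) \<le> ?b"
    using b0 real_le_lsqrt by presburger
qed

lift_definition ell2_scale :: "complex \<Rightarrow> 'i ell2 \<Rightarrow> 'i ell2" is "\<lambda>c f i. c * f i"
  by (simp add: norm_mult power_mult_distrib summable_on_cmult_right)

lift_definition ell2_delta :: "'i \<Rightarrow> 'i ell2" is "\<lambda>j i. if i = j then 1 else 0"
proof -
  fix j :: 'i
  have "(\<lambda>i. (cmod (if i = j then 1 else 0))\<^sup>2) summable_on {j}" by simp
  also have "?this \<longleftrightarrow> (\<lambda>i. (cmod (if i = j then 1 else 0))\<^sup>2) summable_on UNIV"
    by (rule summable_on_cong_neutral) auto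
  finally show "(\<lambda>i. (cmod (if i = j then 1 else 0))\<^sup>2) summable_on UNIV" .
qed

instantiation ell2 :: (type) real_normed_vector
begin

lift_definition zero_ell2 :: "'a ell2" is "\<lambda>_. 0" by simp

lift_definition plus_ell2 :: "'a ell2 \<Rightarrow> 'a ell2 \<Rightarrow> 'a ell2" is "\<lambda>f g i. f i + g i"
  by (rule ell2_add_bound(1))

lift_definition uminus_ell2 :: "'a ell2 \<Rightarrow> 'a ell2" is "\<lambda>f i. - f i" by simp

definition minus_ell2 :: "'a ell2 \<Rightarrow> 'a ell2 \<Rightarrow> 'a ell2" where "x - y = x + - y" for x y :: "'a ell2"

lift_definition scaleR_ell2 :: "real \<Rightarrow> 'a ell2 \<Rightarrow> 'a ell2" is "\<lambda>r f i. r *\<^sub>R f i"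
  by (simp add: power_mult_distrib summable_on_cmult_right)

lift_definition norm_ell2 :: "'a ell2 \<Rightarrow> real" is "\<lambda>f. sqrt (\<Sum>\<^sub>\<infinity>i. (cmod (f i))\<^sup>2)" .

definition sgn_ell2 :: "'a ell2 \<Rightarrow> 'a ell2" where "sgn x = inverse (norm x) *\<^sub>R x" for x :: "'a ell2"

definition dist_ell2 :: "'a ell2 \<Rightarrow> 'a ell2 \<Rightarrow> real" where "dist x y = norm (x - y)" for x y :: "'a ell2"

definition uniformity_ell2 :: "('a ell2 \<times> 'a ell2) filter" where
  "uniformity_ell2 = (INF e\<in>{0<..}. principal {(x, y). dist x y < e})"

definition open_ell2 :: "'a ell2 set \<Rightarrow> bool" where
  "open_ell2 U \<longleftrightarrow> (\<forall>x\<in>U. \<forall>\<^sub>F (x', y) in uniformity. x' = x \<longrightarrow> y \<in> U)"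

instance
proof
  fix x y z :: "'a ell2" and a b :: real
  show "x + y + z = x + (y + z)" by transfer (simp add: add.assoc)
  show "x + y = y + x" by transfer (simp add: add.commute)
  show "0 + x = x" by transfer simp
  show "- x + x = 0" by transfer simp
  show "x - y = x + - y" by (rule minus_ell2_def)
  show "a *\<^sub>R (x + y) = a *\<^sub>R x + a *\<^sub>R y" by transfer (simp add: scaleR_add_right)
  show "(a + b) *\<^sub>R x = a *\<^sub>R x + b *\<^sub>R x" by transfer (simp add: scaleR_add_left)
  show "a *\<^sub>R b *\<^sub>R x = (a * b) *\<^sub>R x" by transfer simp
  show "1 *\<^sub>R x = x" by transfer simp
  show "sgn x = inverse (norm x) *\<^sub>R x" by (rule sgn_ell2_def)
  show "dist x y = norm (x - y)" by (rule dist_ell2_def)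
  show "(uniformity :: ('a ell2 \<times> 'a ell2) filter)
      = (INF e\<in>{0<..}. principal {(x, y). dist x y < e})"
    by (rule uniformity_ell2_def)
  show "open U = (\<forall>x\<in>U. \<forall>\<^sub>F (x', y) in uniformity. x' = x \<longrightarrow> y \<in> U)" for U :: "'a ell2 set"
    by (rule open_ell2_def)
  show "norm x = 0 \<longleftrightarrow> x = 0"
  proof (transfer, safe)
    fix f :: "'a \<Rightarrow> complex"
    assume f: "(\<lambda>i. (cmod (f i))\<^sup>2) summable_on UNIV"
      and 0: "sqrt (\<Sum>\<^sub>\<infinity>i. (cmod (f i))\<^sup>2) = 0"
    have "(cmod (f i))\<^sup>2 = 0" for i
      by (rule nonneg_infsum_le_0D[OF _ f]) (use 0 in auto)
    then show "f = (\<lambda>_. 0)" by auto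
  qed simp
  show "norm (x + y) \<le> norm x + norm y" by transfer (rule ell2_add_bound(2))
  show "norm (a *\<^sub>R x) = \<bar>a\<bar> * norm x"
    by transfer (simp add: power_mult_distrib infsum_cmult_right' real_sqrt_mult)
qed

end

definition ell2_inner :: "'i ell2 \<Rightarrow> 'i ell2 \<Rightarrow> complex" where
  "ell2_inner x y = (\<Sum>\<^sub>\<infinity>i. ell2_apply x i * cnj (ell2_apply y i))"


section \<open>Normed \<open>*\<close>-algebras\<close>

record 'v star_algebra =
  carrier :: "'v set"
  zero :: 'v
  add :: "'v \<Rightarrow> 'v \<Rightarrow> 'v"
  scale :: "complex \<Rightarrow> 'v \<Rightarrow> 'v"
  mult :: "'v \<Rightarrow> 'v \<Rightarrow> 'v"
  star :: "'v \<Rightarrow> 'v"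
  anorm :: "'v \<Rightarrow> real"

definition diff :: "'v star_algebra \<Rightarrow> 'v \<Rightarrow> 'v \<Rightarrow> 'v" where
  "diff A x y = add A x (scale A (- 1) y)"

definition star_hom :: "'v star_algebra \<Rightarrow> 'w star_algebra \<Rightarrow> ('v \<Rightarrow> 'w) \<Rightarrow> bool" where
  "star_hom A B h \<longleftrightarrow> h \<in> carrier A \<rightarrow> carrier B \<and>
    (\<forall>x\<in>carrier A. \<forall>y\<in>carrier A. h (add A x y) = add B (h x) (h y)) \<and>
    (\<forall>c. \<forall>x\<in>carrier A. h (scale A c x) = scale B c (h x)) \<and>
    (\<forall>x\<in>carrier A. \<forall>y\<in>carrier A. h (mult A x y) = mult B (h x) (h y)) \<and>
    (\<forall>x\<in>carrier A. h (star A x) = star B (h x))"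

definition ker :: "'v star_algebra \<Rightarrow> 'w star_algebra \<Rightarrow> ('v \<Rightarrow> 'w) \<Rightarrow> 'v set" where
  "ker A B h = {x \<in> carrier A. h x = zero B}"

definition set_sum :: "'v star_algebra \<Rightarrow> 'v set \<Rightarrow> 'v set \<Rightarrow> 'v set" where
  "set_sum A X Y = {add A x y | x y. x \<in> X \<and> y \<in> Y}"

definition norm_closed :: "'v star_algebra \<Rightarrow> 'v set \<Rightarrow> bool" where
  "norm_closed A K \<longleftrightarrow> (\<forall>u. \<forall>x\<in>carrier A.
    (\<forall>n::nat. u n \<in> K) \<and> (\<lambda>n. anorm A (diff A (u n) x)) \<longlonglongrightarrow> 0 \<longrightarrow> x \<in> K)"

definition closed_star_subalgebra :: "'v star_algebra \<Rightarrow> 'v set \<Rightarrow> bool" where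
  "closed_star_subalgebra A K \<longleftrightarrow> K \<subseteq> carrier A \<and> zero A \<in> K \<and>
    (\<forall>x\<in>K. \<forall>y\<in>K. add A x y \<in> K \<and> mult A x y \<in> K) \<and>
    (\<forall>x\<in>K. star A x \<in> K \<and> (\<forall>c. scale A c x \<in> K)) \<and> norm_closed A K"

definition closed_ideal :: "'v star_algebra \<Rightarrow> 'v set \<Rightarrow> bool" where
  "closed_ideal A K \<longleftrightarrow> K \<subseteq> carrier A \<and> zero A \<in> K \<and>
    (\<forall>x\<in>K. \<forall>y\<in>K. add A x y \<in> K) \<and> (\<forall>c. \<forall>x\<in>K. scale A c x \<in> K) \<and>
    (\<forall>a\<in>carrier A. \<forall>x\<in>K. mult A a x \<in> K \<and> mult A x a \<in> K) \<and> norm_closed A K"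

definition generated_cstar_algebra :: "'v star_algebra \<Rightarrow> 'v set \<Rightarrow> 'v star_algebra" where
  "generated_cstar_algebra A G =
    A\<lparr>carrier := \<Inter>{K. closed_star_subalgebra A K \<and> G \<subseteq> K}\<rparr>"

definition generated_closed_ideal :: "'v star_algebra \<Rightarrow> 'v set \<Rightarrow> 'v set" where
  "generated_closed_ideal A G = \<Inter>{K. closed_ideal A K \<and> G \<subseteq> K}"

definition coset :: "'v star_algebra \<Rightarrow> 'v set \<Rightarrow> 'v \<Rightarrow> 'v set" where
  "coset A K x = {add A x k | k. k \<in> K}"

text \<open>Operations on cosets (and below on classes of Cauchy sequences and on germs) are written as
  unions over all representatives; all members of such a union coincide.\<close>

definition quotient_algebra :: "'v star_algebra \<Rightarrow> 'v set \<Rightarrow> 'v set star_algebra" where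
  "quotient_algebra A K = \<lparr>
    carrier = coset A K ` carrier A,
    zero = coset A K (zero A),
    add = (\<lambda>X Y. \<Union>x\<in>X. \<Union>y\<in>Y. coset A K (add A x y)),
    scale = (\<lambda>c X. \<Union>x\<in>X. coset A K (scale A c x)),
    mult = (\<lambda>X Y. \<Union>x\<in>X. \<Union>y\<in>Y. coset A K (mult A x y)),
    star = (\<lambda>X. \<Union>x\<in>X. coset A K (star A x)),
    anorm = (\<lambda>X. INF x\<in>X. anorm A x)\<rparr>"

definition cstar_norm :: "'v star_algebra \<Rightarrow> bool" where
  "cstar_norm A \<longleftrightarrow>
    (\<forall>x\<in>carrier A. 0 \<le> anorm A x \<and> (anorm A x = 0 \<longleftrightarrow> x = zero A)) \<and>
    (\<forall>c. \<forall>x\<in>carrier A. anorm A (scale A c x) = cmod c * anorm A x) \<and>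
    (\<forall>x\<in>carrier A. \<forall>y\<in>carrier A. anorm A (add A x y) \<le> anorm A x + anorm A y) \<and>
    (\<forall>x\<in>carrier A. \<forall>y\<in>carrier A. anorm A (mult A x y) \<le> anorm A x * anorm A y) \<and>
    (\<forall>x\<in>carrier A. anorm A (mult A (star A x) x) = (anorm A x)\<^sup>2)"


subsection \<open>Completion\<close>

definition cauchy_seqs :: "'v star_algebra \<Rightarrow> (nat \<Rightarrow> 'v) set" where
  "cauchy_seqs A = {u. (\<forall>n. u n \<in> carrier A) \<and>
    (\<forall>e>0. \<exists>M. \<forall>m\<ge>M. \<forall>n\<ge>M. anorm A (diff A (u m) (u n)) < e)}"

definition cauchy_rel :: "'v star_algebra \<Rightarrow> ((nat \<Rightarrow> 'v) \<times> (nat \<Rightarrow> 'v)) set" where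
  "cauchy_rel A = {(u, v). u \<in> cauchy_seqs A \<and> v \<in> cauchy_seqs A \<and>
    (\<lambda>n. anorm A (diff A (u n) (v n))) \<longlonglongrightarrow> 0}"

definition cstar_completion :: "'v star_algebra \<Rightarrow> (nat \<Rightarrow> 'v) set star_algebra" where
  "cstar_completion A = \<lparr>
    carrier = cauchy_seqs A // cauchy_rel A,
    zero = cauchy_rel A `` {\<lambda>_. zero A},
    add = (\<lambda>X Y. \<Union>u\<in>X. \<Union>v\<in>Y. cauchy_rel A `` {\<lambda>n. add A (u n) (v n)}),
    scale = (\<lambda>c X. \<Union>u\<in>X. cauchy_rel A `` {\<lambda>n. scale A c (u n)}),
    mult = (\<lambda>X Y. \<Union>u\<in>X. \<Union>v\<in>Y. cauchy_rel A `` {\<lambda>n. mult A (u n) (v n)}),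
    star = (\<lambda>X. \<Union>u\<in>X. cauchy_rel A `` {\<lambda>n. star A (u n)}),
    anorm = (\<lambda>X. THE r. \<forall>u\<in>X. (\<lambda>n. anorm A (u n)) \<longlonglongrightarrow> r)\<rparr>"

text \<open>The extension to completions (with target the completion of \<open>B\<close>) of a bounded linear map
  \<open>T\<close> into \<open>B\<close>.\<close>

definition completion_map ::
    "'w star_algebra \<Rightarrow> ('v \<Rightarrow> 'w) \<Rightarrow> (nat \<Rightarrow> 'v) set \<Rightarrow> (nat \<Rightarrow> 'w) set" where
  "completion_map B T X = (\<Union>u\<in>X. cauchy_rel B `` {\<lambda>n. T (u n)})"


subsection \<open>Bounded operators on \<open>\<ell>\<^sup>2\<close>\<close>

text \<open>The library's bounded operators are only real-linear, hence the carrier condition.\<close>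

definition bounded_operators :: "('i ell2 \<Rightarrow>\<^sub>L 'i ell2) star_algebra" where
  "bounded_operators = \<lparr>
    carrier = {T. \<forall>c x. blinfun_apply T (ell2_scale c x) = ell2_scale c (blinfun_apply T x)},
    zero = 0,
    add = (+),
    scale = (\<lambda>c T. Blinfun (\<lambda>x. ell2_scale c (blinfun_apply T x))),
    mult = (o\<^sub>L),
    star = (\<lambda>T. THE T'. \<forall>x y. ell2_inner (blinfun_apply T x) y = ell2_inner x (blinfun_apply T' y)),
    anorm = norm\<rparr>"


section \<open>Topological groupoids and their convolution algebras\<close>

record ('g, 'u) groupoid =
  arrows :: "'g set"
  units :: "'u set"
  src :: "'g \<Rightarrow> 'u"
  rng :: "'g \<Rightarrow> 'u"
  gmult :: "'g \<Rightarrow> 'g \<Rightarrow> 'g"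
  ginv :: "'g \<Rightarrow> 'g"
  gtop :: "'g topology"

definition reduction :: "('g, 'u) groupoid \<Rightarrow> 'u set \<Rightarrow> ('g, 'u) groupoid" where
  "reduction G D = (let R = {g \<in> arrows G. src G g \<in> D \<and> rng G g \<in> D} in
    G\<lparr>arrows := R, units := D, gtop := subtopology (gtop G) R\<rparr>)"

definition groupoid_diff :: "('g, 'u) groupoid \<Rightarrow> ('g, 'u) groupoid \<Rightarrow> ('g, 'u) groupoid" where
  "groupoid_diff G H = G\<lparr>arrows := arrows G - arrows H, units := units G - units H,
    gtop := subtopology (gtop G) (arrows G - arrows H)\<rparr>"

text \<open>Functions on a groupoid are total functions vanishing outside the set of arrows, so that
  extension by zero from a subgroupoid does not change the function.\<close>

definition Cc_on :: "('g, 'u) groupoid \<Rightarrow> 'g set \<Rightarrow> ('g \<Rightarrow> complex) set" where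
  "Cc_on G V = (let T = subtopology (gtop G) V in
    {f. continuous_map T euclidean f \<and> compactin T (T closure_of {x \<in> V. f x \<noteq> 0}) \<and>
      (\<forall>x. x \<notin> V \<longrightarrow> f x = 0)})"

definition Cc :: "('g, 'u) groupoid \<Rightarrow> ('g \<Rightarrow> complex) set" where
  "Cc G = {\<lambda>x. \<Sum>k<n. c k * F k x | (n::nat) (c :: nat \<Rightarrow> complex) F.
    \<forall>k<n. \<exists>V. openin (gtop G) V \<and> Hausdorff_space (subtopology (gtop G) V) \<and> F k \<in> Cc_on G V}"

definition convolution ::
    "('g, 'u) groupoid \<Rightarrow> ('g \<Rightarrow> complex) \<Rightarrow> ('g \<Rightarrow> complex) \<Rightarrow> 'g \<Rightarrow> complex" where
  "convolution G f1 f2 = (\<lambda>g. if g \<in> arrows G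
    then \<Sum>\<^sub>\<infinity>h\<in>{h \<in> arrows G. rng G h = rng G g}. f1 h * f2 (gmult G (ginv G h) g) else 0)"

definition involution :: "('g, 'u) groupoid \<Rightarrow> ('g \<Rightarrow> complex) \<Rightarrow> 'g \<Rightarrow> complex" where
  "involution G f = (\<lambda>g. if g \<in> arrows G then cnj (f (ginv G g)) else 0)"

definition convolution_algebra ::
    "('g, 'u) groupoid \<Rightarrow> (('g \<Rightarrow> complex) \<Rightarrow> real) \<Rightarrow> ('g \<Rightarrow> complex) star_algebra" where
  "convolution_algebra G N = \<lparr>
    carrier = Cc G,
    zero = (\<lambda>_. 0),
    add = (\<lambda>f1 f2 g. f1 g + f2 g),
    scale = (\<lambda>c f g. c * f g),
    mult = convolution G,
    star = involution G,
    anorm = N\<rparr>"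

text \<open>The left regular representation at the unit \<open>x\<close>. The space \<open>\<ell>\<^sup>2(G\<^sub>x)\<close> is the subspace of the
  families over all of \<open>'g\<close> supported on \<open>G\<^sub>x\<close>, and the operator is extended by zero to its
  orthogonal complement; this does not affect its norm.\<close>

definition regular_rep ::
    "('g, 'u) groupoid \<Rightarrow> 'u \<Rightarrow> ('g \<Rightarrow> complex) \<Rightarrow> 'g ell2 \<Rightarrow> 'g ell2" where
  "regular_rep G x f \<xi> = Abs_ell2 (\<lambda>g. if g \<in> arrows G \<and> src G g = x
    then \<Sum>\<^sub>\<infinity>h\<in>{h \<in> arrows G. rng G h = rng G g}. f h * ell2_apply \<xi> (gmult G (ginv G h) g)
    else 0)"

text \<open>The supremum is taken in the nonnegative reals, whence the \<open>0\<close>, which matters only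
  for the empty groupoid.\<close>

definition reduced_norm :: "('g, 'u) groupoid \<Rightarrow> ('g \<Rightarrow> complex) \<Rightarrow> real" where
  "reduced_norm G f = Sup (insert 0 ((\<lambda>x. onorm (regular_rep G x f)) ` units G))"

definition reduced_Cc :: "('g, 'u) groupoid \<Rightarrow> ('g \<Rightarrow> complex) star_algebra" where
  "reduced_Cc G = convolution_algebra G (reduced_norm G)"

definition reduced_cstar :: "('g, 'u) groupoid \<Rightarrow> (nat \<Rightarrow> 'g \<Rightarrow> complex) set star_algebra" where
  "reduced_cstar G = cstar_completion (reduced_Cc G)"

text \<open>The canonical map \<open>C\<^sup>*\<^sub>r(H) \<rightarrow> C\<^sup>*\<^sub>r(G)\<close> given by extending functions by zero.\<close>

definition ext_zero_map ::
    "('g, 'u) groupoid \<Rightarrow> (nat \<Rightarrow> 'g \<Rightarrow> complex) set \<Rightarrow> (nat \<Rightarrow> 'g \<Rightarrow> complex) set" where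
  "ext_zero_map G = completion_map (reduced_Cc G) (\<lambda>f. f)"

definition restrict_fun :: "('g, 'u) groupoid \<Rightarrow> ('g \<Rightarrow> complex) \<Rightarrow> 'g \<Rightarrow> complex" where
  "restrict_fun H f = (\<lambda>g. if g \<in> arrows H then f g else 0)"

definition restriction_map :: "('g, 'u) groupoid \<Rightarrow> (('g \<Rightarrow> complex) \<Rightarrow> real) \<Rightarrow>
    (nat \<Rightarrow> 'g \<Rightarrow> complex) set \<Rightarrow> (nat \<Rightarrow> 'g \<Rightarrow> complex) set" where
  "restriction_map H N = completion_map (convolution_algebra H N) (restrict_fun H)"

text \<open>\<open>N\<close> is a C*-norm on \<open>C\<^sub>c(H)\<close> for which restriction of functions is bounded and induces a
  short exact sequence \<open>0 \<rightarrow> C\<^sup>*\<^sub>r(G \<setminus> H) \<rightarrow> C\<^sup>*\<^sub>r(G) \<rightarrow> C\<^sup>*\<^sub>N(H) \<rightarrow> 0\<close>.\<close>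

definition exact_norm ::
    "('g, 'u) groupoid \<Rightarrow> ('g, 'u) groupoid \<Rightarrow> (('g \<Rightarrow> complex) \<Rightarrow> real) \<Rightarrow> bool" where
  "exact_norm G H N \<longleftrightarrow>
    cstar_norm (convolution_algebra H N) \<and>
    (\<exists>C. \<forall>f\<in>Cc G. N (restrict_fun H f) \<le> C * reduced_norm G f) \<and>
    inj_on (ext_zero_map G) (carrier (reduced_cstar (groupoid_diff G H))) \<and>
    ext_zero_map G ` carrier (reduced_cstar (groupoid_diff G H))
      = ker (reduced_cstar G) (cstar_completion (convolution_algebra H N)) (restriction_map H N) \<and>
    restriction_map H N ` carrier (reduced_cstar G)
      = carrier (cstar_completion (convolution_algebra H N))"


section \<open>Left cancellative monoids\<close>

class left_cancellative_monoid = monoid_mult +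
  assumes left_cancel: "s * t = s * t' \<Longrightarrow> t = t'"

definition partial_inv :: "('a \<rightharpoonup> 'b) \<Rightarrow> ('b \<rightharpoonup> 'a)" where
  "partial_inv g = (\<lambda>y. if y \<in> ran g then Some (THE x. g x = Some y) else None)"

definition left_translation :: "'a::left_cancellative_monoid \<Rightarrow> ('a \<rightharpoonup> 'a)" where
  "left_translation s = (\<lambda>t. Some (s * t))"

inductive_set left_inverse_hull :: "('a::left_cancellative_monoid \<rightharpoonup> 'a) set" where
  "left_translation s \<in> left_inverse_hull"
| "g \<in> left_inverse_hull \<Longrightarrow> partial_inv g \<in> left_inverse_hull"
| "g \<in> left_inverse_hull \<Longrightarrow> h \<in> left_inverse_hull \<Longrightarrow> g \<circ>\<^sub>m h \<in> left_inverse_hull"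

definition constructible_ideals :: "'a::left_cancellative_monoid set set" where
  "constructible_ideals = dom ` left_inverse_hull"

definition foundation_set :: "'a::left_cancellative_monoid set set \<Rightarrow> 'a set \<Rightarrow> bool" where
  "foundation_set F X \<longleftrightarrow> finite F \<and> F \<noteq> {} \<and> F \<subseteq> constructible_ideals \<and>
    X \<in> constructible_ideals \<and> (\<forall>Z\<in>F. Z \<subseteq> X) \<and>
    (\<forall>Y\<in>constructible_ideals. Y \<noteq> {} \<and> Y \<subseteq> X \<longrightarrow> (\<exists>Z\<in>F. Y \<inter> Z \<noteq> {}))"


subsection \<open>Characters and the groupoid of germs\<close>

text \<open>Characters take values in \<open>bool\<close> instead of \<open>{0,1}\<close>. They are total functions that are false
  outside the constructible ideals; the product topology on \<^typ>\<open>'a set \<Rightarrow> bool\<close> then induces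
  the topology of pointwise convergence on the constructible ideals.\<close>

type_synonym 'a character = "'a set \<Rightarrow> bool"
type_synonym 'a germ = "(('a \<rightharpoonup> 'a) \<times> 'a character) set"

definition characters :: "'a::left_cancellative_monoid character set" where
  "characters = {\<omega>. (\<forall>X. \<omega> X \<longrightarrow> X \<in> constructible_ideals) \<and> (\<exists>X. \<omega> X) \<and>
    (\<forall>X\<in>constructible_ideals. \<forall>Y\<in>constructible_ideals. \<omega> (X \<inter> Y) \<longleftrightarrow> \<omega> X \<and> \<omega> Y)}"

definition point_character :: "'a::left_cancellative_monoid \<Rightarrow> 'a character" where
  "point_character s = (\<lambda>X. X \<in> constructible_ideals \<and> s \<in> X)"

definition Omega :: "'a::left_cancellative_monoid character set" where
  "Omega = characters \<inter> closure (range point_character)"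

definition ideal_filter :: "'a::left_cancellative_monoid set set \<Rightarrow> bool" where
  "ideal_filter F \<longleftrightarrow> F \<noteq> {} \<and> F \<subseteq> constructible_ideals - {{}} \<and>
    (\<forall>X\<in>F. \<forall>Y\<in>F. X \<inter> Y \<in> F) \<and> (\<forall>X\<in>F. \<forall>Y\<in>constructible_ideals. X \<subseteq> Y \<longrightarrow> Y \<in> F)"

definition maximal_filter :: "'a::left_cancellative_monoid set set \<Rightarrow> bool" where
  "maximal_filter F \<longleftrightarrow> ideal_filter F \<and> (\<forall>F'. ideal_filter F' \<and> F \<subseteq> F' \<longrightarrow> F' = F)"

definition Omega_max :: "'a::left_cancellative_monoid character set" where
  "Omega_max = {\<omega> \<in> Omega. maximal_filter {X. \<omega> X}}"

definition boundary_Omega :: "'a::left_cancellative_monoid character set" where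
  "boundary_Omega = Omega \<inter> closure Omega_max"

definition push_character ::
    "('a \<rightharpoonup> 'a) \<Rightarrow> 'a::left_cancellative_monoid character \<Rightarrow> 'a character" where
  "push_character g \<omega> = (\<lambda>X. X \<in> constructible_ideals \<and> \<omega> {t. \<exists>u\<in>X. g t = Some u})"

definition germ_pairs :: "(('a::left_cancellative_monoid \<rightharpoonup> 'a) \<times> 'a character) set" where
  "germ_pairs = {(g, \<omega>). g \<in> left_inverse_hull \<and> \<omega> \<in> Omega \<and> \<omega> (dom g)}"

definition germ_rel ::
    "((('a::left_cancellative_monoid \<rightharpoonup> 'a) \<times> 'a character) \<times> (('a \<rightharpoonup> 'a) \<times> 'a character)) set" where
  "germ_rel = {((g1, \<omega>1), (g2, \<omega>2)). (g1, \<omega>1) \<in> germ_pairs \<and> (g2, \<omega>2) \<in> germ_pairs \<and>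
    \<omega>1 = \<omega>2 \<and> (\<exists>A\<in>constructible_ideals. \<omega>1 A \<and> g1 |` A = g2 |` A)}"

definition germ :: "('a \<rightharpoonup> 'a) \<Rightarrow> 'a::left_cancellative_monoid character \<Rightarrow> 'a germ" where
  "germ g \<omega> = germ_rel `` {(g, \<omega>)}"

definition basic_open ::
    "('a \<rightharpoonup> 'a) \<Rightarrow> 'a::left_cancellative_monoid character set \<Rightarrow> 'a germ set" where
  "basic_open g U = germ g ` U"

definition groupoid_P :: "('a::left_cancellative_monoid germ, 'a character) groupoid" where
  "groupoid_P = \<lparr>
    arrows = germ_pairs // germ_rel,
    units = Omega,
    src = (\<lambda>a. THE \<omega>. \<exists>g. (g, \<omega>) \<in> a),
    rng = (\<lambda>a. THE \<psi>. \<exists>g \<omega>. (g, \<omega>) \<in> a \<and> \<psi> = push_character g \<omega>),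
    gmult = (\<lambda>a b. \<Union>{germ (g \<circ>\<^sub>m h) \<psi> | g \<omega> h \<psi>.
      (g, \<omega>) \<in> a \<and> (h, \<psi>) \<in> b \<and> \<omega> = push_character h \<psi>}),
    ginv = (\<lambda>a. \<Union>{germ (partial_inv g) (push_character g \<omega>) | g \<omega>. (g, \<omega>) \<in> a}),
    gtop = topology_generated_by {basic_open g U | g U. g \<in> left_inverse_hull \<and>
      openin (top_of_set Omega) U \<and> U \<subseteq> {\<omega> \<in> Omega. \<omega> (dom g)}}\<rparr>"

definition boundary_groupoid_P :: "('a::left_cancellative_monoid germ, 'a character) groupoid" where
  "boundary_groupoid_P = reduction groupoid_P boundary_Omega"


subsection \<open>The reduced C*-algebra of the monoid\<close>

lift_definition ell2_translate :: "'a::left_cancellative_monoid \<Rightarrow> 'a ell2 \<Rightarrow> 'a ell2" is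
  "\<lambda>s f u. if u \<in> range ((*) s) then f (inv ((*) s) u) else 0"
proof -
  fix s :: 'a and f :: "'a \<Rightarrow> complex"
  assume f: "(\<lambda>i. (cmod (f i))\<^sup>2) summable_on UNIV"
  let ?g = "\<lambda>u. (cmod (if u \<in> range ((*) s) then f (inv ((*) s) u) else 0))\<^sup>2"
  have inj: "inj ((*) s)" by (auto intro: injI left_cancel)
  have "?g \<circ> (*) s = (\<lambda>i. (cmod (f i))\<^sup>2)"
    by (auto simp: inv_f_f[OF inj])
  then have "?g summable_on range ((*) s)"
    using f summable_on_reindex[OF inj, of ?g] by simp
  also have "?this \<longleftrightarrow> ?g summable_on UNIV"
    by (rule summable_on_cong_neutral) auto
  finally show "?g summable_on UNIV" .
qed

lift_definition ell2_restrict :: "'i set \<Rightarrow> 'i ell2 \<Rightarrow> 'i ell2" is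
  "\<lambda>X f i. if i \<in> X then f i else 0"
  by (rule summable_on_comparison_test) auto

definition left_regular :: "'a::left_cancellative_monoid \<Rightarrow> 'a ell2 \<Rightarrow>\<^sub>L 'a ell2" where
  "left_regular s = Blinfun (ell2_translate s)"

definition projection :: "'i set \<Rightarrow> 'i ell2 \<Rightarrow>\<^sub>L 'i ell2" where
  "projection X = Blinfun (ell2_restrict X)"

lemma bounded_linear_ell2_translate: "bounded_linear (ell2_translate (s :: 'a::left_cancellative_monoid))"
proof (rule bounded_linear_intro[where K = 1])
  fix x y :: "'a ell2" and r :: real
  show "ell2_translate s (x + y) = ell2_translate s x + ell2_translate s y"
    by transfer auto
  show "ell2_translate s (r *\<^sub>R x) = r *\<^sub>R ell2_translate s x"
    by transfer auto
  show "norm (ell2_translate s x) \<le> norm x * 1"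
  proof transfer
    fix s :: 'a and f :: "'a \<Rightarrow> complex"
    let ?g = "\<lambda>u. (cmod (if u \<in> range ((*) s) then f (inv ((*) s) u) else 0))\<^sup>2"
    have inj: "inj ((*) s)" by (auto intro: injI left_cancel)
    have "infsum ?g UNIV = infsum ?g (range ((*) s))"
      by (rule infsum_cong_neutral) auto
    also have "\<dots> = infsum (?g \<circ> (*) s) UNIV"
      by (rule infsum_reindex[OF inj])
    also have "?g \<circ> (*) s = (\<lambda>i. (cmod (f i))\<^sup>2)"
      by (auto simp: inv_f_f[OF inj])
    finally show "sqrt (infsum ?g UNIV) \<le> sqrt (\<Sum>\<^sub>\<infinity>i. (cmod (f i))\<^sup>2) * 1"
      by simp
  qed
qed

lemma left_regular_delta:
  "blinfun_apply (left_regular s) (ell2_delta t) = ell2_delta (s * t)"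
proof -
  have inv: "inv ((*) s) (s * t) = t" for s t :: 'a
    by (rule inv_f_f) (auto intro: injI left_cancel)
  have "ell2_translate s (ell2_delta t) = ell2_delta (s * t)"
    by transfer (auto simp: fun_eq_iff inv)
  then show ?thesis
    by (simp add: left_regular_def bounded_linear_Blinfun_apply[OF bounded_linear_ell2_translate])
qed

lemma bounded_linear_ell2_restrict: "bounded_linear (ell2_restrict (X :: 'i set))"
proof (rule bounded_linear_intro[where K = 1])
  fix x y :: "'i ell2" and r :: real
  show "ell2_restrict X (x + y) = ell2_restrict X x + ell2_restrict X y"
    by transfer auto
  show "ell2_restrict X (r *\<^sub>R x) = r *\<^sub>R ell2_restrict X x"
    by transfer auto
  show "norm (ell2_restrict X x) \<le> norm x * 1"
  proof transfer
    fix X :: "'i set" and f :: "'i \<Rightarrow> complex"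
    assume f: "(\<lambda>i. (cmod (f i))\<^sup>2) summable_on UNIV"
    have "(\<Sum>\<^sub>\<infinity>i. (cmod (if i \<in> X then f i else 0))\<^sup>2) \<le> (\<Sum>\<^sub>\<infinity>i. (cmod (f i))\<^sup>2)"
      by (intro infsum_mono f summable_on_comparison_test[OF f]) auto
    then show "sqrt (\<Sum>\<^sub>\<infinity>i. (cmod (if i \<in> X then f i else 0))\<^sup>2)
        \<le> sqrt (\<Sum>\<^sub>\<infinity>i. (cmod (f i))\<^sup>2) * 1"
      by simp
  qed
qed

lemma projection_delta:
  "blinfun_apply (projection X) (ell2_delta t) = (if t \<in> X then ell2_delta t else 0)"
proof -
  have "ell2_restrict X (ell2_delta t) = (if t \<in> X then ell2_delta t else 0)"
    by transfer auto
  then show ?thesis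
    by (simp add: projection_def bounded_linear_Blinfun_apply[OF bounded_linear_ell2_restrict])
qed

definition monoid_cstar :: "('a::left_cancellative_monoid ell2 \<Rightarrow>\<^sub>L 'a ell2) star_algebra" where
  "monoid_cstar = generated_cstar_algebra bounded_operators (range left_regular)"

definition foundation_ideal :: "('a::left_cancellative_monoid ell2 \<Rightarrow>\<^sub>L 'a ell2) set" where
  "foundation_ideal = generated_closed_ideal monoid_cstar
    {projection (X - \<Union>F) | X F. foundation_set F X}"

definition monoid_quotient :: "('a::left_cancellative_monoid ell2 \<Rightarrow>\<^sub>L 'a ell2) set star_algebra" where
  "monoid_quotient = quotient_algebra monoid_cstar foundation_ideal"

definition quotient_proj ::
    "('a::left_cancellative_monoid ell2 \<Rightarrow>\<^sub>L 'a ell2) \<Rightarrow> ('a ell2 \<Rightarrow>\<^sub>L 'a ell2) set" where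
  "quotient_proj = coset monoid_cstar foundation_ideal"

text \<open>The bijection \<open>s \<mapsto> [s, \<chi>\<^sub>e]\<close> from the monoid onto \<open>\<G>\<^sub>P(S)\<^bsub>\<chi>\<^sub>e\<^esub>\<close>, and the induced
  identifications of the \<open>\<ell>\<^sup>2\<close>-spaces in both directions.\<close>

definition point_arrow :: "'a::left_cancellative_monoid \<Rightarrow> 'a germ" where
  "point_arrow s = germ (left_translation s) (point_character 1)"

definition to_fibre :: "'a::left_cancellative_monoid ell2 \<Rightarrow> 'a germ ell2" where
  "to_fibre \<xi> = Abs_ell2 (\<lambda>a. if a \<in> range point_arrow
    then ell2_apply \<xi> (inv point_arrow a) else 0)"

definition from_fibre :: "'a::left_cancellative_monoid germ ell2 \<Rightarrow> 'a ell2" where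
  "from_fibre \<eta> = Abs_ell2 (\<lambda>s. ell2_apply \<eta> (point_arrow s))"

definition rho_e_Cc ::
    "('a germ \<Rightarrow> complex) \<Rightarrow> 'a::left_cancellative_monoid ell2 \<Rightarrow>\<^sub>L 'a ell2" where
  "rho_e_Cc f = Blinfun
    (\<lambda>\<xi>. from_fibre (regular_rep groupoid_P (point_character 1) f (to_fibre \<xi>)))"

definition rho_e ::
    "(nat \<Rightarrow> 'a germ \<Rightarrow> complex) set \<Rightarrow> 'a::left_cancellative_monoid ell2 \<Rightarrow>\<^sub>L 'a ell2" where
  "rho_e X = (THE T. \<forall>u\<in>X. (\<lambda>n. rho_e_Cc (u n)) \<longlonglongrightarrow> T)"

end

theory Submission
  imports Defs
begin

text \<open>Each of the algebras \<open>C\<^sub>c\<close> of \<open>\<G>\<^sub>P(S)\<close>, of its reduction to the boundary and of the complement is spanned by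
  functions that live on the basic bisections of elements of the left inverse hull. The clopen sets
  of characters that contain \<open>X\<close> but none of \<open>X\<^sub>1, \<dots>, X\<^sub>m\<close>, for a foundation set of \<open>X\<close>, cover the
  complement of the boundary in \<open>\<Omega>(S)\<close>, and \<open>\<rho>\<close>, the representation at \<open>\<chi>\<^sub>e\<close>, maps their indicator
  functions to the projections that generate the foundation ideal \<open>I\<close>. Hence \<open>I\<close> is the closure of
  the image under \<open>\<rho>\<close> of \<open>C\<^sub>c\<close> of the complement.

  An image of a C*-algebra is closed because approximate preimages can be chosen with controlled
  norm. Concretely, if \<open>\<rho>(f)\<close> has norm at most \<open>1\<close> and \<open>N = 4m\<close> is large, then \<open>h = f(1 - f\<^sup>*f/N)\<^sup>m\<close> has
  reduced norm at most \<open>2\<close>, while \<open>\<rho>(h)\<close> differs from \<open>\<rho>(f)\<close> by at most \<open>1/4\<close> in norm. Iterating this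
  lifts every element of \<open>I\<close> to the reduced algebra of the complement of the boundary, which is the
  first claim. The kernel of \<open>q \<circ> \<rho>\<close> then contains that of \<open>\<phi>\<close>, so that \<open>q \<circ> \<rho>\<close>
  factors through \<open>\<phi>\<close>.\<close>

section \<open>Square-summable families\<close>

text \<open>The groupoid of germs may fail to be Hausdorff, and a function in \<open>Cc\<close> is
  then only a sum of functions continuous on their own open sets. On a source fibre, however, the
  bisection of \<open>k\<close> acts as a partial bijection, and convolution with a function on it
  is a weighted partial permutation. Boundedness, adjoints and multiplicativity are checked there
  and extended additively. Supports are cut along clopen cylinders instead of by partitions of
  unity.

  The delicate inclusion is that of the kernel of q \<circ> \<rho> in the sum. An element of I is a
  limit of images \<rho>(f) with f in C_c of the complement, but nothing bounds the reduced norms of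
  these f, as \<rho> may have a kernel. Damping stays inside C_c of the complement, because h is f
  times a polynomial in f^* f. On scalars, t(1 - t^2/N)^m is at most the root of N/(m+1) for t^2
  \<le> N, and it differs from t by at most m/N for t \<le> 1. With N = 4m these bounds become 2 and
  1/4 whatever the norm of f is, and an error factor below 1 is what a geometric series
  needs.\<close>

lemmas ell2_apply_simps [simp] =
  plus_ell2.rep_eq zero_ell2.rep_eq uminus_ell2.rep_eq scaleR_ell2.rep_eq ell2_scale.rep_eq

lemma ell2_apply_diff [simp]: "ell2_apply (x - y) i = ell2_apply x i - ell2_apply y i"
  by (simp only: minus_ell2_def plus_ell2.rep_eq uminus_ell2.rep_eq) simp

lemma ell2_apply_summable: "(\<lambda>i. (cmod (ell2_apply x i))\<^sup>2) summable_on UNIV"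
  using ell2_apply by auto

lemma norm_ell2_sq: "(norm x)\<^sup>2 = (\<Sum>\<^sub>\<infinity>i. (cmod (ell2_apply x i))\<^sup>2)"
  by (simp add: norm_ell2.rep_eq infsum_nonneg)

lemma ell2_eqI: "(\<And>i. ell2_apply x i = ell2_apply y i) \<Longrightarrow> x = y"
  by (simp add: ell2_apply_inject[symmetric] fun_eq_iff)

lemma ell2_apply_Abs:
  "(\<lambda>i. (cmod (f i))\<^sup>2) summable_on UNIV \<Longrightarrow> ell2_apply (Abs_ell2 f) = f"
  by (simp add: Abs_ell2_inverse)

lemma sum_sq_le_norm_ell2:
  assumes "finite F"
  shows "(\<Sum>i\<in>F. (cmod (ell2_apply x i))\<^sup>2) \<le> (norm x)\<^sup>2"
  unfolding norm_ell2_sq by (intro finite_sum_le_infsum ell2_apply_summable assms) auto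

lemma cmod_ell2_apply_le: "cmod (ell2_apply x i) \<le> norm x"
proof -
  have "(cmod (ell2_apply x i))\<^sup>2 \<le> (norm x)\<^sup>2"
    using sum_sq_le_norm_ell2[of "{i}" x] by simp
  then show ?thesis by (rule power2_le_imp_le) simp
qed

lemma norm_ell2_leI:
  assumes "\<And>F. finite F \<Longrightarrow> (\<Sum>i\<in>F. (cmod (ell2_apply x i))\<^sup>2) \<le> c\<^sup>2" "0 \<le> c"
  shows "norm x \<le> c"
proof -
  have "(norm x)\<^sup>2 \<le> c\<^sup>2"
    unfolding norm_ell2_sq by (intro infsum_le_finite_sums ell2_apply_summable assms(1))
  then show ?thesis by (rule power2_le_imp_le) (rule assms(2))
qed

text \<open>Completeness is what lets \<open>rho_e\<close> be a limit of operators. The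
  coordinatewise limit works because a Cauchy bound on finite partial sums survives the limit in the
  second index.\<close>

instance ell2 :: (type) banach
proof
  fix X :: "nat \<Rightarrow> 'a ell2"
  assume X: "Cauchy X"
  have "Cauchy (\<lambda>n. ell2_apply (X n) i)" for i
  proof (rule metric_CauchyI)
    fix e :: real assume "e > 0"
    then obtain M where M: "\<And>m n. m \<ge> M \<Longrightarrow> n \<ge> M \<Longrightarrow> dist (X m) (X n) < e"
      using metric_CauchyD[OF X] by blast
    have "dist (ell2_apply (X m) i) (ell2_apply (X n) i) < e" if "m \<ge> M" "n \<ge> M" for m n
      using cmod_ell2_apply_le[of "X m - X n" i] M[OF that] by (simp add: dist_norm)
    then show "\<exists>M. \<forall>m\<ge>M. \<forall>n\<ge>M. dist (ell2_apply (X m) i) (ell2_apply (X n) i) < e" by blast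
  qed
  then have "\<exists>l. (\<lambda>n. ell2_apply (X n) i) \<longlonglongrightarrow> l" for i
    using Cauchy_convergent convergent_def by blast
  then obtain f where f: "\<And>i. (\<lambda>n. ell2_apply (X n) i) \<longlonglongrightarrow> f i" by metis
  have bound: "(\<Sum>i\<in>F. (cmod (ell2_apply (X n) i - f i))\<^sup>2) \<le> e\<^sup>2"
    if M: "\<And>m n. m \<ge> M \<Longrightarrow> n \<ge> M \<Longrightarrow> dist (X m) (X n) < e" and F: "finite F" and n: "n \<ge> M"
    for e M n F
  proof (rule LIMSEQ_le_const2)
    show "(\<lambda>m. \<Sum>i\<in>F. (cmod (ell2_apply (X n) i - ell2_apply (X m) i))\<^sup>2)
        \<longlonglongrightarrow> (\<Sum>i\<in>F. (cmod (ell2_apply (X n) i - f i))\<^sup>2)"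
      by (intro tendsto_intros f)
    have "(\<Sum>i\<in>F. (cmod (ell2_apply (X n) i - ell2_apply (X m) i))\<^sup>2) \<le> e\<^sup>2" if "m \<ge> M" for m
    proof -
      have "(\<Sum>i\<in>F. (cmod (ell2_apply (X n - X m) i))\<^sup>2) \<le> (norm (X n - X m))\<^sup>2"
        by (rule sum_sq_le_norm_ell2[OF F])
      also have "\<dots> \<le> e\<^sup>2"
        using M[OF n that] by (intro power_mono) (auto simp: dist_norm)
      finally show ?thesis by simp
    qed
    then show "\<exists>N. \<forall>m\<ge>N. (\<Sum>i\<in>F. (cmod (ell2_apply (X n) i - ell2_apply (X m) i))\<^sup>2) \<le> e\<^sup>2"
      by blast
  qed
  have diff: "(\<lambda>i. (cmod (ell2_apply (X n) i - f i))\<^sup>2) summable_on UNIV"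
    if M: "\<And>m n. m \<ge> M \<Longrightarrow> n \<ge> M \<Longrightarrow> dist (X m) (X n) < e" and n: "n \<ge> M" for e M n
    by (intro nonneg_bdd_above_summable_on bdd_aboveI[of _ "e\<^sup>2"]) (auto intro: bound[OF M _ n])
  obtain M where M: "\<And>m n. m \<ge> M \<Longrightarrow> n \<ge> M \<Longrightarrow> dist (X m) (X n) < 1"
    using metric_CauchyD[OF X zero_less_one] by blast
  \<comment> \<open>\<open>f\<close> is \<open>X M\<close> minus their difference, and both of these
    are square-summable.\<close>
  have "(\<lambda>i. (cmod (ell2_apply (X M) i + - (ell2_apply (X M) i - f i)))\<^sup>2) summable_on UNIV"
    by (rule ell2_add_bound(1)[OF ell2_apply_summable])
      (use diff[OF M order_refl] in \<open>simp only: norm_minus_cancel\<close>)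
  then have "(\<lambda>i. (cmod (f i))\<^sup>2) summable_on UNIV" by simp
  then have fapp: "ell2_apply (Abs_ell2 f) = f" by (rule ell2_apply_Abs)
  have "X \<longlonglongrightarrow> Abs_ell2 f"
  proof (rule metric_LIMSEQ_I)
    fix r :: real assume "r > 0"
    then obtain M where M: "\<And>m n. m \<ge> M \<Longrightarrow> n \<ge> M \<Longrightarrow> dist (X m) (X n) < r / 2"
      using metric_CauchyD[OF X, of "r / 2"] by auto
    have "dist (X n) (Abs_ell2 f) < r" if "n \<ge> M" for n
    proof -
      have "norm (X n - Abs_ell2 f) \<le> r / 2"
        using bound[OF M _ that] \<open>r > 0\<close> by (intro norm_ell2_leI) (auto simp: fapp)
      with \<open>r > 0\<close> show ?thesis by (simp add: dist_norm)
    qed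
    then show "\<exists>M. \<forall>n\<ge>M. dist (X n) (Abs_ell2 f) < r" by blast
  qed
  then show "convergent X" by (rule convergentI)
qed

section \<open>The inner product\<close>

lemma ell2_inner_summable:
  "(\<lambda>i. ell2_apply x i * cnj (ell2_apply y i)) summable_on UNIV"
proof (rule abs_summable_summable, rule summable_on_comparison_test)
  show "(\<lambda>i. (cmod (ell2_apply x i))\<^sup>2 + (cmod (ell2_apply y i))\<^sup>2) summable_on UNIV"
    by (intro summable_on_add ell2_apply_summable)
  show "norm (ell2_apply x i * cnj (ell2_apply y i))
      \<le> (cmod (ell2_apply x i))\<^sup>2 + (cmod (ell2_apply y i))\<^sup>2" for i
    using sum_squares_bound[of "cmod (ell2_apply x i)" "cmod (ell2_apply y i)"]
      mult_nonneg_nonneg[OF norm_ge_zero[of "ell2_apply x i"] norm_ge_zero[of "ell2_apply y i"]]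
    by (simp only: norm_mult complex_mod_cnj mult.assoc)
qed auto

lemma ell2_inner_add_left: "ell2_inner (x + y) z = ell2_inner x z + ell2_inner y z"
  unfolding ell2_inner_def
  by (subst infsum_add[symmetric]) (auto simp: ell2_inner_summable algebra_simps)

lemma ell2_inner_scale_left: "ell2_inner (ell2_scale c x) y = c * ell2_inner x y"
  unfolding ell2_inner_def by (simp add: infsum_cmult_right' mult.assoc)

lemma ell2_inner_commute: "ell2_inner x y = cnj (ell2_inner y x)"
  unfolding ell2_inner_def by (simp flip: infsum_cnj add: mult.commute)

lemma ell2_inner_add_right: "ell2_inner x (y + z) = ell2_inner x y + ell2_inner x z"
  by (metis ell2_inner_add_left ell2_inner_commute complex_cnj_add)

lemma ell2_inner_scale_right: "ell2_inner x (ell2_scale c y) = cnj c * ell2_inner x y"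
  by (metis ell2_inner_scale_left ell2_inner_commute complex_cnj_mult)

lemma ell2_scale_minus_one: "ell2_scale (- 1) x = - x"
  by (rule ell2_eqI) simp

lemma ell2_scale_of_real: "ell2_scale (of_real r) x = r *\<^sub>R x"
  by (rule ell2_eqI) (simp add: scaleR_conv_of_real)

lemma ell2_inner_self: "ell2_inner x x = of_real ((norm x)\<^sup>2)"
proof -
  have "ell2_inner x x = (\<Sum>\<^sub>\<infinity>i. of_real ((cmod (ell2_apply x i))\<^sup>2))"
    unfolding ell2_inner_def by (simp add: complex_norm_square del: of_real_power)
  also have "\<dots> = of_real (\<Sum>\<^sub>\<infinity>i. (cmod (ell2_apply x i))\<^sup>2)"
    by (rule infsumI) (simp only: has_sum_of_real_iff, rule has_sum_infsum, rule ell2_apply_summable)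
  finally show ?thesis by (simp add: norm_ell2_sq)
qed

lemma ell2_inner_delta_right: "ell2_inner x (ell2_delta i) = ell2_apply x i"
proof -
  have "ell2_inner x (ell2_delta i)
      = (\<Sum>\<^sub>\<infinity>j\<in>{i}. ell2_apply x j * cnj (ell2_apply (ell2_delta i) j))"
    unfolding ell2_inner_def
    by (rule infsum_cong_neutral) (auto simp: ell2_delta.rep_eq)
  then show ?thesis by (simp add: ell2_delta.rep_eq)
qed

lemma ell2_inner_left_eqI: "(\<And>y. ell2_inner x y = ell2_inner x' y) \<Longrightarrow> x = x'"
  by (metis ell2_eqI ell2_inner_delta_right)

lemma ell2_inner_right_eqI: "(\<And>x. ell2_inner x y = ell2_inner x y') \<Longrightarrow> y = y'"
  by (metis ell2_inner_left_eqI ell2_inner_commute)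

text \<open>The real part of the complex inner product induces the same norm. The class provides
  Cauchy-Schwarz and the expansions of squared norms on which the estimate for damped powers
  rests.\<close>

instantiation ell2 :: (type) real_inner
begin

definition inner_ell2 :: "'a ell2 \<Rightarrow> 'a ell2 \<Rightarrow> real" where
  "inner_ell2 x y = Re (ell2_inner x y)"

instance
proof
  fix x y z :: "'a ell2" and r :: real
  show "inner x y = inner y x"
    unfolding inner_ell2_def by (subst ell2_inner_commute) simp
  show "inner (x + y) z = inner x z + inner y z"
    by (simp add: inner_ell2_def ell2_inner_add_left)
  show "inner (r *\<^sub>R x) y = r * inner x y"
    by (simp add: inner_ell2_def ell2_inner_scale_left flip: ell2_scale_of_real)
  show "0 \<le> inner x x" "inner x x = 0 \<longleftrightarrow> x = 0" "norm x = sqrt (inner x x)"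
    by (simp_all add: inner_ell2_def ell2_inner_self)
qed

end

text \<open>A unimodular factor \<open>c\<close> turns the complex inner product into its own
  modulus, which reduces the claim to the real Cauchy-Schwarz inequality.\<close>

lemma cmod_ell2_inner_le: "cmod (ell2_inner x y) \<le> norm x * norm y"
proof (cases "ell2_inner x y = 0")
  case False
  define c where "c = cnj (ell2_inner x y) / cmod (ell2_inner x y)"
  have c1: "cmod c = 1" using False by (simp add: c_def norm_divide)
  have ns: "norm (ell2_scale c x) = norm x"
    by (simp add: norm_ell2.rep_eq norm_mult c1)
  have "c * ell2_inner x y = of_real (cmod (ell2_inner x y))"
    using False complex_norm_square[of "ell2_inner x y"]
    by (simp add: c_def field_simps power2_eq_square)
  then have "cmod (ell2_inner x y) = inner (ell2_scale c x) y"
    by (simp add: inner_ell2_def ell2_inner_scale_left)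
  also have "\<dots> \<le> norm x * norm y"
    using norm_cauchy_schwarz[of "ell2_scale c x" y] by (simp add: ns)
  finally show ?thesis .
qed simp

lemma norm_ell2_scale: "norm (ell2_scale c x) = cmod c * norm x"
  by (simp add: norm_ell2.rep_eq norm_mult power_mult_distrib infsum_cmult_right' real_sqrt_mult)

lemma ell2_scale_add: "ell2_scale c (x + y) = ell2_scale c x + ell2_scale c y"
  by (rule ell2_eqI) (simp add: algebra_simps)

lemma ell2_scale_diff: "ell2_scale c (x - y) = ell2_scale c x - ell2_scale c y"
  by (rule ell2_eqI) (simp add: algebra_simps)

lemma bounded_linear_ell2_scale: "bounded_linear (ell2_scale c)"
proof (rule bounded_linear_intro[where K = "cmod c"])
  show "ell2_scale c (r *\<^sub>R x) = r *\<^sub>R ell2_scale c x" for r and x :: "'a ell2"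
    by (rule ell2_eqI) simp
qed (simp_all add: ell2_scale_add norm_ell2_scale mult.commute)

text \<open>On finite sets, injectivity of \<open>p\<close> turns the sum into one over distinct
  coordinates of \<open>x\<close>. Functions on bisections and both identifications of the fibre at
  \<chi>_e with the monoid are instances of this estimate.\<close>

lemma weighted_permutation_summable:
  assumes inj: "inj_on p P" and w: "\<And>a. a \<in> P \<Longrightarrow> cmod (w a) \<le> M"
  shows "(\<lambda>a. (cmod (if a \<in> P then w a * ell2_apply x (p a) else 0))\<^sup>2) summable_on UNIV"
    and "(\<Sum>\<^sub>\<infinity>a. (cmod (if a \<in> P then w a * ell2_apply x (p a) else 0))\<^sup>2) \<le> M\<^sup>2 * (norm x)\<^sup>2"
proof -
  let ?f = "\<lambda>a. (cmod (if a \<in> P then w a * ell2_apply x (p a) else 0))\<^sup>2"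
  have bound: "sum ?f F \<le> M\<^sup>2 * (norm x)\<^sup>2" if F: "finite F" for F
  proof -
    have "sum ?f F = (\<Sum>a\<in>F \<inter> P. (cmod (w a * ell2_apply x (p a)))\<^sup>2)"
      using F by (intro sum.mono_neutral_cong_right) auto
    also have "\<dots> \<le> (\<Sum>a\<in>F \<inter> P. M\<^sup>2 * (cmod (ell2_apply x (p a)))\<^sup>2)"
      using w by (intro sum_mono) (auto simp: norm_mult power_mult_distrib intro!: mult_right_mono power_mono)
    also have "\<dots> = M\<^sup>2 * (\<Sum>b\<in>p ` (F \<inter> P). (cmod (ell2_apply x b))\<^sup>2)"
      by (subst sum.reindex) (auto simp: sum_distrib_left intro: inj_on_subset[OF inj])
    also have "\<dots> \<le> M\<^sup>2 * (norm x)\<^sup>2"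
      using F by (intro mult_left_mono sum_sq_le_norm_ell2) auto
    finally show ?thesis .
  qed
  show summ: "?f summable_on UNIV"
    by (intro nonneg_bdd_above_summable_on bdd_aboveI[of _ "M\<^sup>2 * (norm x)\<^sup>2"]) (auto intro: bound)
  show "infsum ?f UNIV \<le> M\<^sup>2 * (norm x)\<^sup>2"
    by (intro infsum_le_finite_sums summ bound) auto
qed

section \<open>Adjoint pairs of operators\<close>

text \<open>A relation between plain functions: having an adjoint already forces complex linearity
  and determines the adjoint, so neither has to be carried along separately.\<close>

definition adjoint_pair :: "('i ell2 \<Rightarrow> 'j ell2) \<Rightarrow> ('j ell2 \<Rightarrow> 'i ell2) \<Rightarrow> bool" where
  "adjoint_pair T T' \<longleftrightarrow> (\<forall>x y. ell2_inner (T x) y = ell2_inner x (T' y))"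

lemma adjoint_pair_sym: "adjoint_pair T T' \<Longrightarrow> adjoint_pair T' T"
  unfolding adjoint_pair_def by (metis ell2_inner_commute)

lemma adjoint_pair_unique: "adjoint_pair T T' \<Longrightarrow> adjoint_pair T T'' \<Longrightarrow> T' = T''"
  unfolding adjoint_pair_def by (metis ell2_inner_right_eqI ext)

lemma adjoint_pair_scale:
  assumes "adjoint_pair T T'"
  shows "T (ell2_scale c x) = ell2_scale c (T x)"
proof (rule ell2_inner_left_eqI)
  show "ell2_inner (T (ell2_scale c x)) y = ell2_inner (ell2_scale c (T x)) y" for y
    using assms by (simp add: adjoint_pair_def ell2_inner_scale_left)
qed

lemma adjoint_pair_add:
  assumes "adjoint_pair T T'"
  shows "T (x + y) = T x + T y"
proof (rule ell2_inner_left_eqI)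
  show "ell2_inner (T (x + y)) z = ell2_inner (T x + T y) z" for z
    using assms by (simp add: adjoint_pair_def ell2_inner_add_left)
qed

text \<open>The square of the norm of T'y is the inner product of TT'y with y, hence at most M times
  the norms of T'y and of y; one factor cancels. The case T'y = 0 is where \<open>0 \<le> M\<close>
  enters.\<close>

lemma adjoint_pair_norm_le:
  assumes adj: "adjoint_pair T T'" and T: "\<And>x. norm (T x) \<le> M * norm x" and M: "0 \<le> M"
  shows "norm (T' y) \<le> M * norm y"
proof (cases "T' y = 0")
  case False
  have "(norm (T' y))\<^sup>2 = cmod (ell2_inner (T' y) (T' y))" by (simp add: ell2_inner_self norm_power)
  also have "\<dots> = cmod (ell2_inner (T (T' y)) y)" using adj by (simp add: adjoint_pair_def)
  also have "\<dots> \<le> (M * norm (T' y)) * norm y"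
    by (intro order_trans[OF cmod_ell2_inner_le] mult_right_mono T) auto
  finally have "norm (T' y) * norm (T' y) \<le> (M * norm y) * norm (T' y)"
    by (simp add: power2_eq_square mult_ac)
  with False show ?thesis by simp
qed (use M in simp)

section \<open>Damped powers of an operator\<close>

lemma norm_diff_scaleR_sq:
  fixes u w :: "'h::real_inner"
  shows "(norm (u - r *\<^sub>R w))\<^sup>2 = (norm u)\<^sup>2 - 2 * r * inner u w + r\<^sup>2 * (norm w)\<^sup>2"
  unfolding power2_norm_eq_inner
  by (simp add: inner_diff_left inner_diff_right inner_commute[of w u] power2_eq_square algebra_simps)

text \<open>Replaces continuous functional calculus: for \<open>N \<ge> \<parallel>x\<parallel>\<^sup>2\<close> the norms of \<open>x(1 - x\<^sup>*x/N)\<^sup>j\<xi>\<close> decrease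
  in \<open>j\<close>, while their squares sum to at most \<open>N\<parallel>\<xi>\<parallel>\<^sup>2\<close>.\<close>

lemma damped_power_norm_le:
  fixes T T' :: "'h::real_inner \<Rightarrow> 'h" and N :: real
  assumes T: "linear T" and adj: "\<And>x y. inner (T x) y = inner x (T' y)"
    and N: "N > 0" and TN: "\<And>x. (norm (T x))\<^sup>2 \<le> N * (norm x)\<^sup>2"
    and y0: "\<And>\<xi>. y 0 \<xi> = T \<xi>"
    and ySuc: "\<And>j \<xi>. y (Suc j) \<xi> = y j \<xi> - (1 / N) *\<^sub>R y j (T' (T \<xi>))"
  shows "(norm (y m \<xi>))\<^sup>2 \<le> N / (real m + 1) * (norm \<xi>)\<^sup>2"
    and "norm (y m \<xi>) \<le> norm (T \<xi>)"
proof -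
  \<comment> \<open>\<open>Q\<close> is 1 - T'T/N, so that y_j is T Q^j. The hypotheses give the
    recursion in unfolded form because it is also applied to functions, where no unit is at
    hand.\<close>
  define Q where "Q \<xi> = \<xi> - (1 / N) *\<^sub>R T' (T \<xi>)" for \<xi>
  \<comment> \<open>The adjoint inherits the bound: the squared norm of T'v is at most the norm of
    TT'v times that of v, and squaring once more lets \<open>TN\<close> be applied to T'v.\<close>
  have T': "norm (T' v) * norm (T' v) \<le> N * (norm v)\<^sup>2" for v
  proof -
    have "norm (T' v) * norm (T' v) = inner (T (T' v)) v" by (simp add: adj flip: power2_eq_square power2_norm_eq_inner)
    also have "\<dots> \<le> norm (T (T' v)) * norm v" by (rule norm_cauchy_schwarz)
    finally have 1: "(norm (T' v))\<^sup>2 \<le> norm (T (T' v)) * norm v" by (simp add: power2_eq_square)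
    have "((norm (T' v))\<^sup>2)\<^sup>2 \<le> (norm (T (T' v)) * norm v)\<^sup>2"
      by (intro power_mono 1) auto
    also have "\<dots> \<le> (N * (norm (T' v))\<^sup>2) * (norm v)\<^sup>2"
      using TN[of "T' v"] by (simp add: power_mult_distrib mult_right_mono)
    finally have "(norm (T' v))\<^sup>2 * (norm (T' v))\<^sup>2 \<le> (N * (norm v)\<^sup>2) * (norm (T' v))\<^sup>2"
      by (simp add: power2_eq_square mult_ac)
    then show ?thesis
      using N by (cases "T' v = 0") (auto simp: power2_eq_square)
  qed
  have lin: "linear (y j)" for j
  proof -
    have lin': "linear T'"
    proof (rule linearI)
      show "T' (a + b) = T' a + T' b" for a b
        by (rule vector_eq_rdot[THEN iffD1]) (metis adj inner_commute inner_add_left inner_add_right)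
      show "T' (r *\<^sub>R a) = r *\<^sub>R T' a" for r a
        by (rule vector_eq_rdot[THEN iffD1]) (metis adj inner_commute inner_scaleR_left inner_scaleR_right)
    qed
    show ?thesis
    proof (induction j)
      case 0
      have "y 0 = T" by (simp add: y0 fun_eq_iff)
      with T show ?case by simp
    next
      case (Suc j)
      show ?case
        by (rule linearI)
          (simp_all add: ySuc linear_add[OF Suc] linear_add[OF T] linear_add[OF lin']
            linear_scale[OF Suc] linear_scale[OF T] linear_scale[OF lin'] algebra_simps)
    qed
  qed
  have yQ: "y (Suc j) \<xi> = y j (Q \<xi>)" for j \<xi>
    by (simp add: ySuc Q_def linear_diff[OF lin] linear_scale[OF lin])
  have yT: "y j \<xi> = T ((Q ^^ j) \<xi>)" for j \<xi>
    by (induction j arbitrary: \<xi>) (simp_all add: y0 yQ funpow_swap1)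
  have Tadj: "inner v (T' (T v)) = (norm (T v))\<^sup>2" for v
    by (metis adj power2_norm_eq_inner)
  \<comment> \<open>In the expanded square, the cross term contributes -2/N and the quadratic term
    at most +1/N times the squared norm of Tv. The remaining loss of 1/N is what the telescoping sum
    collects.\<close>
  have Qn: "(norm (Q v))\<^sup>2 \<le> (norm v)\<^sup>2 - (norm (T v))\<^sup>2 / N" for v
  proof -
    have e1: "(norm (Q v))\<^sup>2 = (norm v)\<^sup>2 - 2 / N * (norm (T v))\<^sup>2 + (norm (T' (T v)))\<^sup>2 / N\<^sup>2"
      unfolding Q_def norm_diff_scaleR_sq Tadj by (simp add: power_divide)
    have "(norm (T' (T v)))\<^sup>2 / N\<^sup>2 \<le> (N * (norm (T v))\<^sup>2) / N\<^sup>2"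
      by (intro divide_right_mono) (use T'[of "T v"] in \<open>auto simp: power2_eq_square\<close>)
    also have "\<dots> = (norm (T v))\<^sup>2 / N" using N by (simp add: power2_eq_square)
    finally show ?thesis using e1 by simp
  qed
  have TQ: "(norm (T (Q v)))\<^sup>2 \<le> (norm (T v))\<^sup>2" for v
  proof -
    have e1: "T (Q v) = T v - (1 / N) *\<^sub>R T (T' (T v))"
      by (simp add: Q_def linear_diff[OF T] linear_scale[OF T])
    have e2: "inner (T v) (T (T' (T v))) = (norm (T' (T v)))\<^sup>2"
      by (metis adj inner_commute power2_norm_eq_inner)
    have e3: "(norm (T (Q v)))\<^sup>2
      = (norm (T v))\<^sup>2 - 2 / N * (norm (T' (T v)))\<^sup>2 + (norm (T (T' (T v))))\<^sup>2 / N\<^sup>2"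
      unfolding e1 norm_diff_scaleR_sq e2 by (simp add: power_divide)
    have "(norm (T (T' (T v))))\<^sup>2 / N\<^sup>2 \<le> (N * (norm (T' (T v)))\<^sup>2) / N\<^sup>2"
      by (intro divide_right_mono TN) auto
    also have "\<dots> = (norm (T' (T v)))\<^sup>2 / N" using N by (simp add: power2_eq_square)
    also have "\<dots> \<le> 2 / N * (norm (T' (T v)))\<^sup>2" using N by (simp add: field_simps)
    finally show ?thesis using e3 by simp
  qed
  have yd: "(norm (y k \<xi>))\<^sup>2 \<le> (norm (y j \<xi>))\<^sup>2" if "j \<le> k" for j k
    using that
  proof (induction rule: dec_induct)
    case (step k)
    have "(norm (y (Suc k) \<xi>))\<^sup>2 \<le> (norm (y k \<xi>))\<^sup>2"
      using TQ[of "(Q ^^ k) \<xi>"] by (simp add: yT)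
    with step.IH show ?case by linarith
  qed simp
  \<comment> \<open>Telescoping of \<open>Qn\<close> along the orbit of \<xi> under
    \<open>Q\<close>. As the summands decrease in \<open>j\<close>, the last of the
    \<open>m + 1\<close> is at most their mean.\<close>
  have "(\<Sum>j\<le>m. (norm (y j \<xi>))\<^sup>2 / N) \<le> (norm \<xi>)\<^sup>2 - (norm ((Q ^^ Suc m) \<xi>))\<^sup>2"
  proof (induction m)
    case 0
    then show ?case using Qn[of \<xi>] by (simp add: yT)
  next
    case (Suc m)
    have "(norm ((Q ^^ Suc (Suc m)) \<xi>))\<^sup>2
        \<le> (norm ((Q ^^ Suc m) \<xi>))\<^sup>2 - (norm (y (Suc m) \<xi>))\<^sup>2 / N"
      using Qn[of "(Q ^^ Suc m) \<xi>"] by (simp only: yT funpow.simps o_apply)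
    with Suc show ?case by (simp only: sum.atMost_Suc)
  qed
  moreover have "(\<Sum>j\<le>m. (norm (y m \<xi>))\<^sup>2 / N) \<le> (\<Sum>j\<le>m. (norm (y j \<xi>))\<^sup>2 / N)"
    using N by (intro sum_mono divide_right_mono yd) auto
  moreover have "(\<Sum>j\<le>m. (norm (y m \<xi>))\<^sup>2 / N) = (real m + 1) * ((norm (y m \<xi>))\<^sup>2 / N)"
    by simp
  ultimately have *: "(real m + 1) * ((norm (y m \<xi>))\<^sup>2 / N) \<le> (norm \<xi>)\<^sup>2"
    using zero_le_power2[of "norm ((Q ^^ Suc m) \<xi>)"] by linarith
  have nz: "real m + 1 \<noteq> 0" by linarith
  have "(norm (y m \<xi>))\<^sup>2 = N / (real m + 1) * ((real m + 1) * ((norm (y m \<xi>))\<^sup>2 / N))"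
    using N nz by simp
  also have "\<dots> \<le> N / (real m + 1) * (norm \<xi>)\<^sup>2"
    using N by (intro mult_left_mono *) simp
  finally show "(norm (y m \<xi>))\<^sup>2 \<le> N / (real m + 1) * (norm \<xi>)\<^sup>2" .
  show "norm (y m \<xi>) \<le> norm (T \<xi>)"
    using power2_le_imp_le[OF yd[of 0 m, OF le0] norm_ge_zero] unfolding y0 .
qed

text \<open>Passing from y_j to its successor subtracts y_j(T'T\<xi>)/N, whose norm is at most that
  of \<xi> divided by N: T and T' are contractions, and y_j is one by the preceding lemma, which
  applies since N \<ge> 1.\<close>

lemma damped_power_dist_le:
  fixes T T' :: "'h::real_inner \<Rightarrow> 'h" and N :: real
  assumes T: "linear T" and adj: "\<And>x y. inner (T x) y = inner x (T' y)"
    and N: "N \<ge> 1" and T1: "\<And>x. norm (T x) \<le> norm x" and T'1: "\<And>x. norm (T' x) \<le> norm x"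
    and y0: "\<And>\<xi>. y 0 \<xi> = T \<xi>"
    and ySuc: "\<And>j \<xi>. y (Suc j) \<xi> = y j \<xi> - (1 / N) *\<^sub>R y j (T' (T \<xi>))"
  shows "norm (y m \<xi> - T \<xi>) \<le> real m / N * norm \<xi>"
proof -
  have y1: "norm (y j v) \<le> norm v" for j v
  proof -
    have TN: "(norm (T x))\<^sup>2 \<le> N * (norm x)\<^sup>2" for x
    proof -
      have "(norm (T x))\<^sup>2 \<le> (norm x)\<^sup>2"
        by (rule power_mono[OF T1 norm_ge_zero])
      also have "\<dots> \<le> N * (norm x)\<^sup>2"
        using mult_right_mono[OF N zero_le_power2[of "norm x"]] by simp
      finally show ?thesis .
    qed
    have "0 < N" using N by linarith
    then have "norm (y j v) \<le> norm (T v)"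
      using damped_power_norm_le(2)[where T = T and T' = T' and y = y and N = N, OF T adj _ TN y0 ySuc]
      by blast
    then show ?thesis using T1[of v] by linarith
  qed
  show ?thesis
  proof (induction m)
    case (Suc m)
    have 1: "norm (y (Suc m) \<xi> - T \<xi>) \<le> norm (y m \<xi> - T \<xi>) + norm ((1 / N) *\<^sub>R y m (T' (T \<xi>)))"
      unfolding ySuc using norm_triangle_ineq4[of "y m \<xi> - T \<xi>" "(1 / N) *\<^sub>R y m (T' (T \<xi>))"]
      by (simp add: algebra_simps)
    have "norm (y m (T' (T \<xi>))) \<le> norm \<xi>"
      by (rule order_trans[OF y1 order_trans[OF T'1 T1]])
    then have "norm ((1 / N) *\<^sub>R y m (T' (T \<xi>))) \<le> norm \<xi> / N"
      using N mult_left_mono[of "norm (y m (T' (T \<xi>)))" "norm \<xi>" "1 / N"] by simp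
    with 1 Suc have "norm (y (Suc m) \<xi> - T \<xi>) \<le> real m / N * norm \<xi> + norm \<xi> / N"
      by linarith
    also have "\<dots> = real (Suc m) / N * norm \<xi>" by (simp add: add_divide_distrib distrib_right)
    finally show ?case .
  qed (simp add: y0)
qed

section \<open>The left inverse hull\<close>

text \<open>The hull acts on constructible ideals by these preimages, and through
  \<open>push_character\<close> on characters.\<close>

definition map_vimage :: "('a \<rightharpoonup> 'b) \<Rightarrow> 'b set \<Rightarrow> 'a set" where
  "map_vimage g X = {t. \<exists>u\<in>X. g t = Some u}"

lemma map_vimage_comp: "map_vimage (g \<circ>\<^sub>m h) X = map_vimage h (map_vimage g X)"
  by (auto simp: map_vimage_def map_comp_def split: option.splits)

lemma map_vimage_Int:
  "map_vimage g (X \<inter> Y) = map_vimage g X \<inter> map_vimage g Y"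
  by (auto simp: map_vimage_def)

lemma map_vimage_UNIV: "map_vimage g UNIV = dom g"
  by (auto simp: map_vimage_def)

lemma dom_map_comp: "dom (g \<circ>\<^sub>m h) = map_vimage h (dom g)"
  by (auto simp: map_vimage_def map_comp_def split: option.splits)

lemma map_vimage_mono: "X \<subseteq> Y \<Longrightarrow> map_vimage g X \<subseteq> map_vimage g Y"
  by (auto simp: map_vimage_def)

lemma map_vimage_id_on: "map_vimage (Some |` X) Y = X \<inter> Y"
  by (auto simp: map_vimage_def restrict_map_def split: if_splits)

lemma partial_inv_eq_Some_iff:
  assumes "inj_on g (dom g)"
  shows "partial_inv g y = Some x \<longleftrightarrow> g x = Some y"
proof -
  have "(THE x. g x = Some y) = x" if "g x = Some y" for x
    using that assms by (auto simp: inj_on_def dom_def intro!: the_equality)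
  then show ?thesis
    by (auto simp: partial_inv_def ran_def)
qed

lemma dom_partial_inv: "dom (partial_inv g) = ran g"
  by (auto simp: partial_inv_def split: if_splits)

lemma map_eqI: "(\<And>x y. g x = Some y \<longleftrightarrow> h x = Some y) \<Longrightarrow> g = h"
  by (rule ext) (metis option.exhaust)

lemma inj_on_dom_partial_inv:
  assumes "inj_on g (dom g)"
  shows "inj_on (partial_inv g) (dom (partial_inv g))"
proof (rule inj_onI)
  fix x y
  assume "x \<in> dom (partial_inv g)" "partial_inv g x = partial_inv g y"
  then obtain u where "partial_inv g x = Some u" "partial_inv g y = Some u"
    by (metis domD)
  then show "x = y" by (simp add: partial_inv_eq_Some_iff[OF assms])
qed

lemma inj_on_dom_comp:
  assumes "inj_on g (dom g)" "inj_on h (dom h)"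
  shows "inj_on (g \<circ>\<^sub>m h) (dom (g \<circ>\<^sub>m h))"
proof (rule inj_onI)
  fix x y
  assume "x \<in> dom (g \<circ>\<^sub>m h)" "(g \<circ>\<^sub>m h) x = (g \<circ>\<^sub>m h) y"
  then obtain u v z where "h x = Some u" "h y = Some v" "g u = Some z" "g v = Some z"
    by (auto simp: map_comp_def split: option.splits)
  then show "x = y" using assms by (metis domI inj_onD)
qed

lemma partial_inv_involution: "inj_on g (dom g) \<Longrightarrow> partial_inv (partial_inv g) = g"
  by (rule map_eqI) (simp add: partial_inv_eq_Some_iff inj_on_dom_partial_inv)

lemma partial_inv_comp:
  assumes "inj_on g (dom g)" "inj_on h (dom h)"
  shows "partial_inv (g \<circ>\<^sub>m h) = partial_inv h \<circ>\<^sub>m partial_inv g"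
  by (rule map_eqI)
    (auto simp: partial_inv_eq_Some_iff[OF inj_on_dom_comp[OF assms]] map_comp_Some_iff
      partial_inv_eq_Some_iff[OF assms(1)] partial_inv_eq_Some_iff[OF assms(2)])

lemma partial_inv_comp_self:
  assumes "inj_on g (dom g)"
  shows "partial_inv g \<circ>\<^sub>m g = Some |` dom g"
  by (rule map_eqI)
    (auto simp: map_comp_def restrict_map_def partial_inv_eq_Some_iff[OF assms] split: option.splits
      intro: inj_onD[OF assms])

lemma partial_inv_left_translation_left_translation:
  "partial_inv (left_translation s) \<circ>\<^sub>m left_translation s = Some"
proof -
  have "inj_on (left_translation s) (dom (left_translation s))"
    by (auto simp: left_translation_def inj_on_def intro: left_cancel)
  from partial_inv_comp_self[OF this] show ?thesis
    by (simp add: left_translation_def dom_def restrict_map_def)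
qed

lemma hull_inj: "g \<in> left_inverse_hull \<Longrightarrow> inj_on g (dom g)"
proof (induction rule: left_inverse_hull.induct)
  case (1 s)
  then show ?case by (auto simp: left_translation_def inj_on_def intro: left_cancel)
qed (auto intro: inj_on_dom_partial_inv inj_on_dom_comp)

lemma hull_injD: "g \<in> left_inverse_hull \<Longrightarrow> g x = Some u \<Longrightarrow> g y = Some u \<Longrightarrow> x = y"
  using hull_inj by (metis domI inj_onD)

lemmas hull_partial_inv_iff = partial_inv_eq_Some_iff[OF hull_inj]
  and hull_partial_inv_involution [simp] = partial_inv_involution[OF hull_inj]

text \<open>Left translations commute with right multiplication, and inverses and compositions of
  partial maps inherit this. An element of the hull that is defined at 1 is thus determined by its
  value there.\<close>

lemma hull_equivariant:
  "g \<in> left_inverse_hull \<Longrightarrow> g x = Some y \<Longrightarrow> g (x * t) = Some (y * t)"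
proof (induction arbitrary: x y rule: left_inverse_hull.induct)
  case (2 g)
  then show ?case by (auto simp: hull_partial_inv_iff)
qed (auto simp: left_translation_def mult.assoc map_comp_def split: option.splits)

lemma id_in_hull: "Some \<in> left_inverse_hull"
  using partial_inv_left_translation_left_translation[of 1]
  by (metis left_inverse_hull.intros)

lemma constructible_UNIV [simp]: "UNIV \<in> constructible_ideals"
  using id_in_hull by (force simp: constructible_ideals_def)

lemma dom_constructible [simp]: "g \<in> left_inverse_hull \<Longrightarrow> dom g \<in> constructible_ideals"
  by (simp add: constructible_ideals_def)

text \<open>The partial identity on the domain of g is the inverse of g composed with g. Composing
  with partial identities restricts maps, which makes preimages and intersections of constructible
  ideals constructible.\<close>

lemma id_on_in_hull:
  "X \<in> constructible_ideals \<Longrightarrow> Some |` X \<in> left_inverse_hull"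
  unfolding constructible_ideals_def
  using partial_inv_comp_self[OF hull_inj] left_inverse_hull.intros by fastforce

lemma map_vimage_constructible:
  assumes "g \<in> left_inverse_hull" "X \<in> constructible_ideals"
  shows "map_vimage g X \<in> constructible_ideals"
proof -
  have "map_vimage g X = dom ((Some |` X) \<circ>\<^sub>m g)"
    by (simp add: dom_map_comp)
  with assms show ?thesis
    using dom_constructible left_inverse_hull.intros(3) id_on_in_hull by metis
qed

lemma constructible_Int [intro]:
  assumes "X \<in> constructible_ideals" "Y \<in> constructible_ideals"
  shows "X \<inter> Y \<in> constructible_ideals"
  using map_vimage_constructible[OF id_on_in_hull[OF assms(1)] assms(2)]
  by (simp add: map_vimage_id_on)

lemma map_vimage_partial_inv:
  assumes "g \<in> left_inverse_hull"
  shows "map_vimage g (map_vimage (partial_inv g) X) = X \<inter> dom g"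
  using assms by (auto simp: map_vimage_def hull_partial_inv_iff dest: hull_injD)

section \<open>Characters\<close>

lemma characterD:
  assumes "\<omega> \<in> characters"
  shows character_constructible: "\<omega> X \<Longrightarrow> X \<in> constructible_ideals"
    and character_Int: "X \<in> constructible_ideals \<Longrightarrow> Y \<in> constructible_ideals \<Longrightarrow>
      \<omega> (X \<inter> Y) \<longleftrightarrow> \<omega> X \<and> \<omega> Y"
  using assms by (auto simp: characters_def)

lemma character_mono:
  assumes "\<omega> \<in> characters" "\<omega> X" "X \<subseteq> Y" "Y \<in> constructible_ideals"
  shows "\<omega> Y"
  using character_Int[of \<omega> X Y] assms character_constructible by (metis inf.absorb1)

lemma character_UNIV: "\<omega> \<in> characters \<Longrightarrow> \<omega> UNIV"
  using character_mono[OF _ _ subset_UNIV constructible_UNIV] by (auto simp: characters_def)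

lemma character_Inter:
  assumes "\<omega> \<in> characters"
  shows "finite P \<Longrightarrow> (\<And>X. X \<in> P \<Longrightarrow> \<omega> X) \<Longrightarrow> \<omega> (\<Inter>P)"
proof (induction rule: finite_induct)
  case empty
  then show ?case using assms by (simp add: character_UNIV)
next
  case (insert X P)
  then have "\<omega> X" "\<omega> (\<Inter>P)" by auto
  then show ?case
    using character_Int[OF assms] character_constructible[OF assms] by simp
qed

lemma point_character_character: "point_character s \<in> characters"
  by (auto simp: characters_def point_character_def intro!: exI[of _ UNIV])

lemma continuous_eval_character: "continuous_on S (\<lambda>\<omega> :: 'a set \<Rightarrow> bool. \<omega> X)"
  using continuous_on_product_coordinates[of X] continuous_on_subset by blast

lemma open_character_set: "open {\<omega> :: 'a set \<Rightarrow> bool. \<omega> X}"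
proof -
  have "open ((\<lambda>\<omega> :: 'a set \<Rightarrow> bool. \<omega> X) -` {True})"
    by (rule open_vimage[OF open_discrete continuous_eval_character])
  then show ?thesis by (simp add: vimage_def)
qed

lemma closed_character_set: "closed {\<omega> :: 'a set \<Rightarrow> bool. \<omega> X}"
proof -
  have "open ((\<lambda>\<omega> :: 'a set \<Rightarrow> bool. \<omega> X) -` {False})"
    by (rule open_vimage[OF open_discrete continuous_eval_character])
  moreover have "- {\<omega> :: 'a set \<Rightarrow> bool. \<omega> X} = (\<lambda>\<omega>. \<omega> X) -` {False}" by auto
  ultimately show ?thesis by (simp add: closed_def)
qed

text \<open>For finite \<open>P\<close> and \<open>Q\<close> these clopen sets form a basis of the
  product topology. If \<open>F\<close> is a foundation set for \<open>X\<close>, then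
  \<open>cylinder {X} F\<close> is the set of characters that corresponds to the projection onto
  \<open>X - \<Union>F\<close>.\<close>

definition cylinder :: "'a set set \<Rightarrow> 'a set set \<Rightarrow> 'a character set" where
  "cylinder P Q = {\<omega>. (\<forall>X\<in>P. \<omega> X) \<and> (\<forall>X\<in>Q. \<not> \<omega> X)}"

lemma open_cylinder:
  assumes "finite P" "finite Q"
  shows "open (cylinder P Q)"
proof -
  have "cylinder P Q = (\<Inter>X\<in>P. {\<omega>. \<omega> X}) \<inter> (\<Inter>X\<in>Q. - {\<omega>. \<omega> X})"
    by (auto simp: cylinder_def)
  then show ?thesis
    using assms by (simp only:)
      (intro open_Int open_INT ballI open_character_set open_Compl closed_character_set; assumption)
qed

lemma closed_cylinder: "closed (cylinder P Q)"
proof -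
  have "cylinder P Q = (\<Inter>X\<in>P. {\<omega>. \<omega> X}) \<inter> (\<Inter>X\<in>Q. - {\<omega>. \<omega> X})"
    by (auto simp: cylinder_def)
  then show ?thesis
    by (simp only:) (intro closed_Int closed_INT ballI open_character_set closed_Compl closed_character_set)
qed

text \<open>A basic box restricts only finitely many coordinates; as the coordinates are Boolean,
  these can be frozen at their values at \<omega>.\<close>

lemma open_contains_cylinder:
  fixes \<omega> :: "'a character"
  assumes "open U" "\<omega> \<in> U"
  obtains P Q where "finite P" "finite Q" "\<omega> \<in> cylinder P Q" "cylinder P Q \<subseteq> U"
proof -
  have "openin (product_topology (\<lambda>i. euclidean) UNIV) U"
    using assms(1) by (simp add: open_fun_def)
  then obtain B where B: "finite {i. B i \<noteq> (UNIV :: bool set)}" "\<omega> \<in> Pi\<^sub>E UNIV B" "Pi\<^sub>E UNIV B \<subseteq> U"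
    using assms(2) by (auto simp: openin_product_topology_alt)
  let ?I = "{i. B i \<noteq> UNIV}"
  show thesis
  proof (rule that[of "{i \<in> ?I. \<omega> i}" "{i \<in> ?I. \<not> \<omega> i}"])
    show "\<omega> \<in> cylinder {i \<in> ?I. \<omega> i} {i \<in> ?I. \<not> \<omega> i}"
      by (auto simp: cylinder_def)
    show "cylinder {i \<in> ?I. \<omega> i} {i \<in> ?I. \<not> \<omega> i} \<subseteq> U"
    proof
      fix \<psi> assume "\<psi> \<in> cylinder {i \<in> ?I. \<omega> i} {i \<in> ?I. \<not> \<omega> i}"
      then have "\<psi> i = \<omega> i" if "B i \<noteq> UNIV" for i
        using that by (auto simp: cylinder_def)
      then have "\<psi> i \<in> B i" for i
        using B(2) by (cases "B i = UNIV") (auto simp: PiE_iff)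
      then show "\<psi> \<in> U" using B(3) by (auto simp: PiE_iff)
    qed
  qed (use B(1) in auto)
qed

text \<open>Each condition of the rewritten form involves finitely many coordinates. Being nonzero
  is not of this kind, but for a multiplicative \<omega> it amounts to
  \<open>\<omega> UNIV\<close>.\<close>

lemma closed_characters: "closed (characters :: 'a::left_cancellative_monoid character set)"
proof -
  have *: "(characters :: 'a character set) = {\<omega>. \<omega> UNIV}
     \<inter> (\<Inter>X\<in>- constructible_ideals. - {\<omega>. \<omega> X})
     \<inter> (\<Inter>X\<in>constructible_ideals. \<Inter>Y\<in>constructible_ideals.
        ({\<omega>. \<omega> (X \<inter> Y)} \<inter> {\<omega>. \<omega> X} \<inter> {\<omega>. \<omega> Y}) \<union> (- {\<omega>. \<omega> (X \<inter> Y)} \<inter> (- {\<omega>. \<omega> X} \<union> - {\<omega>. \<omega> Y})))"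
    (is "?l = ?r")
  proof (intro equalityI subsetI)
    fix \<omega> assume "\<omega> \<in> ?l"
    then show "\<omega> \<in> ?r" using character_UNIV[of \<omega>] by (auto simp: characters_def)
  next
    fix \<omega> assume "\<omega> \<in> ?r"
    then show "\<omega> \<in> ?l" unfolding characters_def by simp blast
  qed
  show ?thesis unfolding *
    by (intro closed_Int closed_INT closed_Un ballI closed_character_set closed_Compl open_character_set)
qed

lemma Omega_closure: "Omega = closure (range point_character)"
  unfolding Omega_def using point_character_character
  by (intro Int_absorb1 closure_minimal closed_characters) auto

lemma Omega_character: "\<omega> \<in> Omega \<Longrightarrow> \<omega> \<in> characters"
  by (simp add: Omega_def)

lemma point_character_Omega [simp]: "point_character s \<in> Omega"
  unfolding Omega_closure using closure_subset by fastforce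

lemma closed_Omega: "closed Omega"
  by (simp add: Omega_closure)

lemma compact_characters_UNIV: "compact (UNIV :: 'a character set)"
proof -
  have "compact_space (product_topology (\<lambda>i :: 'a set. (euclidean :: bool topology)) UNIV)"
    by (intro compact_space_product_topology[THEN iffD2] disjI2 ballI)
      (simp add: compact_space_def finite_imp_compact)
  then have "compact_space (euclidean :: ('a set \<Rightarrow> bool) topology)"
    by (simp add: euclidean_product_topology)
  then show ?thesis by (simp add: compact_space_def)
qed

lemma compact_closed_characters: "closed K \<Longrightarrow> compact (K :: 'a character set)"
  using closed_Int_compact[OF _ compact_characters_UNIV] by fastforce

lemma compact_Omega: "compact Omega"
  by (rule compact_closed_characters[OF closed_Omega])

text \<open>Characters as such may take the value 1 at the empty ideal. Point characters vanish
  there, and this closed condition passes to the closure.\<close>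

lemma character_not_empty: "\<omega> \<in> Omega \<Longrightarrow> \<not> \<omega> {}"
proof -
  have "closure (range point_character) \<subseteq> - {\<omega> :: 'a character. \<omega> {}}"
    by (rule closure_minimal) (auto simp: point_character_def open_character_set)
  then show "\<omega> \<in> Omega \<Longrightarrow> \<not> \<omega> {}" by (auto simp: Omega_closure)
qed

lemma push_character_eq:
  "push_character g \<omega> X \<longleftrightarrow> X \<in> constructible_ideals \<and> \<omega> (map_vimage g X)"
  by (simp add: push_character_def map_vimage_def)

lemma push_character_comp:
  assumes "g \<in> left_inverse_hull"
  shows "push_character (g \<circ>\<^sub>m h) \<omega> = push_character g (push_character h \<omega>)"
  using assms by (auto simp: fun_eq_iff push_character_eq map_vimage_comp map_vimage_constructible)

lemma push_character_dom_comp: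
  assumes "k \<in> left_inverse_hull"
  shows "push_character g \<omega> (dom k) \<longleftrightarrow> \<omega> (dom (k \<circ>\<^sub>m g))"
  using assms by (simp add: push_character_eq dom_map_comp)

text \<open>Pulling back along the inverse of g and then along g replaces an ideal by its
  intersection with the domain of g, which \<omega> does not notice because it is 1 on that
  domain.\<close>

lemma push_character_inv:
  assumes "g \<in> left_inverse_hull" "\<omega> \<in> characters" "\<omega> (dom g)"
  shows "push_character (partial_inv g) (push_character g \<omega>) = \<omega>"
proof
  fix X
  have "\<omega> (X \<inter> dom g) \<longleftrightarrow> \<omega> X" if "X \<in> constructible_ideals"
    using assms that by (simp add: character_Int)
  then show "push_character (partial_inv g) (push_character g \<omega>) X = \<omega> X"
    using assms character_constructible[OF assms(2), of X]
    by (auto simp: push_character_eq map_vimage_partial_inv map_vimage_constructible left_inverse_hull.intros)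
qed

lemma push_character_ran:
  assumes "g \<in> left_inverse_hull"
  shows "push_character g \<omega> (dom (partial_inv g)) \<longleftrightarrow> \<omega> (dom g)"
proof -
  have "map_vimage g (dom (partial_inv g)) = dom g"
    by (auto simp: map_vimage_def dom_partial_inv ran_def)
  with assms show ?thesis by (simp add: push_character_eq left_inverse_hull.intros)
qed

lemma push_point_character:
  assumes "g \<in> left_inverse_hull" "g s = Some t"
  shows "push_character g (point_character s) = point_character t"
proof
  fix X
  have "s \<in> map_vimage g X \<longleftrightarrow> t \<in> X"
    using assms(2) by (simp add: map_vimage_def)
  then show "push_character g (point_character s) X = point_character t X"
    using map_vimage_constructible[OF assms(1), of X] by (auto simp: push_character_eq point_character_def)
qed

lemma continuous_push_character: "continuous_on S (push_character g)"
proof (rule continuous_on_coordinatewise_then_product)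
  show "continuous_on S (\<lambda>\<omega>. push_character g \<omega> X)" for X
    by (cases "X \<in> constructible_ideals")
      (simp_all add: push_character_eq continuous_eval_character)
qed

text \<open>The condition \<open>\<omega> (dom g)\<close> is open, so \<omega> is a limit of point
  characters of elements of the domain. These are pushed to point characters, and pushing is
  continuous.\<close>

lemma push_character_Omega:
  assumes "g \<in> left_inverse_hull" "\<omega> \<in> Omega" "\<omega> (dom g)"
  shows "push_character g \<omega> \<in> Omega"
proof -
  have "\<omega> \<in> closure ({\<omega>. \<omega> (dom g)} \<inter> range point_character)"
    using assms(2,3) open_Int_closure_subset[OF open_character_set] unfolding Omega_closure by blast
  then have "push_character g \<omega> \<in> closure (push_character g ` ({\<omega>. \<omega> (dom g)} \<inter> range point_character))"
    using image_closure_subset[OF continuous_push_character closed_closure closure_subset] by blast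
  moreover have "push_character g ` ({\<omega>. \<omega> (dom g)} \<inter> range point_character) \<subseteq> range point_character"
  proof clarify
    fix s assume "point_character s (dom g)"
    then obtain t where "g s = Some t" by (auto simp: point_character_def)
    then show "push_character g (point_character s) \<in> range point_character"
      using push_point_character[OF assms(1)] by blast
  qed
  ultimately show ?thesis
    unfolding Omega_closure by (meson closure_mono subsetD)
qed

section \<open>The groupoid of germs\<close>

lemma germ_pairs_iff:
  "(g, \<omega>) \<in> germ_pairs \<longleftrightarrow> g \<in> left_inverse_hull \<and> \<omega> \<in> Omega \<and> \<omega> (dom g)"
  by (simp add: germ_pairs_def)

lemma germ_pairs_comp:
  assumes "(h, \<psi>) \<in> germ_pairs" "(g, push_character h \<psi>) \<in> germ_pairs"
  shows "(g \<circ>\<^sub>m h, \<psi>) \<in> germ_pairs"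
  using assms by (auto simp: germ_pairs_iff push_character_dom_comp left_inverse_hull.intros)

lemma germ_pairs_inv:
  assumes "(g, \<omega>) \<in> germ_pairs"
  shows "(partial_inv g, push_character g \<omega>) \<in> germ_pairs"
  using assms by (auto simp: germ_pairs_iff push_character_ran push_character_Omega left_inverse_hull.intros)

lemma equiv_germ_rel:
  "equiv germ_pairs (germ_rel :: ((('a::left_cancellative_monoid \<rightharpoonup> 'a) \<times> 'a character) \<times> _) set)"
proof (rule equivI)
  show "germ_rel \<subseteq> germ_pairs \<times> germ_pairs" by (auto simp: germ_rel_def)
  show "refl_on germ_pairs germ_rel"
    by (auto simp: refl_on_def germ_rel_def germ_pairs_iff)
  show "sym germ_rel"
    by (auto simp: sym_def germ_rel_def)
  show "trans germ_rel"
  proof (rule transI)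
    fix p q r
    assume "(p, q) \<in> germ_rel" "(q, r) \<in> germ_rel"
    then obtain g h k \<omega> A B where pqr: "p = (g, \<omega>)" "r = (k, \<omega>)"
      and *: "(g, \<omega>) \<in> germ_pairs" "A \<in> constructible_ideals" "\<omega> A" "g |` A = h |` A"
        "B \<in> constructible_ideals" "\<omega> B" "h |` B = k |` B" "(k, \<omega>) \<in> germ_pairs"
      by (auto simp: germ_rel_def)
    have "g |` (A \<inter> B) = (h |` A) |` B" by (simp flip: *(4))
    also have "\<dots> = (h |` B) |` A" by (simp add: Int_commute)
    also have "\<dots> = k |` (A \<inter> B)" by (simp add: *(7) Int_commute)
    finally have "g |` (A \<inter> B) = k |` (A \<inter> B)" .
    moreover have "\<omega> (A \<inter> B)"
      using * character_Int[of \<omega> A B] by (simp add: germ_pairs_iff Omega_character)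
    ultimately show "(p, r) \<in> germ_rel"
      using * by (auto simp: germ_rel_def pqr)
  qed
qed

lemma germ_eq_iff:
  assumes "(g, \<omega>) \<in> germ_pairs" "(h, \<psi>) \<in> germ_pairs"
  shows "germ g \<omega> = germ h \<psi> \<longleftrightarrow> \<omega> = \<psi> \<and> (\<exists>A\<in>constructible_ideals. \<omega> A \<and> g |` A = h |` A)"
  unfolding germ_def eq_equiv_class_iff[OF equiv_germ_rel assms]
  using assms by (auto simp: germ_rel_def)

lemma germ_eqI:
  assumes "(g, \<omega>) \<in> germ_pairs" "(h, \<omega>) \<in> germ_pairs" "\<omega> A" "g |` A = h |` A"
  shows "germ g \<omega> = germ h \<omega>"
  using assms character_constructible[OF Omega_character, of \<omega> A]
  by (auto simp: germ_eq_iff germ_pairs_iff)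

lemma mem_germ_iff:
  assumes "(g, \<omega>) \<in> germ_pairs"
  shows "(h, \<psi>) \<in> germ g \<omega> \<longleftrightarrow> (h, \<psi>) \<in> germ_pairs \<and> germ h \<psi> = germ g \<omega>"
proof -
  have "(h, \<psi>) \<in> germ g \<omega> \<longleftrightarrow> ((g, \<omega>), (h, \<psi>)) \<in> germ_rel" by (simp add: germ_def)
  also have "\<dots> \<longleftrightarrow> (h, \<psi>) \<in> germ_pairs \<and> germ h \<psi> = germ g \<omega>"
    unfolding germ_def using equiv_class_eq_iff[OF equiv_germ_rel] assms
    by (metis (no_types, lifting))
  finally show ?thesis .
qed

lemma arrows_eq: "arrows groupoid_P = (\<lambda>(g, \<omega>). germ g \<omega>) ` germ_pairs"
  by (auto simp: groupoid_P_def quotient_def germ_def)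

lemma arrows_cases:
  assumes "a \<in> arrows groupoid_P"
  obtains g \<omega> where "a = germ g \<omega>" "(g, \<omega>) \<in> germ_pairs"
  using assms by (auto simp: arrows_eq)

lemma germ_arrow [simp]: "(g, \<omega>) \<in> germ_pairs \<Longrightarrow> germ g \<omega> \<in> arrows groupoid_P"
  by (auto simp: arrows_eq)

lemma src_germ [simp]:
  assumes "(g, \<omega>) \<in> germ_pairs"
  shows "src groupoid_P (germ g \<omega>) = \<omega>"
  unfolding groupoid_P_def using assms
  by (auto simp: mem_germ_iff germ_eq_iff)

text \<open>This makes the range well defined. The preimages of an ideal under \<open>g\<close> and
  \<open>h\<close> agree inside \<open>A\<close>, and \<omega> sees only the part of an ideal inside
  \<open>A\<close>.\<close>

lemma germ_eq_push:
  assumes "(g, \<omega>) \<in> germ_pairs" "(h, \<psi>) \<in> germ_pairs" "germ g \<omega> = germ h \<psi>"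
  shows "push_character g \<omega> = push_character h \<psi>"
proof -
  from assms obtain A where A: "\<omega> = \<psi>" "A \<in> constructible_ideals" "\<omega> A" "g |` A = h |` A"
    by (auto simp: germ_eq_iff)
  have \<omega>: "\<omega> \<in> characters" and g: "g \<in> left_inverse_hull" and h: "h \<in> left_inverse_hull"
    using assms A(1) by (auto simp: germ_pairs_iff Omega_character)
  have "\<omega> (map_vimage g X) \<longleftrightarrow> \<omega> (map_vimage h X)" if "X \<in> constructible_ideals" for X
  proof -
    have "A \<inter> map_vimage g X = A \<inter> map_vimage h X"
      using A(4) by (auto simp: map_vimage_def restrict_map_def fun_eq_iff split: if_splits)
    then show ?thesis
      using character_Int[OF \<omega> A(2)] map_vimage_constructible[OF g that]
        map_vimage_constructible[OF h that] A(3) by metis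
  qed
  then show ?thesis using A(1) by (auto simp: fun_eq_iff push_character_eq)
qed

lemma rng_germ [simp]:
  assumes "(g, \<omega>) \<in> germ_pairs"
  shows "rng groupoid_P (germ g \<omega>) = push_character g \<omega>"
  unfolding groupoid_P_def using assms
  by (auto simp: mem_germ_iff intro!: the_equality dest: germ_eq_push[OF _ assms])

text \<open>If the left factors agree on \<open>A\<close> and the right factors on \<open>B\<close>,
  then both products agree on the intersection of \<open>B\<close> with the preimage of
  \<open>A\<close> under \<open>h\<close>, and \<psi> is 1 on this intersection.\<close>

lemma germ_comp_cong:
  assumes "(g, push_character h \<psi>) \<in> germ_pairs" "(g', push_character h \<psi>) \<in> germ_pairs"
    "(h, \<psi>) \<in> germ_pairs" "(h', \<psi>) \<in> germ_pairs"
    "germ g (push_character h \<psi>) = germ g' (push_character h \<psi>)" "germ h \<psi> = germ h' \<psi>"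
  shows "germ (g \<circ>\<^sub>m h) \<psi> = germ (g' \<circ>\<^sub>m h') \<psi>"
proof -
  obtain A where A: "A \<in> constructible_ideals" "push_character h \<psi> A" "g |` A = g' |` A"
    using assms by (auto simp: germ_eq_iff)
  obtain B where B: "B \<in> constructible_ideals" "\<psi> B" "h |` B = h' |` B"
    using assms by (auto simp: germ_eq_iff)
  show ?thesis
  proof (rule germ_eqI)
    show "(g \<circ>\<^sub>m h, \<psi>) \<in> germ_pairs" using assms by (auto intro: germ_pairs_comp)
    show "(g' \<circ>\<^sub>m h', \<psi>) \<in> germ_pairs"
      using assms germ_eq_push[OF assms(3,4,6)] by (auto intro: germ_pairs_comp)
    have "\<psi> (map_vimage h A)" using A by (simp add: push_character_eq)
    moreover have "\<psi> \<in> characters" "map_vimage h A \<in> constructible_ideals"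
      using assms(3) A(1) by (auto simp: germ_pairs_iff Omega_character map_vimage_constructible)
    ultimately show "\<psi> (map_vimage h A \<inter> B)"
      using B by (simp add: character_Int)
    show "(g \<circ>\<^sub>m h) |` (map_vimage h A \<inter> B) = (g' \<circ>\<^sub>m h') |` (map_vimage h A \<inter> B)"
    proof
      fix x
      have "(g \<circ>\<^sub>m h) x = (g' \<circ>\<^sub>m h') x" if x: "x \<in> map_vimage h A" "x \<in> B"
      proof -
        obtain u where u: "u \<in> A" "h x = Some u" using x by (auto simp: map_vimage_def)
        moreover have "h' x = h x" using B(3) x by (metis restrict_in)
        moreover have "g u = g' u" using A(3) u by (metis restrict_in)
        ultimately show ?thesis by (simp add: map_comp_def)
      qed
      then show "((g \<circ>\<^sub>m h) |` (map_vimage h A \<inter> B)) x = ((g' \<circ>\<^sub>m h') |` (map_vimage h A \<inter> B)) x"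
        by (simp add: restrict_map_def)
    qed
  qed
qed

text \<open>All products of representatives have the same germ, so that the union defining
  \<open>gmult\<close> is that of a single set. Inverses are treated in the same way below.\<close>

lemma gmult_germ [simp]:
  assumes h: "(h, \<psi>) \<in> germ_pairs" and g: "(g, push_character h \<psi>) \<in> germ_pairs"
  shows "gmult groupoid_P (germ g (push_character h \<psi>)) (germ h \<psi>) = germ (g \<circ>\<^sub>m h) \<psi>"
proof -
  have eq: "germ (g' \<circ>\<^sub>m h') \<psi>' = germ (g \<circ>\<^sub>m h) \<psi>"
    if "(g', \<omega>') \<in> germ g (push_character h \<psi>)" "(h', \<psi>') \<in> germ h \<psi>" "\<omega>' = push_character h' \<psi>'"
    for g' \<omega>' h' \<psi>'
  proof -
    have h': "(h', \<psi>') \<in> germ_pairs" "germ h' \<psi>' = germ h \<psi>"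
      using that h by (auto simp: mem_germ_iff)
    then have "\<psi>' = \<psi>" using h by (simp add: germ_eq_iff)
    have g': "(g', \<omega>') \<in> germ_pairs" "germ g' \<omega>' = germ g (push_character h \<psi>)"
      using that g by (auto simp: mem_germ_iff)
    then have "\<omega>' = push_character h \<psi>" using g by (simp add: germ_eq_iff)
    then show ?thesis
      using germ_comp_cong[of g h \<psi> g' h'] g h g' h' \<open>\<psi>' = \<psi>\<close> by simp
  qed
  have "(g, push_character h \<psi>) \<in> germ g (push_character h \<psi>)" "(h, \<psi>) \<in> germ h \<psi>"
    using g h by (auto simp: mem_germ_iff)
  then have "{germ (g' \<circ>\<^sub>m h') \<psi>' | g' \<omega>' h' \<psi>'. (g', \<omega>') \<in> germ g (push_character h \<psi>)
      \<and> (h', \<psi>') \<in> germ h \<psi> \<and> \<omega>' = push_character h' \<psi>'} = {germ (g \<circ>\<^sub>m h) \<psi>}" (is "?S = _")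
    using eq by (intro equalityI subsetI) (blast, blast)
  moreover have "gmult groupoid_P (germ g (push_character h \<psi>)) (germ h \<psi>) = \<Union>?S"
    by (simp add: groupoid_P_def)
  ultimately show ?thesis by simp
qed

lemma ginv_germ [simp]:
  assumes g: "(g, \<omega>) \<in> germ_pairs"
  shows "ginv groupoid_P (germ g \<omega>) = germ (partial_inv g) (push_character g \<omega>)"
proof -
  have eq: "germ (partial_inv g') (push_character g' \<omega>') = germ (partial_inv g) (push_character g \<omega>)"
    if "(g', \<omega>') \<in> germ g \<omega>" for g' \<omega>'
  proof -
    have g': "(g', \<omega>') \<in> germ_pairs" "germ g' \<omega>' = germ g \<omega>"
      using that g by (auto simp: mem_germ_iff)
    then obtain A where A: "\<omega>' = \<omega>" "A \<in> constructible_ideals" "\<omega> A" "g' |` A = g |` A"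
      using g by (auto simp: germ_eq_iff)
    have push: "push_character g' \<omega>' = push_character g \<omega>"
      by (rule germ_eq_push[OF g'(1) g g'(2)])
    have hull: "g \<in> left_inverse_hull" "g' \<in> left_inverse_hull"
      using g g' by (auto simp: germ_pairs_iff)
    show ?thesis unfolding push
    proof (rule germ_eqI[where A = "map_vimage (partial_inv g) A"])
      show "(partial_inv g', push_character g \<omega>) \<in> germ_pairs"
        "(partial_inv g, push_character g \<omega>) \<in> germ_pairs"
        using germ_pairs_inv[OF g'(1)] germ_pairs_inv[OF g] push by auto
      show "push_character g \<omega> (map_vimage (partial_inv g) A)"
        using g A(2,3) hull by (simp add: push_character_eq map_vimage_partial_inv
            map_vimage_constructible left_inverse_hull.intros germ_pairs_iff character_Int Omega_character)
      have "partial_inv g' y = partial_inv g y" if y: "y \<in> map_vimage (partial_inv g) A" for y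
      proof -
        obtain x where x: "x \<in> A" "partial_inv g y = Some x"
          using y by (auto simp: map_vimage_def)
        have "g x = Some y" using x(2) by (simp add: hull_partial_inv_iff hull)
        then have "g' x = Some y" using A(4) x(1) by (metis restrict_in)
        then show ?thesis using x(2) by (simp add: hull_partial_inv_iff[symmetric] hull)
      qed
      then show "partial_inv g' |` map_vimage (partial_inv g) A = partial_inv g |` map_vimage (partial_inv g) A"
        by (auto simp: restrict_map_def)
    qed
  qed
  have "(g, \<omega>) \<in> germ g \<omega>" using g by (simp add: mem_germ_iff)
  then have "{germ (partial_inv g') (push_character g' \<omega>') | g' \<omega>'. (g', \<omega>') \<in> germ g \<omega>}
      = {germ (partial_inv g) (push_character g \<omega>)}" (is "?S = _")
    using eq by (intro equalityI subsetI) (blast, blast)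
  moreover have "ginv groupoid_P (germ g \<omega>) = \<Union>?S"
    by (simp add: groupoid_P_def)
  ultimately show ?thesis by simp
qed

lemma units_groupoid_P [simp]: "units groupoid_P = Omega"
  by (simp add: groupoid_P_def)

lemma gtop_groupoid_P: "gtop groupoid_P
    = topology_generated_by {basic_open g U | g U. g \<in> left_inverse_hull \<and>
      openin (top_of_set Omega) U \<and> U \<subseteq> {\<omega> \<in> Omega. \<omega> (dom g)}}"
  by (simp add: groupoid_P_def)

section \<open>The convolution algebra spanned by functions on bisections\<close>

lemma arrow_rng_Omega: "a \<in> arrows groupoid_P \<Longrightarrow> rng groupoid_P a \<in> Omega"
  by (erule arrows_cases) (auto simp: germ_pairs_iff push_character_Omega)

lemma arrow_src_Omega: "a \<in> arrows groupoid_P \<Longrightarrow> src groupoid_P a \<in> Omega"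
  by (erule arrows_cases) (auto simp: germ_pairs_iff)

lemma map_comp_assoc: "(f \<circ>\<^sub>m g) \<circ>\<^sub>m h = f \<circ>\<^sub>m (g \<circ>\<^sub>m h)"
  by (rule ext) (simp add: map_comp_def split: option.split)

lemma map_comp_dom_subset: "dom (g \<circ>\<^sub>m h) \<subseteq> dom h"
  by (auto simp: map_comp_def split: option.splits)

text \<open>The function \<phi> is transported to the bisection of \<open>g\<close> along the source
  map. Only its values at those characters in \<open>Omega\<close> that contain the domain of
  \<open>g\<close> matter. If the groupoid is not Hausdorff, the extension by 0 need not be
  continuous.\<close>

definition bisection_fun ::
    "('a \<rightharpoonup> 'a) \<Rightarrow> ('a character \<Rightarrow> complex) \<Rightarrow> 'a::left_cancellative_monoid germ \<Rightarrow> complex" where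
  "bisection_fun g \<phi> a
    = (if \<exists>\<omega>. (g, \<omega>) \<in> germ_pairs \<and> a = germ g \<omega> then \<phi> (src groupoid_P a) else 0)"

lemma bisection_fun_germ:
  assumes "(h, \<omega>) \<in> germ_pairs"
  shows "bisection_fun g \<phi> (germ h \<omega>)
    = (if (g, \<omega>) \<in> germ_pairs \<and> germ h \<omega> = germ g \<omega> then \<phi> \<omega> else 0)"
  using assms by (auto simp: bisection_fun_def germ_eq_iff)

lemma bisection_fun_not_arrow: "a \<notin> arrows groupoid_P \<Longrightarrow> bisection_fun g \<phi> a = 0"
  by (auto simp: bisection_fun_def)

lemma bisection_fun_cong:
  assumes "\<And>\<omega>. \<omega> \<in> Omega \<Longrightarrow> \<omega> (dom g) \<Longrightarrow> \<phi> \<omega> = \<psi> \<omega>"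
  shows "bisection_fun g \<phi> = bisection_fun g \<psi>"
  using assms by (auto simp: bisection_fun_def fun_eq_iff germ_pairs_iff)

text \<open>This is meaningful if the range of the arrow contains the domain of \<open>k\<close>.
  Sources are preserved, so \<open>k\<close> acts on each source fibre as a partial bijection, with
  \<open>partial_inv k\<close> acting as its inverse.\<close>

definition germ_act ::
    "('a \<rightharpoonup> 'a) \<Rightarrow> 'a germ \<Rightarrow> 'a::left_cancellative_monoid germ" where
  "germ_act k a = gmult groupoid_P (germ k (rng groupoid_P a)) a"

lemma germ_act_germ:
  assumes "(g, x) \<in> germ_pairs" "k \<in> left_inverse_hull" "push_character g x (dom k)"
  shows "germ_act k (germ g x) = germ (k \<circ>\<^sub>m g) x" "(k \<circ>\<^sub>m g, x) \<in> germ_pairs"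
proof -
  have "(k, push_character g x) \<in> germ_pairs"
    using assms by (auto simp: germ_pairs_iff push_character_Omega)
  then show "germ_act k (germ g x) = germ (k \<circ>\<^sub>m g) x" "(k \<circ>\<^sub>m g, x) \<in> germ_pairs"
    using assms(1) by (simp_all add: germ_act_def germ_pairs_comp)
qed

lemma germ_act:
  assumes a: "a \<in> arrows groupoid_P" and k: "k \<in> left_inverse_hull" "rng groupoid_P a (dom k)"
  shows germ_act_arrow: "germ_act k a \<in> arrows groupoid_P"
    and src_germ_act: "src groupoid_P (germ_act k a) = src groupoid_P a"
    and rng_germ_act: "rng groupoid_P (germ_act k a) = push_character k (rng groupoid_P a)"
proof -
  obtain g x where gx: "a = germ g x" "(g, x) \<in> germ_pairs" using a by (rule arrows_cases)
  then have k': "push_character g x (dom k)" using k by simp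
  show "germ_act k a \<in> arrows groupoid_P" "src groupoid_P (germ_act k a) = src groupoid_P a"
    "rng groupoid_P (germ_act k a) = push_character k (rng groupoid_P a)"
    using germ_act_germ[OF gx(2) k(1) k'] gx k by (simp_all add: push_character_comp)
qed

lemma germ_act_comp:
  assumes a: "a \<in> arrows groupoid_P" and k: "k \<in> left_inverse_hull" and h: "h \<in> left_inverse_hull"
    and h': "rng groupoid_P a (dom h)" and k': "rng groupoid_P (germ_act h a) (dom k)"
  shows "germ_act k (germ_act h a) = germ_act (k \<circ>\<^sub>m h) a"
proof -
  obtain g x where gx: "a = germ g x" "(g, x) \<in> germ_pairs" using a by (rule arrows_cases)
  have 1: "push_character g x (dom h)" using h' gx by simp
  note 2 = germ_act_germ[OF gx(2) h 1]
  have 3: "push_character (h \<circ>\<^sub>m g) x (dom k)" using k' 2 gx by simp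
  have "push_character g x (dom (k \<circ>\<^sub>m h))"
    using 3 by (simp add: push_character_comp h flip: push_character_dom_comp[OF k])
  from germ_act_germ(1)[OF gx(2) left_inverse_hull.intros(3)[OF k h] this]
  show ?thesis
    using germ_act_germ(1)[OF 2(2) k 3] 2 gx by (simp add: map_comp_assoc)
qed

lemma germ_act_id:
  assumes a: "a \<in> arrows groupoid_P" and X: "X \<in> constructible_ideals" "rng groupoid_P a X"
  shows "germ_act (Some |` X) a = a"
proof -
  obtain g x where gx: "a = germ g x" "(g, x) \<in> germ_pairs" using a by (rule arrows_cases)
  have 1: "push_character g x (dom (Some |` X))" using X gx by simp
  note 2 = germ_act_germ[OF gx(2) id_on_in_hull[OF X(1)] 1]
  have "germ (Some |` X \<circ>\<^sub>m g) x = germ g x"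
  proof (rule germ_eqI[OF 2(2) gx(2), where A = "map_vimage g X"])
    show "x (map_vimage g X)" using X gx by (simp add: push_character_eq)
    show "((Some |` X) \<circ>\<^sub>m g) |` map_vimage g X = g |` map_vimage g X"
      by (auto simp: restrict_map_def map_comp_def map_vimage_def fun_eq_iff)
  qed
  with 2 gx show ?thesis by simp
qed

lemma germ_act_inverse:
  assumes a: "a \<in> arrows groupoid_P" and k: "k \<in> left_inverse_hull" and k': "rng groupoid_P a (dom k)"
  shows "germ_act (partial_inv k) (germ_act k a) = a"
proof -
  have "germ_act (partial_inv k) (germ_act k a) = germ_act (partial_inv k \<circ>\<^sub>m k) a"
    using assms by (intro germ_act_comp left_inverse_hull.intros)
      (auto simp: rng_germ_act push_character_ran)
  also have "\<dots> = a"
    using assms by (simp add: partial_inv_comp_self hull_inj germ_act_id)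
  finally show ?thesis .
qed

text \<open>The sum that \<open>convolution\<close> and \<open>regular_rep\<close> share, before
  values off the arrows or off the fibre are cut to 0.\<close>

definition left_conv :: "('a::left_cancellative_monoid germ \<Rightarrow> complex) \<Rightarrow> ('a germ \<Rightarrow> complex)
    \<Rightarrow> 'a germ \<Rightarrow> complex" where
  "left_conv f \<xi> a = (\<Sum>\<^sub>\<infinity>h\<in>{h \<in> arrows groupoid_P. rng groupoid_P h = rng groupoid_P a}.
    f h * \<xi> (gmult groupoid_P (ginv groupoid_P h) a))"

lemma convolution_left_conv:
  "convolution groupoid_P f1 f2 = (\<lambda>a. if a \<in> arrows groupoid_P then left_conv f1 f2 a else 0)"
  unfolding convolution_def left_conv_def ..

lemma regular_rep_left_conv:
  "regular_rep groupoid_P x f \<xi> = Abs_ell2 (\<lambda>a. if a \<in> arrows groupoid_P \<and> src groupoid_P a = x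
    then left_conv f (ell2_apply \<xi>) a else 0)"
  unfolding regular_rep_def left_conv_def ..

text \<open>The range map is injective on the bisection of \<open>k\<close>: the source is recovered
  from the range by pushing with the inverse.\<close>

lemma bisection_fun_rng_unique:
  assumes "k \<in> left_inverse_hull" "h \<in> arrows groupoid_P" "bisection_fun k \<phi> h \<noteq> 0"
  shows "rng groupoid_P h (dom (partial_inv k))"
    "h = germ k (push_character (partial_inv k) (rng groupoid_P h))"
proof -
  obtain \<omega> where \<omega>: "(k, \<omega>) \<in> germ_pairs" "h = germ k \<omega>"
    using assms(3) by (auto simp: bisection_fun_def split: if_splits)
  then show "rng groupoid_P h (dom (partial_inv k))"
    "h = germ k (push_character (partial_inv k) (rng groupoid_P h))"
    by (auto simp: push_character_ran germ_pairs_iff push_character_inv Omega_character)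
qed

text \<open>At most one summand survives, at the germ of \<open>k\<close> that has the range of
  \<open>a\<close>. Left convolution with a function on a bisection is thus a weighted partial
  permutation, and the analysis of the regular representations rests on this formula.\<close>

lemma left_conv_bisection_fun:
  assumes k: "k \<in> left_inverse_hull" and a: "a \<in> arrows groupoid_P"
  shows "left_conv (bisection_fun k \<phi>) \<xi> a
    = (if rng groupoid_P a (dom (partial_inv k))
       then \<phi> (push_character (partial_inv k) (rng groupoid_P a)) * \<xi> (germ_act (partial_inv k) a)
       else 0)"
proof (cases "rng groupoid_P a (dom (partial_inv k))")
  case True
  define r where "r = rng groupoid_P a"
  define h0 where "h0 = germ k (push_character (partial_inv k) r)"
  have r: "r \<in> Omega" "r (dom (partial_inv k))"
    using a True by (auto simp: r_def arrow_rng_Omega)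
  have kk: "partial_inv k \<in> left_inverse_hull" by (intro left_inverse_hull.intros k)
  have pair: "(k, push_character (partial_inv k) r) \<in> germ_pairs"
    using germ_pairs_inv[of "partial_inv k" r] r kk k by (simp add: germ_pairs_iff)
  have ret: "push_character k (push_character (partial_inv k) r) = r"
    using push_character_inv[OF kk Omega_character[OF r(1)] r(2)] k by simp
  have "left_conv (bisection_fun k \<phi>) \<xi> a
      = (\<Sum>\<^sub>\<infinity>h\<in>{h0}. bisection_fun k \<phi> h * \<xi> (gmult groupoid_P (ginv groupoid_P h) a))"
    unfolding left_conv_def
  proof (rule infsum_cong_neutral)
    fix h assume h: "h \<in> {h0} - {h \<in> arrows groupoid_P. rng groupoid_P h = rng groupoid_P a}"
    then have "h = h0" by simp
    with h pair ret show "bisection_fun k \<phi> h * \<xi> (gmult groupoid_P (ginv groupoid_P h) a) = 0"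
      by (simp add: h0_def r_def)
  next
    fix h assume h: "h \<in> {h \<in> arrows groupoid_P. rng groupoid_P h = rng groupoid_P a} - {h0}"
    then have "bisection_fun k \<phi> h = 0"
      using bisection_fun_rng_unique(2)[OF k, of h \<phi>] by (auto simp: h0_def r_def)
    then show "bisection_fun k \<phi> h * \<xi> (gmult groupoid_P (ginv groupoid_P h) a) = 0" by simp
  qed simp
  also have "\<dots> = \<phi> (push_character (partial_inv k) r) * \<xi> (germ_act (partial_inv k) a)"
    using pair ret by (simp add: h0_def bisection_fun_germ germ_act_def r_def)
  finally show ?thesis using True by (simp add: r_def)
next
  case False
  have "left_conv (bisection_fun k \<phi>) \<xi> a = 0"
    unfolding left_conv_def
  proof (rule infsum_0)
    fix h assume h: "h \<in> {h \<in> arrows groupoid_P. rng groupoid_P h = rng groupoid_P a}"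
    then have "bisection_fun k \<phi> h = 0"
      using bisection_fun_rng_unique(1)[OF k, of h \<phi>] False by auto
    then show "bisection_fun k \<phi> h * \<xi> (gmult groupoid_P (ginv groupoid_P h) a) = 0" by simp
  qed
  with False show ?thesis by simp
qed

text \<open>Finite sums of functions on bisections, with scalars absorbed into the weights. The
  parameter \<open>Q\<close> selects the admissible weights, so that bounded ones and compactly
  supported ones over any set of units share one induction principle.\<close>

inductive_set bisection_span ::
    "(('a \<rightharpoonup> 'a) \<Rightarrow> ('a character \<Rightarrow> complex) \<Rightarrow> bool)
      \<Rightarrow> ('a::left_cancellative_monoid germ \<Rightarrow> complex) set"
  for Q where
  zero: "(\<lambda>_. 0) \<in> bisection_span Q"
| step: "f \<in> bisection_span Q \<Longrightarrow> Q g \<phi> \<Longrightarrow> (\<lambda>a. bisection_fun g \<phi> a + f a) \<in> bisection_span Q"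

lemma bisection_span_generator: "Q g \<phi> \<Longrightarrow> bisection_fun g \<phi> \<in> bisection_span Q"
  using bisection_span.step[OF bisection_span.zero, of Q g \<phi>] by simp

lemma bisection_span_add:
  "f \<in> bisection_span Q \<Longrightarrow> f' \<in> bisection_span Q \<Longrightarrow> (\<lambda>a. f a + f' a) \<in> bisection_span Q"
  by (induction rule: bisection_span.induct) (auto simp: add.assoc intro: bisection_span.step)

lemma bisection_span_sum:
  "finite I \<Longrightarrow> (\<And>i. i \<in> I \<Longrightarrow> F i \<in> bisection_span Q) \<Longrightarrow> (\<lambda>a. \<Sum>i\<in>I. F i a) \<in> bisection_span Q"
  by (induction rule: finite_induct) (auto intro: bisection_span.zero bisection_span_add)

lemma bisection_fun_scale: "c * bisection_fun g \<phi> a = bisection_fun g (\<lambda>\<omega>. c * \<phi> \<omega>) a"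
  by (auto simp: bisection_fun_def)

lemma bisection_span_scale:
  assumes "\<And>g \<phi>. Q g \<phi> \<Longrightarrow> Q g (\<lambda>\<omega>. c * \<phi> \<omega>)"
  shows "f \<in> bisection_span Q \<Longrightarrow> (\<lambda>a. c * f a) \<in> bisection_span Q"
  by (induction rule: bisection_span.induct)
    (auto simp: distrib_left bisection_fun_scale intro: assms bisection_span.intros)

lemma bisection_span_mono:
  assumes "\<And>g \<phi>. Q g \<phi> \<Longrightarrow> Q' g \<phi>"
  shows "f \<in> bisection_span Q \<Longrightarrow> f \<in> bisection_span Q'"
  by (induction rule: bisection_span.induct) (auto intro: assms bisection_span.intros)

text \<open>Boundedness without continuity suffices for the algebraic identities and the norm
  estimates of the regular representations. They are proved once in \<open>bounded_span\<close>,
  which contains C_c of the groupoid, of its boundary reduction and of the complement.\<close>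

definition bounded_on_dom :: "('a \<rightharpoonup> 'a) \<Rightarrow> ('a::left_cancellative_monoid character \<Rightarrow> complex) \<Rightarrow> bool" where
  "bounded_on_dom g \<phi> \<longleftrightarrow> g \<in> left_inverse_hull \<and>
    (\<exists>M. \<forall>\<omega>\<in>Omega. \<omega> (dom g) \<longrightarrow> cmod (\<phi> \<omega>) \<le> M)"

abbreviation bounded_span :: "('a::left_cancellative_monoid germ \<Rightarrow> complex) set" where
  "bounded_span \<equiv> bisection_span bounded_on_dom"

lemma bounded_span_scale: "f \<in> bounded_span \<Longrightarrow> (\<lambda>a. c * f a) \<in> bounded_span"
proof (rule bisection_span_scale)
  fix g :: "'a \<rightharpoonup> 'a" and \<phi> assume "bounded_on_dom g \<phi>"
  then obtain M where "g \<in> left_inverse_hull" "\<forall>\<omega>\<in>Omega. \<omega> (dom g) \<longrightarrow> cmod (\<phi> \<omega>) \<le> M"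
    by (auto simp: bounded_on_dom_def)
  then have "g \<in> left_inverse_hull \<and> (\<forall>\<omega>\<in>Omega. \<omega> (dom g) \<longrightarrow> cmod (c * \<phi> \<omega>) \<le> cmod c * M)"
    by (simp add: norm_mult mult_left_mono)
  then show "bounded_on_dom g (\<lambda>\<omega>. c * \<phi> \<omega>)"
    unfolding bounded_on_dom_def by blast
qed

lemma bounded_span_not_arrow: "f \<in> bounded_span \<Longrightarrow> a \<notin> arrows groupoid_P \<Longrightarrow> f a = 0"
  by (induction rule: bisection_span.induct) (auto simp: bisection_fun_not_arrow)

text \<open>Each range fibre meets the support of such a function in a finite set, so that the
  sums defining convolutions are finite.\<close>

lemma bounded_span_finite:
  "f \<in> bounded_span \<Longrightarrow> finite {h \<in> arrows groupoid_P. rng groupoid_P h = r \<and> f h \<noteq> 0}"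
proof (induction rule: bisection_span.induct)
  case (step f g \<phi>)
  have "{h \<in> arrows groupoid_P. rng groupoid_P h = r \<and> bisection_fun g \<phi> h + f h \<noteq> 0}
      \<subseteq> {germ g (push_character (partial_inv g) r)} \<union> {h \<in> arrows groupoid_P. rng groupoid_P h = r \<and> f h \<noteq> 0}"
    using bisection_fun_rng_unique(2)[of g _ \<phi>] step(2) by (auto simp: bounded_on_dom_def)
  with step(3) show ?case by (meson finite.intros finite_UnI finite_subset)
qed simp

lemma left_conv_summable:
  assumes "f \<in> bounded_span"
  shows "(\<lambda>h. f h * \<xi> (gmult groupoid_P (ginv groupoid_P h) a))
    summable_on {h \<in> arrows groupoid_P. rng groupoid_P h = r}"
  by (rule finite_nonzero_values_imp_summable_on, rule finite_subset[OF _ bounded_span_finite[OF assms, of r]]) auto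

lemma left_conv_add_left:
  assumes "f \<in> bounded_span" "f' \<in> bounded_span"
  shows "left_conv (\<lambda>a. f a + f' a) \<xi> a = left_conv f \<xi> a + left_conv f' \<xi> a"
  unfolding left_conv_def distrib_right by (intro infsum_add left_conv_summable assms)

lemma left_conv_add_right:
  assumes "f \<in> bounded_span"
  shows "left_conv f (\<lambda>a. \<xi> a + \<xi>' a) a = left_conv f \<xi> a + left_conv f \<xi>' a"
  unfolding left_conv_def distrib_left by (intro infsum_add left_conv_summable assms)

lemma left_conv_scale_left: "left_conv (\<lambda>a. c * f a) \<xi> a = c * left_conv f \<xi> a"
  unfolding left_conv_def mult.assoc by (rule infsum_cmult_right')

lemma left_conv_scale_right: "left_conv f (\<lambda>a. c * \<xi> a) a = c * left_conv f \<xi> a"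
  unfolding left_conv_def mult.left_commute[of _ c] by (rule infsum_cmult_right')

lemma left_conv_zero [simp]: "left_conv (\<lambda>_. 0) \<xi> a = 0" "left_conv f (\<lambda>_. 0) a = 0"
  by (simp_all add: left_conv_def)

text \<open>The weight of a product of two bisections: the left weight is evaluated at the pushed
  character. The value 0 off the domain of the composition keeps supports under control;
  \<open>star_fun\<close> is cut off likewise.\<close>

definition mult_fun where
  "mult_fun k \<phi> h \<psi> = (\<lambda>\<omega>. if \<omega> (dom (k \<circ>\<^sub>m h)) then \<phi> (push_character h \<omega>) * \<psi> \<omega> else (0::complex))"

definition star_fun where
  "star_fun k \<phi> = (\<lambda>\<omega>. if \<omega> (dom (partial_inv k)) then cnj (\<phi> (push_character (partial_inv k) \<omega>)) else 0)"

lemma germ_act_eq_germ_iff: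
  assumes a: "a \<in> arrows groupoid_P" and k: "k \<in> left_inverse_hull" "rng groupoid_P a (dom (partial_inv k))"
    and h: "(h, \<omega>) \<in> germ_pairs"
  shows "germ_act (partial_inv k) a = germ h \<omega> \<longleftrightarrow> (k \<circ>\<^sub>m h, \<omega>) \<in> germ_pairs \<and> a = germ (k \<circ>\<^sub>m h) \<omega>"
proof
  have kk: "partial_inv k \<in> left_inverse_hull" by (intro left_inverse_hull.intros k)
  assume *: "germ_act (partial_inv k) a = germ h \<omega>"
  have "a = germ_act k (germ h \<omega>)"
    using germ_act_inverse[OF a kk k(2)] k by (simp add: *)
  moreover have "rng groupoid_P (germ h \<omega>) (dom k)"
    using rng_germ_act[OF a kk k(2)] k h push_character_ran[OF kk] * by simp
  ultimately show "(k \<circ>\<^sub>m h, \<omega>) \<in> germ_pairs \<and> a = germ (k \<circ>\<^sub>m h) \<omega>"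
    using germ_act_germ[OF h k(1)] h by simp
next
  assume *: "(k \<circ>\<^sub>m h, \<omega>) \<in> germ_pairs \<and> a = germ (k \<circ>\<^sub>m h) \<omega>"
  then have 1: "push_character h \<omega> (dom k)"
    using k by (simp add: germ_pairs_iff push_character_dom_comp)
  then have "a = germ_act k (germ h \<omega>)"
    using * germ_act_germ[OF h k(1)] by simp
  then show "germ_act (partial_inv k) a = germ h \<omega>"
    using germ_act_inverse[OF germ_arrow[OF h] k(1)] 1 h by simp
qed

text \<open>The bisections of \<open>k\<close> and \<open>h\<close> multiply to that of their
  composition: an arrow lies in the latter exactly if acting on it by the inverse of
  \<open>k\<close> is possible and gives a germ of \<open>h\<close>. The only surviving summand is
  then the product of the weights.\<close>

lemma convolution_bisection_fun:
  assumes k: "k \<in> left_inverse_hull" and h: "h \<in> left_inverse_hull"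
  shows "convolution groupoid_P (bisection_fun k \<phi>) (bisection_fun h \<psi>)
    = bisection_fun (k \<circ>\<^sub>m h) (mult_fun k \<phi> h \<psi>)"
proof
  fix a
  show "convolution groupoid_P (bisection_fun k \<phi>) (bisection_fun h \<psi>) a
    = bisection_fun (k \<circ>\<^sub>m h) (mult_fun k \<phi> h \<psi>) a"
  proof (cases "a \<in> arrows groupoid_P")
    case True
    define b where "b = germ_act (partial_inv k) a"
    have kk: "partial_inv k \<in> left_inverse_hull" by (intro left_inverse_hull.intros k)
    have e: "convolution groupoid_P (bisection_fun k \<phi>) (bisection_fun h \<psi>) a
      = (if rng groupoid_P a (dom (partial_inv k))
       then \<phi> (push_character (partial_inv k) (rng groupoid_P a)) * bisection_fun h \<psi> b else 0)"
      using True by (simp add: convolution_left_conv left_conv_bisection_fun k b_def)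
    show ?thesis
    proof (cases "\<exists>\<omega>. (k \<circ>\<^sub>m h, \<omega>) \<in> germ_pairs \<and> a = germ (k \<circ>\<^sub>m h) \<omega>")
      case *: True
      then obtain \<omega> where \<omega>: "(k \<circ>\<^sub>m h, \<omega>) \<in> germ_pairs" "a = germ (k \<circ>\<^sub>m h) \<omega>" by blast
      have hw: "(h, \<omega>) \<in> germ_pairs"
        using \<omega> h by (auto simp: germ_pairs_iff intro: character_mono[OF Omega_character _ map_comp_dom_subset])
      have kw: "push_character h \<omega> (dom k)"
        using \<omega>(1) k by (simp add: germ_pairs_iff push_character_dom_comp)
      have r: "rng groupoid_P a = push_character k (push_character h \<omega>)"
        using \<omega> k by (simp add: push_character_comp)
      then have r1: "rng groupoid_P a (dom (partial_inv k))"
        using kw by (simp add: push_character_ran k)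
      have r2: "push_character (partial_inv k) (rng groupoid_P a) = push_character h \<omega>"
        using kw hw h by (simp add: r push_character_inv k germ_pairs_iff push_character_Omega Omega_character)
      have "b = germ h \<omega>"
        unfolding b_def using germ_act_eq_germ_iff[OF True k r1 hw] \<omega> by simp
      then show ?thesis
        using e r1 r2 \<omega> hw by (simp add: bisection_fun_germ mult_fun_def germ_pairs_iff)
    next
      case *: False
      have "bisection_fun h \<psi> b = 0" if "rng groupoid_P a (dom (partial_inv k))"
        using germ_act_eq_germ_iff[OF True k that] * by (auto simp: bisection_fun_def b_def)
      moreover have "bisection_fun (k \<circ>\<^sub>m h) (mult_fun k \<phi> h \<psi>) a = 0"
        using * by (auto simp: bisection_fun_def)
      ultimately show ?thesis using e by simp
    qed
  qed (simp add: convolution_def bisection_fun_not_arrow)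
qed

lemma ginv_arrow:
  assumes "a \<in> arrows groupoid_P"
  shows "ginv groupoid_P a \<in> arrows groupoid_P" "ginv groupoid_P (ginv groupoid_P a) = a"
    "src groupoid_P (ginv groupoid_P a) = rng groupoid_P a"
    "rng groupoid_P (ginv groupoid_P a) = src groupoid_P a"
proof -
  obtain g x where gx: "a = germ g x" "(g, x) \<in> germ_pairs" using assms by (rule arrows_cases)
  note p = germ_pairs_inv[OF gx(2)]
  show "ginv groupoid_P a \<in> arrows groupoid_P" "ginv groupoid_P (ginv groupoid_P a) = a"
    "src groupoid_P (ginv groupoid_P a) = rng groupoid_P a"
    "rng groupoid_P (ginv groupoid_P a) = src groupoid_P a"
    using gx p by (auto simp: germ_pairs_iff push_character_inv Omega_character)
qed

lemma involution_bisection_fun: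
  assumes k: "k \<in> left_inverse_hull"
  shows "involution groupoid_P (bisection_fun k \<phi>) = bisection_fun (partial_inv k) (star_fun k \<phi>)"
proof
  fix a
  have kk: "partial_inv k \<in> left_inverse_hull" by (intro left_inverse_hull.intros k)
  show "involution groupoid_P (bisection_fun k \<phi>) a = bisection_fun (partial_inv k) (star_fun k \<phi>) a"
  proof (cases "a \<in> arrows groupoid_P")
    case True
    show ?thesis
    proof (cases "\<exists>\<omega>. (partial_inv k, \<omega>) \<in> germ_pairs \<and> a = germ (partial_inv k) \<omega>")
      case *: True
      then obtain \<omega> where \<omega>: "(partial_inv k, \<omega>) \<in> germ_pairs" "a = germ (partial_inv k) \<omega>" by blast
      then have "ginv groupoid_P a = germ k (push_character (partial_inv k) \<omega>)"
        "(k, push_character (partial_inv k) \<omega>) \<in> germ_pairs"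
        using k germ_pairs_inv[OF \<omega>(1)] by auto
      with \<omega> show ?thesis
        by (simp add: involution_def bisection_fun_germ star_fun_def germ_pairs_iff)
    next
      case *: False
      have "bisection_fun k \<phi> (ginv groupoid_P a) = 0"
      proof (rule ccontr)
        assume "bisection_fun k \<phi> (ginv groupoid_P a) \<noteq> 0"
        then obtain \<omega> where \<omega>: "(k, \<omega>) \<in> germ_pairs" "ginv groupoid_P a = germ k \<omega>"
          by (auto simp: bisection_fun_def split: if_splits)
        then have "a = germ (partial_inv k) (push_character k \<omega>)"
          using ginv_arrow(2)[OF True] by simp
        with germ_pairs_inv[OF \<omega>(1)] * show False by blast
      qed
      with * show ?thesis by (auto simp: involution_def bisection_fun_def)
    qed
  qed (simp add: involution_def bisection_fun_not_arrow)
qed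

lemma involution_add:
  "involution G (\<lambda>a. f a + f' a) = (\<lambda>a. involution G f a + involution G f' a)"
  by (auto simp: involution_def)

lemma involution_zero [simp]: "involution G (\<lambda>_. 0) = (\<lambda>_. 0)"
  by (auto simp: involution_def)

lemma involution_involution:
  assumes "f \<in> bounded_span"
  shows "involution groupoid_P (involution groupoid_P f) = f"
  using bounded_span_not_arrow[OF assms] by (auto simp: involution_def fun_eq_iff ginv_arrow)

lemma convolution_add_left:
  assumes "f \<in> bounded_span" "f' \<in> bounded_span"
  shows "convolution groupoid_P (\<lambda>a. f a + f' a) h
    = (\<lambda>a. convolution groupoid_P f h a + convolution groupoid_P f' h a)"
  using assms by (auto simp: convolution_left_conv left_conv_add_left)

lemma convolution_add_right:
  assumes "f \<in> bounded_span"
  shows "convolution groupoid_P f (\<lambda>a. h a + h' a)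
    = (\<lambda>a. convolution groupoid_P f h a + convolution groupoid_P f h' a)"
  using assms by (auto simp: convolution_left_conv left_conv_add_right)

lemma convolution_zero [simp]:
  "convolution groupoid_P (\<lambda>_. 0) h = (\<lambda>_. 0)" "convolution groupoid_P f (\<lambda>_. 0) = (\<lambda>_. 0)"
  by (auto simp: convolution_left_conv)

text \<open>The kinds of weights of the two factors and of the product are kept apart, so that the
  statement yields subalgebras as well as ideals.\<close>

lemma bisection_span_convolution:
  assumes sub: "\<And>g \<phi>. Q g \<phi> \<Longrightarrow> bounded_on_dom g \<phi>" "\<And>g \<phi>. Q' g \<phi> \<Longrightarrow> bounded_on_dom g \<phi>"
    and mult: "\<And>k \<phi> h \<psi>. Q k \<phi> \<Longrightarrow> Q' h \<psi> \<Longrightarrow> Q'' (k \<circ>\<^sub>m h) (mult_fun k \<phi> h \<psi>)"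
    and f: "f \<in> bisection_span Q" and f': "f' \<in> bisection_span Q'"
  shows "convolution groupoid_P f f' \<in> bisection_span Q''"
  using f
proof (induction rule: bisection_span.induct)
  case (step f k \<phi>)
  note b = bisection_span_mono[of Q bounded_on_dom, OF sub(1)]
  have "convolution groupoid_P (bisection_fun k \<phi>) f' \<in> bisection_span Q''"
    using f'
  proof (induction rule: bisection_span.induct)
    case (step f' h \<psi>)
    have "k \<in> left_inverse_hull" "h \<in> left_inverse_hull"
      using sub \<open>Q k \<phi>\<close> step by (auto simp: bounded_on_dom_def)
    then show ?case
      using step mult[OF \<open>Q k \<phi>\<close>] bisection_span_generator[of bounded_on_dom k \<phi>, OF sub(1)[OF \<open>Q k \<phi>\<close>]]
      by (simp add: convolution_add_right convolution_bisection_fun bisection_span.step)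
  qed (simp add: bisection_span.zero)
  with step show ?case
    using b[of f] bisection_span_generator[of bounded_on_dom k \<phi>, OF sub(1)]
    by (simp add: convolution_add_left bisection_span_add)
qed (simp add: bisection_span.zero)

lemma bisection_span_involution:
  assumes hull: "\<And>g \<phi>. Q g \<phi> \<Longrightarrow> g \<in> left_inverse_hull"
    and star: "\<And>k \<phi>. Q k \<phi> \<Longrightarrow> Q (partial_inv k) (star_fun k \<phi>)"
    and f: "f \<in> bisection_span Q"
  shows "involution groupoid_P f \<in> bisection_span Q"
  using f
  by (induction rule: bisection_span.induct)
    (auto simp: involution_add involution_bisection_fun hull intro!: bisection_span.intros star)

lemma bounded_on_dom_mult_fun:
  assumes "bounded_on_dom k \<phi>" "bounded_on_dom h \<psi>"
  shows "bounded_on_dom (k \<circ>\<^sub>m h) (mult_fun k \<phi> h \<psi>)"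
proof -
  obtain M M' where M: "\<And>\<omega>. \<omega> \<in> Omega \<Longrightarrow> \<omega> (dom k) \<Longrightarrow> cmod (\<phi> \<omega>) \<le> M"
    "\<And>\<omega>. \<omega> \<in> Omega \<Longrightarrow> \<omega> (dom h) \<Longrightarrow> cmod (\<psi> \<omega>) \<le> M'"
    and kh: "k \<in> left_inverse_hull" "h \<in> left_inverse_hull"
    using assms by (auto simp: bounded_on_dom_def)
  have "cmod (mult_fun k \<phi> h \<psi> \<omega>) \<le> M * M'" if \<omega>: "\<omega> \<in> Omega" "\<omega> (dom (k \<circ>\<^sub>m h))" for \<omega>
  proof -
    have "\<omega> (dom h)"
      using character_mono[OF Omega_character[OF \<omega>(1)] \<omega>(2) map_comp_dom_subset] kh by simp
    moreover have "push_character h \<omega> (dom k)" using \<omega> kh by (simp add: push_character_dom_comp)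
    ultimately have "cmod (\<phi> (push_character h \<omega>)) \<le> M" "cmod (\<psi> \<omega>) \<le> M'"
      using M \<omega> kh push_character_Omega by blast+
    moreover from this(1) have "0 \<le> M" using norm_ge_zero order_trans by blast
    ultimately show ?thesis
      using \<omega> by (simp add: mult_fun_def norm_mult mult_mono)
  qed
  with kh show ?thesis by (auto simp: bounded_on_dom_def left_inverse_hull.intros)
qed

lemma bounded_on_dom_star_fun:
  assumes "bounded_on_dom k \<phi>"
  shows "bounded_on_dom (partial_inv k) (star_fun k \<phi>)"
proof -
  obtain M where M: "\<And>\<omega>. \<omega> \<in> Omega \<Longrightarrow> \<omega> (dom k) \<Longrightarrow> cmod (\<phi> \<omega>) \<le> M"
    and k: "k \<in> left_inverse_hull"
    using assms by (auto simp: bounded_on_dom_def)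
  have kk: "partial_inv k \<in> left_inverse_hull" by (intro left_inverse_hull.intros k)
  have "cmod (star_fun k \<phi> \<omega>) \<le> M" if \<omega>: "\<omega> \<in> Omega" "\<omega> (dom (partial_inv k))" for \<omega>
    using M[of "push_character (partial_inv k) \<omega>"] \<omega> push_character_Omega[OF kk \<omega>]
      push_character_ran[OF kk, of \<omega>] k
    by (simp add: star_fun_def)
  with kk show ?thesis by (auto simp: bounded_on_dom_def)
qed

lemma bounded_span_convolution:
  "f \<in> bounded_span \<Longrightarrow> f' \<in> bounded_span \<Longrightarrow> convolution groupoid_P f f' \<in> bounded_span"
  by (rule bisection_span_convolution[where Q = bounded_on_dom and Q' = bounded_on_dom])
    (auto intro: bounded_on_dom_mult_fun)

lemma bounded_span_involution: "f \<in> bounded_span \<Longrightarrow> involution groupoid_P f \<in> bounded_span"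
  by (rule bisection_span_involution[where Q = bounded_on_dom])
    (simp add: bounded_on_dom_def, rule bounded_on_dom_star_fun)

section \<open>The regular representations\<close>

text \<open>The adjoint of a weighted partial permutation is the inverse permutation with conjugated
  weights; the proof reindexes the sum along \<open>p\<close>.\<close>

lemma infsum_partial_permutation:
  fixes w x y :: "_ \<Rightarrow> complex"
  assumes "\<And>a. a \<in> P \<Longrightarrow> p a \<in> Q \<and> q (p a) = a" "\<And>b. b \<in> Q \<Longrightarrow> q b \<in> P \<and> p (q b) = b"
  shows "(\<Sum>\<^sub>\<infinity>a. (if a \<in> P then w a * x (p a) else 0) * cnj (y a))
    = (\<Sum>\<^sub>\<infinity>b. x b * cnj (if b \<in> Q then cnj (w (q b)) * y (q b) else 0))"
proof -
  have bij: "bij_betw p P Q" using assms by (intro bij_betw_byWitness[where f' = q]) auto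
  have "(\<Sum>\<^sub>\<infinity>a. (if a \<in> P then w a * x (p a) else 0) * cnj (y a))
      = (\<Sum>\<^sub>\<infinity>a\<in>P. x (p a) * (w (q (p a)) * cnj (y (q (p a)))))"
    using assms(1) by (intro infsum_cong_neutral) auto
  also have "\<dots> = (\<Sum>\<^sub>\<infinity>b\<in>Q. x b * (w (q b) * cnj (y (q b))))"
    by (rule infsum_reindex_bij_betw[OF bij])
  also have "\<dots> = (\<Sum>\<^sub>\<infinity>b. x b * cnj (if b \<in> Q then cnj (w (q b)) * y (q b) else 0))"
    by (intro infsum_cong_neutral) auto
  finally show ?thesis .
qed

abbreviation (input) fibre :: "'a::left_cancellative_monoid character \<Rightarrow> 'a germ set" where
  "fibre x \<equiv> {a \<in> arrows groupoid_P. src groupoid_P a = x}"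

lemma fibre_conv_bisection_fun:
  assumes k: "k \<in> left_inverse_hull"
  shows "(if a \<in> fibre x then left_conv (bisection_fun k \<phi>) \<xi> a else 0)
    = (if a \<in> {a \<in> fibre x. rng groupoid_P a (dom (partial_inv k))}
       then \<phi> (push_character (partial_inv k) (rng groupoid_P a)) * \<xi> (germ_act (partial_inv k) a) else 0)"
  using left_conv_bisection_fun[OF k, of a \<phi> \<xi>] by auto

lemma germ_act_fibre:
  assumes k: "k \<in> left_inverse_hull" and a: "a \<in> {a \<in> fibre x. rng groupoid_P a (dom k)}"
  shows "germ_act k a \<in> {a \<in> fibre x. rng groupoid_P a (dom (partial_inv k))}
    \<and> germ_act (partial_inv k) (germ_act k a) = a"
  using assms germ_act_inverse[of a k]
  by (simp add: germ_act_arrow src_germ_act rng_germ_act push_character_ran)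

lemma fibre_conv_bisection_fun_bound:
  assumes k: "k \<in> left_inverse_hull"
    and M: "\<And>\<omega>. \<omega> \<in> Omega \<Longrightarrow> \<omega> (dom k) \<Longrightarrow> cmod (\<phi> \<omega>) \<le> M" "0 \<le> M"
  shows "(\<lambda>a. (cmod (if a \<in> fibre x then left_conv (bisection_fun k \<phi>) (ell2_apply \<xi>) a else 0))\<^sup>2)
      summable_on UNIV"
    and "sqrt (\<Sum>\<^sub>\<infinity>a. (cmod (if a \<in> fibre x then left_conv (bisection_fun k \<phi>) (ell2_apply \<xi>) a else 0))\<^sup>2)
      \<le> M * norm \<xi>"
proof -
  have kk: "partial_inv k \<in> left_inverse_hull" by (intro left_inverse_hull.intros k)
  define P where "P = {a \<in> fibre x. rng groupoid_P a (dom (partial_inv k))}"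
  have inj: "inj_on (germ_act (partial_inv k)) P"
    by (rule inj_on_inverseI[where g = "germ_act k"])
      (use germ_act_fibre[OF kk] k in \<open>auto simp: P_def\<close>)
  have w: "cmod (\<phi> (push_character (partial_inv k) (rng groupoid_P a))) \<le> M" if "a \<in> P" for a
  proof (rule M(1))
    have r: "rng groupoid_P a \<in> Omega" "rng groupoid_P a (dom (partial_inv k))"
      using that arrow_rng_Omega by (auto simp: P_def)
    show "push_character (partial_inv k) (rng groupoid_P a) \<in> Omega"
      by (rule push_character_Omega[OF kk r])
    show "push_character (partial_inv k) (rng groupoid_P a) (dom k)"
      using push_character_ran[OF kk, of "rng groupoid_P a"] r k by simp
  qed
  note ws = weighted_permutation_summable[where P = P and p = "germ_act (partial_inv k)" and x = \<xi>
      and w = "\<lambda>a. \<phi> (push_character (partial_inv k) (rng groupoid_P a))", OF inj w]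
  show "(\<lambda>a. (cmod (if a \<in> fibre x then left_conv (bisection_fun k \<phi>) (ell2_apply \<xi>) a else 0))\<^sup>2)
      summable_on UNIV"
    unfolding fibre_conv_bisection_fun[OF k] using ws(1) by (simp only: P_def)
  have "(\<Sum>\<^sub>\<infinity>a. (cmod (if a \<in> fibre x then left_conv (bisection_fun k \<phi>) (ell2_apply \<xi>) a else 0))\<^sup>2)
      \<le> M\<^sup>2 * (norm \<xi>)\<^sup>2"
    unfolding fibre_conv_bisection_fun[OF k] using ws(2) by (simp only: P_def)
  then show "sqrt (\<Sum>\<^sub>\<infinity>a. (cmod (if a \<in> fibre x then left_conv (bisection_fun k \<phi>) (ell2_apply \<xi>) a else 0))\<^sup>2)
      \<le> M * norm \<xi>"
    using M(2) by (simp add: real_le_lsqrt power_mult_distrib)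
qed

text \<open>The constant is uniform in the unit \<open>x\<close>: for a single bisection it bounds
  the weight, and constants add up. This makes the supremum in the reduced norm finite.\<close>

lemma fibre_conv_bound:
  assumes "f \<in> bounded_span"
  shows "\<exists>M\<ge>0. \<forall>x \<xi>.
    (\<lambda>a. (cmod (if a \<in> fibre x then left_conv f (ell2_apply \<xi>) a else 0))\<^sup>2) summable_on UNIV \<and>
    sqrt (\<Sum>\<^sub>\<infinity>a. (cmod (if a \<in> fibre x then left_conv f (ell2_apply \<xi>) a else 0))\<^sup>2) \<le> M * norm \<xi>"
  using assms
proof (induction rule: bisection_span.induct)
  case (step f k \<phi>)
  then obtain M where M: "0 \<le> M" "\<And>x \<xi>.
    (\<lambda>a. (cmod (if a \<in> fibre x then left_conv f (ell2_apply \<xi>) a else 0))\<^sup>2) summable_on UNIV"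
    "\<And>x \<xi>. sqrt (\<Sum>\<^sub>\<infinity>a. (cmod (if a \<in> fibre x then left_conv f (ell2_apply \<xi>) a else 0))\<^sup>2) \<le> M * norm \<xi>"
    by blast
  obtain M' where k: "k \<in> left_inverse_hull"
    and M': "\<And>\<omega>. \<omega> \<in> Omega \<Longrightarrow> \<omega> (dom k) \<Longrightarrow> cmod (\<phi> \<omega>) \<le> M'"
    using step(2) by (auto simp: bounded_on_dom_def)
  have M'': "\<And>\<omega>. \<omega> \<in> Omega \<Longrightarrow> \<omega> (dom k) \<Longrightarrow> cmod (\<phi> \<omega>) \<le> max 0 M'" using M' by fastforce
  note b = fibre_conv_bisection_fun_bound[where \<phi> = \<phi>, OF k M'' max.cobounded1]
  have e: "(if a \<in> fibre x then left_conv (\<lambda>a. bisection_fun k \<phi> a + f a) \<xi> a else 0)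
    = (if a \<in> fibre x then left_conv (bisection_fun k \<phi>) \<xi> a else 0) + (if a \<in> fibre x then left_conv f \<xi> a else 0)"
    for a x \<xi>
    using left_conv_add_left[OF bisection_span_generator[of bounded_on_dom k \<phi>, OF step(2)] step(1)] by simp
  show ?case unfolding e
  proof (intro exI[of _ "max 0 M' + M"] conjI allI)
    show "0 \<le> max 0 M' + M" using M by simp
    fix x and \<xi> :: "'a germ ell2"
    note add = ell2_add_bound[OF b(1)[where x = x and \<xi> = \<xi>] M(2)[of x \<xi>]]
    show "(\<lambda>a. (cmod ((if a \<in> fibre x then left_conv (bisection_fun k \<phi>) (ell2_apply \<xi>) a else 0)
        + (if a \<in> fibre x then left_conv f (ell2_apply \<xi>) a else 0)))\<^sup>2) summable_on UNIV"
      by (rule add(1))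
    show "sqrt (\<Sum>\<^sub>\<infinity>a. (cmod ((if a \<in> fibre x then left_conv (bisection_fun k \<phi>) (ell2_apply \<xi>) a else 0)
        + (if a \<in> fibre x then left_conv f (ell2_apply \<xi>) a else 0)))\<^sup>2) \<le> (max 0 M' + M) * norm \<xi>"
      using add(2) b(2)[where x = x and \<xi> = \<xi>] M(3)[of x \<xi>] unfolding distrib_right by linarith
  qed
qed (intro exI[of _ 0], simp cong: if_cong)

text \<open>\<open>regular_rep\<close> is defined through \<open>Abs_ell2\<close> and has the
  intended coordinates only if they are square-summable, which the preceding bound
  guarantees.\<close>

lemma ell2_apply_regular_rep:
  assumes "f \<in> bounded_span"
  shows "ell2_apply (regular_rep groupoid_P x f \<xi>) a
    = (if a \<in> fibre x then left_conv f (ell2_apply \<xi>) a else 0)"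
proof -
  have "(\<lambda>a. (cmod (if a \<in> fibre x then left_conv f (ell2_apply \<xi>) a else 0))\<^sup>2) summable_on UNIV"
    using fibre_conv_bound[OF assms] by blast
  from ell2_apply_Abs[OF this] show ?thesis
    by (simp add: regular_rep_left_conv)
qed

lemma regular_rep_bisection_fun_le:
  assumes k: "k \<in> left_inverse_hull"
    and M: "\<And>\<omega>. \<omega> \<in> Omega \<Longrightarrow> \<omega> (dom k) \<Longrightarrow> cmod (\<phi> \<omega>) \<le> M" "0 \<le> M"
  shows "norm (regular_rep groupoid_P x (bisection_fun k \<phi>) \<xi>) \<le> M * norm \<xi>"
proof -
  have "bounded_on_dom k \<phi>" using assms by (auto simp: bounded_on_dom_def)
  from bisection_span_generator[of bounded_on_dom, OF this]
  show ?thesis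
    using fibre_conv_bisection_fun_bound(2)[OF k M, where x = x and \<xi> = \<xi>]
    by (simp only: norm_ell2.rep_eq ell2_apply_regular_rep)
qed

lemma regular_rep_bounded:
  assumes "f \<in> bounded_span"
  obtains M where "0 \<le> M" "\<And>x \<xi>. norm (regular_rep groupoid_P x f \<xi>) \<le> M * norm \<xi>"
proof -
  from fibre_conv_bound[OF assms] obtain M where "M \<ge> 0" "\<And>x \<xi>.
    sqrt (\<Sum>\<^sub>\<infinity>a. (cmod (if a \<in> fibre x then left_conv f (ell2_apply \<xi>) a else 0))\<^sup>2) \<le> M * norm \<xi>"
    by blast
  then show thesis
    by (intro that) (simp_all only: norm_ell2.rep_eq ell2_apply_regular_rep[OF assms])
qed

lemma regular_rep_fun_add:
  assumes "f \<in> bounded_span" "f' \<in> bounded_span"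
  shows "regular_rep groupoid_P x (\<lambda>a. f a + f' a) \<xi>
    = regular_rep groupoid_P x f \<xi> + regular_rep groupoid_P x f' \<xi>"
  by (rule ell2_eqI) (simp add: ell2_apply_regular_rep assms bisection_span_add left_conv_add_left)

lemma regular_rep_fun_scale:
  assumes "f \<in> bounded_span"
  shows "regular_rep groupoid_P x (\<lambda>a. c * f a) \<xi> = ell2_scale c (regular_rep groupoid_P x f \<xi>)"
  by (rule ell2_eqI) (simp add: ell2_apply_regular_rep assms bounded_span_scale left_conv_scale_left)

lemma regular_rep_fun_zero: "regular_rep groupoid_P x (\<lambda>_. 0) \<xi> = 0"
  by (rule ell2_eqI) (simp add: ell2_apply_regular_rep bisection_span.zero)

lemma adjoint_pair_add_op:
  "adjoint_pair T T' \<Longrightarrow> adjoint_pair U U' \<Longrightarrow> adjoint_pair (\<lambda>\<xi>. T \<xi> + U \<xi>) (\<lambda>\<xi>. T' \<xi> + U' \<xi>)"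
  by (simp add: adjoint_pair_def ell2_inner_add_left ell2_inner_add_right)

lemma regular_rep_bisection_fun_adjoint:
  assumes b: "bounded_on_dom k \<phi>"
  shows "adjoint_pair (regular_rep groupoid_P x (bisection_fun k \<phi>))
    (regular_rep groupoid_P x (bisection_fun (partial_inv k) (star_fun k \<phi>)))"
  unfolding adjoint_pair_def
proof (intro allI)
  fix \<xi> \<eta> :: "'a germ ell2"
  have k: "k \<in> left_inverse_hull" using b by (simp add: bounded_on_dom_def)
  have kk: "partial_inv k \<in> left_inverse_hull" by (intro left_inverse_hull.intros k)
  define P where "P = {a \<in> fibre x. rng groupoid_P a (dom (partial_inv k))}"
  define Q where "Q = {a \<in> fibre x. rng groupoid_P a (dom k)}"
  let ?w = "\<lambda>a. \<phi> (push_character (partial_inv k) (rng groupoid_P a))"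
  have e: "(if b \<in> Q then cnj (?w (germ_act k b)) * ell2_apply \<eta> (germ_act k b) else 0)
    = ell2_apply (regular_rep groupoid_P x (bisection_fun (partial_inv k) (star_fun k \<phi>)) \<eta>) b" for b
  proof -
    have "star_fun k \<phi> (push_character k (rng groupoid_P b)) = cnj (?w (germ_act k b))" if "b \<in> Q"
      using that k by (simp add: Q_def star_fun_def rng_germ_act push_character_ran)
    then show ?thesis
      unfolding ell2_apply_regular_rep[OF bisection_span_generator[of bounded_on_dom, OF bounded_on_dom_star_fun[OF b]]]
        fibre_conv_bisection_fun[OF kk] using k by (simp add: Q_def)
  qed
  have "ell2_inner (regular_rep groupoid_P x (bisection_fun k \<phi>) \<xi>) \<eta>
    = (\<Sum>\<^sub>\<infinity>a. (if a \<in> P then ?w a * ell2_apply \<xi> (germ_act (partial_inv k) a) else 0) * cnj (ell2_apply \<eta> a))"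
    unfolding ell2_inner_def P_def
    by (simp only: ell2_apply_regular_rep bisection_span_generator[of bounded_on_dom, OF b]
        fibre_conv_bisection_fun[OF k])
  also have "\<dots> = (\<Sum>\<^sub>\<infinity>b. ell2_apply \<xi> b *
      cnj (if b \<in> Q then cnj (?w (germ_act k b)) * ell2_apply \<eta> (germ_act k b) else 0))"
    by (rule infsum_partial_permutation)
      (use germ_act_fibre[OF kk, of _ x] germ_act_fibre[OF k, of _ x] k in \<open>auto simp: P_def Q_def\<close>)
  also have "\<dots> = ell2_inner \<xi> (regular_rep groupoid_P x (bisection_fun (partial_inv k) (star_fun k \<phi>)) \<eta>)"
    unfolding ell2_inner_def e ..
  finally show "ell2_inner (regular_rep groupoid_P x (bisection_fun k \<phi>) \<xi>) \<eta>
    = ell2_inner \<xi> (regular_rep groupoid_P x (bisection_fun (partial_inv k) (star_fun k \<phi>)) \<eta>)" .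
qed

lemma regular_rep_adjoint:
  "f \<in> bounded_span \<Longrightarrow>
    adjoint_pair (regular_rep groupoid_P x f) (regular_rep groupoid_P x (involution groupoid_P f))"
proof (induction rule: bisection_span.induct)
  case zero
  show ?case by (simp add: adjoint_pair_def regular_rep_fun_zero ell2_inner_def)
next
  case (step f k \<phi>)
  have k: "k \<in> left_inverse_hull" using step by (simp add: bounded_on_dom_def)
  note gen = bisection_span_generator[of bounded_on_dom, OF step(2)]
    bisection_span_generator[of bounded_on_dom, OF bounded_on_dom_star_fun[OF step(2)]]
  show ?case
    using adjoint_pair_add_op[OF regular_rep_bisection_fun_adjoint[OF step(2)] step(3)] gen step(1)
      bounded_span_involution[OF step(1)]
    by (simp add: involution_add involution_bisection_fun[OF k] regular_rep_fun_add)
qed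

text \<open>Additivity in both factors leaves one bisection each. There both sides evaluate \<xi> at
  the same arrow, because acting by the inverse of the composition means acting by the inverse of
  \<open>k\<close> and then by that of \<open>h\<close>, and the weights agree.\<close>

lemma regular_rep_convolution:
  assumes f: "f \<in> bounded_span" and f': "f' \<in> bounded_span"
  shows "regular_rep groupoid_P x (convolution groupoid_P f f') \<xi>
    = regular_rep groupoid_P x f (regular_rep groupoid_P x f' \<xi>)"
  using f
proof (induction rule: bisection_span.induct)
  case zero
  show ?case by (simp add: regular_rep_fun_zero)
next
  case (step f k \<phi>)
  note gen = bisection_span_generator[of bounded_on_dom, OF step(2)]
  have k: "k \<in> left_inverse_hull" using step by (simp add: bounded_on_dom_def)
  have kk: "partial_inv k \<in> left_inverse_hull" by (intro left_inverse_hull.intros k)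
  have "regular_rep groupoid_P x (convolution groupoid_P (bisection_fun k \<phi>) f') \<xi>
    = regular_rep groupoid_P x (bisection_fun k \<phi>) (regular_rep groupoid_P x f' \<xi>)"
    using f'
  proof (induction rule: bisection_span.induct)
    case zero
    show ?case
      by (rule ell2_eqI) (simp add: regular_rep_fun_zero ell2_apply_regular_rep[OF gen])
  next
    case (step f' h \<psi>)
    note gen' = bisection_span_generator[of bounded_on_dom, OF step(2)]
    have h: "h \<in> left_inverse_hull" using step by (simp add: bounded_on_dom_def)
    have hh: "partial_inv h \<in> left_inverse_hull" by (intro left_inverse_hull.intros h)
    have kh: "k \<circ>\<^sub>m h \<in> left_inverse_hull" by (intro left_inverse_hull.intros h k)
    have "regular_rep groupoid_P x (convolution groupoid_P (bisection_fun k \<phi>) (bisection_fun h \<psi>)) \<xi>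
      = regular_rep groupoid_P x (bisection_fun k \<phi>) (regular_rep groupoid_P x (bisection_fun h \<psi>) \<xi>)"
    proof (rule ell2_eqI)
      fix a
      show "ell2_apply (regular_rep groupoid_P x (convolution groupoid_P (bisection_fun k \<phi>) (bisection_fun h \<psi>)) \<xi>) a
        = ell2_apply (regular_rep groupoid_P x (bisection_fun k \<phi>) (regular_rep groupoid_P x (bisection_fun h \<psi>) \<xi>)) a"
      proof (cases "a \<in> fibre x")
        case True
        define r where "r = rng groupoid_P a"
        define b where "b = germ_act (partial_inv k) a"
        have inv: "partial_inv (k \<circ>\<^sub>m h) = partial_inv h \<circ>\<^sub>m partial_inv k"
          by (rule partial_inv_comp[OF hull_inj[OF k] hull_inj[OF h]])
        have L: "ell2_apply (regular_rep groupoid_P x (convolution groupoid_P (bisection_fun k \<phi>) (bisection_fun h \<psi>)) \<xi>) a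
          = (if r (dom (partial_inv (k \<circ>\<^sub>m h))) then
              mult_fun k \<phi> h \<psi> (push_character (partial_inv (k \<circ>\<^sub>m h)) r) * ell2_apply \<xi> (germ_act (partial_inv (k \<circ>\<^sub>m h)) a)
             else 0)"
          unfolding convolution_bisection_fun[OF k h] r_def
          using True bisection_span_generator[of bounded_on_dom, OF bounded_on_dom_mult_fun[OF \<open>bounded_on_dom k \<phi>\<close> \<open>bounded_on_dom h \<psi>\<close>]]
          by (simp add: ell2_apply_regular_rep left_conv_bisection_fun[OF kh])
        have R: "ell2_apply (regular_rep groupoid_P x (bisection_fun k \<phi>) (regular_rep groupoid_P x (bisection_fun h \<psi>) \<xi>)) a
          = (if r (dom (partial_inv k)) then \<phi> (push_character (partial_inv k) r) *
              (if b \<in> fibre x then left_conv (bisection_fun h \<psi>) (ell2_apply \<xi>) b else 0) else 0)"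
          using True by (simp add: ell2_apply_regular_rep gen gen' left_conv_bisection_fun[OF k] r_def b_def)
        show ?thesis
        proof (cases "r (dom (partial_inv k))")
          case rk: True
          have b: "b \<in> fibre x" "rng groupoid_P b = push_character (partial_inv k) r"
            using True rk kk by (simp_all add: b_def r_def germ_act_arrow src_germ_act rng_germ_act)
          have r': "r (dom (partial_inv (k \<circ>\<^sub>m h))) \<longleftrightarrow> rng groupoid_P b (dom (partial_inv h))"
            by (simp add: inv b(2) push_character_dom_comp[OF hh])
          have R': "ell2_apply (regular_rep groupoid_P x (bisection_fun k \<phi>) (regular_rep groupoid_P x (bisection_fun h \<psi>) \<xi>)) a
            = (if rng groupoid_P b (dom (partial_inv h)) then \<phi> (push_character (partial_inv k) r) *
                (\<psi> (push_character (partial_inv h) (rng groupoid_P b)) * ell2_apply \<xi> (germ_act (partial_inv h) b)) else 0)"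
            unfolding R using rk b by (simp add: left_conv_bisection_fun[OF h])
          show ?thesis
          proof (cases "rng groupoid_P b (dom (partial_inv h))")
            case rh: True
            have b\<Omega>: "rng groupoid_P b \<in> Omega" using b(1) by (auto intro: arrow_rng_Omega)
            have act: "germ_act (partial_inv (k \<circ>\<^sub>m h)) a = germ_act (partial_inv h) b"
              unfolding inv b_def using True rk rh
              by (intro germ_act_comp[symmetric] kk hh) (simp_all add: r_def b_def)
            have push: "push_character (partial_inv (k \<circ>\<^sub>m h)) r = push_character (partial_inv h) (rng groupoid_P b)"
              unfolding inv b(2) by (rule push_character_comp[OF hh])
            have ph: "push_character h (push_character (partial_inv h) (rng groupoid_P b)) = rng groupoid_P b"
              using push_character_inv[OF hh Omega_character[OF b\<Omega>] rh] h by simp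
            have "rng groupoid_P b (dom k)"
              using push_character_ran[OF kk, of r] rk k by (simp add: b(2))
            then have "mult_fun k \<phi> h \<psi> (push_character (partial_inv (k \<circ>\<^sub>m h)) r)
              = \<phi> (rng groupoid_P b) * \<psi> (push_character (partial_inv h) (rng groupoid_P b))"
              unfolding push by (simp add: mult_fun_def ph flip: push_character_dom_comp[OF k])
            then show ?thesis unfolding L R' using rh by (simp add: act r' b(2))
          qed (simp add: L R' r')
        next
          case rk: False
          have "\<not> r (dom (partial_inv (k \<circ>\<^sub>m h)))"
            unfolding inv using rk True character_mono[OF Omega_character _ map_comp_dom_subset]
              arrow_rng_Omega[of a] dom_constructible[OF kk] unfolding r_def by blast
          then show ?thesis using rk by (simp add: L R)
        qed
      next
        case False
        then show ?thesis
          using bounded_span_convolution[OF gen gen'] by (auto simp: ell2_apply_regular_rep gen)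
      qed
    qed
    then show ?case
      using gen gen' step bounded_span_convolution[OF gen gen'] bounded_span_convolution[OF gen step(1)]
        adjoint_pair_add[OF regular_rep_adjoint[OF gen]]
      by (simp add: convolution_add_right regular_rep_fun_add)
  qed
  then show ?case
    using gen step f' bounded_span_convolution[OF gen f'] bounded_span_convolution[OF step(1) f']
    by (simp add: convolution_add_left regular_rep_fun_add bisection_span_add)
qed

lemma linear_regular_rep: "f \<in> bounded_span \<Longrightarrow> linear (regular_rep groupoid_P x f)"
  using adjoint_pair_add[OF regular_rep_adjoint] adjoint_pair_scale[OF regular_rep_adjoint]
  by (intro linearI) (auto simp flip: ell2_scale_of_real)

lemma bounded_linear_regular_rep:
  assumes "f \<in> bounded_span"
  shows "bounded_linear (regular_rep groupoid_P x f)"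
proof -
  obtain M where "\<And>x \<xi>. norm (regular_rep groupoid_P x f \<xi>) \<le> M * norm \<xi>"
    using regular_rep_bounded[OF assms] by blast
  then show ?thesis
    using linear_regular_rep[OF assms, of x]
    by (intro bounded_linear_intro[where K = M]) (auto simp: linear_add linear_scale mult.commute)
qed

section \<open>The reduced norm\<close>

abbreviation (input) rnorm :: "('a::left_cancellative_monoid germ \<Rightarrow> complex) \<Rightarrow> real" where
  "rnorm \<equiv> reduced_norm groupoid_P"

lemma reduced_norm_nonneg_bdd:
  assumes "f \<in> bounded_span"
  shows "bdd_above (insert 0 ((\<lambda>x. onorm (regular_rep groupoid_P x f)) ` Omega))"
proof -
  obtain M where M: "0 \<le> M" "\<And>x \<xi>. norm (regular_rep groupoid_P x f \<xi>) \<le> M * norm \<xi>"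
    using regular_rep_bounded[OF assms] by blast
  have "onorm (regular_rep groupoid_P x f) \<le> M" for x by (rule onorm_bound[OF M])
  with M(1) show ?thesis by (intro bdd_aboveI[of _ M]) auto
qed

lemma reduced_norm_nonneg: "f \<in> bounded_span \<Longrightarrow> 0 \<le> rnorm f"
  unfolding reduced_norm_def by (rule cSup_upper) (use reduced_norm_nonneg_bdd in auto)

lemma norm_regular_rep_le:
  assumes "f \<in> bounded_span" "x \<in> Omega"
  shows "norm (regular_rep groupoid_P x f \<xi>) \<le> rnorm f * norm \<xi>"
proof -
  have "onorm (regular_rep groupoid_P x f) \<le> rnorm f"
    unfolding reduced_norm_def by (rule cSup_upper) (use assms reduced_norm_nonneg_bdd in auto)
  then show ?thesis
    using onorm[OF bounded_linear_regular_rep[OF assms(1), of x], of \<xi>]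
    by (meson mult_right_mono norm_ge_zero order_trans)
qed

lemma reduced_norm_leI:
  assumes "0 \<le> M" "\<And>x \<xi>. x \<in> Omega \<Longrightarrow> norm (regular_rep groupoid_P x f \<xi>) \<le> M * norm \<xi>"
  shows "rnorm f \<le> M"
  unfolding reduced_norm_def using assms
  by (intro cSup_least) (auto intro: onorm_bound)

lemma reduced_norm_zero [simp]: "rnorm (\<lambda>_. 0) = 0"
  by (rule antisym[OF reduced_norm_leI reduced_norm_nonneg])
    (simp_all add: regular_rep_fun_zero bisection_span.zero)

lemma reduced_norm_add:
  assumes "f \<in> bounded_span" "f' \<in> bounded_span"
  shows "rnorm (\<lambda>a. f a + f' a) \<le> rnorm f + rnorm f'"
proof (rule reduced_norm_leI)
  show "0 \<le> rnorm f + rnorm f'" using assms by (simp add: reduced_norm_nonneg)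
  fix x :: "'a character" and \<xi> assume x: "x \<in> Omega"
  show "norm (regular_rep groupoid_P x (\<lambda>a. f a + f' a) \<xi>) \<le> (rnorm f + rnorm f') * norm \<xi>"
    unfolding regular_rep_fun_add[OF assms] distrib_right
    by (rule norm_triangle_le) (intro add_mono norm_regular_rep_le assms x)
qed

lemma reduced_norm_scale:
  assumes "f \<in> bounded_span"
  shows "rnorm (\<lambda>a. c * f a) \<le> cmod c * rnorm f"
proof (rule reduced_norm_leI)
  show "0 \<le> cmod c * rnorm f" using assms by (simp add: reduced_norm_nonneg)
  fix x :: "'a character" and \<xi> assume x: "x \<in> Omega"
  show "norm (regular_rep groupoid_P x (\<lambda>a. c * f a) \<xi>) \<le> cmod c * rnorm f * norm \<xi>"
    unfolding regular_rep_fun_scale[OF assms] norm_ell2_scale mult.assoc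
    by (intro mult_left_mono norm_regular_rep_le assms x) auto
qed

lemma reduced_norm_convolution:
  assumes "f \<in> bounded_span" "f' \<in> bounded_span"
  shows "rnorm (convolution groupoid_P f f') \<le> rnorm f * rnorm f'"
proof (rule reduced_norm_leI)
  show "0 \<le> rnorm f * rnorm f'" using assms by (simp add: reduced_norm_nonneg)
  fix x :: "'a character" and \<xi> assume x: "x \<in> Omega"
  have "norm (regular_rep groupoid_P x f (regular_rep groupoid_P x f' \<xi>))
      \<le> rnorm f * norm (regular_rep groupoid_P x f' \<xi>)"
    by (rule norm_regular_rep_le[OF assms(1) x])
  also have "\<dots> \<le> rnorm f * (rnorm f' * norm \<xi>)"
    by (intro mult_left_mono norm_regular_rep_le assms x reduced_norm_nonneg)
  finally show "norm (regular_rep groupoid_P x (convolution groupoid_P f f') \<xi>) \<le> rnorm f * rnorm f' * norm \<xi>"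
    by (simp add: regular_rep_convolution assms mult.assoc)
qed

lemma reduced_norm_involution:
  assumes "f \<in> bounded_span"
  shows "rnorm (involution groupoid_P f) \<le> rnorm f"
proof (rule reduced_norm_leI)
  show "0 \<le> rnorm f" by (rule reduced_norm_nonneg[OF assms])
  fix x :: "'a character" and \<xi> assume x: "x \<in> Omega"
  show "norm (regular_rep groupoid_P x (involution groupoid_P f) \<xi>) \<le> rnorm f * norm \<xi>"
    by (rule adjoint_pair_norm_le[OF regular_rep_adjoint[OF assms] norm_regular_rep_le[OF assms x]
          reduced_norm_nonneg[OF assms]])
qed

lemma reduced_norm_bisection_fun_le:
  assumes "k \<in> left_inverse_hull"
    and "\<And>\<omega>. \<omega> \<in> Omega \<Longrightarrow> \<omega> (dom k) \<Longrightarrow> cmod (\<phi> \<omega>) \<le> M" "0 \<le> M"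
  shows "rnorm (bisection_fun k \<phi>) \<le> M"
  by (rule reduced_norm_leI[OF assms(3) regular_rep_bisection_fun_le[OF assms]])

section \<open>Compactly supported functions on reductions\<close>

definition invariant_set :: "'a::left_cancellative_monoid character set \<Rightarrow> bool" where
  "invariant_set D \<longleftrightarrow> D \<subseteq> Omega \<and>
    (\<forall>g\<in>left_inverse_hull. \<forall>\<omega>\<in>D. \<omega> (dom g) \<longrightarrow> push_character g \<omega> \<in> D)"

lemma invariant_setD:
  assumes "invariant_set D"
  shows "D \<subseteq> Omega" "g \<in> left_inverse_hull \<Longrightarrow> \<omega> \<in> D \<Longrightarrow> \<omega> (dom g) \<Longrightarrow> push_character g \<omega> \<in> D"
  using assms by (auto simp: invariant_set_def)

text \<open>The converse direction is invariance under the inverse of \<open>g\<close>, which leads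
  back from the pushed character to \<omega>.\<close>

lemma invariant_set_push_iff:
  assumes D: "invariant_set D" and g: "g \<in> left_inverse_hull" and \<omega>: "\<omega> \<in> Omega" "\<omega> (dom g)"
  shows "push_character g \<omega> \<in> D \<longleftrightarrow> \<omega> \<in> D"
proof
  assume "push_character g \<omega> \<in> D"
  then have "push_character (partial_inv g) (push_character g \<omega>) \<in> D"
    using \<omega> g by (intro invariant_setD(2)[OF D, of "partial_inv g"] left_inverse_hull.intros)
      (simp_all add: push_character_ran)
  then show "\<omega> \<in> D" using \<omega> g by (simp add: push_character_inv Omega_character)
qed (use invariant_setD(2)[OF D g] \<omega> in auto)

lemma invariant_set_Omega: "invariant_set Omega"
  by (auto simp: invariant_set_def push_character_Omega)

lemma invariant_set_Diff:
  assumes "invariant_set D"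
  shows "invariant_set (Omega - D)"
  using invariant_set_push_iff[OF assms] unfolding invariant_set_def
  by (auto simp: push_character_Omega)

lemma rng_invariant_iff:
  assumes "invariant_set D" "a \<in> arrows groupoid_P"
  shows "rng groupoid_P a \<in> D \<longleftrightarrow> src groupoid_P a \<in> D"
  using assms(2) by (rule arrows_cases) (use invariant_set_push_iff[OF assms(1)] in \<open>auto simp: germ_pairs_iff\<close>)

section \<open>The space of characters is Hausdorff\<close>

instance "fun" :: (type, t0_space) t0_space
proof
  fix x y :: "'a \<Rightarrow> 'b"
  assume "x \<noteq> y"
  then obtain i where "x i \<noteq> y i" by auto
  from this[unfolded separation_t0[of "x i"]] obtain U where U: "open U" "\<not> (x i \<in> U \<longleftrightarrow> y i \<in> U)" by blast
  have "open ((\<lambda>f :: 'a \<Rightarrow> 'b. f i) -` U)"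
    by (intro open_vimage U continuous_on_product_coordinates)
  then show "\<exists>U. open U \<and> \<not> (x \<in> U \<longleftrightarrow> y \<in> U)"
    using U(2) by (intro exI[of _ "(\<lambda>f :: 'a \<Rightarrow> 'b. f i) -` U"]) auto
qed

instance "fun" :: (type, t1_space) t1_space
proof
  fix x y :: "'a \<Rightarrow> 'b"
  assume "x \<noteq> y"
  then obtain i where "x i \<noteq> y i" by auto
  from this[unfolded separation_t1[of "x i"]] obtain U where U: "open U" "x i \<in> U" "y i \<notin> U" by blast
  have "open ((\<lambda>f :: 'a \<Rightarrow> 'b. f i) -` U)"
    by (intro open_vimage U continuous_on_product_coordinates)
  then show "\<exists>U. open U \<and> x \<in> U \<and> y \<notin> U"
    using U(2,3) by (intro exI[of _ "(\<lambda>f :: 'a \<Rightarrow> 'b. f i) -` U"]) auto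
qed

instance "fun" :: (type, t2_space) t2_space
proof
  fix x y :: "'a \<Rightarrow> 'b"
  assume "x \<noteq> y"
  then obtain i where "x i \<noteq> y i" by auto
  from hausdorff[OF this] obtain U V where
    UV: "open U" "open V" "x i \<in> U" "y i \<in> V" "U \<inter> V = {}" by blast
  have "open ((\<lambda>f :: 'a \<Rightarrow> 'b. f i) -` U)" "open ((\<lambda>f :: 'a \<Rightarrow> 'b. f i) -` V)"
    by (intro open_vimage UV continuous_on_product_coordinates)+
  then show "\<exists>U V. open U \<and> open V \<and> x \<in> U \<and> y \<in> V \<and> U \<inter> V = {}"
    using UV(3-5) by (intro exI[of _ "(\<lambda>f :: 'a \<Rightarrow> 'b. f i) -` U"] exI[of _ "(\<lambda>f :: 'a \<Rightarrow> 'b. f i) -` V"]) auto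
qed

lemma Hausdorff_characters: "Hausdorff_space (euclidean :: 'a character topology)"
  using hausdorff unfolding Hausdorff_space_def disjnt_def by auto

text \<open>Weights that are continuous on \<open>D\<close> with compact support inside
  \<open>D\<close> and inside the domain of \<open>g\<close>. Extension by 0 to all of
  \<open>Omega\<close> is built in, so that the same weight describes a function on the reduction to
  \<open>D\<close> and on the whole groupoid.\<close>

definition compact_generator ::
    "'a character set \<Rightarrow> ('a \<rightharpoonup> 'a) \<Rightarrow> ('a::left_cancellative_monoid character \<Rightarrow> complex) \<Rightarrow> bool" where
  "compact_generator D g \<phi> \<longleftrightarrow> g \<in> left_inverse_hull \<and> continuous_on D \<phi> \<and>
    (\<exists>K. compact K \<and> K \<subseteq> D \<and> (\<forall>\<omega>\<in>K. \<omega> (dom g)) \<and> (\<forall>\<omega>\<in>Omega. \<omega> \<notin> K \<longrightarrow> \<phi> \<omega> = 0))"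

lemma compact_generator_bounded:
  assumes "compact_generator D g \<phi>"
  obtains M where "0 \<le> M" "\<And>\<omega>. \<omega> \<in> Omega \<Longrightarrow> cmod (\<phi> \<omega>) \<le> M"
proof -
  obtain K where K: "continuous_on D \<phi>" "compact K" "K \<subseteq> D" "\<And>\<omega>. \<omega> \<in> Omega \<Longrightarrow> \<omega> \<notin> K \<Longrightarrow> \<phi> \<omega> = 0"
    using assms by (auto simp: compact_generator_def)
  have "bounded (\<phi> ` K)"
    by (intro compact_imp_bounded compact_continuous_image continuous_on_subset[OF K(1,3)] K(2))
  then obtain M where M: "\<And>\<omega>. \<omega> \<in> K \<Longrightarrow> cmod (\<phi> \<omega>) \<le> M" by (auto simp: bounded_iff)
  show thesis
  proof (rule that[of "max 0 M"])
    show "cmod (\<phi> \<omega>) \<le> max 0 M" if "\<omega> \<in> Omega" for \<omega>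
      using M[of \<omega>] K(4)[OF that] by (cases "\<omega> \<in> K") auto
  qed simp
qed

lemma compact_generator_bounded_on_dom: "compact_generator D g \<phi> \<Longrightarrow> bounded_on_dom g \<phi>"
  using compact_generator_bounded[of D g \<phi>] unfolding bounded_on_dom_def compact_generator_def by metis

lemma compact_span_bounded_span:
  "f \<in> bisection_span (compact_generator D) \<Longrightarrow> f \<in> bounded_span"
  by (rule bisection_span_mono[where Q = "compact_generator D"]) (rule compact_generator_bounded_on_dom)

text \<open>Cylinders are clopen, and this extension by zero takes the place of cut-off
  functions.\<close>

lemma continuous_on_clopen_if:
  fixes \<phi> :: "'a::topological_space \<Rightarrow> 'b::{topological_space, zero}"
  assumes A: "open A" "closed A" and \<phi>: "continuous_on (D \<inter> A) \<phi>"
  shows "continuous_on D (\<lambda>\<omega>. if \<omega> \<in> A then \<phi> \<omega> else 0)"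
proof -
  have "continuous_on ((D \<inter> A) \<union> (D - A)) (\<lambda>\<omega>. if \<omega> \<in> A then \<phi> \<omega> else 0)"
  proof (rule continuous_on_cases_local[OF _ _ \<phi>])
    have "(D \<inter> A) \<union> (D - A) = D" by blast
    then show "closedin (top_of_set ((D \<inter> A) \<union> (D - A))) (D \<inter> A)"
      "closedin (top_of_set ((D \<inter> A) \<union> (D - A))) (D - A)"
      using A(2) closed_Compl[OF A(1)] closedin_closed_Int[of "- A" D]
      by (auto simp: Diff_eq closedin_closed_Int)
  qed auto
  moreover have "(D \<inter> A) \<union> (D - A) = D" by blast
  ultimately show ?thesis by simp
qed

text \<open>The product weight can be nonzero only where \<psi> is and where the pushed character
  lies in the support of \<phi>. Invariance of \<open>D\<close> puts this set into both
  \<open>D\<close> and \<open>D'\<close>. With \<open>Omega\<close> as one of the two sets, the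
  intersection in the conclusion later yields the ideal property.\<close>

lemma compact_generator_mult_fun:
  assumes D: "invariant_set D" and D': "invariant_set D'"
    and \<phi>: "compact_generator D k \<phi>" and \<psi>: "compact_generator D' h \<psi>"
  shows "compact_generator (D \<inter> D') (k \<circ>\<^sub>m h) (mult_fun k \<phi> h \<psi>)"
proof -
  obtain K where K: "continuous_on D \<phi>" "compact K" "K \<subseteq> D" "\<And>\<omega>. \<omega> \<in> Omega \<Longrightarrow> \<omega> \<notin> K \<Longrightarrow> \<phi> \<omega> = 0"
    and k: "k \<in> left_inverse_hull"
    using \<phi> by (auto simp: compact_generator_def)
  obtain L where L: "continuous_on D' \<psi>" "compact L" "L \<subseteq> D'" "\<And>\<omega>. \<omega> \<in> Omega \<Longrightarrow> \<omega> \<notin> L \<Longrightarrow> \<psi> \<omega> = 0"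
    and h: "h \<in> left_inverse_hull"
    using \<psi> by (auto simp: compact_generator_def)
  have kh: "k \<circ>\<^sub>m h \<in> left_inverse_hull" by (intro left_inverse_hull.intros k h)
  have dh: "\<omega> (dom h)" if "\<omega> \<in> Omega" "\<omega> (dom (k \<circ>\<^sub>m h))" for \<omega>
    using character_mono[OF Omega_character[OF that(1)] that(2) map_comp_dom_subset] h by simp
  define A where "A = {\<omega> :: 'a character. \<omega> (dom (k \<circ>\<^sub>m h))}"
  define KL where "KL = L \<inter> (A \<inter> push_character h -` K)"
  have "closed (A \<inter> push_character h -` K)"
    unfolding A_def
    by (intro closed_Int closed_character_set closed_vimage compact_imp_closed K(2) continuous_push_character)
  then have "compact KL" unfolding KL_def by (rule compact_Int_closed[OF L(2)])
  moreover have "KL \<subseteq> D \<inter> D'"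
  proof
    fix \<omega> assume \<omega>: "\<omega> \<in> KL"
    then have 1: "\<omega> \<in> Omega" using L(3) invariant_setD(1)[OF D'] by (auto simp: KL_def)
    then have "\<omega> (dom h)" using dh \<omega> by (auto simp: KL_def A_def)
    moreover have "push_character h \<omega> \<in> D" using \<omega> K(3) by (auto simp: KL_def)
    ultimately have "\<omega> \<in> D" using invariant_set_push_iff[OF D h 1] by simp
    with \<omega> L(3) show "\<omega> \<in> D \<inter> D'" by (auto simp: KL_def)
  qed
  moreover have "\<forall>\<omega>\<in>KL. \<omega> (dom (k \<circ>\<^sub>m h))" by (auto simp: KL_def A_def)
  moreover have "mult_fun k \<phi> h \<psi> \<omega> = 0" if "\<omega> \<in> Omega" "\<omega> \<notin> KL" for \<omega>
    using that K(4) L(4) dh[of \<omega>] push_character_Omega[OF h, of \<omega>]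
    by (auto simp: KL_def A_def mult_fun_def)
  moreover have "continuous_on (D \<inter> D') (mult_fun k \<phi> h \<psi>)"
  proof -
    have "push_character h ` (D \<inter> D' \<inter> A) \<subseteq> D"
      using dh invariant_setD[OF D] h by (auto simp: A_def)
    then have "continuous_on (D \<inter> D' \<inter> A) (\<lambda>\<omega>. \<phi> (push_character h \<omega>))"
      using continuous_on_compose2[OF K(1) continuous_push_character] by blast
    moreover have "continuous_on (D \<inter> D' \<inter> A) \<psi>" using L(1) by (rule continuous_on_subset) auto
    ultimately have "continuous_on (D \<inter> D' \<inter> A) (\<lambda>\<omega>. \<phi> (push_character h \<omega>) * \<psi> \<omega>)"
      by (rule continuous_on_mult)
    from continuous_on_clopen_if[OF _ _ this]
    show ?thesis unfolding A_def mult_fun_def by (simp add: open_character_set closed_character_set)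
  qed
  ultimately show ?thesis using kh unfolding compact_generator_def by blast
qed

lemma compact_generator_star_fun:
  assumes D: "invariant_set D" and \<phi>: "compact_generator D k \<phi>"
  shows "compact_generator D (partial_inv k) (star_fun k \<phi>)"
proof -
  obtain K where K: "continuous_on D \<phi>" "compact K" "K \<subseteq> D" "\<And>\<omega>. \<omega> \<in> Omega \<Longrightarrow> \<omega> \<notin> K \<Longrightarrow> \<phi> \<omega> = 0"
    "\<And>\<omega>. \<omega> \<in> K \<Longrightarrow> \<omega> (dom k)"
    and k: "k \<in> left_inverse_hull"
    using \<phi> by (auto simp: compact_generator_def)
  have kk: "partial_inv k \<in> left_inverse_hull" by (intro left_inverse_hull.intros k)
  have K\<Omega>: "\<omega> \<in> Omega" if "\<omega> \<in> K" for \<omega> using that K(3) invariant_setD(1)[OF D] by blast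
  define A where "A = {\<omega> :: 'a character. \<omega> (dom (partial_inv k))}"
  define L where "L = (Omega \<inter> A) \<inter> push_character (partial_inv k) -` K"
  have "closed L"
    unfolding L_def A_def
    by (intro closed_Int closed_Omega closed_character_set closed_vimage compact_imp_closed K(2) continuous_push_character)
  then have "compact L" by (rule compact_closed_characters)
  moreover have "L \<subseteq> D"
    using invariant_set_push_iff[OF D kk] K(3) by (auto simp: L_def A_def)
  moreover have "\<forall>\<omega>\<in>L. \<omega> (dom (partial_inv k))" by (auto simp: L_def A_def)
  moreover have "star_fun k \<phi> \<omega> = 0" if "\<omega> \<in> Omega" "\<omega> \<notin> L" for \<omega>
    using that K(4) push_character_Omega[OF kk, of \<omega>] by (auto simp: L_def A_def star_fun_def)
  moreover have "continuous_on D (star_fun k \<phi>)"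
  proof -
    have "push_character (partial_inv k) ` (D \<inter> A) \<subseteq> D"
      using invariant_setD[OF D] kk by (auto simp: A_def)
    then have "continuous_on (D \<inter> A) (\<lambda>\<omega>. \<phi> (push_character (partial_inv k) \<omega>))"
      using continuous_on_compose2[OF K(1) continuous_push_character] by blast
    then have "continuous_on (D \<inter> A) (\<lambda>\<omega>. cnj (\<phi> (push_character (partial_inv k) \<omega>)))"
      by (rule continuous_on_cnj)
    from continuous_on_clopen_if[OF _ _ this]
    show ?thesis unfolding A_def star_fun_def by (simp add: open_character_set closed_character_set)
  qed
  ultimately show ?thesis using kk unfolding compact_generator_def by blast
qed

section \<open>The topology of germs\<close>

lemma openin_basic_open:
  assumes "g \<in> left_inverse_hull" "openin (top_of_set Omega) U" "U \<subseteq> {\<omega> \<in> Omega. \<omega> (dom g)}"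
  shows "openin (gtop groupoid_P) (basic_open g U)"
  unfolding gtop_groupoid_P by (rule topology_generated_by_Basis) (use assms in blast)

lemma openin_dom_chars: "openin (top_of_set Omega) {\<omega> \<in> Omega. \<omega> (dom g)}"
  using openin_open_Int[OF open_character_set[of "dom g"], of Omega] by (simp add: Int_def)

lemma topspace_gtop:
  "topspace (gtop (groupoid_P :: ('a::left_cancellative_monoid germ, 'a character) groupoid))
    = arrows groupoid_P" (is "topspace (gtop ?G) = _")
proof
  show "topspace (gtop ?G) \<subseteq> arrows ?G"
    unfolding gtop_groupoid_P topology_generated_by_topspace
    by (auto simp: basic_open_def germ_pairs_iff intro!: germ_arrow)
  show "arrows ?G \<subseteq> topspace (gtop ?G)"
  proof
    fix a :: "'a germ" assume "a \<in> arrows ?G"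
    then obtain g \<omega> where "a = germ g \<omega>" "(g, \<omega>) \<in> germ_pairs" by (rule arrows_cases)
    then have "a \<in> basic_open g {\<omega> \<in> Omega. \<omega> (dom g)}" "g \<in> left_inverse_hull"
      by (auto simp: basic_open_def germ_pairs_iff)
    then show "a \<in> topspace (gtop ?G)"
      using openin_subset[OF openin_basic_open[OF _ openin_dom_chars subset_refl]] by blast
  qed
qed

lemma continuous_germ:
  fixes g :: "'a::left_cancellative_monoid \<rightharpoonup> 'a"
  assumes g: "g \<in> left_inverse_hull"
  shows "continuous_map (top_of_set {\<omega> \<in> Omega. \<omega> (dom g)}) (gtop groupoid_P) (germ g)"
  unfolding gtop_groupoid_P
proof (rule continuous_on_generated_topo)
  let ?S = "{\<omega> \<in> Omega. \<omega> (dom g)}"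
  fix W :: "'a germ set" assume "W \<in> {basic_open g U | g U. g \<in> left_inverse_hull \<and>
      openin (top_of_set Omega) U \<and> U \<subseteq> {\<omega> \<in> Omega. \<omega> (dom g)}}"
  then obtain h U where W: "W = basic_open h U" "h \<in> left_inverse_hull"
    "openin (top_of_set Omega) U" "U \<subseteq> {\<omega> \<in> Omega. \<omega> (dom h)}" by blast
  then obtain B where B: "open B" "U = Omega \<inter> B" by (auto simp: openin_open)
  \<comment> \<open>The characters at which \<open>g\<close> and \<open>h\<close> have the same
    germ: a union of open sets, one for each ideal on which the two maps agree.\<close>
  define C where "C = (\<Union>A\<in>{A \<in> constructible_ideals. g |` A = h |` A}. {\<omega>. \<omega> A})"
  have "open C" unfolding C_def by (intro open_UN ballI open_character_set)
  have "germ g \<omega> \<in> W \<longleftrightarrow> \<omega> \<in> B \<inter> C" if \<omega>: "\<omega> \<in> ?S" for \<omega>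
  proof -
    have p: "(g, \<omega>) \<in> germ_pairs" using \<omega> g by (simp add: germ_pairs_iff)
    have "germ g \<omega> \<in> W \<longleftrightarrow> (\<exists>\<psi>\<in>U. germ g \<omega> = germ h \<psi>)" by (auto simp: W basic_open_def)
    also have "\<dots> \<longleftrightarrow> \<omega> \<in> U \<and> \<omega> \<in> C"
    proof -
      have "germ g \<omega> = germ h \<psi> \<longleftrightarrow> \<omega> = \<psi> \<and> \<omega> \<in> C" if "\<psi> \<in> U" for \<psi>
      proof -
        have "(h, \<psi>) \<in> germ_pairs" using that W by (auto simp: germ_pairs_iff)
        from germ_eq_iff[OF p this] show ?thesis by (auto simp: C_def)
      qed
      then show ?thesis by auto
    qed
    finally show ?thesis using \<omega> B by auto
  qed
  then have "germ g -` W \<inter> topspace (top_of_set ?S) = ?S \<inter> (B \<inter> C)" by auto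
  then show "openin (top_of_set ?S) (germ g -` W \<inter> topspace (top_of_set ?S))"
    using openin_open_Int[OF open_Int[OF B(1) \<open>open C\<close>]] by simp
next
  let ?\<B> = "{basic_open g U | g U. g \<in> left_inverse_hull \<and>
      openin (top_of_set Omega) U \<and> U \<subseteq> {\<omega> \<in> Omega. \<omega> (dom g)}}"
  have "basic_open g {\<omega> \<in> Omega. \<omega> (dom g)} \<in> ?\<B>"
    using g openin_dom_chars[of g] by blast
  then have "basic_open g {\<omega> \<in> Omega. \<omega> (dom g)} \<subseteq> \<Union> ?\<B>" by (rule Union_upper)
  then show "germ g ` topspace (top_of_set {\<omega> \<in> Omega. \<omega> (dom g)}) \<subseteq> \<Union> ?\<B>"
    by (simp only: basic_open_def topspace_euclidean_subtopology)
qed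

lemma continuous_src:
  "continuous_map (gtop (groupoid_P :: ('a::left_cancellative_monoid germ, 'a character) groupoid)) (top_of_set Omega) (src groupoid_P)"
proof (rule continuous_map_into_subtopology)
  show "continuous_map (gtop groupoid_P) euclidean (src (groupoid_P :: ('a germ, 'a character) groupoid))"
    unfolding continuous_map_alt
  proof (intro conjI allI impI)
    fix B :: "'a character set" assume "openin euclidean B"
    then have "open B" by simp
    have "src groupoid_P -` B \<inter> topspace (gtop groupoid_P)
      = (\<Union>g\<in>left_inverse_hull. basic_open g ({\<omega> \<in> Omega. \<omega> (dom g)} \<inter> B))"
      unfolding topspace_gtop
      by (auto simp: basic_open_def germ_pairs_iff elim!: arrows_cases)
    moreover have "openin (gtop groupoid_P) (basic_open g ({\<omega> \<in> Omega. \<omega> (dom g)} \<inter> B))"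
      if "g \<in> left_inverse_hull" for g :: "'a \<rightharpoonup> 'a"
    proof (rule openin_basic_open[OF that])
      have "{\<omega> \<in> Omega. \<omega> (dom g)} \<inter> B = Omega \<inter> ({\<omega>. \<omega> (dom g)} \<inter> B)" by auto
      then show "openin (top_of_set Omega) ({\<omega> \<in> Omega. \<omega> (dom g)} \<inter> B)"
        using openin_open_Int[OF open_Int[OF open_character_set[of "dom g"] \<open>open B\<close>]] by simp
    qed auto
    ultimately show "openin (gtop groupoid_P) (src groupoid_P -` B \<inter> topspace (gtop groupoid_P))"
      by auto
  qed auto
qed (auto simp: topspace_gtop arrow_src_Omega)

text \<open>For invariant \<open>D\<close> the source condition already forces the range into
  \<open>D\<close>, so that these are the arrows of the reduction to \<open>D\<close>.\<close>

definition arrows_over :: "'a::left_cancellative_monoid character set \<Rightarrow> 'a germ set" where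
  "arrows_over D = {a \<in> arrows groupoid_P. src groupoid_P a \<in> D}"

lemma arrows_reduction:
  "invariant_set D \<Longrightarrow> arrows (reduction groupoid_P D) = arrows_over D"
  by (auto simp: reduction_def Let_def arrows_over_def rng_invariant_iff)

lemma gtop_reduction:
  "invariant_set D \<Longrightarrow> gtop (reduction groupoid_P D) = subtopology (gtop groupoid_P) (arrows_over D)"
  using arrows_reduction[of D] by (simp add: reduction_def Let_def)

lemma reduction_simps [simp]:
  "units (reduction G D) = D" "src (reduction G D) = src G" "rng (reduction G D) = rng G"
  "gmult (reduction G D) = gmult G" "ginv (reduction G D) = ginv G"
  by (simp_all add: reduction_def Let_def)

lemma bisection_fun_arrows_over:
  assumes "compact_generator D g \<phi>" "D \<subseteq> Omega" "a \<notin> arrows_over D"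
  shows "bisection_fun g \<phi> a = 0"
  using assms by (auto simp: bisection_fun_def arrows_over_def compact_generator_def germ_pairs_iff subset_iff)

lemma compact_span_arrows_over:
  assumes "D \<subseteq> Omega" "a \<notin> arrows_over D"
  shows "f \<in> bisection_span (compact_generator D) \<Longrightarrow> f a = 0"
  by (induction rule: bisection_span.induct) (simp_all add: bisection_fun_arrows_over[OF _ assms])

text \<open>The witness is the part of the bisection of \<open>g\<close> over \<open>D\<close>. The
  source map is injective and continuous there, which makes this part Hausdorff whether or not the
  groupoid is. The closed support is contained in the compact image of \<open>K\<close> under the
  germ map.\<close>

lemma bisection_fun_Cc_on:
  assumes D: "invariant_set D" and \<phi>: "compact_generator D g \<phi>"
  obtains V where "openin (gtop (reduction groupoid_P D)) V"
    "Hausdorff_space (subtopology (gtop (reduction groupoid_P D)) V)"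
    "bisection_fun g \<phi> \<in> Cc_on (reduction groupoid_P D) V"
proof -
  obtain K where K: "continuous_on D \<phi>" "compact K" "K \<subseteq> D" "\<And>\<omega>. \<omega> \<in> Omega \<Longrightarrow> \<omega> \<notin> K \<Longrightarrow> \<phi> \<omega> = 0"
    "\<And>\<omega>. \<omega> \<in> K \<Longrightarrow> \<omega> (dom g)"
    and g: "g \<in> left_inverse_hull"
    using \<phi> by (auto simp: compact_generator_def)
  define S where "S = {\<omega> \<in> D. \<omega> (dom g)}"
  define V where "V = germ g ` S"
  have D\<Omega>: "D \<subseteq> Omega" using invariant_setD(1)[OF D] .
  have pairs: "(g, \<omega>) \<in> germ_pairs" if "\<omega> \<in> S" for \<omega>
    using that D\<Omega> g by (auto simp: S_def germ_pairs_iff)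
  have Veq: "V = basic_open g {\<omega> \<in> Omega. \<omega> (dom g)} \<inter> arrows_over D"
    using D\<Omega> g by (auto simp: V_def S_def basic_open_def arrows_over_def germ_pairs_iff)
  have V: "V \<subseteq> arrows_over D" by (simp add: Veq)
  define T where "T = subtopology (gtop groupoid_P) V"
  have T: "subtopology (gtop (reduction groupoid_P D)) V = T"
    using V by (simp add: gtop_reduction[OF D] subtopology_subtopology T_def Int_absorb1)
  have topT: "topspace T = V"
    using V by (auto simp: T_def topspace_gtop arrows_over_def)
  have src: "continuous_map T (top_of_set D) (src groupoid_P)"
  proof -
    have "continuous_map T euclidean (src groupoid_P)"
      unfolding T_def
      by (rule continuous_map_from_subtopology)
        (rule continuous_src[unfolded continuous_map_in_subtopology, THEN conjunct1])
    then show ?thesis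
      using V by (intro continuous_map_into_subtopology) (auto simp: topT arrows_over_def)
  qed
  have "openin (gtop (reduction groupoid_P D)) V"
    unfolding gtop_reduction[OF D] Veq
    using openin_basic_open[OF g openin_dom_chars subset_refl] by (auto simp: openin_subtopology)
  moreover have H: "Hausdorff_space T"
  proof (rule Hausdorff_space_injective_preimage[OF _ src])
    show "Hausdorff_space (top_of_set D)"
      by (rule Hausdorff_space_subtopology[OF Hausdorff_characters])
    show "inj_on (src groupoid_P) (topspace T)"
      unfolding topT V_def by (rule inj_onI) (auto simp: pairs)
  qed
  moreover have "bisection_fun g \<phi> \<in> Cc_on (reduction groupoid_P D) V"
    unfolding Cc_on_def Let_def T
  proof (intro CollectI conjI allI impI)
    have eq: "bisection_fun g \<phi> a = \<phi> (src groupoid_P a)" if "a \<in> V" for a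
      using that by (auto simp: V_def bisection_fun_germ pairs)
    have "continuous_map (top_of_set D) euclidean \<phi>" using K(1) by simp
    from continuous_map_compose[OF src this]
    show "continuous_map T euclidean (bisection_fun g \<phi>)"
      by (rule continuous_map_eq) (simp add: topT eq)
    have C: "compactin T (germ g ` K)"
    proof (rule image_compactin)
      show "compactin (top_of_set S) K"
        using K by (auto simp: compactin_subtopology S_def)
      have "continuous_map (top_of_set S) (gtop groupoid_P) (germ g)"
        by (rule continuous_map_from_subtopology_mono[OF continuous_germ[OF g]])
          (use D\<Omega> in \<open>auto simp: S_def\<close>)
      then show "continuous_map (top_of_set S) T (germ g)"
        unfolding T_def by (intro continuous_map_into_subtopology) (auto simp: V_def)
    qed
    show "compactin T (T closure_of {x \<in> V. bisection_fun g \<phi> x \<noteq> 0})"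
    proof (rule closed_compactin[OF C _ closedin_closure_of])
      show "T closure_of {x \<in> V. bisection_fun g \<phi> x \<noteq> 0} \<subseteq> germ g ` K"
      proof (rule closure_of_minimal[OF _ compactin_imp_closedin[OF H C]])
        show "{x \<in> V. bisection_fun g \<phi> x \<noteq> 0} \<subseteq> germ g ` K"
        proof clarify
          fix x assume x: "x \<in> V" "bisection_fun g \<phi> x \<noteq> 0"
          then obtain \<omega> where \<omega>: "x = germ g \<omega>" "\<omega> \<in> S" by (auto simp: V_def)
          then have "\<phi> \<omega> \<noteq> 0" using x(2) by (auto simp: bisection_fun_germ pairs)
          then have "\<omega> \<in> K" using K(4)[of \<omega>] \<omega>(2) D\<Omega> by (auto simp: S_def)
          with \<omega>(1) show "x \<in> germ g ` K" by blast
        qed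
      qed
    qed
    show "bisection_fun g \<phi> x = 0" if "x \<notin> V" for x
    proof (rule ccontr)
      assume "bisection_fun g \<phi> x \<noteq> 0"
      then obtain \<omega> where \<omega>: "(g, \<omega>) \<in> germ_pairs" "x = germ g \<omega>" "\<phi> \<omega> \<noteq> 0"
        by (auto simp: bisection_fun_def split: if_splits)
      then have "\<omega> \<in> K" using K(4) by (auto simp: germ_pairs_iff)
      then have "x \<in> V" using \<omega> K by (auto simp: V_def S_def)
      with that show False by simp
    qed
  qed
  ultimately show thesis using T by (intro that) simp_all
qed

text \<open>The neighbourhoods are clopen among all characters, while compactness is asked of their
  trace on \<open>D\<close>. Closed sets have this property, and so have complements of closed sets
  in \<open>Omega\<close>.\<close>

definition locally_compact_in_Omega :: "'a::left_cancellative_monoid character set \<Rightarrow> bool" where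
  "locally_compact_in_Omega D \<longleftrightarrow>
    (\<forall>\<omega>\<in>D. \<exists>U. open U \<and> closed U \<and> \<omega> \<in> U \<and> compact (U \<inter> D))"

text \<open>Induction on the cover. A piece \<open>B\<close> is open in \<open>V\<close> by
  assumption and closed because it is compact and \<open>V\<close> is Hausdorff. So \<open>f\<close>
  splits continuously into its part on \<open>B\<close>, which is a function on a bisection, and a
  rest supported on the remaining pieces.\<close>

lemma bisection_cover_span:
  fixes D :: "'a::left_cancellative_monoid character set"
  assumes D: "D \<subseteq> Omega" and H: "Hausdorff_space (subtopology (gtop groupoid_P) V)"
    and V: "V \<subseteq> arrows_over D"
    and C: "finite C" "\<And>g U. (g, U) \<in> C \<Longrightarrow> g \<in> left_inverse_hull \<and> open U \<and> closed U \<and>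
      compact (U \<inter> D) \<and> U \<inter> D \<subseteq> {\<omega>. \<omega> (dom g)} \<and> germ g ` (U \<inter> D) \<subseteq> V \<and>
      openin (subtopology (gtop groupoid_P) V) (germ g ` (U \<inter> D))"
    and f: "continuous_map (subtopology (gtop groupoid_P) V) euclidean f"
      "\<And>a. a \<notin> (\<Union>(g, U)\<in>C. germ g ` (U \<inter> D)) \<Longrightarrow> f a = 0"
  shows "f \<in> bisection_span (compact_generator D)"
  using C f
proof (induction C arbitrary: f rule: finite_induct)
  case empty
  then have "f = (\<lambda>_. 0)" by auto
  then show ?case by (simp add: bisection_span.zero)
next
  case (insert p C)
  define T where "T = subtopology (gtop groupoid_P) V"
  obtain g U where p: "p = (g, U)" by (cases p)
  have gU: "g \<in> left_inverse_hull" "open U" "closed U" "compact (U \<inter> D)" "U \<inter> D \<subseteq> {\<omega>. \<omega> (dom g)}"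
    "germ g ` (U \<inter> D) \<subseteq> V" "openin T (germ g ` (U \<inter> D))"
    using insert.prems(1)[of g U] by (auto simp: p T_def)
  define B where "B = germ g ` (U \<inter> D)"
  have pairs: "(g, \<omega>) \<in> germ_pairs" if "\<omega> \<in> U \<inter> D" for \<omega>
    using that D gU(1,5) by (auto simp: germ_pairs_iff)
  have topT: "topspace T = V"
    using V by (auto simp: T_def topspace_gtop arrows_over_def)
  have cont: "continuous_map (top_of_set (U \<inter> D)) T (germ g)"
  proof -
    have "continuous_map (top_of_set (U \<inter> D)) (gtop groupoid_P) (germ g)"
      by (rule continuous_map_from_subtopology_mono[OF continuous_germ[OF gU(1)]])
        (use D gU(5) in auto)
    then show ?thesis unfolding T_def using gU(6) by (intro continuous_map_into_subtopology) auto
  qed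
  have "compactin T B"
    unfolding B_def by (rule image_compactin[OF _ cont]) (use gU(4) in \<open>simp add: compactin_subtopology\<close>)
  then have clB: "closedin T B" using H by (simp add: compactin_imp_closedin T_def)
  have opB: "openin T B" using gU(7) by (simp add: B_def)
  have fT: "continuous_map T euclidean f" using insert.prems(2) by (simp add: T_def)
  define f' where "f' a = (if a \<in> B then 0 else f a)" for a
  \<comment> \<open>The inner cut to \<open>D\<close> makes the weight vanish on the part of
    \<open>Omega\<close> off \<open>U \<inter> D\<close>, as \<open>compact_generator\<close>
    demands; it changes no value on \<open>D\<close>.\<close>
  define \<phi> where "\<phi> \<omega> = (if \<omega> \<in> U then if \<omega> \<in> D then f (germ g \<omega>) else 0 else 0)" for \<omega>
  have "f' \<in> bisection_span (compact_generator D)"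
  proof (rule insert.IH)
    show "continuous_map (subtopology (gtop groupoid_P) V) euclidean f'"
      unfolding T_def[symmetric] continuous_map_alt
    proof (intro conjI allI impI)
      fix W :: "complex set" assume W: "openin euclidean W"
      have 1: "openin T ((f -` W \<inter> topspace T) - B)"
        using fT W clB by (intro openin_diff) (auto simp: continuous_map_alt)
      have "f' -` W \<inter> topspace T = ((f -` W \<inter> topspace T) - B) \<union> (if 0 \<in> W then B else {})"
        using openin_subset[OF opB] by (auto simp: f'_def split: if_splits)
      then show "openin T (f' -` W \<inter> topspace T)"
        using openin_Un[OF 1, of "if 0 \<in> W then B else {}"] opB by simp
    qed auto
    show "f' a = 0" if "a \<notin> (\<Union>(g, U)\<in>C. germ g ` (U \<inter> D))" for a
      using insert.prems(3)[of a] that by (auto simp: f'_def B_def p)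
  qed (use insert.prems(1) in auto)
  moreover have "compact_generator D g \<phi>"
    unfolding compact_generator_def
  proof (intro conjI exI[of _ "U \<inter> D"])
    have "continuous_on (D \<inter> U) (\<lambda>\<omega>. f (germ g \<omega>))"
      using continuous_map_compose[OF cont fT] by (simp add: o_def Int_commute)
    then have "continuous_on (D \<inter> U) (\<lambda>\<omega>. if \<omega> \<in> D then f (germ g \<omega>) else 0)"
      by (rule continuous_on_eq) auto
    from continuous_on_clopen_if[OF gU(2,3) this]
    show "continuous_on D \<phi>" by (simp add: \<phi>_def)
  qed (use gU in \<open>auto simp: \<phi>_def\<close>)
  moreover have "f = (\<lambda>a. bisection_fun g \<phi> a + f' a)"
  proof
    fix a
    show "f a = bisection_fun g \<phi> a + f' a"
    proof (cases "a \<in> B")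
      case True
      then obtain \<omega> where "\<omega> \<in> U \<inter> D" "a = germ g \<omega>" by (auto simp: B_def)
      with True pairs[of \<omega>] show ?thesis by (simp add: f'_def bisection_fun_germ \<phi>_def)
    next
      case False
      have "bisection_fun g \<phi> a = 0"
      proof (rule ccontr)
        assume "bisection_fun g \<phi> a \<noteq> 0"
        then obtain \<omega> where \<omega>: "(g, \<omega>) \<in> germ_pairs" "a = germ g \<omega>" "\<phi> \<omega> \<noteq> 0"
          by (auto simp: bisection_fun_def split: if_splits)
        then have "a \<in> B" by (auto simp: \<phi>_def B_def split: if_splits)
        with False show False by simp
      qed
      with False show ?thesis by (simp add: f'_def)
    qed
  qed
  ultimately show ?case using bisection_span.step by metis
qed

text \<open>Every point of the compact support has a neighbourhood inside \<open>V\<close> that is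
  the germ image of a compact trace on \<open>D\<close> of a clopen set. A finite subcover is what
  the preceding lemma asks for.\<close>

lemma Cc_on_subset_span:
  fixes D :: "'a::left_cancellative_monoid character set"
  assumes D: "invariant_set D" and LC: "locally_compact_in_Omega D"
    and V: "openin (gtop (reduction groupoid_P D)) V"
    and H: "Hausdorff_space (subtopology (gtop (reduction groupoid_P D)) V)"
    and f: "f \<in> Cc_on (reduction groupoid_P D) V"
  shows "f \<in> bisection_span (compact_generator D)"
proof -
  have D\<Omega>: "D \<subseteq> Omega" using invariant_setD(1)[OF D] .
  obtain Q where Q: "openin (gtop groupoid_P) Q" "V = Q \<inter> arrows_over D"
    using V by (auto simp: gtop_reduction[OF D] openin_subtopology)
  define T where "T = subtopology (gtop groupoid_P) V"
  have T: "subtopology (gtop (reduction groupoid_P D)) V = T"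
    using Q(2) by (simp add: gtop_reduction[OF D] subtopology_subtopology T_def Int_absorb1)
  have topT: "topspace T = V"
    using Q by (auto simp: T_def topspace_gtop arrows_over_def)
  define K where "K = T closure_of {x \<in> V. f x \<noteq> 0}"
  have f: "continuous_map T euclidean f" "compactin T K" "\<And>x. x \<notin> V \<Longrightarrow> f x = 0"
    using f by (auto simp: Cc_on_def Let_def T K_def)
  define good where "good = {(g, U). g \<in> left_inverse_hull \<and> open U \<and> closed U \<and>
      compact (U \<inter> D) \<and> U \<inter> D \<subseteq> {\<omega>. \<omega> (dom g)} \<and> germ g ` (U \<inter> D) \<subseteq> V \<and>
      openin T (germ g ` (U \<inter> D))}"
  have cover: "\<exists>(g, U)\<in>good. a \<in> germ g ` (U \<inter> D)" if a: "a \<in> K" for a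
  proof -
    have aV: "a \<in> V" using a compactin_subset_topspace[OF f(2)] topT by auto
    then have aQ: "a \<in> Q" "a \<in> arrows groupoid_P" "src groupoid_P a \<in> D"
      using Q by (auto simp: arrows_over_def)
    obtain g \<omega> where g\<omega>: "a = germ g \<omega>" "(g, \<omega>) \<in> germ_pairs" using aQ(2) by (rule arrows_cases)
    have g: "g \<in> left_inverse_hull" "\<omega> (dom g)" and \<omega>: "\<omega> \<in> D"
      using g\<omega> aQ by (auto simp: germ_pairs_iff)
    let ?S = "{\<omega> \<in> Omega. \<omega> (dom g)}"
    have "openin (top_of_set ?S) {\<omega> \<in> topspace (top_of_set ?S). germ g \<omega> \<in> Q}"
      by (rule openin_continuous_map_preimage[OF continuous_germ[OF g(1)] Q(1)])
    then obtain B where B: "open B" "{\<omega> \<in> ?S. germ g \<omega> \<in> Q} = ?S \<inter> B"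
      by (auto simp: openin_open)
    have "\<omega> \<in> B" using B(2) g\<omega> aQ by (auto simp: germ_pairs_iff)
    from open_contains_cylinder[OF B(1) this] obtain P R
      where PR: "finite P" "finite R" "\<omega> \<in> cylinder P R" "cylinder P R \<subseteq> B" .
    obtain U1 where U1: "open U1" "closed U1" "\<omega> \<in> U1" "compact (U1 \<inter> D)"
      using LC \<omega> by (auto simp: locally_compact_in_Omega_def)
    \<comment> \<open>The cylinder keeps the germs inside \<open>Q\<close>, \<open>U1\<close> makes
      the trace on \<open>D\<close> compact, and the last set keeps \<open>U\<close> inside the
      domain of the germ map.\<close>
    define U where "U = cylinder P R \<inter> U1 \<inter> {\<omega>. \<omega> (dom g)}"
    have op: "open U" unfolding U_def
      by (intro open_Int open_cylinder PR U1 open_character_set)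
    have cl: "closed U" unfolding U_def
      by (intro closed_Int closed_cylinder U1 closed_character_set)
    have "U \<inter> D = (U1 \<inter> D) \<inter> U" by (auto simp: U_def)
    then have cp: "compact (U \<inter> D)" using compact_Int_closed[OF U1(4) cl] by simp
    have sub: "germ g ` (U \<inter> D) = basic_open g (Omega \<inter> U) \<inter> V"
    proof (intro equalityI subsetI)
      fix b assume "b \<in> germ g ` (U \<inter> D)"
      then obtain \<psi> where \<psi>: "b = germ g \<psi>" "\<psi> \<in> U" "\<psi> \<in> D" by auto
      then have 1: "\<psi> \<in> ?S" "\<psi> \<in> B" using D\<Omega> PR(4) by (auto simp: U_def)
      then have "germ g \<psi> \<in> Q" using B(2) by blast
      moreover have "germ g \<psi> \<in> arrows_over D"
        using 1 \<psi> g by (simp add: arrows_over_def germ_pairs_iff)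
      ultimately show "b \<in> basic_open g (Omega \<inter> U) \<inter> V"
        using \<psi> 1 by (auto simp: Q(2) basic_open_def)
    next
      fix b assume "b \<in> basic_open g (Omega \<inter> U) \<inter> V"
      then obtain \<psi> where \<psi>: "b = germ g \<psi>" "\<psi> \<in> U" "\<psi> \<in> Omega" "b \<in> arrows_over D"
        by (auto simp: basic_open_def Q(2))
      moreover have "(g, \<psi>) \<in> germ_pairs" using \<psi> g by (simp add: germ_pairs_iff U_def)
      ultimately show "b \<in> germ g ` (U \<inter> D)" by (auto simp: arrows_over_def)
    qed
    have "openin (gtop groupoid_P) (basic_open g (Omega \<inter> U))"
      by (rule openin_basic_open[OF g(1) openin_open_Int[OF op]]) (auto simp: U_def)
    then have "openin T (germ g ` (U \<inter> D))"
      unfolding sub T_def by (auto simp: openin_subtopology)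
    then have "(g, U) \<in> good"
      unfolding good_def using g(1) op cl cp sub by (auto simp: U_def)
    moreover have "a \<in> germ g ` (U \<inter> D)"
      using g\<omega>(1) \<omega> PR(3) U1(3) g(2) by (auto simp: U_def)
    ultimately show ?thesis by blast
  qed
  let ?B = "\<lambda>(g, U). germ g ` (U \<inter> D)"
  have "(\<forall>W\<in>?B ` good. openin T W) \<and> K \<subseteq> \<Union> (?B ` good)"
  proof
    show "\<forall>W\<in>?B ` good. openin T W" by (auto simp: good_def)
    show "K \<subseteq> \<Union> (?B ` good)"
    proof
      fix a assume "a \<in> K"
      from cover[OF this] show "a \<in> \<Union> (?B ` good)" by auto
    qed
  qed
  moreover have "\<forall>\<U>. (\<forall>U\<in>\<U>. openin T U) \<and> K \<subseteq> \<Union>\<U> \<longrightarrow> (\<exists>\<F>. finite \<F> \<and> \<F> \<subseteq> \<U> \<and> K \<subseteq> \<Union>\<F>)"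
    using f(2) unfolding compactin_def by (rule conjunct2)
  ultimately have "\<exists>\<F>. finite \<F> \<and> \<F> \<subseteq> ?B ` good \<and> K \<subseteq> \<Union>\<F>"
    by (elim allE[of _ "?B ` good"] impE)
  then obtain \<F> where \<F>: "finite \<F>" "\<F> \<subseteq> ?B ` good" "K \<subseteq> \<Union>\<F>"
    by (elim exE conjE)
  obtain C where C: "C \<subseteq> good" "finite C" "\<F> = ?B ` C"
    using finite_subset_image[OF \<F>(1,2)] by blast
  show ?thesis
  proof (rule bisection_cover_span[OF D\<Omega> _ _ C(2)])
    show "Hausdorff_space (subtopology (gtop groupoid_P) V)" using H T by (simp add: T_def)
    show "V \<subseteq> arrows_over D" by (simp add: Q)
    show "continuous_map (subtopology (gtop groupoid_P) V) euclidean f" using f(1) by (simp add: T_def)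
    show "f a = 0" if "a \<notin> (\<Union>(g, U)\<in>C. germ g ` (U \<inter> D))" for a
    proof (rule ccontr)
      assume "f a \<noteq> 0"
      then have "a \<in> {x \<in> V. f x \<noteq> 0}" using f(3) by auto
      then have "a \<in> K"
        unfolding K_def using closure_of_subset[of "{x \<in> V. f x \<noteq> 0}" T] topT by blast
      with \<F>(3) C(3) that show False by auto
    qed
    show "g \<in> left_inverse_hull \<and> open U \<and> closed U \<and>
      compact (U \<inter> D) \<and> U \<inter> D \<subseteq> {\<omega>. \<omega> (dom g)} \<and> germ g ` (U \<inter> D) \<subseteq> V \<and>
      openin (subtopology (gtop groupoid_P) V) (germ g ` (U \<inter> D))" if "(g, U) \<in> C" for g U
    proof -
      have "(g, U) \<in> good" using C(1) that by blast
      then show ?thesis unfolding good_def T_def by simp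
    qed
  qed
qed

lemma compact_generator_scale:
  "compact_generator D g \<phi> \<Longrightarrow> compact_generator D g (\<lambda>\<omega>. c * \<phi> \<omega>)"
  by (auto simp: compact_generator_def intro!: continuous_on_mult continuous_on_const)

lemma compact_span_scale:
  "f \<in> bisection_span (compact_generator D) \<Longrightarrow> (\<lambda>a. c * f a) \<in> bisection_span (compact_generator D)"
  by (rule bisection_span_scale[where Q = "compact_generator D"]) (rule compact_generator_scale)

lemma Cc_reduction:
  assumes D: "invariant_set D" and LC: "locally_compact_in_Omega D"
  shows "Cc (reduction groupoid_P D) = bisection_span (compact_generator D)"
proof (intro equalityI subsetI)
  fix f assume "f \<in> Cc (reduction groupoid_P D)"
  then obtain n c F where f: "f = (\<lambda>x. \<Sum>k<(n::nat). c k * F k x)"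
    and F: "\<And>k. k < n \<Longrightarrow> \<exists>V. openin (gtop (reduction groupoid_P D)) V \<and>
      Hausdorff_space (subtopology (gtop (reduction groupoid_P D)) V) \<and> F k \<in> Cc_on (reduction groupoid_P D) V"
    unfolding Cc_def by blast
  show "f \<in> bisection_span (compact_generator D)"
    unfolding f
  proof (rule bisection_span_sum)
    fix k assume "k \<in> {..<n}"
    then have "F k \<in> bisection_span (compact_generator D)"
      using F[of k] Cc_on_subset_span[OF D LC] by auto
    then show "(\<lambda>a. c k * F k a) \<in> bisection_span (compact_generator D)"
      by (rule compact_span_scale)
  qed simp
next
  fix f assume "f \<in> bisection_span (compact_generator D)"
  then show "f \<in> Cc (reduction groupoid_P D)"
  proof (induction rule: bisection_span.induct)
    case zero
    show ?case unfolding Cc_def by (intro CollectI exI[of _ "0::nat"]) auto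
  next
    case (step f g \<phi>)
    from step(3) obtain n c F where f: "f = (\<lambda>x. \<Sum>k<(n::nat). c k * F k x)"
      and F: "\<forall>k<n. \<exists>V. openin (gtop (reduction groupoid_P D)) V \<and>
        Hausdorff_space (subtopology (gtop (reduction groupoid_P D)) V) \<and> F k \<in> Cc_on (reduction groupoid_P D) V"
      unfolding Cc_def by blast
    obtain V where V: "openin (gtop (reduction groupoid_P D)) V"
      "Hausdorff_space (subtopology (gtop (reduction groupoid_P D)) V)"
      "bisection_fun g \<phi> \<in> Cc_on (reduction groupoid_P D) V"
      using bisection_fun_Cc_on[OF D step(2)] .
    let ?c = "c(n := 1)" and ?F = "F(n := bisection_fun g \<phi>)"
    have "(\<lambda>a. bisection_fun g \<phi> a + f a) = (\<lambda>x. \<Sum>k<Suc n. ?c k * ?F k x)"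
      by (simp add: f fun_eq_iff)
    moreover have "\<forall>k<Suc n. \<exists>V. openin (gtop (reduction groupoid_P D)) V \<and>
        Hausdorff_space (subtopology (gtop (reduction groupoid_P D)) V) \<and> ?F k \<in> Cc_on (reduction groupoid_P D) V"
      using F V by (auto simp: less_Suc_eq)
    ultimately show ?case unfolding Cc_def by blast
  qed
qed

section \<open>The boundary\<close>

lemma ideal_filterD:
  assumes "ideal_filter F"
  shows "F \<noteq> {}" "X \<in> F \<Longrightarrow> X \<in> constructible_ideals" "{} \<notin> F"
    "X \<in> F \<Longrightarrow> Y \<in> F \<Longrightarrow> X \<inter> Y \<in> F"
    "X \<in> F \<Longrightarrow> Y \<in> constructible_ideals \<Longrightarrow> X \<subseteq> Y \<Longrightarrow> Y \<in> F"
proof -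
  from assms have F: "F \<noteq> {}" "F \<subseteq> constructible_ideals - {{}}" "\<forall>X\<in>F. \<forall>Y\<in>F. X \<inter> Y \<in> F"
    "\<forall>X\<in>F. \<forall>Y\<in>constructible_ideals. X \<subseteq> Y \<longrightarrow> Y \<in> F"
    unfolding ideal_filter_def by simp_all
  show "F \<noteq> {}" by (rule F(1))
  show "X \<in> F \<Longrightarrow> X \<in> constructible_ideals" using F(2) by auto
  show "{} \<notin> F" using F(2) by auto
  show "X \<in> F \<Longrightarrow> Y \<in> F \<Longrightarrow> X \<inter> Y \<in> F" using F(3) by simp
  show "X \<in> F \<Longrightarrow> Y \<in> constructible_ideals \<Longrightarrow> X \<subseteq> Y \<Longrightarrow> Y \<in> F" using F(4) by simp
qed

lemma ideal_filterI:
  assumes "F \<noteq> {}" "\<And>X. X \<in> F \<Longrightarrow> X \<in> constructible_ideals" "{} \<notin> F"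
    "\<And>X Y. X \<in> F \<Longrightarrow> Y \<in> F \<Longrightarrow> X \<inter> Y \<in> F"
    "\<And>X Y. X \<in> F \<Longrightarrow> Y \<in> constructible_ideals \<Longrightarrow> X \<subseteq> Y \<Longrightarrow> Y \<in> F"
  shows "ideal_filter F"
  using assms unfolding ideal_filter_def by blast

lemma ideal_filter_character:
  assumes "\<omega> \<in> Omega"
  shows "ideal_filter {X. \<omega> X}"
proof (rule ideal_filterI)
  have \<omega>: "\<omega> \<in> characters" using assms by (rule Omega_character)
  show "{X. \<omega> X} \<noteq> {}" using character_UNIV[OF \<omega>] by blast
  show "{} \<notin> {X. \<omega> X}" using character_not_empty[OF assms] by simp
  show "X \<in> constructible_ideals" if "X \<in> {X. \<omega> X}" for X
    using that character_constructible[OF \<omega>] by simp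
  show "X \<inter> Y \<in> {X. \<omega> X}" if "X \<in> {X. \<omega> X}" "Y \<in> {X. \<omega> X}" for X Y
    using that character_Int[OF \<omega>, of X Y] character_constructible[OF \<omega>] by simp
  show "Y \<in> {X. \<omega> X}" if "X \<in> {X. \<omega> X}" "Y \<in> constructible_ideals" "X \<subseteq> Y" for X Y
    using that character_mono[OF \<omega>] by simp
qed

lemma maximal_filter_exists:
  fixes X :: "'a::left_cancellative_monoid set"
  assumes X: "X \<in> constructible_ideals" "X \<noteq> {}"
  obtains F where "maximal_filter F" "X \<in> F"
proof -
  let ?A = "{F :: 'a set set. ideal_filter F \<and> X \<in> F}"
  have "ideal_filter {Y \<in> constructible_ideals. X \<subseteq> Y}"
    using X by (intro ideal_filterI) (auto intro: constructible_Int)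
  then have "{Y \<in> constructible_ideals. X \<subseteq> Y} \<in> ?A" using X by simp
  then have ne: "?A \<noteq> {}" by blast
  have "\<exists>M\<in>?A. \<forall>F\<in>?A. M \<subseteq> F \<longrightarrow> F = M"
  proof (rule subset_Zorn_nonempty[OF ne])
    fix \<C> assume \<C>: "\<C> \<noteq> {}" "subset.chain ?A \<C>"
    then have sub: "\<And>F. F \<in> \<C> \<Longrightarrow> ideal_filter F \<and> X \<in> F"
      and lin: "\<And>F G. F \<in> \<C> \<Longrightarrow> G \<in> \<C> \<Longrightarrow> F \<subseteq> G \<or> G \<subseteq> F"
      by (auto simp: subset_chain_def)
    have "ideal_filter (\<Union>\<C>)"
    proof (rule ideal_filterI)
      show "\<Union>\<C> \<noteq> {}" using \<C>(1) sub by blast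
      show "{} \<notin> \<Union>\<C>" using sub ideal_filterD(3) by blast
      show "Y \<in> constructible_ideals" if "Y \<in> \<Union>\<C>" for Y
        using that sub ideal_filterD(2) by blast
      show "Y \<inter> Z \<in> \<Union>\<C>" if YZ: "Y \<in> \<Union>\<C>" "Z \<in> \<Union>\<C>" for Y Z
      proof -
        obtain F G where FG: "F \<in> \<C>" "G \<in> \<C>" "Y \<in> F" "Z \<in> G" using YZ by blast
        from lin[OF FG(1,2)] show ?thesis
        proof
          assume "F \<subseteq> G"
          then have "Y \<inter> Z \<in> G" using FG sub ideal_filterD(4)[of G Y Z] by blast
          with FG show ?thesis by blast
        next
          assume "G \<subseteq> F"
          then have "Y \<inter> Z \<in> F" using FG sub ideal_filterD(4)[of F Y Z] by blast
          with FG show ?thesis by blast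
        qed
      qed
      show "Z \<in> \<Union>\<C>" if "Y \<in> \<Union>\<C>" "Z \<in> constructible_ideals" "Y \<subseteq> Z" for Y Z
        using that sub ideal_filterD(5) by blast
    qed
    moreover have "X \<in> \<Union>\<C>" using \<C>(1) sub by blast
    ultimately show "\<Union>\<C> \<in> ?A" by simp
  qed
  then obtain M where M: "ideal_filter M" "X \<in> M"
    "\<And>F. ideal_filter F \<Longrightarrow> X \<in> F \<Longrightarrow> M \<subseteq> F \<Longrightarrow> F = M"
    by blast
  have "maximal_filter M"
    unfolding maximal_filter_def using M by blast
  then show thesis using M(2) by (rule that)
qed

text \<open>If \<open>Z\<close> met every member of \<open>F\<close>, the ideals that contain Y
  \<inter> Z for some Y in \<open>F\<close> would form a filter containing \<open>F\<close> and
  \<open>Z\<close>, against maximality.\<close>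

lemma maximal_filter_disjoint:
  assumes F: "maximal_filter F" and Z: "Z \<in> constructible_ideals" "Z \<notin> F"
  obtains Y where "Y \<in> F" "Y \<inter> Z = {}"
proof (cases "\<exists>Y\<in>F. Y \<inter> Z = {}")
  case False
  have F': "ideal_filter F" using F by (simp add: maximal_filter_def)
  define F1 where "F1 = {W \<in> constructible_ideals. \<exists>Y\<in>F. Y \<inter> Z \<subseteq> W}"
  have "ideal_filter F1"
  proof (rule ideal_filterI)
    show "F1 \<noteq> {}" using ideal_filterD(1)[OF F'] Z by (auto simp: F1_def)
    show "{} \<notin> F1" using False by (auto simp: F1_def)
    show "X \<in> constructible_ideals" if "X \<in> F1" for X using that by (simp add: F1_def)
    show "X \<inter> Y \<in> F1" if XY: "X \<in> F1" "Y \<in> F1" for X Y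
    proof -
      obtain U V where UV: "U \<in> F" "V \<in> F" "U \<inter> Z \<subseteq> X" "V \<inter> Z \<subseteq> Y" using XY by (auto simp: F1_def)
      then have "U \<inter> V \<in> F" "(U \<inter> V) \<inter> Z \<subseteq> X \<inter> Y" using ideal_filterD(4)[OF F'] by auto
      moreover have "X \<inter> Y \<in> constructible_ideals" using XY by (auto simp: F1_def)
      ultimately show ?thesis by (auto simp: F1_def)
    qed
    show "Y \<in> F1" if "X \<in> F1" "Y \<in> constructible_ideals" "X \<subseteq> Y" for X Y
      using that by (auto simp: F1_def)
  qed
  moreover have "F \<subseteq> F1" using ideal_filterD(2)[OF F'] by (auto simp: F1_def)
  ultimately have "F1 = F" using F by (auto simp: maximal_filter_def)
  moreover have "Z \<in> F1" using Z ideal_filterD(1)[OF F'] by (auto simp: F1_def)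
  ultimately show thesis using Z by simp
qed (use that in blast)

lemma in_closure_cylinderI:
  fixes \<omega> :: "'a character"
  assumes "\<And>P Q. finite P \<Longrightarrow> finite Q \<Longrightarrow> \<omega> \<in> cylinder P Q \<Longrightarrow> cylinder P Q \<inter> S \<noteq> {}"
  shows "\<omega> \<in> closure S"
proof (rule ccontr)
  assume "\<omega> \<notin> closure S"
  then have "\<omega> \<in> - closure S" by simp
  from open_contains_cylinder[OF open_Compl[OF closed_closure] this] obtain P Q
    where "finite P" "finite Q" "\<omega> \<in> cylinder P Q" "cylinder P Q \<subseteq> - closure S" .
  with assms[of P Q] closure_subset[of S] show False by blast
qed

text \<open>To find a point character in \<open>cylinder P Q\<close>, choose for each constructible
  member of \<open>Q\<close> a member of \<open>F\<close> disjoint from it. These and the members of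
  \<open>P\<close> intersect in a member of \<open>F\<close>, which is nonempty, and any of its
  elements will do.\<close>

lemma maximal_filter_Omega_max:
  assumes F: "maximal_filter F"
  shows "(\<lambda>X. X \<in> F) \<in> Omega_max"
proof -
  have F': "ideal_filter F" using F by (simp add: maximal_filter_def)
  have ne: "X \<inter> Y \<in> F \<longleftrightarrow> X \<in> F \<and> Y \<in> F"
    if "X \<in> constructible_ideals" "Y \<in> constructible_ideals" for X Y
    using that ideal_filterD(4)[OF F'] ideal_filterD(5)[OF F', of "X \<inter> Y"] by blast
  then have char: "(\<lambda>X. X \<in> F) \<in> characters"
    using ideal_filterD(1,2)[OF F'] by (auto simp: characters_def)
  have "(\<lambda>X. X \<in> F) \<in> closure (range point_character)"
  proof (rule in_closure_cylinderI)
    fix P Q assume PQ: "finite P" "finite Q" "(\<lambda>X. X \<in> F) \<in> cylinder P Q"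
    have "\<exists>Y\<in>F. Y \<inter> Z = {}" if Z: "Z \<in> Q \<inter> constructible_ideals" for Z
    proof -
      have "Z \<in> constructible_ideals" "Z \<notin> F"
        using Z PQ(3) by (auto simp: cylinder_def)
      then obtain Y where "Y \<in> F" "Y \<inter> Z = {}" by (rule maximal_filter_disjoint[OF F])
      then show ?thesis by blast
    qed
    then obtain y where y: "\<And>Z. Z \<in> Q \<inter> constructible_ideals \<Longrightarrow> y Z \<in> F \<and> y Z \<inter> Z = {}"
      by metis
    let ?R = "P \<union> y ` (Q \<inter> constructible_ideals)"
    have "\<Inter>?R \<in> F"
      by (rule character_Inter[OF char]) (use PQ y in \<open>auto simp: cylinder_def\<close>)
    then have "\<Inter>?R \<noteq> {}" using ideal_filterD(3)[OF F'] by metis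
    then obtain s where s: "s \<in> \<Inter>?R" by blast
    have "P \<subseteq> constructible_ideals" using PQ(3) ideal_filterD(2)[OF F'] by (auto simp: cylinder_def)
    then have "point_character s \<in> cylinder P Q"
      using s y by (fastforce simp: cylinder_def point_character_def)
    then show "cylinder P Q \<inter> range point_character \<noteq> {}" by blast
  qed
  with F show ?thesis by (simp add: Omega_max_def Omega_closure)
qed

text \<open>A filter \<open>F'\<close> that contains the pushed one is pulled back along the inverse
  of \<open>g\<close>. The result \<open>F2\<close> contains the filter of \<omega>, so the two are
  equal by maximality, and hence every member of \<open>F'\<close> already belongs to the pushed
  filter.\<close>

lemma Omega_max_push:
  assumes g: "g \<in> left_inverse_hull" and \<omega>: "\<omega> \<in> Omega_max" "\<omega> (dom g)"
  shows "push_character g \<omega> \<in> Omega_max"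
proof -
  have gg: "partial_inv g \<in> left_inverse_hull" by (intro left_inverse_hull.intros g)
  have \<omega>\<Omega>: "\<omega> \<in> Omega" and max: "maximal_filter {X. \<omega> X}" using \<omega> by (auto simp: Omega_max_def)
  have push\<Omega>: "push_character g \<omega> \<in> Omega" by (rule push_character_Omega[OF g \<omega>\<Omega> \<omega>(2)])
  have "F' = {X. push_character g \<omega> X}"
    if F': "ideal_filter F'" "{X. push_character g \<omega> X} \<subseteq> F'" for F'
  proof -
    define F2 where "F2 = {X \<in> constructible_ideals. map_vimage (partial_inv g) X \<in> F'}"
    have ranF: "dom (partial_inv g) \<in> F'"
      using F'(2) push_character_ran[OF g, of \<omega>] \<omega>(2) by blast
    have "ideal_filter F2"
    proof (rule ideal_filterI)
      have "UNIV \<in> F2" using ranF by (simp add: F2_def map_vimage_UNIV)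
      then show "F2 \<noteq> {}" by blast
      show "{} \<notin> F2" using ideal_filterD(3)[OF F'(1)] by (simp add: F2_def map_vimage_def)
      show "X \<in> constructible_ideals" if "X \<in> F2" for X using that by (simp add: F2_def)
      show "X \<inter> Y \<in> F2" if "X \<in> F2" "Y \<in> F2" for X Y
        using that ideal_filterD(4)[OF F'(1)] by (auto simp: F2_def map_vimage_Int)
      show "Y \<in> F2" if "X \<in> F2" "Y \<in> constructible_ideals" "X \<subseteq> Y" for X Y
        using that ideal_filterD(5)[OF F'(1) _ map_vimage_constructible[OF gg] map_vimage_mono]
        by (auto simp: F2_def)
    qed
    moreover have "{X. \<omega> X} \<subseteq> F2"
    proof clarify
      fix X assume "\<omega> X"
      then have "push_character (partial_inv g) (push_character g \<omega>) X"
        using push_character_inv[OF g Omega_character[OF \<omega>\<Omega>] \<omega>(2)] by simp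
      then show "X \<in> F2" using F'(2) by (auto simp: push_character_eq[of "partial_inv g"] F2_def)
    qed
    ultimately have F2: "F2 = {X. \<omega> X}" using max by (auto simp: maximal_filter_def)
    have "push_character g \<omega> X" if X: "X \<in> F'" for X
    proof -
      have XJ: "X \<in> constructible_ideals" using ideal_filterD(2)[OF F'(1) X] .
      have "map_vimage (partial_inv g) (map_vimage g X) = X \<inter> dom (partial_inv g)"
        using map_vimage_partial_inv[OF gg] g by simp
      then have "map_vimage g X \<in> F2"
        using ideal_filterD(4)[OF F'(1) X ranF] map_vimage_constructible[OF g XJ] by (simp add: F2_def)
      then show ?thesis using F2 XJ by (auto simp: push_character_eq)
    qed
    with F'(2) show ?thesis by blast
  qed
  with ideal_filter_character[OF push\<Omega>] have "maximal_filter {X. push_character g \<omega> X}"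
    unfolding maximal_filter_def by blast
  with push\<Omega> show ?thesis by (simp add: Omega_max_def)
qed

lemma closed_boundary: "closed boundary_Omega"
  unfolding boundary_Omega_def by (intro closed_Int closed_Omega closed_closure)

lemma invariant_set_boundary: "invariant_set boundary_Omega"
  unfolding invariant_set_def
proof (intro conjI ballI impI)
  show "boundary_Omega \<subseteq> Omega" by (auto simp: boundary_Omega_def)
  fix g and \<omega> :: "'a character"
  assume g: "g \<in> left_inverse_hull" and \<omega>: "\<omega> \<in> boundary_Omega" "\<omega> (dom g)"
  have "\<omega> \<in> closure ({\<omega>. \<omega> (dom g)} \<inter> Omega_max)"
    using \<omega> open_Int_closure_subset[OF open_character_set, of "dom g" Omega_max]
    by (auto simp: boundary_Omega_def)
  then have "push_character g \<omega> \<in> closure (push_character g ` ({\<omega>. \<omega> (dom g)} \<inter> Omega_max))"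
    using image_closure_subset[OF continuous_push_character closed_closure closure_subset] by blast
  moreover have "push_character g ` ({\<omega>. \<omega> (dom g)} \<inter> Omega_max) \<subseteq> Omega_max"
    using Omega_max_push[OF g] by auto
  ultimately have "push_character g \<omega> \<in> closure Omega_max" by (meson closure_mono subsetD)
  then show "push_character g \<omega> \<in> boundary_Omega"
    using push_character_Omega[OF g, of \<omega>] \<omega> by (auto simp: boundary_Omega_def)
qed

lemma locally_compact_closed:
  "closed D \<Longrightarrow> locally_compact_in_Omega D"
  unfolding locally_compact_in_Omega_def
  by (intro ballI exI[of _ UNIV]) (simp add: compact_closed_characters)

lemma locally_compact_Diff:
  assumes "closed D"
  shows "locally_compact_in_Omega (Omega - D)"
  unfolding locally_compact_in_Omega_def
proof
  fix \<omega> assume "\<omega> \<in> Omega - D"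
  then have "\<omega> \<in> - D" by simp
  from open_contains_cylinder[OF open_Compl[OF assms] this] obtain P Q
    where PQ: "finite P" "finite Q" "\<omega> \<in> cylinder P Q" "cylinder P Q \<subseteq> - D" .
  then have "cylinder P Q \<inter> (Omega - D) = cylinder P Q \<inter> Omega" by blast
  then have "compact (cylinder P Q \<inter> (Omega - D))"
    by (simp add: compact_closed_characters closed_Int closed_cylinder closed_Omega)
  with PQ show "\<exists>U. open U \<and> closed U \<and> \<omega> \<in> U \<and> compact (U \<inter> (Omega - D))"
    by (intro exI[of _ "cylinder P Q"] conjI open_cylinder closed_cylinder)
qed

section \<open>Foundation sets and the complement of the boundary\<close>

text \<open>A maximal filter with \<open>X\<close> but no member of \<open>F\<close> contains, for
  each member, an ideal disjoint from it. Their intersection with \<open>X\<close> would be a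
  nonempty ideal that misses all of \<open>F\<close>. As the cylinder is open, it also misses the
  closure of \<open>Omega_max\<close>.\<close>

lemma foundation_set_disjoint_boundary:
  assumes F: "foundation_set F X"
  shows "cylinder {X} F \<inter> boundary_Omega = {}"
proof -
  have "cylinder {X} F \<inter> Omega_max = {}"
  proof (rule ccontr)
    assume "cylinder {X} F \<inter> Omega_max \<noteq> {}"
    then obtain \<omega> where \<omega>: "\<omega> X" "\<And>Z. Z \<in> F \<Longrightarrow> \<not> \<omega> Z" "\<omega> \<in> Omega" "maximal_filter {X. \<omega> X}"
      by (auto simp: cylinder_def Omega_max_def)
    have "\<exists>Y. \<omega> Y \<and> Y \<inter> Z = {}" if Z: "Z \<in> F" for Z
    proof -
      have "Z \<in> constructible_ideals" "Z \<notin> {X. \<omega> X}"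
        using Z \<omega>(2) F by (auto simp: foundation_set_def)
      then obtain Y where "Y \<in> {X. \<omega> X}" "Y \<inter> Z = {}" by (rule maximal_filter_disjoint[OF \<omega>(4)])
      then show ?thesis by blast
    qed
    then obtain y where y: "\<And>Z. Z \<in> F \<Longrightarrow> \<omega> (y Z) \<and> y Z \<inter> Z = {}" by metis
    let ?Y = "\<Inter>(insert X (y ` F))"
    have "\<omega> ?Y"
      by (rule character_Inter[OF Omega_character[OF \<omega>(3)]])
        (use F y \<omega>(1) in \<open>auto simp: foundation_set_def\<close>)
    then have "?Y \<in> constructible_ideals" "?Y \<noteq> {}"
      using character_constructible[OF Omega_character[OF \<omega>(3)]] character_not_empty[OF \<omega>(3)] by metis+
    moreover have "?Y \<subseteq> X" by simp
    ultimately obtain Z where "Z \<in> F" "?Y \<inter> Z \<noteq> {}"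
      using F unfolding foundation_set_def by meson
    with y[of Z] show False by auto
  qed
  moreover have "open (cylinder {X} F)"
    using F by (intro open_cylinder) (auto simp: foundation_set_def)
  ultimately have "cylinder {X} F \<inter> closure Omega_max = {}"
    by (simp add: open_Int_closure_eq_empty)
  then show ?thesis by (auto simp: boundary_Omega_def)
qed

text \<open>Off the boundary, a character has a basic neighbourhood without maximal filters. Its
  positive conditions intersect to \<open>X\<close>, and its negative ones, intersected with
  \<open>X\<close>, form \<open>F\<close>. A nonempty ideal inside \<open>X\<close> that missed all
  of \<open>F\<close> would belong to a maximal filter in that neighbourhood.\<close>

lemma foundation_set_neighbourhood:
  assumes \<omega>: "\<omega> \<in> Omega" "\<omega> \<notin> boundary_Omega"
  obtains X F where "foundation_set F X" "\<omega> \<in> cylinder {X} F"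
proof -
  have \<omega>c: "\<omega> \<in> characters" using \<omega>(1) by (rule Omega_character)
  have "\<omega> \<in> - closure Omega_max" using \<omega> by (simp add: boundary_Omega_def)
  from open_contains_cylinder[OF open_Compl[OF closed_closure] this] obtain P Q
    where PQ: "finite P" "finite Q" "\<omega> \<in> cylinder P Q" "cylinder P Q \<subseteq> - closure Omega_max" .
  then have max: "cylinder P Q \<inter> Omega_max = {}" using closure_subset by blast
  define X where "X = \<Inter>P"
  define F where "F = (\<lambda>Z. X \<inter> Z) ` (Q \<inter> constructible_ideals)"
  have \<omega>X: "\<omega> X"
    unfolding X_def by (rule character_Inter[OF \<omega>c PQ(1)]) (use PQ(3) in \<open>auto simp: cylinder_def\<close>)
  then have XJ: "X \<in> constructible_ideals" by (rule character_constructible[OF \<omega>c])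
  have PJ: "P \<subseteq> constructible_ideals"
    using PQ(3) character_constructible[OF \<omega>c] by (auto simp: cylinder_def)
  have meets: "\<exists>Z\<in>F. Y \<inter> Z \<noteq> {}" if Y: "Y \<in> constructible_ideals" "Y \<noteq> {}" "Y \<subseteq> X" for Y
  proof (rule ccontr)
    assume *: "\<not> (\<exists>Z\<in>F. Y \<inter> Z \<noteq> {})"
    obtain G where G: "maximal_filter G" "Y \<in> G" using maximal_filter_exists[OF Y(1,2)] .
    then have G': "ideal_filter G" by (simp add: maximal_filter_def)
    have "Z \<in> G" if "Z \<in> P" for Z
      using ideal_filterD(5)[OF G' G(2), of Z] that PJ Y(3) by (auto simp: X_def)
    moreover have "Z \<notin> G" if "Z \<in> Q" for Z
    proof
      assume "Z \<in> G"
      then have "Z \<in> constructible_ideals" "Y \<inter> Z \<in> G"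
        using ideal_filterD(2,4)[OF G'] G(2) by blast+
      then have "Z \<in> constructible_ideals" "Y \<inter> Z \<noteq> {}"
        using ideal_filterD(3)[OF G'] by (blast, metis)
      moreover have "Y \<inter> Z = Y \<inter> (X \<inter> Z)" using Y(3) by blast
      ultimately show False using * that by (auto simp: F_def)
    qed
    ultimately have "(\<lambda>X. X \<in> G) \<in> cylinder P Q" by (auto simp: cylinder_def)
    with maximal_filter_Omega_max[OF G(1)] max show False by blast
  qed
  have "X \<noteq> {}" using \<omega>X character_not_empty[OF \<omega>(1)] by auto
  \<comment> \<open>Foundation sets are nonempty by definition; testing \<open>meets\<close> on
    \<open>X\<close> itself provides a member.\<close>
  from meets[OF XJ this subset_refl] have "F \<noteq> {}" by blast
  then have "foundation_set F X"
    using PQ(2) XJ meets by (auto simp: foundation_set_def F_def)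
  moreover have "\<omega> \<in> cylinder {X} F"
    using \<omega>X PQ(3) character_Int[OF \<omega>c XJ] by (auto simp: cylinder_def F_def)
  ultimately show thesis by (rule that)
qed

section \<open>The representation at the point character of the identity\<close>

lemma bounded_linear_adjoint_pair:
  assumes "adjoint_pair T T'" "\<And>x. norm (T x) \<le> M * norm x"
  shows "bounded_linear T"
  using adjoint_pair_add[OF assms(1)] adjoint_pair_scale[OF assms(1)] assms(2)
  by (intro bounded_linear_intro[where K = M]) (simp_all add: mult.commute flip: ell2_scale_of_real)

lemma left_translation_germ_pair: "(left_translation s, point_character 1) \<in> germ_pairs"
proof -
  have "dom (left_translation s) = UNIV" by (auto simp: left_translation_def)
  moreover have "point_character 1 UNIV" by (simp add: point_character_def)
  ultimately show ?thesis by (simp add: germ_pairs_iff left_inverse_hull.intros)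
qed

lemma hull_eq_left_translation:
  assumes "g \<in> left_inverse_hull" "g 1 = Some s"
  shows "g = left_translation s"
  using hull_equivariant[OF assms] by (auto simp: left_translation_def)

lemma point_arrow_arrow [simp]: "point_arrow s \<in> arrows groupoid_P"
  by (simp add: point_arrow_def left_translation_germ_pair)

lemma src_point_arrow [simp]: "src groupoid_P (point_arrow s) = point_character 1"
  by (simp add: point_arrow_def left_translation_germ_pair)

lemma rng_point_arrow [simp]: "rng groupoid_P (point_arrow s) = point_character s"
proof -
  have "left_translation s 1 = Some s" by (simp add: left_translation_def)
  then show ?thesis
    by (simp add: point_arrow_def left_translation_germ_pair left_inverse_hull.intros push_point_character)
qed

lemma inj_point_arrow: "inj point_arrow"
proof (rule injI)
  fix s t :: 'a assume "point_arrow s = point_arrow t"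
  then obtain A where A: "point_character 1 A" "left_translation s |` A = left_translation t |` A"
    by (auto simp: point_arrow_def germ_eq_iff left_translation_germ_pair)
  then have "1 \<in> A" by (simp add: point_character_def)
  then have "left_translation s 1 = left_translation t 1" using A(2) by (metis restrict_in)
  then show "s = t" by (simp add: left_translation_def)
qed

lemma germ_point_character:
  assumes "(g, point_character 1) \<in> germ_pairs" "g 1 = Some s"
  shows "germ g (point_character 1) = point_arrow s"
  using assms hull_eq_left_translation[of g s] by (simp add: point_arrow_def germ_pairs_iff)

text \<open>The character of 1 contains the domain of a map only if the map is defined at 1, and by
  equivariance the map is then a left translation.\<close>

lemma fibre_point_character: "fibre (point_character 1) = range point_arrow"
proof (intro equalityI subsetI)
  fix a assume "a \<in> fibre (point_character 1)"
  then obtain g where g: "a = germ g (point_character 1)" "(g, point_character 1) \<in> germ_pairs"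
    by (auto elim!: arrows_cases)
  then obtain s where "g 1 = Some s" by (auto simp: germ_pairs_iff point_character_def)
  then show "a \<in> range point_arrow" using germ_point_character g by blast
qed auto

lemma germ_act_point_arrow:
  assumes k: "k \<in> left_inverse_hull" "k s = Some t"
  shows "germ_act k (point_arrow s) = point_arrow t"
proof -
  have "push_character (left_translation s) (point_character 1) (dom k)"
  proof -
    have "push_character (left_translation s) (point_character 1) = point_character s"
      using rng_point_arrow[of s] by (simp add: point_arrow_def left_translation_germ_pair)
    then show ?thesis using k by (auto simp: point_character_def)
  qed
  note * = germ_act_germ[OF left_translation_germ_pair k(1) this]
  have "(k \<circ>\<^sub>m left_translation s) 1 = Some t" using k by (simp add: left_translation_def)
  from germ_point_character[OF *(2) this] *(1) show ?thesis by (simp add: point_arrow_def)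
qed

lemma ell2_apply_to_fibre:
  "ell2_apply (to_fibre \<xi>) a = (if a \<in> range point_arrow then ell2_apply \<xi> (inv point_arrow a) else 0)"
  and norm_to_fibre_le: "norm (to_fibre \<xi>) \<le> norm \<xi>"
proof -
  note ws = weighted_permutation_summable[where P = "range point_arrow" and p = "inv point_arrow"
      and w = "\<lambda>_. 1" and M = 1 and x = \<xi>, OF inj_on_inv_into[OF subset_refl], unfolded mult_1_left]
  have eq: "ell2_apply (to_fibre \<xi>) = (\<lambda>a. if a \<in> range point_arrow then ell2_apply \<xi> (inv point_arrow a) else 0)"
    unfolding to_fibre_def by (rule ell2_apply_Abs) (use ws(1) in simp)
  then show "ell2_apply (to_fibre \<xi>) a = (if a \<in> range point_arrow then ell2_apply \<xi> (inv point_arrow a) else 0)"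
    by simp
  have "(norm (to_fibre \<xi>))\<^sup>2 \<le> (norm \<xi>)\<^sup>2"
    unfolding norm_ell2_sq[of "to_fibre \<xi>"] eq using ws(2) by simp
  then show "norm (to_fibre \<xi>) \<le> norm \<xi>" by (rule power2_le_imp_le) simp
qed

lemma ell2_apply_from_fibre: "ell2_apply (from_fibre \<eta>) s = ell2_apply \<eta> (point_arrow s)"
  and norm_from_fibre_le: "norm (from_fibre \<eta>) \<le> norm \<eta>"
proof -
  note ws = weighted_permutation_summable[where P = UNIV and p = point_arrow
      and w = "\<lambda>_. 1" and M = 1 and x = \<eta>, OF inj_point_arrow, unfolded mult_1_left]
  have eq: "ell2_apply (from_fibre \<eta>) = (\<lambda>s. ell2_apply \<eta> (point_arrow s))"
    unfolding from_fibre_def by (rule ell2_apply_Abs) (use ws(1) in simp)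
  then show "ell2_apply (from_fibre \<eta>) s = ell2_apply \<eta> (point_arrow s)" by simp
  have "(norm (from_fibre \<eta>))\<^sup>2 \<le> (norm \<eta>)\<^sup>2"
    unfolding norm_ell2_sq[of "from_fibre \<eta>"] eq using ws(2) by simp
  then show "norm (from_fibre \<eta>) \<le> norm \<eta>" by (rule power2_le_imp_le) simp
qed

lemma adjoint_pair_fibre: "adjoint_pair to_fibre from_fibre"
  unfolding adjoint_pair_def ell2_inner_def
proof (intro allI)
  fix \<xi> :: "'a ell2" and \<eta> :: "'a germ ell2"
  have "(\<Sum>\<^sub>\<infinity>a. (if a \<in> range point_arrow then 1 * ell2_apply \<xi> (inv point_arrow a) else 0) * cnj (ell2_apply \<eta> a))
    = (\<Sum>\<^sub>\<infinity>b. ell2_apply \<xi> b * cnj (if b \<in> UNIV then cnj 1 * ell2_apply \<eta> (point_arrow b) else 0))"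
    by (rule infsum_partial_permutation) (auto simp: inv_f_f[OF inj_point_arrow])
  then show "(\<Sum>\<^sub>\<infinity>i. ell2_apply (to_fibre \<xi>) i * cnj (ell2_apply \<eta> i))
    = (\<Sum>\<^sub>\<infinity>i. ell2_apply \<xi> i * cnj (ell2_apply (from_fibre \<eta>) i))"
    by (simp add: ell2_apply_to_fibre ell2_apply_from_fibre cong: if_cong)
qed

text \<open>In general the composition is the projection onto the vectors supported on the fibre.
  Values of the regular representation at the character of 1 are such vectors, which is what
  multiplicativity of \<open>rho_e_Cc\<close> needs.\<close>

lemma to_from_fibre:
  assumes "\<And>a. a \<notin> range point_arrow \<Longrightarrow> ell2_apply \<eta> a = 0"
  shows "to_fibre (from_fibre \<eta>) = \<eta>"
  by (rule ell2_eqI) (use assms in \<open>auto simp: ell2_apply_to_fibre ell2_apply_from_fibre inv_f_f[OF inj_point_arrow]\<close>)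

lemma bounded_linear_to_fibre: "bounded_linear to_fibre"
  by (rule bounded_linear_adjoint_pair[OF adjoint_pair_fibre, where M = 1]) (simp add: norm_to_fibre_le)

lemma bounded_linear_from_fibre: "bounded_linear from_fibre"
  by (rule bounded_linear_adjoint_pair[OF adjoint_pair_sym[OF adjoint_pair_fibre], where M = 1])
    (simp add: norm_from_fibre_le)

section \<open>The representation on functions\<close>

lemma rho_e_Cc_apply:
  assumes "f \<in> bounded_span"
  shows "blinfun_apply (rho_e_Cc f) \<xi> = from_fibre (regular_rep groupoid_P (point_character 1) f (to_fibre \<xi>))"
proof -
  have "bounded_linear (\<lambda>\<xi>. from_fibre (regular_rep groupoid_P (point_character 1) f (to_fibre \<xi>)))"
    using bounded_linear_compose[OF bounded_linear_from_fibre
        bounded_linear_compose[OF bounded_linear_regular_rep[OF assms] bounded_linear_to_fibre]] .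
  then show ?thesis unfolding rho_e_Cc_def by (simp add: bounded_linear_Blinfun_apply)
qed

lemma rho_e_Cc_adjoint:
  assumes "f \<in> bounded_span"
  shows "adjoint_pair (blinfun_apply (rho_e_Cc f)) (blinfun_apply (rho_e_Cc (involution groupoid_P f)))"
  unfolding adjoint_pair_def
proof (intro allI)
  fix \<xi> \<eta> :: "'a ell2"
  let ?R = "regular_rep groupoid_P (point_character 1)"
  have "ell2_inner (from_fibre (?R f (to_fibre \<xi>))) \<eta> = ell2_inner (?R f (to_fibre \<xi>)) (to_fibre \<eta>)"
    by (rule adjoint_pair_sym[OF adjoint_pair_fibre, unfolded adjoint_pair_def, rule_format])
  also have "\<dots> = ell2_inner (to_fibre \<xi>) (?R (involution groupoid_P f) (to_fibre \<eta>))"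
    using regular_rep_adjoint[OF assms] by (simp add: adjoint_pair_def)
  also have "\<dots> = ell2_inner \<xi> (from_fibre (?R (involution groupoid_P f) (to_fibre \<eta>)))"
    by (rule adjoint_pair_fibre[unfolded adjoint_pair_def, rule_format])
  finally show "ell2_inner (blinfun_apply (rho_e_Cc f) \<xi>) \<eta>
      = ell2_inner \<xi> (blinfun_apply (rho_e_Cc (involution groupoid_P f)) \<eta>)"
    by (simp add: rho_e_Cc_apply assms bounded_span_involution)
qed

lemma norm_rho_e_Cc_le:
  assumes "f \<in> bounded_span"
  shows "norm (rho_e_Cc f) \<le> reduced_norm groupoid_P f"
proof (rule norm_blinfun_bound[OF reduced_norm_nonneg[OF assms]])
  fix \<xi> :: "'a ell2"
  let ?R = "regular_rep groupoid_P (point_character 1)"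
  have "norm (from_fibre (?R f (to_fibre \<xi>))) \<le> norm (?R f (to_fibre \<xi>))"
    by (rule norm_from_fibre_le)
  also have "\<dots> \<le> reduced_norm groupoid_P f * norm (to_fibre \<xi>)"
    by (rule norm_regular_rep_le[OF assms]) simp
  also have "\<dots> \<le> reduced_norm groupoid_P f * norm \<xi>"
    by (intro mult_left_mono norm_to_fibre_le reduced_norm_nonneg assms)
  finally show "norm (blinfun_apply (rho_e_Cc f) \<xi>) \<le> reduced_norm groupoid_P f * norm \<xi>"
    by (simp add: rho_e_Cc_apply assms)
qed

lemma rho_e_Cc_convolution:
  assumes "f \<in> bounded_span" "f' \<in> bounded_span"
  shows "rho_e_Cc (convolution groupoid_P f f') = rho_e_Cc f o\<^sub>L rho_e_Cc f'"
proof (rule blinfun_eqI)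
  fix \<xi> :: "'a ell2"
  let ?R = "regular_rep groupoid_P (point_character 1)"
  have "to_fibre (from_fibre (?R f' (to_fibre \<xi>))) = ?R f' (to_fibre \<xi>)"
    by (rule to_from_fibre) (simp only: ell2_apply_regular_rep[OF assms(2)] fibre_point_character if_False)
  then show "blinfun_apply (rho_e_Cc (convolution groupoid_P f f')) \<xi> = blinfun_apply (rho_e_Cc f o\<^sub>L rho_e_Cc f') \<xi>"
    by (simp add: rho_e_Cc_apply assms bounded_span_convolution regular_rep_convolution)
qed

lemma rho_e_Cc_add:
  assumes "f \<in> bounded_span" "f' \<in> bounded_span"
  shows "rho_e_Cc (\<lambda>a. f a + f' a) = rho_e_Cc f + rho_e_Cc f'"
  by (rule blinfun_eqI)
    (simp add: rho_e_Cc_apply assms bisection_span_add regular_rep_fun_add blinfun.add_left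
      linear_add[OF bounded_linear.linear[OF bounded_linear_from_fibre]])

lemma rho_e_Cc_scale:
  assumes "f \<in> bounded_span"
  shows "blinfun_apply (rho_e_Cc (\<lambda>a. c * f a)) \<xi> = ell2_scale c (blinfun_apply (rho_e_Cc f) \<xi>)"
  by (simp add: rho_e_Cc_apply assms bounded_span_scale regular_rep_fun_scale
      adjoint_pair_scale[OF adjoint_pair_sym[OF adjoint_pair_fibre]])

lemma rho_e_Cc_zero: "rho_e_Cc (\<lambda>_. 0) = 0"
  using norm_rho_e_Cc_le[OF bisection_span.zero] by simp

lemma rho_e_Cc_diff:
  assumes "f \<in> bounded_span" "f' \<in> bounded_span"
  shows "rho_e_Cc (\<lambda>a. f a - f' a) = rho_e_Cc f - rho_e_Cc f'"
proof -
  have "rho_e_Cc (\<lambda>a. f a + - 1 * f' a) = rho_e_Cc f + rho_e_Cc (\<lambda>a. - 1 * f' a)"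
    by (intro rho_e_Cc_add assms bounded_span_scale)
  moreover have "rho_e_Cc (\<lambda>a. - 1 * f' a) = - rho_e_Cc f'"
    by (rule blinfun_eqI) (simp only: rho_e_Cc_scale assms ell2_scale_minus_one blinfun.minus_left)
  ultimately show ?thesis by simp
qed

text \<open>Read on basis vectors: the vector at t goes to the one at k(t), multiplied with the
  weight at the point character of t, and to 0 if k is not defined at t.\<close>

lemma rho_e_Cc_bisection_fun:
  assumes "bounded_on_dom k \<phi>"
  shows "ell2_apply (blinfun_apply (rho_e_Cc (bisection_fun k \<phi>)) \<xi>) s
    = (case partial_inv k s of None \<Rightarrow> 0 | Some t \<Rightarrow> \<phi> (point_character t) * ell2_apply \<xi> t)"
proof -
  have gen: "bisection_fun k \<phi> \<in> bounded_span" by (rule bisection_span_generator[of bounded_on_dom, OF assms])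
  have k: "k \<in> left_inverse_hull" using assms by (simp add: bounded_on_dom_def)
  have kk: "partial_inv k \<in> left_inverse_hull" by (intro left_inverse_hull.intros k)
  have "ell2_apply (blinfun_apply (rho_e_Cc (bisection_fun k \<phi>)) \<xi>) s
    = (if point_character s (dom (partial_inv k)) then
       \<phi> (push_character (partial_inv k) (point_character s)) * ell2_apply (to_fibre \<xi>) (germ_act (partial_inv k) (point_arrow s))
       else 0)"
    by (simp add: rho_e_Cc_apply gen ell2_apply_from_fibre ell2_apply_regular_rep left_conv_bisection_fun[OF k])
  also have "\<dots> = (case partial_inv k s of None \<Rightarrow> 0 | Some t \<Rightarrow> \<phi> (point_character t) * ell2_apply \<xi> t)"
  proof (cases "partial_inv k s")
    case None
    then show ?thesis by (auto simp: point_character_def)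
  next
    case (Some t)
    then have "point_character s (dom (partial_inv k))" using kk by (auto simp: point_character_def)
    then show ?thesis
      using Some by (simp add: push_point_character[OF kk Some] germ_act_point_arrow[OF kk Some]
          ell2_apply_to_fibre inv_f_f[OF inj_point_arrow])
  qed
  finally show ?thesis .
qed

section \<open>Algebras of operators\<close>

lemma bounded_operators_simps [simp]:
  "zero bounded_operators = 0" "add bounded_operators = (+)" "mult bounded_operators = (o\<^sub>L)"
  "anorm bounded_operators = norm"
  by (simp_all add: bounded_operators_def)

lemma scale_bounded_operators_apply [simp]:
  "blinfun_apply (scale bounded_operators c T) x = ell2_scale c (blinfun_apply T x)"
proof -
  have "bounded_linear (\<lambda>x. ell2_scale c (blinfun_apply T x))"
    by (intro bounded_linear_compose[OF bounded_linear_ell2_scale] blinfun.bounded_linear_right)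
  then show ?thesis by (simp add: bounded_operators_def bounded_linear_Blinfun_apply)
qed

lemma bounded_operators_diff [simp]: "diff bounded_operators S T = S - T"
proof -
  have "scale bounded_operators (- 1) T = - T"
    by (rule blinfun_eqI) (simp only: scale_bounded_operators_apply ell2_scale_minus_one blinfun.minus_left)
  then show ?thesis by (simp add: diff_def)
qed

lemma star_bounded_operators:
  assumes "adjoint_pair (blinfun_apply T) (blinfun_apply T')"
  shows "star bounded_operators T = T'"
proof -
  have "(THE U. \<forall>x y. ell2_inner (blinfun_apply T x) y = ell2_inner x (blinfun_apply U y)) = T'"
  proof (rule the_equality)
    show "\<forall>x y. ell2_inner (blinfun_apply T x) y = ell2_inner x (blinfun_apply T' y)"
      using assms by (simp add: adjoint_pair_def)
    fix U assume "\<forall>x y. ell2_inner (blinfun_apply T x) y = ell2_inner x (blinfun_apply U y)"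
    then have "adjoint_pair (blinfun_apply T) (blinfun_apply U)" by (simp add: adjoint_pair_def)
    from adjoint_pair_unique[OF this assms] show "U = T'" by (simp add: blinfun_apply_inject)
  qed
  then show ?thesis by (simp add: bounded_operators_def)
qed

lemma bounded_operators_carrier_adjoint:
  "adjoint_pair (blinfun_apply T) T' \<Longrightarrow> T \<in> carrier bounded_operators"
  using adjoint_pair_scale[of "blinfun_apply T" T'] by (simp add: bounded_operators_def)

lemma norm_adjoint_le:
  assumes "adjoint_pair (blinfun_apply T) (blinfun_apply T')"
  shows "norm T' \<le> norm T"
  by (rule norm_blinfun_bound) (simp_all add: adjoint_pair_norm_le[OF assms norm_blinfun])

lemma adjoint_pair_blinfun_diff:
  assumes "adjoint_pair (blinfun_apply S) (blinfun_apply S')" "adjoint_pair (blinfun_apply T) (blinfun_apply T')"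
  shows "adjoint_pair (blinfun_apply (S - T)) (blinfun_apply (S' - T'))"
proof -
  have "adjoint_pair (\<lambda>x. - blinfun_apply T x) (\<lambda>x. - blinfun_apply T' x)"
    using assms(2) unfolding adjoint_pair_def ell2_scale_minus_one[symmetric]
    by (simp add: ell2_inner_scale_left ell2_inner_scale_right)
  from adjoint_pair_add_op[OF assms(1) this] show ?thesis
    by (simp add: adjoint_pair_def blinfun.diff_left)
qed

text \<open>Taking adjoints does not increase the norms of differences, so the adjoints form a
  Cauchy sequence, and Cauchy-Schwarz carries the adjoint relation over to the limits.\<close>

lemma adjoint_limit:
  fixes T :: "nat \<Rightarrow> 'i ell2 \<Rightarrow>\<^sub>L 'i ell2"
  assumes adj: "\<And>n. adjoint_pair (blinfun_apply (T n)) (blinfun_apply (T' n))" and L: "T \<longlonglongrightarrow> L"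
  obtains L' where "T' \<longlonglongrightarrow> L'" "adjoint_pair (blinfun_apply L) (blinfun_apply L')"
proof -
  have le: "norm (T' m - T' n) \<le> norm (T m - T n)" for m n
    by (intro norm_adjoint_le adjoint_pair_blinfun_diff adj)
  have "Cauchy T'"
  proof (rule metric_CauchyI)
    fix e :: real assume "e > 0"
    then obtain M where "\<And>m n. m \<ge> M \<Longrightarrow> n \<ge> M \<Longrightarrow> dist (T m) (T n) < e"
      using metric_CauchyD[OF LIMSEQ_imp_Cauchy[OF L]] by blast
    then show "\<exists>M. \<forall>m\<ge>M. \<forall>n\<ge>M. dist (T' m) (T' n) < e"
      using le by (auto simp: dist_norm intro!: exI[of _ M] order_le_less_trans[OF le])
  qed
  then obtain L' where L': "T' \<longlonglongrightarrow> L'"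
    using Cauchy_convergent convergent_def by blast
  have "ell2_inner (blinfun_apply L x) y = ell2_inner x (blinfun_apply L' y)" for x y
  proof -
    have 1: "(\<lambda>n. ell2_inner (blinfun_apply (T n) x) y) \<longlonglongrightarrow> ell2_inner (blinfun_apply L x) y"
    proof (rule LIM_zero_cancel, rule Lim_null_comparison)
      show "\<forall>\<^sub>F n in sequentially. norm (ell2_inner (blinfun_apply (T n) x) y - ell2_inner (blinfun_apply L x) y)
          \<le> norm (T n - L) * norm x * norm y"
      proof (intro always_eventually allI)
        fix n
        have "ell2_inner (blinfun_apply (T n) x) y = ell2_inner (blinfun_apply L x) y
            + ell2_inner (blinfun_apply (T n - L) x) y"
          by (simp add: blinfun.diff_left flip: ell2_inner_add_left)
        then have "norm (ell2_inner (blinfun_apply (T n) x) y - ell2_inner (blinfun_apply L x) y)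
            \<le> norm (blinfun_apply (T n - L) x) * norm y"
          using cmod_ell2_inner_le[of "blinfun_apply (T n - L) x" y] by simp
        also have "\<dots> \<le> norm (T n - L) * norm x * norm y"
          by (intro mult_right_mono norm_blinfun) simp
        finally show "norm (ell2_inner (blinfun_apply (T n) x) y - ell2_inner (blinfun_apply L x) y)
          \<le> norm (T n - L) * norm x * norm y" .
      qed
      show "(\<lambda>n. norm (T n - L) * norm x * norm y) \<longlonglongrightarrow> 0"
        using L by (intro tendsto_mult_left_zero) (simp add: LIM_zero tendsto_norm_zero)
    qed
    have 2: "(\<lambda>n. ell2_inner x (blinfun_apply (T' n) y)) \<longlonglongrightarrow> ell2_inner x (blinfun_apply L' y)"
    proof (rule LIM_zero_cancel, rule Lim_null_comparison)
      show "\<forall>\<^sub>F n in sequentially. norm (ell2_inner x (blinfun_apply (T' n) y) - ell2_inner x (blinfun_apply L' y))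
          \<le> norm (T' n - L') * norm y * norm x"
      proof (intro always_eventually allI)
        fix n
        have "ell2_inner x (blinfun_apply (T' n) y) = ell2_inner x (blinfun_apply L' y)
            + ell2_inner x (blinfun_apply (T' n - L') y)"
          by (simp add: blinfun.diff_left flip: ell2_inner_add_right)
        then have "norm (ell2_inner x (blinfun_apply (T' n) y) - ell2_inner x (blinfun_apply L' y))
            \<le> norm x * norm (blinfun_apply (T' n - L') y)"
          using cmod_ell2_inner_le[of x "blinfun_apply (T' n - L') y"] by simp
        also have "\<dots> = norm (blinfun_apply (T' n - L') y) * norm x" by (rule mult.commute)
        also have "\<dots> \<le> norm (T' n - L') * norm y * norm x"
          by (intro mult_right_mono norm_blinfun) simp
        finally show "norm (ell2_inner x (blinfun_apply (T' n) y) - ell2_inner x (blinfun_apply L' y))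
          \<le> norm (T' n - L') * norm y * norm x" .
      qed
      show "(\<lambda>n. norm (T' n - L') * norm y * norm x) \<longlonglongrightarrow> 0"
        using L' by (intro tendsto_mult_left_zero) (simp add: LIM_zero tendsto_norm_zero)
    qed
    have "(\<lambda>n. ell2_inner x (blinfun_apply (T' n) y)) \<longlonglongrightarrow> ell2_inner (blinfun_apply L x) y"
      using 1 adj by (simp add: adjoint_pair_def)
    from LIMSEQ_unique[OF this 2] show ?thesis .
  qed
  then have "adjoint_pair (blinfun_apply L) (blinfun_apply L')" by (simp add: adjoint_pair_def)
  with L' show thesis by (rule that)
qed

text \<open>The closed image of the functions supported over \<open>D\<close>. For
  \<open>Omega\<close> it turns out to be the algebra of the monoid, and for the complement of the
  boundary the foundation ideal.\<close>

definition operator_closure :: "'a::left_cancellative_monoid character set \<Rightarrow> ('a ell2 \<Rightarrow>\<^sub>L 'a ell2) set" where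
  "operator_closure D = closure (rho_e_Cc ` bisection_span (compact_generator D))"

lemma operator_closureI:
  "f \<in> bisection_span (compact_generator D) \<Longrightarrow> rho_e_Cc f \<in> operator_closure D"
  unfolding operator_closure_def by (rule subsetD[OF closure_subset]) simp

lemma operator_closureD:
  assumes "T \<in> operator_closure D"
  shows "\<exists>f :: nat \<Rightarrow> _. (\<forall>n. f n \<in> bisection_span (compact_generator D)) \<and> (\<lambda>n. rho_e_Cc (f n)) \<longlonglongrightarrow> T"
proof -
  obtain x where x: "\<And>n::nat. x n \<in> rho_e_Cc ` bisection_span (compact_generator D)" "x \<longlonglongrightarrow> T"
    using assms unfolding operator_closure_def closure_sequential by blast
  then have "\<exists>f. f \<in> bisection_span (compact_generator D) \<and> x n = rho_e_Cc f" for n by blast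
  then obtain f where f: "\<And>n. f n \<in> bisection_span (compact_generator D) \<and> x n = rho_e_Cc (f n)" by metis
  then have "x = (\<lambda>n. rho_e_Cc (f n))" by auto
  then show ?thesis using x(2) f by blast
qed

lemma operator_closure_lim:
  assumes "\<And>n::nat. f n \<in> bisection_span (compact_generator D)" "(\<lambda>n. rho_e_Cc (f n)) \<longlonglongrightarrow> T"
  shows "T \<in> operator_closure D"
  unfolding operator_closure_def closure_sequential
  using assms by (intro exI[of _ "\<lambda>n. rho_e_Cc (f n)"]) auto

lemma closed_operator_closure: "closed (operator_closure D)"
  by (simp add: operator_closure_def)

lemma operator_closure_zero: "0 \<in> operator_closure D"
  using operator_closureI[OF bisection_span.zero, of D] by (simp add: rho_e_Cc_zero)

lemma operator_closure_add:
  assumes "S \<in> operator_closure D" "T \<in> operator_closure D"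
  shows "S + T \<in> operator_closure D"
proof -
  obtain f f' where f: "\<And>n. f n \<in> bisection_span (compact_generator D)" "(\<lambda>n. rho_e_Cc (f n)) \<longlonglongrightarrow> S"
    and f': "\<And>n. f' n \<in> bisection_span (compact_generator D)" "(\<lambda>n. rho_e_Cc (f' n)) \<longlonglongrightarrow> T"
    using operator_closureD[OF assms(1)] operator_closureD[OF assms(2)] by blast
  show ?thesis
  proof (rule operator_closure_lim)
    show "(\<lambda>a. f n a + f' n a) \<in> bisection_span (compact_generator D)" for n
      by (rule bisection_span_add[OF f(1) f'(1)])
    show "(\<lambda>n. rho_e_Cc (\<lambda>a. f n a + f' n a)) \<longlonglongrightarrow> S + T"
      using tendsto_add[OF f(2) f'(2)]
      by (simp add: rho_e_Cc_add[OF compact_span_bounded_span[OF f(1)] compact_span_bounded_span[OF f'(1)]])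
  qed
qed

lemma rho_e_Cc_scale_eq:
  "f \<in> bounded_span \<Longrightarrow> rho_e_Cc (\<lambda>a. c * f a) = scale bounded_operators c (rho_e_Cc f)"
  by (rule blinfun_eqI) (simp add: rho_e_Cc_scale)

lemma tendsto_scale_bounded_operators:
  assumes "T \<longlonglongrightarrow> L"
  shows "(\<lambda>n. scale bounded_operators c (T n)) \<longlonglongrightarrow> scale bounded_operators c L"
proof (rule LIM_zero_cancel, rule Lim_null_comparison)
  show "\<forall>\<^sub>F n in sequentially. norm (scale bounded_operators c (T n) - scale bounded_operators c L) \<le> cmod c * norm (T n - L)"
  proof (intro always_eventually allI norm_blinfun_bound)
    fix n x
    have "norm (blinfun_apply (scale bounded_operators c (T n) - scale bounded_operators c L) x)
        = cmod c * norm (blinfun_apply (T n - L) x)"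
      by (simp add: blinfun.diff_left norm_ell2_scale flip: ell2_scale_diff)
    also have "\<dots> \<le> cmod c * (norm (T n - L) * norm x)"
      by (intro mult_left_mono norm_blinfun) simp
    finally show "norm (blinfun_apply (scale bounded_operators c (T n) - scale bounded_operators c L) x)
      \<le> cmod c * norm (T n - L) * norm x" by (simp add: mult.assoc)
  qed simp
  show "(\<lambda>n. cmod c * norm (T n - L)) \<longlonglongrightarrow> 0"
    using assms by (intro tendsto_mult_right_zero) (simp add: LIM_zero tendsto_norm_zero)
qed

lemma operator_closure_scale:
  assumes "T \<in> operator_closure D"
  shows "scale bounded_operators c T \<in> operator_closure D"
proof -
  obtain f where f: "\<And>n. f n \<in> bisection_span (compact_generator D)" "(\<lambda>n. rho_e_Cc (f n)) \<longlonglongrightarrow> T"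
    using operator_closureD[OF assms] by blast
  show ?thesis
  proof (rule operator_closure_lim)
    show "(\<lambda>a. c * f n a) \<in> bisection_span (compact_generator D)" for n
      by (rule compact_span_scale[OF f(1)])
    show "(\<lambda>n. rho_e_Cc (\<lambda>a. c * f n a)) \<longlonglongrightarrow> scale bounded_operators c T"
      using tendsto_scale_bounded_operators[OF f(2)]
      by (simp add: rho_e_Cc_scale_eq[OF compact_span_bounded_span[OF f(1)]])
  qed
qed

lemma compact_span_convolution:
  assumes "invariant_set D" "invariant_set D'"
    "f \<in> bisection_span (compact_generator D)" "f' \<in> bisection_span (compact_generator D')"
  shows "convolution groupoid_P f f' \<in> bisection_span (compact_generator (D \<inter> D'))"
proof (rule bisection_span_convolution[where Q = "compact_generator D" and Q' = "compact_generator D'"])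
  show "bounded_on_dom g \<phi>" if "compact_generator D g \<phi>" for g \<phi>
    using that by (rule compact_generator_bounded_on_dom)
  show "bounded_on_dom g \<phi>" if "compact_generator D' g \<phi>" for g \<phi>
    using that by (rule compact_generator_bounded_on_dom)
  show "compact_generator (D \<inter> D') (k \<circ>\<^sub>m h) (mult_fun k \<phi> h \<psi>)"
    if "compact_generator D k \<phi>" "compact_generator D' h \<psi>" for k \<phi> h \<psi>
    by (rule compact_generator_mult_fun[OF assms(1,2) that])
qed (rule assms(3,4))+

lemma compact_span_involution:
  assumes "invariant_set D" "f \<in> bisection_span (compact_generator D)"
  shows "involution groupoid_P f \<in> bisection_span (compact_generator D)"
proof (rule bisection_span_involution[where Q = "compact_generator D", OF _ _ assms(2)])
  show "g \<in> left_inverse_hull" if "compact_generator D g \<phi>" for g \<phi>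
    using that by (simp add: compact_generator_def)
  show "compact_generator D (partial_inv k) (star_fun k \<phi>)" if "compact_generator D k \<phi>" for k \<phi>
    by (rule compact_generator_star_fun[OF assms(1) that])
qed

text \<open>Equal sets give a subalgebra; with \<open>Omega\<close> as one of the sets, the other
  one gives an ideal.\<close>

lemma operator_closure_compose:
  assumes D: "invariant_set D" "invariant_set D'"
    and ST: "S \<in> operator_closure D" "T \<in> operator_closure D'"
  shows "S o\<^sub>L T \<in> operator_closure (D \<inter> D')"
proof -
  obtain f where f: "\<And>n. f n \<in> bisection_span (compact_generator D)" "(\<lambda>n. rho_e_Cc (f n)) \<longlonglongrightarrow> S"
    using operator_closureD[OF ST(1)] by blast
  obtain f' where f': "\<And>n. f' n \<in> bisection_span (compact_generator D')" "(\<lambda>n. rho_e_Cc (f' n)) \<longlonglongrightarrow> T"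
    using operator_closureD[OF ST(2)] by blast
  show ?thesis
  proof (rule operator_closure_lim)
    show "convolution groupoid_P (f n) (f' n) \<in> bisection_span (compact_generator (D \<inter> D'))" for n
      by (rule compact_span_convolution[OF D f(1) f'(1)])
    show "(\<lambda>n. rho_e_Cc (convolution groupoid_P (f n) (f' n))) \<longlonglongrightarrow> (S o\<^sub>L T)"
      using bounded_bilinear.tendsto[OF bounded_bilinear_blinfun_compose f(2) f'(2)]
      by (simp add: rho_e_Cc_convolution[OF compact_span_bounded_span[OF f(1)] compact_span_bounded_span[OF f'(1)]])
  qed
qed

lemma operator_closure_adjoint:
  assumes D: "invariant_set D" and T: "T \<in> operator_closure D"
  obtains T' where "T' \<in> operator_closure D" "adjoint_pair (blinfun_apply T) (blinfun_apply T')"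
proof -
  obtain f where f: "\<And>n. f n \<in> bisection_span (compact_generator D)" "(\<lambda>n. rho_e_Cc (f n)) \<longlonglongrightarrow> T"
    using operator_closureD[OF T] by blast
  obtain T' where T': "(\<lambda>n. rho_e_Cc (involution groupoid_P (f n))) \<longlonglongrightarrow> T'"
    "adjoint_pair (blinfun_apply T) (blinfun_apply T')"
    using adjoint_limit[OF rho_e_Cc_adjoint[OF compact_span_bounded_span[OF f(1)]] f(2)] .
  from operator_closure_lim[OF compact_span_involution[OF D f(1)] T'(1)] T'(2)
  show thesis by (rule that)
qed

lemma operator_closure_star:
  assumes "invariant_set D" "T \<in> operator_closure D"
  shows "star bounded_operators T \<in> operator_closure D" "T \<in> carrier bounded_operators"
  using operator_closure_adjoint[OF assms] star_bounded_operators bounded_operators_carrier_adjoint by metis+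

section \<open>Generators of the reduced C*-algebra and of the foundation ideal\<close>

text \<open>The weight is cut off at the clopen set of characters containing the domain of
  \<open>g\<close>. This leaves the function on the bisection unchanged and provides the compact
  support.\<close>

lemma bisection_fun_in_compact_span:
  assumes g: "g \<in> left_inverse_hull" and \<phi>: "continuous_on Omega \<phi>"
  shows "bisection_fun g \<phi> \<in> bisection_span (compact_generator Omega)"
proof -
  define \<psi> where "\<psi> = (\<lambda>\<omega>. if \<omega> \<in> {\<omega>. \<omega> (dom g)} then \<phi> \<omega> else 0)"
  have "continuous_on Omega \<psi>"
    unfolding \<psi>_def
    by (rule continuous_on_clopen_if[OF open_character_set closed_character_set continuous_on_subset[OF \<phi>]]) auto
  moreover have "compact (Omega \<inter> {\<omega>. \<omega> (dom g)})"
    by (intro compact_closed_characters closed_Int closed_Omega closed_character_set)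
  ultimately have "compact_generator Omega g \<psi>"
    unfolding compact_generator_def using g
    by (intro conjI exI[of _ "Omega \<inter> {\<omega>. \<omega> (dom g)}"]) (auto simp: \<psi>_def)
  moreover have "bisection_fun g \<phi> = bisection_fun g \<psi>"
    by (rule bisection_fun_cong) (simp add: \<psi>_def)
  ultimately show ?thesis by (simp add: bisection_span_generator)
qed

lemma continuous_bounded_on_dom:
  assumes "g \<in> left_inverse_hull" "continuous_on Omega \<phi>"
  shows "bounded_on_dom g \<phi>"
proof -
  have "bounded (\<phi> ` Omega)"
    by (intro compact_imp_bounded compact_continuous_image assms compact_Omega)
  then show ?thesis using assms(1) by (auto simp: bounded_on_dom_def bounded_iff)
qed

section \<open>Functions supported off the boundary\<close>

lemma foundation_cover:
  assumes K: "compact K" "K \<subseteq> Omega - boundary_Omega"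
  obtains C where "finite C" "\<And>X F. (X, F) \<in> C \<Longrightarrow> foundation_set F X" "K \<subseteq> (\<Union>(X, F)\<in>C. cylinder {X} F)"
proof -
  let ?I = "{(X, F). foundation_set F X}"
  have op: "open (case p of (X, F) \<Rightarrow> cylinder {X} F)" if p: "p \<in> ?I" for p
  proof -
    obtain X F where "p = (X, F)" "foundation_set F X" using p by auto
    then show ?thesis by (auto simp: foundation_set_def intro: open_cylinder)
  qed
  have "K \<subseteq> (\<Union>p\<in>?I. case p of (X, F) \<Rightarrow> cylinder {X} F)"
  proof
    fix \<omega> assume "\<omega> \<in> K"
    then have "\<omega> \<in> Omega" "\<omega> \<notin> boundary_Omega" using K(2) by auto
    then obtain X F where "foundation_set F X" "\<omega> \<in> cylinder {X} F" by (rule foundation_set_neighbourhood)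
    then show "\<omega> \<in> (\<Union>p\<in>?I. case p of (X, F) \<Rightarrow> cylinder {X} F)" by auto
  qed
  from compactE_image[OF K(1) op this] obtain C where
    C: "C \<subseteq> ?I" "finite C" "K \<subseteq> (\<Union>p\<in>C. case p of (X, F) \<Rightarrow> cylinder {X} F)" by metis
  show thesis by (rule that[OF C(2) _ C(3)]) (use C(1) in auto)
qed

text \<open>The support is covered by finitely many cylinders of foundation sets. Their union is
  clopen and misses the boundary, so that the extension of the weight by 0 is continuous across the
  boundary.\<close>

lemma compact_generator_off_boundary:
  assumes \<phi>: "compact_generator (Omega - boundary_Omega) g \<phi>"
  obtains C where "finite C" "\<And>X F. (X, F) \<in> C \<Longrightarrow> foundation_set F X" "continuous_on Omega \<phi>"
    "\<And>\<omega>. \<omega> \<in> Omega \<Longrightarrow> \<omega> \<notin> (\<Union>(X, F)\<in>C. cylinder {X} F) \<Longrightarrow> \<phi> \<omega> = 0"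
proof -
  obtain K where K: "compact K" "K \<subseteq> Omega - boundary_Omega" "\<And>\<omega>. \<omega> \<in> Omega \<Longrightarrow> \<omega> \<notin> K \<Longrightarrow> \<phi> \<omega> = 0"
    and cont: "continuous_on (Omega - boundary_Omega) \<phi>"
    using \<phi> by (auto simp: compact_generator_def)
  obtain C where C: "finite C" "\<And>X F. (X, F) \<in> C \<Longrightarrow> foundation_set F X" "K \<subseteq> (\<Union>(X, F)\<in>C. cylinder {X} F)"
    using foundation_cover[OF K(1,2)] by metis
  define U where "U = (\<Union>(X, F)\<in>C. cylinder {X} F)"
  have "open U" unfolding U_def
    using C(2) by (intro open_UN) (auto simp: foundation_set_def intro: open_cylinder)
  moreover have "closed U" unfolding U_def
    by (intro closed_UN C(1)) (auto intro: closed_cylinder)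
  moreover have "continuous_on (Omega \<inter> U) \<phi>"
  proof (rule continuous_on_subset[OF cont])
    show "Omega \<inter> U \<subseteq> Omega - boundary_Omega"
      using foundation_set_disjoint_boundary C(2) unfolding U_def by fastforce
  qed
  ultimately have c: "continuous_on Omega (\<lambda>\<omega>. if \<omega> \<in> U then \<phi> \<omega> else 0)"
    by (rule continuous_on_clopen_if)
  have z: "\<phi> \<omega> = 0" if "\<omega> \<in> Omega" "\<omega> \<notin> U" for \<omega>
    using that K(3) C(3) unfolding U_def by blast
  have "continuous_on Omega \<phi>"
    by (rule continuous_on_eq[OF c]) (use z in auto)
  then show thesis using C(1,2) z by (intro that[of C]) (auto simp: U_def)
qed

lemma compact_span_off_boundary_subset:
  "f \<in> bisection_span (compact_generator (Omega - boundary_Omega))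
    \<Longrightarrow> f \<in> bisection_span (compact_generator Omega)"
proof (induction rule: bisection_span.induct)
  case (step f g \<phi>)
  have "g \<in> left_inverse_hull" using step(2) by (simp add: compact_generator_def)
  moreover have "continuous_on Omega \<phi>" using compact_generator_off_boundary[OF step(2)] by metis
  ultimately show ?case using bisection_span_add[OF bisection_fun_in_compact_span step(3)] by simp
qed (rule bisection_span.zero)

lemma norm_rho_e_Cc_bisection_fun_le:
  assumes "g \<in> left_inverse_hull" "\<And>\<omega>. \<omega> \<in> Omega \<Longrightarrow> cmod (\<phi> \<omega>) \<le> M" "0 \<le> M"
  shows "norm (rho_e_Cc (bisection_fun g \<phi>)) \<le> M"
proof -
  have "bounded_on_dom g \<phi>" using assms by (auto simp: bounded_on_dom_def)
  from norm_rho_e_Cc_le[OF bisection_span_generator[of bounded_on_dom, OF this]]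
  show ?thesis using reduced_norm_bisection_fun_le[of g \<phi> M] assms by force
qed

lemma left_regular_eq: "left_regular s = rho_e_Cc (bisection_fun (left_translation s) (\<lambda>_. 1))"
proof (intro blinfun_eqI ell2_eqI)
  fix \<xi> u
  have b: "bounded_on_dom (left_translation s) (\<lambda>_. 1)"
    by (rule continuous_bounded_on_dom) (auto intro: left_inverse_hull.intros)
  have inv: "inv ((*) s) (s * t) = t" for t
    by (rule inv_f_f) (auto intro: injI left_cancel)
  have L: "ell2_apply (blinfun_apply (left_regular s) \<xi>) u
      = (if u \<in> range ((*) s) then ell2_apply \<xi> (inv ((*) s) u) else 0)"
    by (simp add: left_regular_def bounded_linear_Blinfun_apply[OF bounded_linear_ell2_translate]
        ell2_translate.rep_eq)
  have pinv: "partial_inv (left_translation s) u = Some t \<longleftrightarrow> u = s * t" for t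
    by (simp add: hull_partial_inv_iff left_inverse_hull.intros) (auto simp: left_translation_def)
  show "ell2_apply (blinfun_apply (left_regular s) \<xi>) u
      = ell2_apply (blinfun_apply (rho_e_Cc (bisection_fun (left_translation s) (\<lambda>_. 1))) \<xi>) u"
  proof (cases "partial_inv (left_translation s) u")
    case None
    then have "u \<notin> range ((*) s)" using pinv by (metis option.distinct(1) rangeE)
    with None show ?thesis unfolding L rho_e_Cc_bisection_fun[OF b] by simp
  next
    case (Some t)
    then have "u = s * t" using pinv by simp
    with Some show ?thesis unfolding L rho_e_Cc_bisection_fun[OF b] by (simp add: inv)
  qed
qed

lemma rho_e_Cc_diagonal:
  assumes "bounded_on_dom Some \<phi>"
  shows "ell2_apply (blinfun_apply (rho_e_Cc (bisection_fun Some \<phi>)) \<xi>) s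
    = \<phi> (point_character s) * ell2_apply \<xi> s"
proof -
  have "partial_inv Some s = Some s" by (simp add: hull_partial_inv_iff id_in_hull)
  then show ?thesis by (simp add: rho_e_Cc_bisection_fun[OF assms])
qed

text \<open>A partial identity becomes a diagonal operator, whose weight is one of the indicator
  functions that separate characters in the Stone-Weierstrass argument.\<close>

lemma rho_e_Cc_id_on:
  assumes X: "X \<in> constructible_ideals"
  shows "rho_e_Cc (bisection_fun (Some |` X) (\<lambda>_. 1))
    = rho_e_Cc (bisection_fun Some (\<lambda>\<omega>. if \<omega> X then 1 else 0))"
proof (intro blinfun_eqI ell2_eqI)
  fix \<xi> s
  have b: "bounded_on_dom (Some |` X) (\<lambda>_. 1)"
    by (rule continuous_bounded_on_dom[OF id_on_in_hull[OF X]]) simp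
  have b': "bounded_on_dom Some (\<lambda>\<omega>. if \<omega> X then 1 else 0)"
    unfolding bounded_on_dom_def by (auto simp: id_in_hull intro!: exI[of _ 1])
  have "partial_inv (Some |` X) s = (if s \<in> X then Some s else None)"
  proof -
    have *: "partial_inv (Some |` X) s = Some t \<longleftrightarrow> t \<in> X \<and> s = t" for t
      unfolding hull_partial_inv_iff[OF id_on_in_hull[OF X]] by (auto simp: restrict_map_def)
    show ?thesis
    proof (cases "partial_inv (Some |` X) s")
      case None
      then show ?thesis using *[of s] by auto
    next
      case (Some t)
      then show ?thesis using *[of t] by auto
    qed
  qed
  then show "ell2_apply (blinfun_apply (rho_e_Cc (bisection_fun (Some |` X) (\<lambda>_. 1))) \<xi>) s
    = ell2_apply (blinfun_apply (rho_e_Cc (bisection_fun Some (\<lambda>\<omega>. if \<omega> X then 1 else 0))) \<xi>) s"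
    unfolding rho_e_Cc_bisection_fun[OF b] rho_e_Cc_diagonal[OF b']
    using X by (simp add: point_character_def)
qed

lemma projection_eq:
  assumes F: "foundation_set F X"
  shows "projection (X - \<Union>F) = rho_e_Cc (bisection_fun Some (\<lambda>\<omega>. if \<omega> \<in> cylinder {X} F then 1 else 0))"
proof (intro blinfun_eqI ell2_eqI)
  fix \<xi> s
  have b: "bounded_on_dom Some (\<lambda>\<omega>. if \<omega> \<in> cylinder {X} F then 1 else 0)"
    unfolding bounded_on_dom_def by (auto simp: id_in_hull intro!: exI[of _ 1])
  have "point_character s \<in> cylinder {X} F \<longleftrightarrow> s \<in> X - \<Union>F"
    using F by (auto simp: cylinder_def point_character_def foundation_set_def subset_iff)
  then show "ell2_apply (blinfun_apply (projection (X - \<Union>F)) \<xi>) s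
    = ell2_apply (blinfun_apply (rho_e_Cc (bisection_fun Some (\<lambda>\<omega>. if \<omega> \<in> cylinder {X} F then 1 else 0))) \<xi>) s"
    unfolding rho_e_Cc_diagonal[OF b] projection_def
    by (simp add: bounded_linear_Blinfun_apply[OF bounded_linear_ell2_restrict] ell2_restrict.rep_eq)
qed

lemma continuous_indicator_cylinder:
  assumes "finite P" "finite Q"
  shows "continuous_on S (\<lambda>\<omega>. if \<omega> \<in> cylinder P Q then 1 else (0 :: complex))"
  by (rule continuous_on_clopen_if[OF open_cylinder[OF assms] closed_cylinder]) simp

lemma push_character_Some: "\<omega> \<in> characters \<Longrightarrow> push_character Some \<omega> = \<omega>"
  using character_constructible[of \<omega>] by (auto simp: fun_eq_iff push_character_def)

lemma rho_e_Cc_compose_diagonal: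
  assumes k: "k \<in> left_inverse_hull" and "continuous_on Omega \<phi>" "continuous_on Omega \<psi>"
  shows "rho_e_Cc (bisection_fun k \<phi>) o\<^sub>L rho_e_Cc (bisection_fun Some \<psi>)
    = rho_e_Cc (bisection_fun k (\<lambda>\<omega>. \<phi> \<omega> * \<psi> \<omega>))"
proof -
  have "bisection_fun (k \<circ>\<^sub>m Some) (mult_fun k \<phi> Some \<psi>) = bisection_fun k (\<lambda>\<omega>. \<phi> \<omega> * \<psi> \<omega>)"
  proof -
    have "k \<circ>\<^sub>m Some = k" by (auto simp: map_comp_def)
    then show ?thesis
      by (simp add: mult_fun_def) (rule bisection_fun_cong, simp add: push_character_Some Omega_character)
  qed
  then show ?thesis
    using rho_e_Cc_convolution[of "bisection_fun k \<phi>" "bisection_fun Some \<psi>"]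
      bisection_span_generator[of bounded_on_dom, OF continuous_bounded_on_dom[OF k assms(2)]]
      bisection_span_generator[of bounded_on_dom, OF continuous_bounded_on_dom[OF id_in_hull assms(3)]]
    by (simp add: convolution_bisection_fun[OF k id_in_hull])
qed

section \<open>Generation of the algebra of the monoid\<close>

lemma closed_star_subalgebraD:
  assumes "closed_star_subalgebra A K"
  shows "K \<subseteq> carrier A" "zero A \<in> K" "x \<in> K \<Longrightarrow> y \<in> K \<Longrightarrow> add A x y \<in> K"
    "x \<in> K \<Longrightarrow> y \<in> K \<Longrightarrow> mult A x y \<in> K" "x \<in> K \<Longrightarrow> star A x \<in> K"
    "x \<in> K \<Longrightarrow> scale A c x \<in> K" "norm_closed A K"
  using assms unfolding closed_star_subalgebra_def by simp_all

text \<open>\<open>norm_closed\<close> speaks only of limits inside the carrier, that is, of complex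
  linear ones. A limit of complex linear operators is of this kind because scaling is
  continuous.\<close>

lemma norm_closed_bounded_operators:
  assumes "norm_closed bounded_operators K" "K \<subseteq> carrier bounded_operators"
    and u: "\<And>n::nat. u n \<in> K" "u \<longlonglongrightarrow> T"
  shows "T \<in> K"
proof -
  have "blinfun_apply T (ell2_scale c x) = ell2_scale c (blinfun_apply T x)" for c x
  proof (rule LIMSEQ_unique)
    show "(\<lambda>n. blinfun_apply (u n) (ell2_scale c x)) \<longlonglongrightarrow> blinfun_apply T (ell2_scale c x)"
      by (intro blinfun.tendsto u tendsto_const)
    have "blinfun_apply (u n) (ell2_scale c x) = ell2_scale c (blinfun_apply (u n) x)" for n
      using u(1)[of n] assms(2) by (auto simp: bounded_operators_def)
    moreover have "(\<lambda>n. ell2_scale c (blinfun_apply (u n) x)) \<longlonglongrightarrow> ell2_scale c (blinfun_apply T x)"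
      by (intro bounded_linear.tendsto[OF bounded_linear_ell2_scale] blinfun.tendsto u tendsto_const)
    ultimately show "(\<lambda>n. blinfun_apply (u n) (ell2_scale c x)) \<longlonglongrightarrow> ell2_scale c (blinfun_apply T x)"
      by simp
  qed
  then have T: "T \<in> carrier bounded_operators" by (simp add: bounded_operators_def)
  have lim: "(\<lambda>n. norm (u n - T)) \<longlonglongrightarrow> 0"
    using u(2) by (simp add: LIM_zero tendsto_norm_zero)
  have "\<forall>u. \<forall>x\<in>carrier bounded_operators. (\<forall>n. u n \<in> K) \<and> (\<lambda>n. norm (u n - x)) \<longlonglongrightarrow> 0 \<longrightarrow> x \<in> K"
    using assms(1) by (simp add: norm_closed_def)
  from this[THEN spec[of _ u], THEN bspec[of _ _ T]] T lim u(1) show ?thesis by simp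
qed

text \<open>The constant weight 1 turns the hull into partial isometries, for which inversion
  becomes the adjoint and composition the product.\<close>

lemma rho_e_Cc_one_in_subalgebra:
  assumes K: "closed_star_subalgebra bounded_operators K" "range left_regular \<subseteq> K"
  shows "g \<in> left_inverse_hull \<Longrightarrow> rho_e_Cc (bisection_fun g (\<lambda>_. 1)) \<in> K"
proof (induction rule: left_inverse_hull.induct)
  case (1 s)
  then show ?case using K(2) by (auto simp flip: left_regular_eq)
next
  case (2 g)
  have gen: "bisection_fun g (\<lambda>_. 1) \<in> bounded_span"
    by (rule bisection_span_generator[of bounded_on_dom, OF continuous_bounded_on_dom[OF 2(1)]]) simp
  have "bisection_fun (partial_inv g) (star_fun g (\<lambda>_. 1)) = bisection_fun (partial_inv g) (\<lambda>_. 1)"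
    by (rule bisection_fun_cong) (simp add: star_fun_def)
  then have "star bounded_operators (rho_e_Cc (bisection_fun g (\<lambda>_. 1))) = rho_e_Cc (bisection_fun (partial_inv g) (\<lambda>_. 1))"
    using star_bounded_operators[OF rho_e_Cc_adjoint[OF gen]] by (simp add: involution_bisection_fun[OF 2(1)])
  with closed_star_subalgebraD(5)[OF K(1) 2(2)] show ?case by simp
next
  case (3 g h)
  have gen: "bisection_fun g (\<lambda>_. 1) \<in> bounded_span" "bisection_fun h (\<lambda>_. 1) \<in> bounded_span"
    by (rule bisection_span_generator[of bounded_on_dom, OF continuous_bounded_on_dom[OF 3(1)]]
        bisection_span_generator[of bounded_on_dom, OF continuous_bounded_on_dom[OF 3(2)]]; simp)+
  have "bisection_fun (g \<circ>\<^sub>m h) (mult_fun g (\<lambda>_. 1) h (\<lambda>_. 1)) = bisection_fun (g \<circ>\<^sub>m h) (\<lambda>_. 1)"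
    by (rule bisection_fun_cong) (simp add: mult_fun_def)
  then have "rho_e_Cc (bisection_fun g (\<lambda>_. 1)) o\<^sub>L rho_e_Cc (bisection_fun h (\<lambda>_. 1)) = rho_e_Cc (bisection_fun (g \<circ>\<^sub>m h) (\<lambda>_. 1))"
    using rho_e_Cc_convolution[OF gen] by (simp add: convolution_bisection_fun[OF 3(1,2)])
  with closed_star_subalgebraD(4)[OF K(1) 3(3,4)] show ?case by simp
qed

lemma rho_e_Cc_uniform_limit:
  fixes F :: "nat \<Rightarrow> 'a::left_cancellative_monoid character \<Rightarrow> complex"
  assumes F: "\<And>n. continuous_on Omega (F n)" "continuous_on Omega \<phi>"
    and lim: "uniform_limit Omega F \<phi> sequentially"
  shows "(\<lambda>n. rho_e_Cc (bisection_fun Some (F n))) \<longlonglongrightarrow> rho_e_Cc (bisection_fun Some \<phi>)"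
proof (rule metric_LIMSEQ_I)
  fix e :: real assume e: "e > 0"
  have "\<forall>\<^sub>F n in sequentially. \<forall>\<omega>\<in>Omega. dist (F n \<omega>) (\<phi> \<omega>) < e / 2"
    by (rule uniform_limitD[OF lim]) (use e in simp)
  then obtain M where M: "\<And>n \<omega>. n \<ge> M \<Longrightarrow> \<omega> \<in> Omega \<Longrightarrow> dist (F n \<omega>) (\<phi> \<omega>) < e / 2"
    unfolding eventually_sequentially by blast
  have "dist (rho_e_Cc (bisection_fun Some (F n))) (rho_e_Cc (bisection_fun Some \<phi>)) < e" if n: "n \<ge> M" for n
  proof -
    have "(\<lambda>a. bisection_fun Some (F n) a - bisection_fun Some \<phi> a) = bisection_fun Some (\<lambda>\<omega>. F n \<omega> - \<phi> \<omega>)"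
      by (rule ext) (auto simp: bisection_fun_def)
    then have "rho_e_Cc (bisection_fun Some (F n)) - rho_e_Cc (bisection_fun Some \<phi>)
        = rho_e_Cc (bisection_fun Some (\<lambda>\<omega>. F n \<omega> - \<phi> \<omega>))"
      using rho_e_Cc_diff[OF
          bisection_span_generator[of bounded_on_dom, OF continuous_bounded_on_dom[OF id_in_hull F(1)[of n]]]
          bisection_span_generator[of bounded_on_dom, OF continuous_bounded_on_dom[OF id_in_hull F(2)]]]
      by simp
    moreover have "norm (rho_e_Cc (bisection_fun Some (\<lambda>\<omega>. F n \<omega> - \<phi> \<omega>))) \<le> e / 2"
      by (rule norm_rho_e_Cc_bisection_fun_le[OF id_in_hull])
        (use M[OF n] e in \<open>auto simp: dist_norm intro: less_imp_le\<close>)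
    ultimately show ?thesis using e by (simp add: dist_norm)
  qed
  then show "\<exists>M. \<forall>n\<ge>M. dist (rho_e_Cc (bisection_fun Some (F n))) (rho_e_Cc (bisection_fun Some \<phi>)) < e"
    by blast
qed

text \<open>Stone-Weierstrass on \<open>Omega\<close>: the real weights whose diagonal operators lie
  in \<open>K\<close> form a ring with the constants, and indicators of the sets of characters
  containing a given ideal separate points. Uniform limits of weights become norm limits of
  operators, and complex weights are split into real and imaginary parts.\<close>

lemma rho_e_Cc_diagonal_in_subalgebra:
  fixes \<phi> :: "'a::left_cancellative_monoid character \<Rightarrow> complex"
  assumes K: "closed_star_subalgebra bounded_operators K" "range left_regular \<subseteq> K"
    and \<phi>: "continuous_on Omega \<phi>"
  shows "rho_e_Cc (bisection_fun Some \<phi>) \<in> K"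
proof -
  note KD = closed_star_subalgebraD[OF K(1)]
  have lin: "rho_e_Cc (bisection_fun Some (\<lambda>\<omega>. \<psi> \<omega> + c * \<psi>' \<omega>)) \<in> K"
    if \<psi>: "continuous_on Omega \<psi>" "continuous_on Omega \<psi>'"
      "rho_e_Cc (bisection_fun Some \<psi>) \<in> K" "rho_e_Cc (bisection_fun Some \<psi>') \<in> K" for c \<psi> \<psi>'
  proof -
    note gen = bisection_span_generator[of bounded_on_dom, OF continuous_bounded_on_dom[OF id_in_hull \<psi>(1)]]
      bisection_span_generator[of bounded_on_dom, OF continuous_bounded_on_dom[OF id_in_hull \<psi>(2)]]
    have "bisection_fun Some (\<lambda>\<omega>. \<psi> \<omega> + c * \<psi>' \<omega>) = (\<lambda>a. bisection_fun Some \<psi> a + c * bisection_fun Some \<psi>' a)"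
      by (rule ext) (auto simp: bisection_fun_def)
    then have "rho_e_Cc (bisection_fun Some (\<lambda>\<omega>. \<psi> \<omega> + c * \<psi>' \<omega>))
        = rho_e_Cc (bisection_fun Some \<psi>) + scale bounded_operators c (rho_e_Cc (bisection_fun Some \<psi>'))"
      using rho_e_Cc_add[OF gen(1) bounded_span_scale[OF gen(2)], of c] rho_e_Cc_scale_eq[OF gen(2), of c] by simp
    then show ?thesis using KD(3)[OF \<psi>(3) KD(6)[OF \<psi>(4), of c]] by simp
  qed
  define R where "R = {r :: 'a character \<Rightarrow> real. continuous_on Omega r \<and>
    rho_e_Cc (bisection_fun Some (\<lambda>\<omega>. complex_of_real (r \<omega>))) \<in> K}"
  have one: "rho_e_Cc (bisection_fun Some (\<lambda>_. 1)) \<in> K"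
    by (rule rho_e_Cc_one_in_subalgebra[OF K id_in_hull])
  have zero: "rho_e_Cc (bisection_fun Some (\<lambda>_. 0)) \<in> K"
    using lin[OF _ _ one one, of "- 1"] by simp
  interpret ring: function_ring_on R "Omega :: 'a character set"
  proof
    show "compact (Omega :: 'a character set)" by (rule compact_Omega)
    show "continuous_on Omega r" if "r \<in> R" for r using that by (simp add: R_def)
    show "(\<lambda>x. r x + r' x) \<in> R" if "r \<in> R" "r' \<in> R" for r r'
      using that lin[of "\<lambda>\<omega>. complex_of_real (r \<omega>)" "\<lambda>\<omega>. complex_of_real (r' \<omega>)" 1]
      by (simp add: R_def continuous_on_add continuous_on_of_real)
    show "(\<lambda>x. r x * r' x) \<in> R" if rr: "r \<in> R" "r' \<in> R" for r r'
    proof -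
      have "rho_e_Cc (bisection_fun Some (\<lambda>\<omega>. complex_of_real (r \<omega>))) o\<^sub>L rho_e_Cc (bisection_fun Some (\<lambda>\<omega>. complex_of_real (r' \<omega>)))
          = rho_e_Cc (bisection_fun Some (\<lambda>\<omega>. complex_of_real (r \<omega> * r' \<omega>)))"
        using rr by (subst rho_e_Cc_compose_diagonal[OF id_in_hull])
          (simp_all add: R_def continuous_on_of_real)
      moreover have "rho_e_Cc (bisection_fun Some (\<lambda>\<omega>. complex_of_real (r \<omega>))) o\<^sub>L rho_e_Cc (bisection_fun Some (\<lambda>\<omega>. complex_of_real (r' \<omega>))) \<in> K"
        using KD(4) rr by (simp add: R_def)
      ultimately show ?thesis using rr by (simp add: R_def continuous_on_mult)
    qed
    show "(\<lambda>_. c) \<in> R" for c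
      using lin[OF _ _ zero one, of "complex_of_real c"] by (simp add: R_def)
    show "\<exists>r\<in>R. r \<omega> \<noteq> r \<psi>" if \<omega>: "\<omega> \<in> Omega" "\<psi> \<in> Omega" "\<omega> \<noteq> \<psi>" for \<omega> \<psi> :: "'a character"
    proof -
      obtain X where X: "\<omega> X \<noteq> \<psi> X" using \<omega>(3) by auto
      then have XJ: "X \<in> constructible_ideals"
        using \<omega> character_constructible[OF Omega_character] by metis
      let ?r = "\<lambda>\<omega> :: 'a character. if \<omega> \<in> {\<omega>. \<omega> X} then 1 else (0 :: real)"
      have "continuous_on Omega ?r"
        by (rule continuous_on_clopen_if[OF open_character_set closed_character_set]) simp
      moreover have "(\<lambda>\<omega>. complex_of_real (?r \<omega>)) = (\<lambda>\<omega>. if \<omega> X then 1 else 0)" by auto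
      ultimately have "?r \<in> R"
        using rho_e_Cc_one_in_subalgebra[OF K id_on_in_hull[OF XJ]]
        by (simp add: R_def rho_e_Cc_id_on[OF XJ])
      with X show ?thesis by (intro bexI[of _ ?r]) auto
    qed
  qed
  have real: "rho_e_Cc (bisection_fun Some (\<lambda>\<omega>. complex_of_real (r \<omega>))) \<in> K"
    if r: "continuous_on Omega r" for r :: "'a character \<Rightarrow> real"
  proof -
    obtain F where F: "F \<in> UNIV \<rightarrow> R" "LIM n sequentially. F n :> uniformly_on Omega r"
      using ring.Stone_Weierstrass[OF r] by blast
    have "uniform_limit Omega (\<lambda>n \<omega>. complex_of_real (F n \<omega>)) (\<lambda>\<omega>. complex_of_real (r \<omega>)) sequentially"
    proof (rule uniform_limitI)
      fix e :: real assume "e > 0"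
      from uniform_limitD[OF F(2) this]
      show "\<forall>\<^sub>F n in sequentially. \<forall>\<omega>\<in>Omega. dist (complex_of_real (F n \<omega>)) (complex_of_real (r \<omega>)) < e"
        by (simp add: dist_of_real)
    qed
    from rho_e_Cc_uniform_limit[OF _ _ this]
    have "(\<lambda>n. rho_e_Cc (bisection_fun Some (\<lambda>\<omega>. complex_of_real (F n \<omega>))))
        \<longlonglongrightarrow> rho_e_Cc (bisection_fun Some (\<lambda>\<omega>. complex_of_real (r \<omega>)))"
      using F(1) r by (auto simp: R_def continuous_on_of_real Pi_iff)
    then show ?thesis
      by (rule norm_closed_bounded_operators[OF KD(7) KD(1), rotated]) (use F(1) in \<open>auto simp: R_def\<close>)
  qed
  have "(\<lambda>\<omega>. complex_of_real (Re (\<phi> \<omega>)) + \<i> * complex_of_real (Im (\<phi> \<omega>))) = \<phi>"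
    by (simp add: complex_eq_iff fun_eq_iff)
  then show ?thesis
    using lin[OF _ _ real real, of "\<lambda>\<omega>. Re (\<phi> \<omega>)" "\<lambda>\<omega>. Im (\<phi> \<omega>)" \<i>] \<phi>
    by (simp add: continuous_on_of_real continuous_on_Re continuous_on_Im)
qed

text \<open>A weight on the bisection of \<open>g\<close> factors as the constant weight 1 on this
  bisection times a diagonal weight, and both factors have been placed in \<open>K\<close>.\<close>

lemma operator_closure_subset_subalgebra:
  fixes K :: "('a::left_cancellative_monoid ell2 \<Rightarrow>\<^sub>L 'a ell2) set"
  assumes K: "closed_star_subalgebra bounded_operators K" "range left_regular \<subseteq> K"
  shows "operator_closure Omega \<subseteq> K"
proof
  note KD = closed_star_subalgebraD[OF K(1)]
  have gen: "rho_e_Cc f \<in> K" if "f \<in> bisection_span (compact_generator Omega)" for f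
    using that
  proof (induction rule: bisection_span.induct)
    case zero
    then show ?case using KD(2) by (simp add: rho_e_Cc_zero)
  next
    case (step f g \<phi>)
    have g: "g \<in> left_inverse_hull" and \<phi>: "continuous_on Omega \<phi>"
      using step(2) by (auto simp: compact_generator_def)
    have "rho_e_Cc (bisection_fun g (\<lambda>_. 1)) o\<^sub>L rho_e_Cc (bisection_fun Some \<phi>) = rho_e_Cc (bisection_fun g \<phi>)"
      using rho_e_Cc_compose_diagonal[OF g _ \<phi>, of "\<lambda>_. 1"] by simp
    then have "rho_e_Cc (bisection_fun g \<phi>) \<in> K"
      using KD(4)[OF rho_e_Cc_one_in_subalgebra[OF K g] rho_e_Cc_diagonal_in_subalgebra[OF K \<phi>]] by simp
    moreover have "bisection_fun g \<phi> \<in> bounded_span"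
      by (rule compact_span_bounded_span[OF bisection_span_generator[of "compact_generator Omega", OF step(2)]])
    ultimately show ?case
      using KD(3)[OF _ step(3)] by (simp add: rho_e_Cc_add compact_span_bounded_span[OF step(1)])
  qed
  fix T :: "'a ell2 \<Rightarrow>\<^sub>L 'a ell2" assume "T \<in> operator_closure Omega"
  then obtain f where f: "\<And>n::nat. f n \<in> bisection_span (compact_generator Omega)" "(\<lambda>n. rho_e_Cc (f n)) \<longlonglongrightarrow> T"
    using operator_closureD by blast
  show "T \<in> K" by (rule norm_closed_bounded_operators[OF KD(7) KD(1) gen[OF f(1)] f(2)])
qed

lemma norm_closed_operator_closure:
  assumes "\<And>x y. diff A x y = x - y" "anorm A = norm"
  shows "norm_closed A (operator_closure D)"
  unfolding norm_closed_def assms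
proof (intro allI ballI impI, elim conjE)
  fix u :: "nat \<Rightarrow> _" and x assume u: "\<forall>n. u n \<in> operator_closure D" "(\<lambda>n. norm (u n - x)) \<longlonglongrightarrow> 0"
  have "u \<longlonglongrightarrow> x" by (rule LIM_zero_cancel[OF tendsto_norm_zero_cancel[OF u(2)]])
  from closed_sequentially[OF closed_operator_closure _ this] u(1) show "x \<in> operator_closure D" by blast
qed

lemma monoid_cstar_carrier:
  "carrier (monoid_cstar :: ('a::left_cancellative_monoid ell2 \<Rightarrow>\<^sub>L 'a ell2) star_algebra)
    = operator_closure Omega" (is "?B = ?C")
proof
  have "closed_star_subalgebra bounded_operators (operator_closure Omega)"
    unfolding closed_star_subalgebra_def
    using operator_closure_compose[OF invariant_set_Omega invariant_set_Omega]
    by (auto simp: operator_closure_zero operator_closure_add operator_closure_star[OF invariant_set_Omega]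
        operator_closure_scale norm_closed_operator_closure)
  moreover have "range left_regular \<subseteq> operator_closure Omega"
    by (auto simp: left_regular_eq intro!: operator_closureI bisection_fun_in_compact_span left_inverse_hull.intros)
  ultimately show "?B \<subseteq> ?C"
    unfolding monoid_cstar_def generated_cstar_algebra_def by auto
  show "?C \<subseteq> ?B"
    unfolding monoid_cstar_def generated_cstar_algebra_def
    using operator_closure_subset_subalgebra by auto
qed

lemma monoid_cstar_simps [simp]:
  "zero monoid_cstar = 0" "add monoid_cstar = (+)" "mult monoid_cstar = (o\<^sub>L)" "anorm monoid_cstar = norm"
  "scale monoid_cstar = scale bounded_operators" "star monoid_cstar = star bounded_operators"
  by (simp_all add: monoid_cstar_def generated_cstar_algebra_def)

lemma monoid_cstar_diff [simp]: "diff monoid_cstar S T = S - T"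
  using bounded_operators_diff[of S T] by (simp add: diff_def)

lemma operator_closure_mono: "operator_closure (Omega - boundary_Omega) \<subseteq> operator_closure Omega"
  unfolding operator_closure_def
  by (intro closure_mono image_mono subsetI compact_span_off_boundary_subset)

lemma invariant_set_off_boundary: "invariant_set (Omega - boundary_Omega)"
  by (rule invariant_set_Diff[OF invariant_set_boundary])

lemma closed_ideal_off_boundary: "closed_ideal monoid_cstar (operator_closure (Omega - boundary_Omega))"
proof -
  have "S o\<^sub>L T \<in> operator_closure (Omega - boundary_Omega) \<and> T o\<^sub>L S \<in> operator_closure (Omega - boundary_Omega)"
    if "S \<in> operator_closure Omega" "T \<in> operator_closure (Omega - boundary_Omega)" for S T :: "'a ell2 \<Rightarrow>\<^sub>L 'a ell2"
  proof -
    have "Omega \<inter> (Omega - boundary_Omega) = Omega - boundary_Omega"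
      "(Omega - boundary_Omega) \<inter> Omega = Omega - boundary_Omega" by blast+
    then show ?thesis
      using operator_closure_compose[OF invariant_set_Omega invariant_set_off_boundary that]
        operator_closure_compose[OF invariant_set_off_boundary invariant_set_Omega that(2,1)] by metis
  qed
  then show ?thesis
    unfolding closed_ideal_def monoid_cstar_carrier
    using operator_closure_mono
    by (auto simp: operator_closure_zero operator_closure_add operator_closure_scale norm_closed_operator_closure)
qed

section \<open>The foundation ideal\<close>

lemma foundation_projection_in_closure:
  assumes F: "foundation_set F X"
  shows "projection (X - \<Union>F) \<in> operator_closure (Omega - boundary_Omega)"
  unfolding projection_eq[OF F]
proof (intro operator_closureI bisection_span_generator)
  have fin: "finite F" using F by (simp add: foundation_set_def)
  show "compact_generator (Omega - boundary_Omega) Some (\<lambda>\<omega>. if \<omega> \<in> cylinder {X} F then 1 else 0)"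
    unfolding compact_generator_def
  proof (intro conjI exI[of _ "cylinder {X} F \<inter> Omega"])
    show "compact (cylinder {X} F \<inter> Omega)"
      by (intro compact_closed_characters closed_Int closed_cylinder closed_Omega)
    show "cylinder {X} F \<inter> Omega \<subseteq> Omega - boundary_Omega"
      using foundation_set_disjoint_boundary[OF F] by blast
    show "\<forall>\<omega>\<in>cylinder {X} F \<inter> Omega. \<omega> (dom Some)"
      using character_UNIV[OF Omega_character] by (auto simp: dom_def)
  qed (use fin in \<open>auto simp: id_in_hull continuous_indicator_cylinder\<close>)
qed

text \<open>Induction on the cover: multiplication with the projection of one cylinder leads into
  \<open>K\<close>, and what remains of the weight vanishes off the other cylinders.\<close>

lemma diagonal_in_foundation_ideal:
  assumes K: "closed_ideal monoid_cstar K" "{projection (X - \<Union>F) | X F. foundation_set F X} \<subseteq> K"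
    and C: "finite C" "\<And>X F. (X, F) \<in> C \<Longrightarrow> foundation_set F X"
    and \<psi>: "continuous_on Omega \<psi>"
      "\<And>\<omega>. \<omega> \<in> Omega \<Longrightarrow> \<omega> \<notin> (\<Union>(X, F)\<in>C. cylinder {X} F) \<Longrightarrow> \<psi> \<omega> = 0"
  shows "rho_e_Cc (bisection_fun Some \<psi>) \<in> K"
  using C \<psi>
proof (induction C arbitrary: \<psi> rule: finite_induct)
  case empty
  then have "bisection_fun Some \<psi> = (\<lambda>_. 0)"
    using bisection_fun_cong[of Some \<psi> "\<lambda>_. 0"] by (auto simp: bisection_fun_def)
  then show ?case using K(1) by (simp add: rho_e_Cc_zero closed_ideal_def)
next
  case (insert p C)
  obtain X F where p: "p = (X, F)" by (cases p)
  have F: "foundation_set F X" using insert.prems(1)[of X F] by (simp add: p)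
  have fin: "finite F" using F by (simp add: foundation_set_def)
  let ?i = "\<lambda>\<omega>. if \<omega> \<in> cylinder {X} F then 1 else (0 :: complex)"
  have i: "continuous_on Omega ?i" using fin by (intro continuous_indicator_cylinder) auto
  have c1: "continuous_on Omega (\<lambda>\<omega>. \<psi> \<omega> * ?i \<omega>)" by (rule continuous_on_mult[OF insert.prems(2) i])
  have c2: "continuous_on Omega (\<lambda>\<omega>. \<psi> \<omega> - \<psi> \<omega> * ?i \<omega>)" by (rule continuous_on_diff[OF insert.prems(2) c1])
  have "rho_e_Cc (bisection_fun Some \<psi>) \<in> carrier monoid_cstar"
    unfolding monoid_cstar_carrier
    by (intro operator_closureI bisection_fun_in_compact_span id_in_hull insert.prems(2))
  moreover have "projection (X - \<Union>F) \<in> K" using K(2) F by blast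
  ultimately have "rho_e_Cc (bisection_fun Some \<psi>) o\<^sub>L projection (X - \<Union>F) \<in> K"
    using K(1) by (simp add: closed_ideal_def)
  then have 1: "rho_e_Cc (bisection_fun Some (\<lambda>\<omega>. \<psi> \<omega> * ?i \<omega>)) \<in> K"
    unfolding projection_eq[OF F] rho_e_Cc_compose_diagonal[OF id_in_hull insert.prems(2) i] .
  have 2: "rho_e_Cc (bisection_fun Some (\<lambda>\<omega>. \<psi> \<omega> - \<psi> \<omega> * ?i \<omega>)) \<in> K"
  proof (rule insert.IH[OF _ c2])
    show "\<psi> \<omega> - \<psi> \<omega> * ?i \<omega> = 0" if "\<omega> \<in> Omega" "\<omega> \<notin> (\<Union>(X, F)\<in>C. cylinder {X} F)" for \<omega>
      using insert.prems(3)[OF that(1)] that(2) by (auto simp: p)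
  qed (use insert.prems(1) in blast)
  note gen = bisection_span_generator[of bounded_on_dom, OF continuous_bounded_on_dom[OF id_in_hull c1]]
    bisection_span_generator[of bounded_on_dom, OF continuous_bounded_on_dom[OF id_in_hull c2]]
  have "bisection_fun Some \<psi> = (\<lambda>a. bisection_fun Some (\<lambda>\<omega>. \<psi> \<omega> * ?i \<omega>) a + bisection_fun Some (\<lambda>\<omega>. \<psi> \<omega> - \<psi> \<omega> * ?i \<omega>) a)"
    by (rule ext) (auto simp: bisection_fun_def)
  then have "rho_e_Cc (bisection_fun Some \<psi>)
      = rho_e_Cc (bisection_fun Some (\<lambda>\<omega>. \<psi> \<omega> * ?i \<omega>)) + rho_e_Cc (bisection_fun Some (\<lambda>\<omega>. \<psi> \<omega> - \<psi> \<omega> * ?i \<omega>))"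
    using rho_e_Cc_add[OF gen] by simp
  with 1 2 K(1) show ?case by (simp add: closed_ideal_def)
qed

lemma foundation_ideal_eq:
  "(foundation_ideal :: ('a::left_cancellative_monoid ell2 \<Rightarrow>\<^sub>L 'a ell2) set) = operator_closure (Omega - boundary_Omega)" (is "?I = ?C")
proof
  show "?I \<subseteq> ?C"
    unfolding foundation_ideal_def generated_closed_ideal_def
    using closed_ideal_off_boundary foundation_projection_in_closure by blast
  show "?C \<subseteq> ?I"
    unfolding foundation_ideal_def generated_closed_ideal_def
  proof (intro Inter_greatest, elim CollectE conjE)
    fix K :: "('a ell2 \<Rightarrow>\<^sub>L 'a ell2) set"
    assume K: "closed_ideal monoid_cstar K" "{projection (X - \<Union>F) | X F. foundation_set F X} \<subseteq> K"
    have gen: "rho_e_Cc f \<in> K" if "f \<in> bisection_span (compact_generator (Omega - boundary_Omega))" for f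
      using that
    proof (induction rule: bisection_span.induct)
      case zero
      then show ?case using K(1) by (simp add: rho_e_Cc_zero closed_ideal_def)
    next
      case (step f g \<phi>)
      have g: "g \<in> left_inverse_hull" using step(2) by (simp add: compact_generator_def)
      obtain C where C: "finite C" "\<And>X F. (X, F) \<in> C \<Longrightarrow> foundation_set F X" "continuous_on Omega \<phi>"
        "\<And>\<omega>. \<omega> \<in> Omega \<Longrightarrow> \<omega> \<notin> (\<Union>(X, F)\<in>C. cylinder {X} F) \<Longrightarrow> \<phi> \<omega> = 0"
        using compact_generator_off_boundary[OF step(2)] by metis
      have "rho_e_Cc (bisection_fun g (\<lambda>_. 1)) \<in> carrier monoid_cstar"
        unfolding monoid_cstar_carrier by (intro operator_closureI bisection_fun_in_compact_span g) simp
      moreover have "rho_e_Cc (bisection_fun Some \<phi>) \<in> K"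
        by (rule diagonal_in_foundation_ideal[OF K C])
      ultimately have "rho_e_Cc (bisection_fun g (\<lambda>_. 1)) o\<^sub>L rho_e_Cc (bisection_fun Some \<phi>) \<in> K"
        using K(1) by (simp add: closed_ideal_def)
      then have "rho_e_Cc (bisection_fun g \<phi>) \<in> K"
        using rho_e_Cc_compose_diagonal[OF g _ C(3), of "\<lambda>_. 1"] by simp
      moreover have "bisection_fun g \<phi> \<in> bounded_span"
        by (rule compact_span_bounded_span[OF bisection_span_generator[of "compact_generator _", OF step(2)]])
      ultimately show ?case
        using K(1) step(3) by (simp add: rho_e_Cc_add compact_span_bounded_span[OF step(1)] closed_ideal_def)
    qed
    show "?C \<subseteq> K"
    proof
      fix T :: "'a ell2 \<Rightarrow>\<^sub>L 'a ell2" assume T: "T \<in> operator_closure (Omega - boundary_Omega)"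
      then obtain f where f: "\<And>n::nat. f n \<in> bisection_span (compact_generator (Omega - boundary_Omega))"
        "(\<lambda>n. rho_e_Cc (f n)) \<longlonglongrightarrow> T"
        using operator_closureD by blast
      have Tc: "T \<in> carrier monoid_cstar" using T operator_closure_mono by (auto simp: monoid_cstar_carrier)
      have lim: "(\<lambda>n. norm (rho_e_Cc (f n) - T)) \<longlonglongrightarrow> 0"
        using f(2) by (simp add: LIM_zero tendsto_norm_zero)
      have "\<forall>u. \<forall>x\<in>carrier monoid_cstar. (\<forall>n. u n \<in> K) \<and> (\<lambda>n. norm (u n - x)) \<longlonglongrightarrow> 0 \<longrightarrow> x \<in> K"
        using K(1) by (simp add: closed_ideal_def norm_closed_def)
      from this[THEN spec[of _ "\<lambda>n. rho_e_Cc (f n)"], THEN bspec[of _ _ T]] Tc lim gen[OF f(1)]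
      show "T \<in> K" by simp
    qed
  qed
qed

section \<open>Lifting along the representation\<close>

text \<open>The element f(1 - f^* f/N)^j, unfolded so that it involves no unit. It therefore stays
  among the functions supported over \<open>D\<close> if \<open>f\<close> is one of them and
  \<open>D\<close> is invariant.\<close>

primrec damped_power ::
    "real \<Rightarrow> ('a::left_cancellative_monoid germ \<Rightarrow> complex) \<Rightarrow> nat \<Rightarrow> 'a germ \<Rightarrow> complex" where
  "damped_power N f 0 = f"
| "damped_power N f (Suc j) = (\<lambda>a. damped_power N f j a + complex_of_real (- 1 / N) *
    convolution groupoid_P (damped_power N f j) (convolution groupoid_P (involution groupoid_P f) f) a)"

lemma damped_power_span:
  assumes D: "invariant_set D" and f: "f \<in> bisection_span (compact_generator D)"
  shows "damped_power N f j \<in> bisection_span (compact_generator D)"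
proof (induction j)
  case (Suc j)
  have "convolution groupoid_P (involution groupoid_P f) f \<in> bisection_span (compact_generator D)"
    using compact_span_convolution[OF D D compact_span_involution[OF D f] f] by simp
  from compact_span_convolution[OF D D Suc this]
  show ?case by (simp add: bisection_span_add[OF Suc] compact_span_scale del: of_real_minus of_real_divide)
qed (use f in simp)

lemma bounded_span_adjoint_square:
  "f \<in> bounded_span \<Longrightarrow> convolution groupoid_P (involution groupoid_P f) f \<in> bounded_span"
  by (intro bounded_span_convolution bounded_span_involution)

lemma damped_power_bounded_span:
  "f \<in> bounded_span \<Longrightarrow> damped_power N f j \<in> bounded_span"
proof (induction j)
  case (Suc j)
  then show ?case
    unfolding damped_power.simps
    by (intro bisection_span_add bounded_span_scale bounded_span_convolution bounded_span_adjoint_square)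
qed simp

lemma regular_rep_damped_power:
  assumes f: "f \<in> bounded_span"
  shows "regular_rep groupoid_P x (damped_power N f (Suc j)) \<xi>
    = regular_rep groupoid_P x (damped_power N f j) \<xi> - (1 / N) *\<^sub>R
      regular_rep groupoid_P x (damped_power N f j)
        (regular_rep groupoid_P x (involution groupoid_P f) (regular_rep groupoid_P x f \<xi>))"
proof -
  note d = damped_power_bounded_span[OF f, of N j]
  note s = bounded_span_adjoint_square[OF f]
  note c = bounded_span_convolution[OF d s]
  have "regular_rep groupoid_P x (damped_power N f (Suc j)) \<xi>
    = regular_rep groupoid_P x (damped_power N f j) \<xi> + ell2_scale (complex_of_real (- 1 / N))
      (regular_rep groupoid_P x (convolution groupoid_P (damped_power N f j) (convolution groupoid_P (involution groupoid_P f) f)) \<xi>)"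
    unfolding damped_power.simps
    by (simp only: regular_rep_fun_add[OF d bounded_span_scale[OF c]] regular_rep_fun_scale[OF c])
  then show ?thesis
    by (simp only: ell2_scale_of_real regular_rep_convolution[OF d s]
        regular_rep_convolution[OF bounded_span_involution[OF f] f]) simp
qed

lemma rho_e_Cc_damped_power:
  assumes f: "f \<in> bounded_span"
  shows "blinfun_apply (rho_e_Cc (damped_power N f (Suc j))) \<xi>
    = blinfun_apply (rho_e_Cc (damped_power N f j)) \<xi> - (1 / N) *\<^sub>R
      blinfun_apply (rho_e_Cc (damped_power N f j))
        (blinfun_apply (rho_e_Cc (involution groupoid_P f)) (blinfun_apply (rho_e_Cc f) \<xi>))"
proof -
  note d = damped_power_bounded_span[OF f, of N j]
  note s = bounded_span_adjoint_square[OF f]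
  note c = bounded_span_convolution[OF d s]
  have "blinfun_apply (rho_e_Cc (damped_power N f (Suc j))) \<xi>
    = blinfun_apply (rho_e_Cc (damped_power N f j)) \<xi> + ell2_scale (complex_of_real (- 1 / N))
      (blinfun_apply (rho_e_Cc (convolution groupoid_P (damped_power N f j) (convolution groupoid_P (involution groupoid_P f) f))) \<xi>)"
    unfolding damped_power.simps
    by (simp only: rho_e_Cc_add[OF d bounded_span_scale[OF c]] rho_e_Cc_scale[OF c] blinfun.add_left)
  then show ?thesis
    by (simp only: ell2_scale_of_real rho_e_Cc_convolution[OF d s]
        rho_e_Cc_convolution[OF bounded_span_involution[OF f] f] blinfun_apply_blinfun_compose) simp
qed

lemma adjoint_pair_inner:
  fixes T :: "'i ell2 \<Rightarrow> 'j ell2"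
  shows "adjoint_pair T T' \<Longrightarrow> inner (T x) y = inner x (T' y)"
  by (simp add: adjoint_pair_def inner_ell2_def)

text \<open>The two bounds are different estimates for one recursion. In the regular representations
  \<open>f\<close> may have large norm, and damping brings it down to the root of N/(m+1). Under
  \<open>rho_e_Cc\<close> it is a contraction, and each of the m steps moves it by at most
  1/N.\<close>

lemma rho_e_lift_unit:
  assumes D: "invariant_set D" and f: "f \<in> bisection_span (compact_generator D)" and f1: "norm (rho_e_Cc f) \<le> 1"
  obtains h where "h \<in> bisection_span (compact_generator D)" "reduced_norm groupoid_P h \<le> 2"
    "norm (rho_e_Cc f - rho_e_Cc h) \<le> 1 / 4"
proof -
  have fb: "f \<in> bounded_span" by (rule compact_span_bounded_span[OF f])
  let ?r = "reduced_norm groupoid_P f"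
  \<comment> \<open>If \<open>m\<close> is at least the square of the reduced norm, then so is N =
    4m, as the damping estimate requires; moreover N/(m+1) \<le> 4 and m/N = 1/4. The 1 keeps
    \<open>m\<close> positive.\<close>
  obtain m :: nat where m: "max 1 (?r\<^sup>2) \<le> real m" using real_arch_simple by blast
  define N where "N = 4 * real m"
  have N: "N \<ge> 1" "N > 0" "?r\<^sup>2 \<le> N" using m by (auto simp: N_def)
  define h where "h = damped_power N f m"
  have hb: "h \<in> bounded_span" unfolding h_def by (rule damped_power_bounded_span[OF fb])
  have "h \<in> bisection_span (compact_generator D)"
    unfolding h_def by (rule damped_power_span[OF D f])
  moreover have "reduced_norm groupoid_P h \<le> 2"
  proof (rule reduced_norm_leI)
    fix x :: "'a character" and \<xi> assume x: "x \<in> Omega"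
    let ?T = "regular_rep groupoid_P x f" and ?T' = "regular_rep groupoid_P x (involution groupoid_P f)"
    have TN: "(norm (?T \<eta>))\<^sup>2 \<le> N * (norm \<eta>)\<^sup>2" for \<eta>
    proof -
      have "(norm (?T \<eta>))\<^sup>2 \<le> (?r * norm \<eta>)\<^sup>2"
        by (intro power_mono norm_regular_rep_le fb x) simp
      also have "\<dots> \<le> N * (norm \<eta>)\<^sup>2"
        unfolding power_mult_distrib by (intro mult_right_mono N(3)) simp
      finally show ?thesis .
    qed
    have "(norm (regular_rep groupoid_P x h \<xi>))\<^sup>2 \<le> N / (real m + 1) * (norm \<xi>)\<^sup>2"
      unfolding h_def
      by (rule damped_power_norm_le(1)[where T = ?T and T' = ?T' and N = N
            and y = "\<lambda>j. regular_rep groupoid_P x (damped_power N f j)",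
            OF linear_regular_rep[OF fb] adjoint_pair_inner[OF regular_rep_adjoint[OF fb]] N(2) TN _
              regular_rep_damped_power[OF fb]]) simp
    also have "\<dots> \<le> 4 * (norm \<xi>)\<^sup>2"
      by (intro mult_right_mono) (simp_all add: N_def pos_divide_le_eq)
    also have "\<dots> = (2 * norm \<xi>)\<^sup>2" by (simp add: power_mult_distrib)
    finally show "norm (regular_rep groupoid_P x h \<xi>) \<le> 2 * norm \<xi>"
      by (rule power2_le_imp_le) simp
  qed simp
  moreover have "norm (rho_e_Cc f - rho_e_Cc h) \<le> 1 / 4"
  proof (rule norm_blinfun_bound)
    fix \<xi>
    let ?T = "blinfun_apply (rho_e_Cc f)" and ?T' = "blinfun_apply (rho_e_Cc (involution groupoid_P f))"
    have T1: "norm (?T \<eta>) \<le> norm \<eta>" for \<eta>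
      using order_trans[OF norm_blinfun mult_right_mono[OF f1 norm_ge_zero]] by simp
    have T'1: "norm (?T' \<eta>) \<le> norm \<eta>" for \<eta>
      using adjoint_pair_norm_le[OF rho_e_Cc_adjoint[OF fb], of 1] T1 by simp
    have "norm (blinfun_apply (rho_e_Cc h) \<xi> - ?T \<xi>) \<le> real m / N * norm \<xi>"
      unfolding h_def
      by (rule damped_power_dist_le[where T = ?T and T' = ?T' and N = N
            and y = "\<lambda>j. blinfun_apply (rho_e_Cc (damped_power N f j))",
            OF bounded_linear.linear[OF blinfun.bounded_linear_right]
              adjoint_pair_inner[OF rho_e_Cc_adjoint[OF fb]] N(1) T1 T'1 _ rho_e_Cc_damped_power[OF fb]]) simp
    also have "real m / N = 1 / 4" using m by (simp add: N_def)
    finally show "norm (blinfun_apply (rho_e_Cc f - rho_e_Cc h) \<xi>) \<le> 1 / 4 * norm \<xi>"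
      by (simp add: blinfun.diff_left norm_minus_commute)
  qed simp
  ultimately show thesis by (rule that)
qed

lemma rho_e_lift:
  assumes D: "invariant_set D" and f: "f \<in> bisection_span (compact_generator D)"
    and e: "norm (rho_e_Cc f) \<le> e" "0 < e"
  obtains h where "h \<in> bisection_span (compact_generator D)" "reduced_norm groupoid_P h \<le> 2 * e"
    "norm (rho_e_Cc f - rho_e_Cc h) \<le> e / 4"
proof -
  have fb: "f \<in> bounded_span" by (rule compact_span_bounded_span[OF f])
  have scale: "rho_e_Cc (\<lambda>a. complex_of_real r * f' a) = r *\<^sub>R rho_e_Cc f'" if "f' \<in> bounded_span" for r f'
    by (rule blinfun_eqI) (simp only: rho_e_Cc_scale[OF that] ell2_scale_of_real blinfun.scaleR_left)
  have "norm (rho_e_Cc (\<lambda>a. complex_of_real (1 / e) * f a)) \<le> 1"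
    unfolding scale[OF fb] using e by simp
  from rho_e_lift_unit[OF D compact_span_scale[OF f] this] obtain h where
    h: "h \<in> bisection_span (compact_generator D)" "reduced_norm groupoid_P h \<le> 2"
    "norm (rho_e_Cc (\<lambda>a. complex_of_real (1 / e) * f a) - rho_e_Cc h) \<le> 1 / 4" by blast
  have hb: "h \<in> bounded_span" by (rule compact_span_bounded_span[OF h(1)])
  show thesis
  proof (rule that)
    show "(\<lambda>a. complex_of_real e * h a) \<in> bisection_span (compact_generator D)"
      by (rule compact_span_scale[OF h(1)])
    have "reduced_norm groupoid_P (\<lambda>a. complex_of_real e * h a) \<le> e * reduced_norm groupoid_P h"
      using reduced_norm_scale[OF hb, of "complex_of_real e"] e by simp
    also have "\<dots> \<le> e * 2" using h(2) e by (intro mult_left_mono) auto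
    finally show "reduced_norm groupoid_P (\<lambda>a. complex_of_real e * h a) \<le> 2 * e" by simp
    have "rho_e_Cc f - rho_e_Cc (\<lambda>a. complex_of_real e * h a)
        = e *\<^sub>R (rho_e_Cc (\<lambda>a. complex_of_real (1 / e) * f a) - rho_e_Cc h)"
      unfolding scale[OF fb] scale[OF hb] using e by (simp add: scaleR_diff_right)
    then have "norm (rho_e_Cc f - rho_e_Cc (\<lambda>a. complex_of_real e * h a))
        = e * norm (rho_e_Cc (\<lambda>a. complex_of_real (1 / e) * f a) - rho_e_Cc h)"
      using e by simp
    also have "\<dots> \<le> e * (1 / 4)" using h(3) e by (intro mult_left_mono) auto
    finally show "norm (rho_e_Cc f - rho_e_Cc (\<lambda>a. complex_of_real e * h a)) \<le> e / 4" by simp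
  qed
qed

text \<open>Approximate lifts of controlled norm are summed as in the proof of the open mapping theorem.\<close>

lemma operator_closure_lift:
  assumes D: "invariant_set D" and T: "T \<in> operator_closure D"
  obtains u where "\<And>n::nat. u n \<in> bisection_span (compact_generator D)"
    "\<And>e. 0 < e \<Longrightarrow> \<exists>M. \<forall>m\<ge>M. \<forall>n\<ge>M. reduced_norm groupoid_P (\<lambda>a. u m a - u n a) < e"
    "(\<lambda>n. rho_e_Cc (u n)) \<longlonglongrightarrow> T"
proof -
  \<comment> \<open>The summand 1 makes \<open>c\<close> positive even if \<open>T\<close> is 0. The
    error allowed after n corrections is \<open>c / 2 ^ n\<close>.\<close>
  define c where "c = norm T + 1"
  have c: "c > 0" by (simp add: c_def add_nonneg_pos)
  define P where "P n s \<longleftrightarrow> s \<in> bisection_span (compact_generator D) \<and> norm (T - rho_e_Cc s) \<le> c / 2 ^ n" for n :: nat and s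
  have "\<exists>u. \<forall>n. P n (u n) \<and> reduced_norm groupoid_P (\<lambda>a. u (Suc n) a - u n a) \<le> 3 * (c / 2 ^ n)"
  proof (rule dependent_nat_choice)
    show "\<exists>s. P 0 s"
      by (rule exI[of _ "\<lambda>_. 0"]) (simp add: P_def bisection_span.zero rho_e_Cc_zero c_def)
    fix s n assume s: "P n s"
    define e where "e = c / 2 ^ n"
    have e: "e > 0" using c by (simp add: e_def)
    have sb: "s \<in> bisection_span (compact_generator D)" "norm (T - rho_e_Cc s) \<le> e" using s by (auto simp: P_def e_def)
    obtain f where f: "\<And>n::nat. f n \<in> bisection_span (compact_generator D)" "(\<lambda>n. rho_e_Cc (f n)) \<longlonglongrightarrow> T"
      using operator_closureD[OF T] by blast
    \<comment> \<open>With this margin the correction \<open>g\<close> has norm at most 9/8 e. Its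
      approximate lift leaves an error of at most e/8 + 9/32 e, which is below e/2, and has reduced
      norm at most 9/4 e, which is below the bound 3e that is carried along.\<close>
    obtain k where "norm (rho_e_Cc (f k) - T) < e / 8"
      using LIMSEQ_D[OF f(2), of "e / 8"] e by auto
    then have k: "norm (T - rho_e_Cc (f k)) \<le> e / 8" by (simp add: norm_minus_commute)
    define g where "g = (\<lambda>a. f k a + - 1 * s a)"
    have g: "g \<in> bisection_span (compact_generator D)"
      unfolding g_def by (intro bisection_span_add compact_span_scale f sb)
    have rg: "rho_e_Cc g = rho_e_Cc (f k) - rho_e_Cc s"
      using rho_e_Cc_diff[OF compact_span_bounded_span[OF f(1)] compact_span_bounded_span[OF sb(1)]] by (simp add: g_def)
    have "norm (rho_e_Cc g) \<le> norm (T - rho_e_Cc s) + norm (T - rho_e_Cc (f k))"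
      unfolding rg using norm_triangle_ineq4[of "T - rho_e_Cc s" "T - rho_e_Cc (f k)"] by simp
    then have "norm (rho_e_Cc g) \<le> 9 / 8 * e" using k sb(2) by simp
    from rho_e_lift[OF D g this] e obtain h where h: "h \<in> bisection_span (compact_generator D)"
      "reduced_norm groupoid_P h \<le> 2 * (9 / 8 * e)" "norm (rho_e_Cc g - rho_e_Cc h) \<le> 9 / 8 * e / 4"
      by auto
    have "rho_e_Cc (\<lambda>a. s a + h a) = rho_e_Cc s + rho_e_Cc h"
      by (rule rho_e_Cc_add[OF compact_span_bounded_span[OF sb(1)] compact_span_bounded_span[OF h(1)]])
    then have "T - rho_e_Cc (\<lambda>a. s a + h a) = (T - rho_e_Cc (f k)) + (rho_e_Cc g - rho_e_Cc h)"
      by (simp add: rg)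
    then have "norm (T - rho_e_Cc (\<lambda>a. s a + h a)) \<le> e / 8 + 9 / 8 * e / 4"
      using norm_triangle_le[OF add_mono[OF k h(3)]] by (simp only:)
    also have "\<dots> \<le> e / 2" using e by simp
    also have "\<dots> = c / 2 ^ Suc n" by (simp add: e_def)
    finally have "P (Suc n) (\<lambda>a. s a + h a)"
      using sb(1) h(1) by (simp add: P_def bisection_span_add)
    moreover have "reduced_norm groupoid_P (\<lambda>a. s a + h a - s a) \<le> 3 * (c / 2 ^ n)"
      using h(2) e by (simp flip: e_def)
    ultimately show "\<exists>s'. P (Suc n) s' \<and> reduced_norm groupoid_P (\<lambda>a. s' a - s a) \<le> 3 * (c / 2 ^ n)"
      by blast
  qed
  then obtain u where u: "\<And>n. P n (u n)"
    and du: "\<And>n. reduced_norm groupoid_P (\<lambda>a. u (Suc n) a - u n a) \<le> 3 * (c / 2 ^ n)" by blast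
  have us: "u n \<in> bisection_span (compact_generator D)" and uT: "norm (T - rho_e_Cc (u n)) \<le> c / 2 ^ n" for n
    using u by (auto simp: P_def)
  have ub: "(\<lambda>a. u m a - u n a) \<in> bounded_span" for m n
    using bisection_span_add[OF compact_span_bounded_span[OF us[of m]] bounded_span_scale[OF compact_span_bounded_span[OF us[of n]], of "- 1"]]
    by simp
  \<comment> \<open>The subtracted term makes the induction close: the bound 3c/2^(n+k) for one step
    is exactly the difference of two consecutive values of that term.\<close>
  have "reduced_norm groupoid_P (\<lambda>a. u (n + k) a - u n a) \<le> 6 * (c / 2 ^ n) - 6 * (c / 2 ^ (n + k))" for n k
  proof (induction k)
    case (Suc k)
    have "reduced_norm groupoid_P (\<lambda>a. (u (Suc (n + k)) a - u (n + k) a) + (u (n + k) a - u n a))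
        \<le> 3 * (c / 2 ^ (n + k)) + (6 * (c / 2 ^ n) - 6 * (c / 2 ^ (n + k)))"
      by (rule order_trans[OF reduced_norm_add[OF ub ub] add_mono[OF du Suc]])
    then show ?case by simp
  qed simp
  moreover have "6 * (c / 2 ^ n) - 6 * (c / 2 ^ (n + k)) \<le> 6 * (c / 2 ^ n)" for n k :: nat using c by simp
  ultimately have tail: "reduced_norm groupoid_P (\<lambda>a. u (n + k) a - u n a) \<le> 6 * (c / 2 ^ n)" for n k
    by (rule order_trans)
  have lim: "(\<lambda>n. c / 2 ^ n) \<longlonglongrightarrow> 0"
    by (rule LIMSEQ_divide_realpow_zero) simp
  show thesis
  proof (rule that[OF us])
    fix e :: real assume "0 < e"
    \<comment> \<open>Two late members are compared through \<open>u M\<close>, from which each has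
      distance at most 6c/2^M; hence the 12.\<close>
    then have "\<forall>\<^sub>F n in sequentially. c / 2 ^ n < e / 12"
      using order_tendstoD(2)[OF lim, of "e / 12"] by simp
    then obtain M where M: "c / 2 ^ M < e / 12" by (auto simp: eventually_sequentially)
    show "\<exists>M. \<forall>m\<ge>M. \<forall>n\<ge>M. reduced_norm groupoid_P (\<lambda>a. u m a - u n a) < e"
    proof (intro exI[of _ M] allI impI)
      fix m n assume mn: "m \<ge> M" "n \<ge> M"
      have "reduced_norm groupoid_P (\<lambda>a. (u m a - u M a) + - 1 * (u n a - u M a))
          \<le> reduced_norm groupoid_P (\<lambda>a. u m a - u M a) + reduced_norm groupoid_P (\<lambda>a. - 1 * (u n a - u M a))"
        by (rule reduced_norm_add[OF ub bounded_span_scale[OF ub]])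
      also have "\<dots> \<le> 6 * (c / 2 ^ M) + 6 * (c / 2 ^ M)"
        using tail[of M "m - M"] tail[of M "n - M"] mn reduced_norm_scale[OF ub, of "- 1" n M] by simp
      also have "\<dots> < e" using M by linarith
      finally show "reduced_norm groupoid_P (\<lambda>a. u m a - u n a) < e" by simp
    qed
  next
    have "(\<lambda>n. T - rho_e_Cc (u n)) \<longlonglongrightarrow> 0"
      by (rule Lim_null_comparison[OF _ lim]) (simp add: uT)
    from tendsto_diff[OF tendsto_const[of T] this]
    show "(\<lambda>n. rho_e_Cc (u n)) \<longlonglongrightarrow> T" by simp
  qed
qed

section \<open>Completions of algebras of functions\<close>

text \<open>The properties that make sums and multiples of classes of Cauchy sequences well defined.
  They hold for the reduced norms of the groupoid and of the complement, and for a C*-norm on C_c of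
  the boundary groupoid.\<close>

locale seminormed_functions =
  fixes A :: "('g \<Rightarrow> complex) star_algebra"
  assumes zero_eq: "zero A = (\<lambda>_. 0)"
    and add_eq: "\<And>f h. add A f h = (\<lambda>g. f g + h g)"
    and scale_eq: "\<And>c f. scale A c f = (\<lambda>g. c * f g)"
    and zero_in: "(\<lambda>_. 0) \<in> carrier A"
    and add_in: "\<And>f h. f \<in> carrier A \<Longrightarrow> h \<in> carrier A \<Longrightarrow> (\<lambda>g. f g + h g) \<in> carrier A"
    and scale_in: "\<And>c f. f \<in> carrier A \<Longrightarrow> (\<lambda>g. c * f g) \<in> carrier A"
    and norm_zero: "anorm A (\<lambda>_. 0) = 0"
    and norm_add: "\<And>f h. f \<in> carrier A \<Longrightarrow> h \<in> carrier A \<Longrightarrow>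
      anorm A (\<lambda>g. f g + h g) \<le> anorm A f + anorm A h"
    and norm_scale: "\<And>c f. f \<in> carrier A \<Longrightarrow> anorm A (\<lambda>g. c * f g) \<le> cmod c * anorm A f"
begin

lemma diff_eq: "diff A f h = (\<lambda>g. f g - h g)"
  by (simp add: diff_def add_eq scale_eq)

lemma diff_in: "f \<in> carrier A \<Longrightarrow> h \<in> carrier A \<Longrightarrow> (\<lambda>g. f g - h g) \<in> carrier A"
  using add_in[OF _ scale_in[of h "- 1"], of f] by simp

lemma norm_minus: "f \<in> carrier A \<Longrightarrow> anorm A (\<lambda>g. - f g) \<le> anorm A f"
  using norm_scale[of f "- 1"] by simp

lemma norm_nonneg: "f \<in> carrier A \<Longrightarrow> 0 \<le> anorm A f"
  using norm_add[OF _ scale_in[of f "- 1"], of f] norm_minus[of f] norm_zero by simp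

lemma norm_diff_commute:
  assumes "f \<in> carrier A" "h \<in> carrier A"
  shows "anorm A (\<lambda>g. f g - h g) = anorm A (\<lambda>g. h g - f g)"
  using norm_minus[OF diff_in[OF assms]] norm_minus[OF diff_in[OF assms(2,1)]] by simp

lemma norm_diff_triangle:
  assumes "f \<in> carrier A" "h \<in> carrier A" "k \<in> carrier A"
  shows "anorm A (\<lambda>g. f g - k g) \<le> anorm A (\<lambda>g. f g - h g) + anorm A (\<lambda>g. h g - k g)"
  using norm_add[OF diff_in[OF assms(1,2)] diff_in[OF assms(2,3)]] by simp

lemma norm_le_diff:
  assumes "f \<in> carrier A" "h \<in> carrier A"
  shows "anorm A f \<le> anorm A (\<lambda>g. f g - h g) + anorm A h"
  using norm_add[OF diff_in[OF assms] assms(2)] by simp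

lemma cauchy_seqs_iff:
  "u \<in> cauchy_seqs A \<longleftrightarrow> (\<forall>n. u n \<in> carrier A) \<and>
    (\<forall>e>0. \<exists>M. \<forall>m\<ge>M. \<forall>n\<ge>M. anorm A (\<lambda>g. u m g - u n g) < e)"
  by (simp add: cauchy_seqs_def diff_eq)

lemma cauchy_seqsD:
  assumes "u \<in> cauchy_seqs A" "0 < e"
  obtains M where "\<And>m n. m \<ge> M \<Longrightarrow> n \<ge> M \<Longrightarrow> anorm A (\<lambda>g. u m g - u n g) < e"
proof -
  from assms have "\<exists>M. \<forall>m\<ge>M. \<forall>n\<ge>M. anorm A (\<lambda>g. u m g - u n g) < e"
    by (simp add: cauchy_seqs_iff)
  then show thesis using that by blast
qed

lemma cauchy_seqs_in: "u \<in> cauchy_seqs A \<Longrightarrow> u n \<in> carrier A"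
  by (simp add: cauchy_seqs_iff)

lemma cauchy_rel_iff:
  "(u, v) \<in> cauchy_rel A \<longleftrightarrow> u \<in> cauchy_seqs A \<and> v \<in> cauchy_seqs A \<and>
    (\<lambda>n. anorm A (\<lambda>g. u n g - v n g)) \<longlonglongrightarrow> 0"
  by (simp add: cauchy_rel_def diff_eq)

lemma cauchy_rel_refl: "u \<in> cauchy_seqs A \<Longrightarrow> (u, u) \<in> cauchy_rel A"
  by (simp add: cauchy_rel_iff norm_zero)

lemma cauchy_rel_sym:
  assumes "(u, v) \<in> cauchy_rel A"
  shows "(v, u) \<in> cauchy_rel A"
proof -
  have uv: "u \<in> cauchy_seqs A" "v \<in> cauchy_seqs A" using assms by (auto simp: cauchy_rel_iff)
  have "anorm A (\<lambda>g. u n g - v n g) = anorm A (\<lambda>g. v n g - u n g)" for n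
    by (intro norm_diff_commute cauchy_seqs_in uv)
  with assms show ?thesis by (simp add: cauchy_rel_iff)
qed

lemma cauchy_rel_trans:
  assumes "(u, v) \<in> cauchy_rel A" "(v, w) \<in> cauchy_rel A"
  shows "(u, w) \<in> cauchy_rel A"
proof -
  have uvw: "u \<in> cauchy_seqs A" "v \<in> cauchy_seqs A" "w \<in> cauchy_seqs A"
    using assms by (auto simp: cauchy_rel_iff)
  have "(\<lambda>n. anorm A (\<lambda>g. u n g - w n g)) \<longlonglongrightarrow> 0"
  proof (rule tendsto_sandwich[OF always_eventually always_eventually])
    show "\<forall>n. 0 \<le> anorm A (\<lambda>g. u n g - w n g)"
      by (intro allI norm_nonneg diff_in cauchy_seqs_in uvw)
    show "\<forall>n. anorm A (\<lambda>g. u n g - w n g) \<le> anorm A (\<lambda>g. u n g - v n g) + anorm A (\<lambda>g. v n g - w n g)"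
      by (intro allI norm_diff_triangle cauchy_seqs_in uvw)
    show "(\<lambda>n. anorm A (\<lambda>g. u n g - v n g) + anorm A (\<lambda>g. v n g - w n g)) \<longlonglongrightarrow> 0"
      using tendsto_add[of _ 0 _ _ 0] assms by (fastforce simp: cauchy_rel_iff)
  qed simp
  with uvw show ?thesis by (simp add: cauchy_rel_iff)
qed

definition cls :: "(nat \<Rightarrow> 'g \<Rightarrow> complex) \<Rightarrow> (nat \<Rightarrow> 'g \<Rightarrow> complex) set" where
  "cls u = cauchy_rel A `` {u}"

lemma mem_cls: "v \<in> cls u \<longleftrightarrow> (u, v) \<in> cauchy_rel A"
  by (simp add: cls_def)

lemma cls_eq_iff:
  assumes "u \<in> cauchy_seqs A"
  shows "cls u = cls v \<longleftrightarrow> (u, v) \<in> cauchy_rel A"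
proof
  assume "cls u = cls v"
  then have "u \<in> cls v" using cauchy_rel_refl[OF assms] by (metis mem_cls)
  then show "(u, v) \<in> cauchy_rel A" by (simp add: mem_cls cauchy_rel_sym)
next
  assume *: "(u, v) \<in> cauchy_rel A"
  show "cls u = cls v"
  proof (intro equalityI subsetI)
    show "w \<in> cls v" if "w \<in> cls u" for w
      using cauchy_rel_trans[OF cauchy_rel_sym[OF *]] that by (simp add: mem_cls)
    show "w \<in> cls u" if "w \<in> cls v" for w
      using cauchy_rel_trans[OF *] that by (simp add: mem_cls)
  qed
qed

lemma completion_carrier: "carrier (cstar_completion A) = cls ` cauchy_seqs A"
  by (auto simp: cstar_completion_def quotient_def cls_def)

lemma completion_zero: "zero (cstar_completion A) = cls (\<lambda>_ _. 0)"
  by (simp add: cstar_completion_def zero_eq cls_def)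

lemma cauchy_seqs_add:
  assumes u: "u \<in> cauchy_seqs A" and v: "v \<in> cauchy_seqs A"
  shows "(\<lambda>n g. u n g + v n g) \<in> cauchy_seqs A"
  unfolding cauchy_seqs_iff
proof (intro conjI allI impI)
  show "(\<lambda>g. u n g + v n g) \<in> carrier A" for n by (intro add_in cauchy_seqs_in u v)
  fix e :: real assume "e > 0"
  then have e: "0 < e / 2" by simp
  obtain M where M: "\<And>m n. m \<ge> M \<Longrightarrow> n \<ge> M \<Longrightarrow> anorm A (\<lambda>g. u m g - u n g) < e / 2"
    using cauchy_seqsD[OF u e] by blast
  obtain M' where M': "\<And>m n. m \<ge> M' \<Longrightarrow> n \<ge> M' \<Longrightarrow> anorm A (\<lambda>g. v m g - v n g) < e / 2"
    using cauchy_seqsD[OF v e] by blast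
  have "anorm A (\<lambda>g. u m g + v m g - (u n g + v n g)) < e" if "m \<ge> max M M'" "n \<ge> max M M'" for m n
  proof -
    have "anorm A (\<lambda>g. (u m g - u n g) + (v m g - v n g))
        \<le> anorm A (\<lambda>g. u m g - u n g) + anorm A (\<lambda>g. v m g - v n g)"
      by (intro norm_add diff_in cauchy_seqs_in u v)
    also have "\<dots> < e" using M[of m n] M'[of m n] that by simp
    finally show ?thesis by (simp add: algebra_simps)
  qed
  then show "\<exists>M. \<forall>m\<ge>M. \<forall>n\<ge>M. anorm A (\<lambda>g. u m g + v m g - (u n g + v n g)) < e" by blast
qed

lemma cauchy_rel_add:
  assumes "(u, u') \<in> cauchy_rel A" "(v, v') \<in> cauchy_rel A"
  shows "(\<lambda>n g. u n g + v n g, \<lambda>n g. u' n g + v' n g) \<in> cauchy_rel A"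
proof -
  have s: "u \<in> cauchy_seqs A" "u' \<in> cauchy_seqs A" "v \<in> cauchy_seqs A" "v' \<in> cauchy_seqs A"
    and lim: "(\<lambda>n. anorm A (\<lambda>g. u n g - u' n g)) \<longlonglongrightarrow> 0" "(\<lambda>n. anorm A (\<lambda>g. v n g - v' n g)) \<longlonglongrightarrow> 0"
    using assms by (auto simp: cauchy_rel_iff)
  have "(\<lambda>n. anorm A (\<lambda>g. u n g + v n g - (u' n g + v' n g))) \<longlonglongrightarrow> 0"
  proof (rule tendsto_sandwich[OF always_eventually always_eventually])
    show "\<forall>n. 0 \<le> anorm A (\<lambda>g. u n g + v n g - (u' n g + v' n g))"
      by (intro allI norm_nonneg diff_in add_in cauchy_seqs_in s)
    have "anorm A (\<lambda>g. (u n g - u' n g) + (v n g - v' n g))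
        \<le> anorm A (\<lambda>g. u n g - u' n g) + anorm A (\<lambda>g. v n g - v' n g)" for n
      by (intro norm_add diff_in cauchy_seqs_in s)
    then show "\<forall>n. anorm A (\<lambda>g. u n g + v n g - (u' n g + v' n g))
        \<le> anorm A (\<lambda>g. u n g - u' n g) + anorm A (\<lambda>g. v n g - v' n g)"
      by (simp add: algebra_simps)
    show "(\<lambda>n. anorm A (\<lambda>g. u n g - u' n g) + anorm A (\<lambda>g. v n g - v' n g)) \<longlonglongrightarrow> 0"
      using tendsto_add[OF lim] by simp
  qed simp
  with s show ?thesis by (simp add: cauchy_rel_iff cauchy_seqs_add)
qed

lemma cauchy_seqs_scale:
  assumes u: "u \<in> cauchy_seqs A"
  shows "(\<lambda>n g. c * u n g) \<in> cauchy_seqs A"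
  unfolding cauchy_seqs_iff
proof (intro conjI allI impI)
  show "(\<lambda>g. c * u n g) \<in> carrier A" for n by (intro scale_in cauchy_seqs_in u)
  fix e :: real assume e: "e > 0"
  have c: "cmod c + 1 > 0" by (simp add: add_nonneg_pos)
  then have "0 < e / (cmod c + 1)" using e by simp
  then obtain M where M: "\<And>m n. m \<ge> M \<Longrightarrow> n \<ge> M \<Longrightarrow> anorm A (\<lambda>g. u m g - u n g) < e / (cmod c + 1)"
    using cauchy_seqsD[OF u] by blast
  have "anorm A (\<lambda>g. c * u m g - c * u n g) < e" if mn: "m \<ge> M" "n \<ge> M" for m n
  proof -
    have d: "(\<lambda>g. u m g - u n g) \<in> carrier A" by (intro diff_in cauchy_seqs_in u)
    have "anorm A (\<lambda>g. c * (u m g - u n g)) \<le> cmod c * anorm A (\<lambda>g. u m g - u n g)"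
      by (rule norm_scale[OF d])
    also have "\<dots> \<le> (cmod c + 1) * anorm A (\<lambda>g. u m g - u n g)"
      by (intro mult_right_mono norm_nonneg d) simp
    also have "\<dots> < e" using M[OF mn] c by (simp add: pos_less_divide_eq mult.commute)
    finally show ?thesis by (simp add: algebra_simps)
  qed
  then show "\<exists>M. \<forall>m\<ge>M. \<forall>n\<ge>M. anorm A (\<lambda>g. c * u m g - c * u n g) < e" by blast
qed

lemma cauchy_rel_scale:
  assumes "(u, u') \<in> cauchy_rel A"
  shows "(\<lambda>n g. c * u n g, \<lambda>n g. c * u' n g) \<in> cauchy_rel A"
proof -
  have s: "u \<in> cauchy_seqs A" "u' \<in> cauchy_seqs A"
    and lim: "(\<lambda>n. anorm A (\<lambda>g. u n g - u' n g)) \<longlonglongrightarrow> 0"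
    using assms by (auto simp: cauchy_rel_iff)
  have "(\<lambda>n. anorm A (\<lambda>g. c * u n g - c * u' n g)) \<longlonglongrightarrow> 0"
  proof (rule tendsto_sandwich[OF always_eventually always_eventually])
    show "\<forall>n. 0 \<le> anorm A (\<lambda>g. c * u n g - c * u' n g)"
      by (intro allI norm_nonneg diff_in scale_in cauchy_seqs_in s)
    have "anorm A (\<lambda>g. c * (u n g - u' n g)) \<le> cmod c * anorm A (\<lambda>g. u n g - u' n g)" for n
      by (intro norm_scale diff_in cauchy_seqs_in s)
    then show "\<forall>n. anorm A (\<lambda>g. c * u n g - c * u' n g) \<le> cmod c * anorm A (\<lambda>g. u n g - u' n g)"
      by (simp add: algebra_simps)
    show "(\<lambda>n. cmod c * anorm A (\<lambda>g. u n g - u' n g)) \<longlonglongrightarrow> 0"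
      by (rule tendsto_mult_right_zero[OF lim])
  qed simp
  with s show ?thesis by (simp add: cauchy_rel_iff cauchy_seqs_scale)
qed

text \<open>The operations of the completion are unions over all representatives; the union
  collapses once the expression no longer depends on the representative.\<close>

lemma union_cls:
  assumes "u \<in> cauchy_seqs A" "\<And>u'. (u, u') \<in> cauchy_rel A \<Longrightarrow> G u' = G u"
  shows "(\<Union>u'\<in>cls u. G u') = G u"
proof -
  have "u \<in> cls u" using assms(1) by (simp add: mem_cls cauchy_rel_refl)
  moreover have "G u' = G u" if "u' \<in> cls u" for u' using that assms(2) by (simp add: mem_cls)
  ultimately show ?thesis by blast
qed

lemma completion_add:
  assumes u: "u \<in> cauchy_seqs A" and v: "v \<in> cauchy_seqs A"
  shows "add (cstar_completion A) (cls u) (cls v) = cls (\<lambda>n g. u n g + v n g)"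
proof -
  have "(\<Union>u'\<in>cls u. \<Union>v'\<in>cls v. cls (\<lambda>n g. u' n g + v' n g)) = (\<Union>v'\<in>cls v. cls (\<lambda>n g. u n g + v' n g))"
  proof (rule union_cls[OF u])
    fix u' assume u': "(u, u') \<in> cauchy_rel A"
    have "cls (\<lambda>n g. u' n g + v' n g) = cls (\<lambda>n g. u n g + v' n g)" if "v' \<in> cls v" for v'
    proof -
      have v': "(v', v') \<in> cauchy_rel A" using that by (auto simp: mem_cls cauchy_rel_iff norm_zero)
      note r = cauchy_rel_sym[OF cauchy_rel_add[OF u' v']]
      then show ?thesis using cls_eq_iff by (simp add: cauchy_rel_iff)
    qed
    then show "(\<Union>v'\<in>cls v. cls (\<lambda>n g. u' n g + v' n g)) = (\<Union>v'\<in>cls v. cls (\<lambda>n g. u n g + v' n g))"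
      by simp
  qed
  also have "\<dots> = cls (\<lambda>n g. u n g + v n g)"
  proof (rule union_cls[OF v])
    fix v' assume "(v, v') \<in> cauchy_rel A"
    from cauchy_rel_sym[OF cauchy_rel_add[OF cauchy_rel_refl[OF u] this]]
    show "cls (\<lambda>n g. u n g + v' n g) = cls (\<lambda>n g. u n g + v n g)"
      using cls_eq_iff by (simp add: cauchy_rel_iff)
  qed
  finally show ?thesis by (simp add: cstar_completion_def add_eq cls_def)
qed

lemma completion_scale:
  assumes u: "u \<in> cauchy_seqs A"
  shows "scale (cstar_completion A) c (cls u) = cls (\<lambda>n g. c * u n g)"
proof -
  have "(\<Union>u'\<in>cls u. cls (\<lambda>n g. c * u' n g)) = cls (\<lambda>n g. c * u n g)"
  proof (rule union_cls[OF u])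
    fix u' assume "(u, u') \<in> cauchy_rel A"
    from cauchy_rel_sym[OF cauchy_rel_scale[OF this, of c]]
    show "cls (\<lambda>n g. c * u' n g) = cls (\<lambda>n g. c * u n g)"
      using cls_eq_iff by (simp add: cauchy_rel_iff)
  qed
  then show ?thesis by (simp add: cstar_completion_def scale_eq cls_def)
qed

lemma cauchy_seqs_bounded:
  assumes u: "u \<in> cauchy_seqs A"
  obtains B where "0 \<le> B" "\<And>n. anorm A (u n) \<le> B"
proof -
  obtain M where M: "\<And>m n. m \<ge> M \<Longrightarrow> n \<ge> M \<Longrightarrow> anorm A (\<lambda>g. u m g - u n g) < 1"
    using cauchy_seqsD[OF u zero_less_one] by blast
  \<comment> \<open>The maximum bounds the terms up to \<open>M\<close>, and the later ones are
    within 1 of \<open>u M\<close>.\<close>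
  define B where "B = Max ((\<lambda>n. anorm A (u n)) ` {..M}) + 1"
  have le: "anorm A (u n) \<le> B - 1" if "n \<le> M" for n
    unfolding B_def using that by simp
  have bound: "anorm A (u n) \<le> B" for n
  proof (cases "n \<le> M")
    case True
    with le[of n] show ?thesis by simp
  next
    case False
    have "anorm A (u n) \<le> anorm A (\<lambda>g. u n g - u M g) + anorm A (u M)"
      by (intro norm_le_diff cauchy_seqs_in u)
    also have "\<dots> \<le> 1 + (B - 1)" using M[of n M] le[of M] False by (intro add_mono) auto
    finally show ?thesis by simp
  qed
  moreover have "0 \<le> B" using bound[of 0] norm_nonneg[OF cauchy_seqs_in[OF u]] by (meson order_trans)
  ultimately show thesis by (rule that[rotated])
qed

end

locale seminormed_function_algebra = seminormed_functions +
  assumes mult_in: "\<And>f h. f \<in> carrier A \<Longrightarrow> h \<in> carrier A \<Longrightarrow> mult A f h \<in> carrier A"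
    and star_in: "\<And>f. f \<in> carrier A \<Longrightarrow> star A f \<in> carrier A"
    and mult_diff_left: "\<And>f f' h. f \<in> carrier A \<Longrightarrow> f' \<in> carrier A \<Longrightarrow> h \<in> carrier A \<Longrightarrow>
      mult A (\<lambda>g. f g - f' g) h = (\<lambda>g. mult A f h g - mult A f' h g)"
    and mult_diff_right: "\<And>f f' h. f \<in> carrier A \<Longrightarrow> f' \<in> carrier A \<Longrightarrow> h \<in> carrier A \<Longrightarrow>
      mult A h (\<lambda>g. f g - f' g) = (\<lambda>g. mult A h f g - mult A h f' g)"
    and star_diff: "\<And>f f'. f \<in> carrier A \<Longrightarrow> f' \<in> carrier A \<Longrightarrow>
      star A (\<lambda>g. f g - f' g) = (\<lambda>g. star A f g - star A f' g)"
    and norm_mult: "\<And>f h. f \<in> carrier A \<Longrightarrow> h \<in> carrier A \<Longrightarrow> anorm A (mult A f h) \<le> anorm A f * anorm A h"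
    and norm_star: "\<And>f. f \<in> carrier A \<Longrightarrow> anorm A (star A f) \<le> anorm A f"
begin

lemma norm_mult_diff:
  assumes "f \<in> carrier A" "f' \<in> carrier A" "h \<in> carrier A" "h' \<in> carrier A"
    and B: "anorm A h \<le> B" "anorm A f' \<le> B'"
  shows "anorm A (\<lambda>g. mult A f h g - mult A f' h' g)
    \<le> B * anorm A (\<lambda>g. f g - f' g) + B' * anorm A (\<lambda>g. h g - h' g)"
proof -
  have d: "(\<lambda>g. f g - f' g) \<in> carrier A" "(\<lambda>g. h g - h' g) \<in> carrier A"
    by (intro diff_in assms)+
  have "(\<lambda>g. mult A f h g - mult A f' h' g)
      = (\<lambda>g. mult A (\<lambda>g. f g - f' g) h g + mult A f' (\<lambda>g. h g - h' g) g)"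
    by (simp add: mult_diff_left mult_diff_right assms)
  then have "anorm A (\<lambda>g. mult A f h g - mult A f' h' g)
      \<le> anorm A (mult A (\<lambda>g. f g - f' g) h) + anorm A (mult A f' (\<lambda>g. h g - h' g))"
    using norm_add[OF mult_in[OF d(1) assms(3)] mult_in[OF assms(2) d(2)]] by simp
  also have "\<dots> \<le> anorm A (\<lambda>g. f g - f' g) * anorm A h + anorm A f' * anorm A (\<lambda>g. h g - h' g)"
    by (intro add_mono norm_mult d assms)
  also have "\<dots> \<le> anorm A (\<lambda>g. f g - f' g) * B + B' * anorm A (\<lambda>g. h g - h' g)"
    by (intro add_mono mult_left_mono mult_right_mono B norm_nonneg d)
  finally show ?thesis by (simp add: mult.commute)
qed

lemma cauchy_seqs_mult:
  assumes u: "u \<in> cauchy_seqs A" and v: "v \<in> cauchy_seqs A"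
  shows "(\<lambda>n. mult A (u n) (v n)) \<in> cauchy_seqs A"
  unfolding cauchy_seqs_iff
proof (intro conjI allI impI)
  show "mult A (u n) (v n) \<in> carrier A" for n by (intro mult_in cauchy_seqs_in u v)
  obtain B where B: "0 \<le> B" "\<And>n. anorm A (u n) \<le> B" using cauchy_seqs_bounded[OF u] by blast
  obtain B' where B': "0 \<le> B'" "\<And>n. anorm A (v n) \<le> B'" using cauchy_seqs_bounded[OF v] by blast
  define C where "C = B + B' + 1"
  have C: "C > 0" "B \<le> C" "B' \<le> C" using B(1) B'(1) by (auto simp: C_def)
  fix e :: real assume "e > 0"
  then have e: "0 < e / (2 * C)" using C by simp
  obtain M where M: "\<And>m n. m \<ge> M \<Longrightarrow> n \<ge> M \<Longrightarrow> anorm A (\<lambda>g. u m g - u n g) < e / (2 * C)"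
    using cauchy_seqsD[OF u e] by blast
  obtain M' where M': "\<And>m n. m \<ge> M' \<Longrightarrow> n \<ge> M' \<Longrightarrow> anorm A (\<lambda>g. v m g - v n g) < e / (2 * C)"
    using cauchy_seqsD[OF v e] by blast
  have "anorm A (\<lambda>g. mult A (u m) (v m) g - mult A (u n) (v n) g) < e"
    if mn: "m \<ge> max M M'" "n \<ge> max M M'" for m n
  proof -
    have "anorm A (\<lambda>g. mult A (u m) (v m) g - mult A (u n) (v n) g)
        \<le> C * anorm A (\<lambda>g. u m g - u n g) + C * anorm A (\<lambda>g. v m g - v n g)"
      by (intro norm_mult_diff cauchy_seqs_in u v order_trans[OF B(2) C(2)] order_trans[OF B'(2) C(3)])
    also have "\<dots> < C * (e / (2 * C)) + C * (e / (2 * C))"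
      using M[of m n] M'[of m n] mn C by (intro add_strict_mono mult_strict_left_mono) auto
    also have "\<dots> = e" using C by simp
    finally show ?thesis .
  qed
  then show "\<exists>M. \<forall>m\<ge>M. \<forall>n\<ge>M. anorm A (\<lambda>g. mult A (u m) (v m) g - mult A (u n) (v n) g) < e" by blast
qed

lemma cauchy_rel_mult:
  assumes "(u, u') \<in> cauchy_rel A" "(v, v') \<in> cauchy_rel A"
  shows "(\<lambda>n. mult A (u n) (v n), \<lambda>n. mult A (u' n) (v' n)) \<in> cauchy_rel A"
proof -
  have s: "u \<in> cauchy_seqs A" "u' \<in> cauchy_seqs A" "v \<in> cauchy_seqs A" "v' \<in> cauchy_seqs A"
    and lim: "(\<lambda>n. anorm A (\<lambda>g. u n g - u' n g)) \<longlonglongrightarrow> 0" "(\<lambda>n. anorm A (\<lambda>g. v n g - v' n g)) \<longlonglongrightarrow> 0"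
    using assms by (auto simp: cauchy_rel_iff)
  obtain B where B: "0 \<le> B" "\<And>n. anorm A (u' n) \<le> B" using cauchy_seqs_bounded[OF s(2)] by blast
  obtain B' where B': "0 \<le> B'" "\<And>n. anorm A (v n) \<le> B'" using cauchy_seqs_bounded[OF s(3)] by blast
  have "(\<lambda>n. anorm A (\<lambda>g. mult A (u n) (v n) g - mult A (u' n) (v' n) g)) \<longlonglongrightarrow> 0"
  proof (rule tendsto_sandwich[OF always_eventually always_eventually])
    show "\<forall>n. 0 \<le> anorm A (\<lambda>g. mult A (u n) (v n) g - mult A (u' n) (v' n) g)"
      by (intro allI norm_nonneg diff_in mult_in cauchy_seqs_in s)
    show "\<forall>n. anorm A (\<lambda>g. mult A (u n) (v n) g - mult A (u' n) (v' n) g)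
        \<le> B' * anorm A (\<lambda>g. u n g - u' n g) + B * anorm A (\<lambda>g. v n g - v' n g)"
      by (intro allI norm_mult_diff cauchy_seqs_in s B B')
    show "(\<lambda>n. B' * anorm A (\<lambda>g. u n g - u' n g) + B * anorm A (\<lambda>g. v n g - v' n g)) \<longlonglongrightarrow> 0"
      using tendsto_add[OF tendsto_mult_right_zero[OF lim(1), of B'] tendsto_mult_right_zero[OF lim(2), of B]]
      by simp
  qed simp
  with s show ?thesis by (simp add: cauchy_rel_iff cauchy_seqs_mult)
qed

lemma completion_mult:
  assumes u: "u \<in> cauchy_seqs A" and v: "v \<in> cauchy_seqs A"
  shows "mult (cstar_completion A) (cls u) (cls v) = cls (\<lambda>n. mult A (u n) (v n))"
proof -
  have "(\<Union>u'\<in>cls u. \<Union>v'\<in>cls v. cls (\<lambda>n. mult A (u' n) (v' n))) = (\<Union>v'\<in>cls v. cls (\<lambda>n. mult A (u n) (v' n)))"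
  proof (rule union_cls[OF u])
    fix u' assume u': "(u, u') \<in> cauchy_rel A"
    have "cls (\<lambda>n. mult A (u' n) (v' n)) = cls (\<lambda>n. mult A (u n) (v' n))" if "v' \<in> cls v" for v'
    proof -
      have v': "(v', v') \<in> cauchy_rel A" using that by (auto simp: mem_cls cauchy_rel_iff norm_zero)
      note r = cauchy_rel_sym[OF cauchy_rel_mult[OF u' v']]
      then show ?thesis using cls_eq_iff by (simp add: cauchy_rel_iff)
    qed
    then show "(\<Union>v'\<in>cls v. cls (\<lambda>n. mult A (u' n) (v' n))) = (\<Union>v'\<in>cls v. cls (\<lambda>n. mult A (u n) (v' n)))"
      by simp
  qed
  also have "\<dots> = cls (\<lambda>n. mult A (u n) (v n))"
  proof (rule union_cls[OF v])
    fix v' assume "(v, v') \<in> cauchy_rel A"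
    from cauchy_rel_sym[OF cauchy_rel_mult[OF cauchy_rel_refl[OF u] this]]
    show "cls (\<lambda>n. mult A (u n) (v' n)) = cls (\<lambda>n. mult A (u n) (v n))"
      using cls_eq_iff by (simp add: cauchy_rel_iff)
  qed
  finally show ?thesis by (simp add: cstar_completion_def cls_def)
qed

lemma cauchy_seqs_star:
  assumes u: "u \<in> cauchy_seqs A"
  shows "(\<lambda>n. star A (u n)) \<in> cauchy_seqs A"
proof -
  have "anorm A (\<lambda>g. star A (u m) g - star A (u n) g) \<le> anorm A (\<lambda>g. u m g - u n g)" for m n
    using norm_star[OF diff_in[OF cauchy_seqs_in[OF u] cauchy_seqs_in[OF u]], of m n]
    by (simp add: star_diff cauchy_seqs_in[OF u])
  then have le: "anorm A (\<lambda>g. star A (u m) g - star A (u n) g) < e"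
    if "anorm A (\<lambda>g. u m g - u n g) < e" for m n e
    using that by (rule order_le_less_trans)
  show ?thesis
    unfolding cauchy_seqs_iff
  proof (intro conjI allI impI)
    show "star A (u n) \<in> carrier A" for n by (rule star_in[OF cauchy_seqs_in[OF u]])
    fix e :: real assume "e > 0"
    then obtain M where "\<And>m n. m \<ge> M \<Longrightarrow> n \<ge> M \<Longrightarrow> anorm A (\<lambda>g. u m g - u n g) < e"
      using cauchy_seqsD[OF u] by blast
    then show "\<exists>M. \<forall>m\<ge>M. \<forall>n\<ge>M. anorm A (\<lambda>g. star A (u m) g - star A (u n) g) < e"
      using le by blast
  qed
qed

lemma cauchy_rel_star:
  assumes "(u, u') \<in> cauchy_rel A"
  shows "(\<lambda>n. star A (u n), \<lambda>n. star A (u' n)) \<in> cauchy_rel A"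
proof -
  have s: "u \<in> cauchy_seqs A" "u' \<in> cauchy_seqs A"
    and lim: "(\<lambda>n. anorm A (\<lambda>g. u n g - u' n g)) \<longlonglongrightarrow> 0"
    using assms by (auto simp: cauchy_rel_iff)
  have "(\<lambda>n. anorm A (\<lambda>g. star A (u n) g - star A (u' n) g)) \<longlonglongrightarrow> 0"
  proof (rule tendsto_sandwich[OF always_eventually always_eventually])
    show "\<forall>n. 0 \<le> anorm A (\<lambda>g. star A (u n) g - star A (u' n) g)"
      by (intro allI norm_nonneg diff_in star_in cauchy_seqs_in s)
    show "\<forall>n. anorm A (\<lambda>g. star A (u n) g - star A (u' n) g) \<le> anorm A (\<lambda>g. u n g - u' n g)"
      using norm_star[OF diff_in[OF cauchy_seqs_in[OF s(1)] cauchy_seqs_in[OF s(2)]]]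
      by (simp add: star_diff cauchy_seqs_in[OF s(1)] cauchy_seqs_in[OF s(2)])
  qed (simp_all add: lim)
  with s show ?thesis by (simp add: cauchy_rel_iff cauchy_seqs_star)
qed

lemma completion_star:
  assumes u: "u \<in> cauchy_seqs A"
  shows "star (cstar_completion A) (cls u) = cls (\<lambda>n. star A (u n))"
proof -
  have "(\<Union>u'\<in>cls u. cls (\<lambda>n. star A (u' n))) = cls (\<lambda>n. star A (u n))"
  proof (rule union_cls[OF u])
    fix u' assume "(u, u') \<in> cauchy_rel A"
    from cauchy_rel_sym[OF cauchy_rel_star[OF this]]
    show "cls (\<lambda>n. star A (u' n)) = cls (\<lambda>n. star A (u n))"
      using cls_eq_iff by (simp add: cauchy_rel_iff)
  qed
  then show ?thesis by (simp add: cstar_completion_def cls_def)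
qed

end

section \<open>Extension of bounded maps to completions\<close>

locale bounded_function_map = A: seminormed_functions A + B: seminormed_functions B
  for A :: "('g \<Rightarrow> complex) star_algebra" and B :: "('h \<Rightarrow> complex) star_algebra" +
  fixes T :: "('g \<Rightarrow> complex) \<Rightarrow> ('h \<Rightarrow> complex)" and c :: real
  assumes map_in: "f \<in> carrier A \<Longrightarrow> T f \<in> carrier B"
    and map_diff: "f \<in> carrier A \<Longrightarrow> f' \<in> carrier A \<Longrightarrow> T (\<lambda>g. f g - f' g) = (\<lambda>g. T f g - T f' g)"
    and map_bound: "f \<in> carrier A \<Longrightarrow> anorm B (T f) \<le> c * anorm A f"
begin

text \<open>The constant \<open>c\<close> comes without a sign. It is replaced by a positive one, by
  which an error bound can be divided.\<close>

lemma map_bound_diff: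
  assumes "f \<in> carrier A" "f' \<in> carrier A"
  shows "anorm B (\<lambda>g. T f g - T f' g) \<le> (\<bar>c\<bar> + 1) * anorm A (\<lambda>g. f g - f' g)"
proof -
  have "anorm B (T (\<lambda>g. f g - f' g)) \<le> c * anorm A (\<lambda>g. f g - f' g)"
    by (rule map_bound[OF A.diff_in[OF assms]])
  also have "\<dots> \<le> (\<bar>c\<bar> + 1) * anorm A (\<lambda>g. f g - f' g)"
    by (intro mult_right_mono A.norm_nonneg A.diff_in assms) simp
  finally show ?thesis by (simp add: map_diff assms)
qed

lemma map_cauchy_seqs:
  assumes u: "u \<in> cauchy_seqs A"
  shows "(\<lambda>n. T (u n)) \<in> cauchy_seqs B"
  unfolding B.cauchy_seqs_iff
proof (intro conjI allI impI)
  show "T (u n) \<in> carrier B" for n by (rule map_in[OF A.cauchy_seqs_in[OF u]])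
  fix e :: real assume "e > 0"
  then have "e / (\<bar>c\<bar> + 1) > 0" by simp
  then obtain M where M: "\<And>m n. m \<ge> M \<Longrightarrow> n \<ge> M \<Longrightarrow> anorm A (\<lambda>g. u m g - u n g) < e / (\<bar>c\<bar> + 1)"
    using A.cauchy_seqsD[OF u] by blast
  have "anorm B (\<lambda>g. T (u m) g - T (u n) g) < e" if mn: "m \<ge> M" "n \<ge> M" for m n
  proof -
    have "(\<bar>c\<bar> + 1) * anorm A (\<lambda>g. u m g - u n g) < e"
      using M[OF mn] by (simp add: pos_less_divide_eq mult.commute)
    with map_bound_diff[OF A.cauchy_seqs_in[OF u] A.cauchy_seqs_in[OF u], of m n] show ?thesis by simp
  qed
  then show "\<exists>M. \<forall>m\<ge>M. \<forall>n\<ge>M. anorm B (\<lambda>g. T (u m) g - T (u n) g) < e" by blast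
qed

lemma map_cauchy_rel:
  assumes "(u, u') \<in> cauchy_rel A"
  shows "(\<lambda>n. T (u n), \<lambda>n. T (u' n)) \<in> cauchy_rel B"
proof -
  have s: "u \<in> cauchy_seqs A" "u' \<in> cauchy_seqs A"
    and lim: "(\<lambda>n. anorm A (\<lambda>g. u n g - u' n g)) \<longlonglongrightarrow> 0"
    using assms by (auto simp: A.cauchy_rel_iff)
  have "(\<lambda>n. anorm B (\<lambda>g. T (u n) g - T (u' n) g)) \<longlonglongrightarrow> 0"
  proof (rule tendsto_sandwich[OF always_eventually always_eventually])
    show "\<forall>n. 0 \<le> anorm B (\<lambda>g. T (u n) g - T (u' n) g)"
      by (intro allI B.norm_nonneg B.diff_in map_in A.cauchy_seqs_in s)
    show "\<forall>n. anorm B (\<lambda>g. T (u n) g - T (u' n) g) \<le> (\<bar>c\<bar> + 1) * anorm A (\<lambda>g. u n g - u' n g)"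
      by (intro allI map_bound_diff A.cauchy_seqs_in s)
    show "(\<lambda>n. (\<bar>c\<bar> + 1) * anorm A (\<lambda>g. u n g - u' n g)) \<longlonglongrightarrow> 0"
      by (rule tendsto_mult_right_zero[OF lim])
  qed simp
  with s show ?thesis by (simp add: B.cauchy_rel_iff map_cauchy_seqs)
qed

lemma completion_map_cls:
  assumes u: "u \<in> cauchy_seqs A"
  shows "completion_map B T (A.cls u) = B.cls (\<lambda>n. T (u n))"
proof -
  have "(\<Union>u'\<in>A.cls u. B.cls (\<lambda>n. T (u' n))) = B.cls (\<lambda>n. T (u n))"
  proof (rule A.union_cls[OF u])
    fix u' assume "(u, u') \<in> cauchy_rel A"
    from B.cauchy_rel_sym[OF map_cauchy_rel[OF this]]
    show "B.cls (\<lambda>n. T (u' n)) = B.cls (\<lambda>n. T (u n))"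
      using B.cls_eq_iff by (simp add: B.cauchy_rel_iff)
  qed
  then show ?thesis by (simp add: completion_map_def B.cls_def)
qed

end

section \<open>The algebras of the groupoid, its boundary and the complement\<close>

lemma Cc_cong: "gtop G = gtop H \<Longrightarrow> Cc G = Cc H"
  by (simp add: Cc_def Cc_on_def)

lemma arrows_over_Omega: "arrows_over Omega = arrows groupoid_P"
  by (auto simp: arrows_over_def arrow_src_Omega)

text \<open>\<open>Cc\<close> depends only on the topology, and the whole groupoid has the same
  topology as its reduction to \<open>Omega\<close>, so that the description of reductions
  applies.\<close>

lemma Cc_groupoid_P:
  "Cc (groupoid_P :: ('a::left_cancellative_monoid germ, 'a character) groupoid)
    = bisection_span (compact_generator Omega)" (is "Cc ?G = _")
proof -
  have "gtop (reduction ?G Omega) = gtop ?G"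
    by (simp add: gtop_reduction[OF invariant_set_Omega] arrows_over_Omega flip: topspace_gtop)
  then have "Cc ?G = Cc (reduction ?G Omega)" by (rule Cc_cong[OF sym])
  also have "\<dots> = bisection_span (compact_generator Omega)"
    by (rule Cc_reduction[OF invariant_set_Omega locally_compact_closed[OF closed_Omega]])
  finally show ?thesis .
qed

lemma Cc_boundary: "Cc boundary_groupoid_P = bisection_span (compact_generator boundary_Omega)"
  unfolding boundary_groupoid_P_def
  by (rule Cc_reduction[OF invariant_set_boundary locally_compact_closed[OF closed_boundary]])

abbreviation off_boundary_groupoid ::
    "('a::left_cancellative_monoid germ, 'a character) groupoid" where
  "off_boundary_groupoid \<equiv> groupoid_diff groupoid_P boundary_groupoid_P"

lemma arrows_off_boundary: "arrows off_boundary_groupoid = arrows_over (Omega - boundary_Omega)"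
  by (auto simp: groupoid_diff_def boundary_groupoid_P_def arrows_reduction[OF invariant_set_boundary]
      arrows_over_def arrow_src_Omega)

lemma off_boundary_simps [simp]:
  "units off_boundary_groupoid = Omega - boundary_Omega"
  "src off_boundary_groupoid = src groupoid_P" "rng off_boundary_groupoid = rng groupoid_P"
  "gmult off_boundary_groupoid = gmult groupoid_P" "ginv off_boundary_groupoid = ginv groupoid_P"
  by (simp_all add: groupoid_diff_def boundary_groupoid_P_def)

lemma Cc_off_boundary:
  "Cc (off_boundary_groupoid :: ('a::left_cancellative_monoid germ, 'a character) groupoid)
    = bisection_span (compact_generator (Omega - boundary_Omega))" (is "Cc ?G = _")
proof -
  have "gtop ?G = subtopology (gtop groupoid_P) (arrows ?G)"
    by (simp add: groupoid_diff_def)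
  also have "\<dots> = gtop (reduction groupoid_P (Omega - boundary_Omega))"
    by (simp only: arrows_off_boundary gtop_reduction[OF invariant_set_off_boundary])
  finally have "Cc ?G = Cc (reduction groupoid_P (Omega - boundary_Omega))" by (rule Cc_cong)
  also have "\<dots> = bisection_span (compact_generator (Omega - boundary_Omega))"
    by (rule Cc_reduction[OF invariant_set_off_boundary locally_compact_Diff[OF closed_boundary]])
  finally show ?thesis .
qed

text \<open>An arrow with the same range as an arrow over an invariant set lies over that set too.
  Sums over range fibres thus run over the same arrows in the reduction.\<close>

lemma range_fibre_invariant:
  assumes "invariant_set D" "a \<in> arrows_over D"
  shows "{h \<in> arrows_over D. rng groupoid_P h = rng groupoid_P a}
    = {h \<in> arrows groupoid_P. rng groupoid_P h = rng groupoid_P a}"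
proof -
  have "rng groupoid_P a \<in> D"
    using assms(2) rng_invariant_iff[OF assms(1)] by (simp add: arrows_over_def)
  then have "src groupoid_P h \<in> D" if "h \<in> arrows groupoid_P" "rng groupoid_P h = rng groupoid_P a" for h
    using rng_invariant_iff[OF assms(1) that(1)] that(2) by simp
  then show ?thesis by (auto simp: arrows_over_def)
qed

lemma regular_rep_off_boundary:
  assumes "x \<in> Omega - boundary_Omega"
  shows "regular_rep off_boundary_groupoid x f = regular_rep groupoid_P x f"
proof
  fix \<xi>
  have "(if a \<in> arrows off_boundary_groupoid \<and> src groupoid_P a = x
      then \<Sum>\<^sub>\<infinity>h\<in>{h \<in> arrows off_boundary_groupoid. rng groupoid_P h = rng groupoid_P a}.
        f h * ell2_apply \<xi> (gmult groupoid_P (ginv groupoid_P h) a) else 0)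
    = (if a \<in> arrows groupoid_P \<and> src groupoid_P a = x
      then \<Sum>\<^sub>\<infinity>h\<in>{h \<in> arrows groupoid_P. rng groupoid_P h = rng groupoid_P a}.
        f h * ell2_apply \<xi> (gmult groupoid_P (ginv groupoid_P h) a) else 0)" for a
  proof (cases "a \<in> arrows groupoid_P \<and> src groupoid_P a = x")
    case True
    then have a: "a \<in> arrows_over (Omega - boundary_Omega)" using assms by (simp add: arrows_over_def)
    show ?thesis
      unfolding arrows_off_boundary range_fibre_invariant[OF invariant_set_off_boundary a] using True a by simp
  next
    case False
    then have "\<not> (a \<in> arrows off_boundary_groupoid \<and> src groupoid_P a = x)"
      unfolding arrows_off_boundary by (auto simp: arrows_over_def)
    with False show ?thesis by (simp only: if_False)
  qed
  then show "regular_rep off_boundary_groupoid x f \<xi> = regular_rep groupoid_P x f \<xi>"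
    by (simp only: regular_rep_def off_boundary_simps)
qed

text \<open>At units of the boundary the function acts by 0, because the arrows that enter the sums
  lie over the boundary; at the other units the two representations agree. Extension by zero is thus
  isometric.\<close>

lemma reduced_norm_off_boundary:
  assumes f: "f \<in> bisection_span (compact_generator (Omega - boundary_Omega))"
  shows "reduced_norm off_boundary_groupoid f = reduced_norm groupoid_P f"
proof -
  have fb: "f \<in> bounded_span" by (rule compact_span_bounded_span[OF f])
  have 0: "onorm (regular_rep groupoid_P x f) = 0" if x: "x \<in> boundary_Omega" for x
  proof -
    have "regular_rep groupoid_P x f \<xi> = 0" for \<xi>
    proof (rule ell2_eqI)
      fix a
      have "left_conv f (ell2_apply \<xi>) a = 0" if a: "a \<in> arrows groupoid_P" "src groupoid_P a = x"
        unfolding left_conv_def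
      proof (rule infsum_0)
        fix h assume h: "h \<in> {h \<in> arrows groupoid_P. rng groupoid_P h = rng groupoid_P a}"
        then have "src groupoid_P h \<in> boundary_Omega"
          using rng_invariant_iff[OF invariant_set_boundary, of h]
            rng_invariant_iff[OF invariant_set_boundary a(1)] a(2) x by simp
        then have "h \<notin> arrows_over (Omega - boundary_Omega)" by (simp add: arrows_over_def)
        from compact_span_arrows_over[OF _ this f]
        show "f h * ell2_apply \<xi> (gmult groupoid_P (ginv groupoid_P h) a) = 0" by simp
      qed
      then show "ell2_apply (regular_rep groupoid_P x f \<xi>) a = ell2_apply 0 a"
        by (simp add: ell2_apply_regular_rep[OF fb])
    qed
    then have "regular_rep groupoid_P x f = (\<lambda>_. 0)" by (rule ext)
    then show ?thesis by (simp only: onorm_zero)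
  qed
  have "insert 0 ((\<lambda>x. onorm (regular_rep off_boundary_groupoid x f)) ` (Omega - boundary_Omega))
      = insert 0 ((\<lambda>x. onorm (regular_rep groupoid_P x f)) ` (Omega - boundary_Omega))"
    by (intro arg_cong[where f = "insert 0"] image_cong refl) (simp only: regular_rep_off_boundary)
  also have "\<dots> = insert 0 ((\<lambda>x. onorm (regular_rep groupoid_P x f)) ` Omega)"
    using 0 by auto
  finally show ?thesis by (simp only: reduced_norm_def off_boundary_simps units_groupoid_P)
qed

lemma convolution_algebra_simps [simp]:
  "carrier (convolution_algebra G N) = Cc G" "zero (convolution_algebra G N) = (\<lambda>_. 0)"
  "add (convolution_algebra G N) f h = (\<lambda>g. f g + h g)"
  "scale (convolution_algebra G N) c f = (\<lambda>g. c * f g)"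
  "mult (convolution_algebra G N) = convolution G" "star (convolution_algebra G N) = involution G"
  "anorm (convolution_algebra G N) = N"
  by (simp_all add: convolution_algebra_def)

lemma convolution_diff_left:
  assumes "f \<in> bounded_span" "f' \<in> bounded_span"
  shows "convolution groupoid_P (\<lambda>g. f g - f' g) h
    = (\<lambda>g. convolution groupoid_P f h g - convolution groupoid_P f' h g)"
  using convolution_add_left[OF assms(1) bounded_span_scale[OF assms(2), of "- 1"], of h]
  by (simp add: convolution_left_conv left_conv_scale_left[of "- 1", simplified] fun_eq_iff)

lemma convolution_diff_right:
  assumes "f \<in> bounded_span"
  shows "convolution groupoid_P f (\<lambda>g. h g - h' g)
    = (\<lambda>g. convolution groupoid_P f h g - convolution groupoid_P f h' g)"
  using convolution_add_right[OF assms, of h "\<lambda>g. - 1 * h' g"]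
  by (simp add: convolution_left_conv left_conv_scale_right[of _ "- 1", simplified] fun_eq_iff)

lemma involution_diff:
  "involution G (\<lambda>g. f g - f' g) = (\<lambda>g. involution G f g - involution G f' g)"
  by (auto simp: involution_def)

interpretation full: seminormed_function_algebra
  "reduced_Cc (groupoid_P :: ('a::left_cancellative_monoid germ, 'a character) groupoid)"
proof
  note b = compact_span_bounded_span
  let ?A = "reduced_Cc (groupoid_P :: ('a germ, 'a character) groupoid)"
  fix f h k :: "'a germ \<Rightarrow> complex" and c :: complex
  show "zero ?A = (\<lambda>_. 0)" "add ?A f h = (\<lambda>g. f g + h g)" "scale ?A c f = (\<lambda>g. c * f g)"
    "(\<lambda>_. 0) \<in> carrier ?A" "anorm ?A (\<lambda>_. 0) = 0"
    by (simp_all add: reduced_Cc_def Cc_groupoid_P bisection_span.zero)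
  assume "f \<in> carrier ?A"
  then have f: "f \<in> bisection_span (compact_generator Omega)" by (simp add: reduced_Cc_def Cc_groupoid_P)
  show "(\<lambda>g. c * f g) \<in> carrier ?A" "anorm ?A (\<lambda>g. c * f g) \<le> cmod c * anorm ?A f"
    "star ?A f \<in> carrier ?A" "anorm ?A (star ?A f) \<le> anorm ?A f"
    using f b[OF f] by (simp_all add: reduced_Cc_def Cc_groupoid_P compact_span_scale reduced_norm_scale
        compact_span_involution[OF invariant_set_Omega] reduced_norm_involution)
  assume "h \<in> carrier ?A"
  then have h: "h \<in> bisection_span (compact_generator Omega)" by (simp add: reduced_Cc_def Cc_groupoid_P)
  show "(\<lambda>g. f g + h g) \<in> carrier ?A" "anorm ?A (\<lambda>g. f g + h g) \<le> anorm ?A f + anorm ?A h"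
    "mult ?A f h \<in> carrier ?A" "anorm ?A (mult ?A f h) \<le> anorm ?A f * anorm ?A h"
    "star ?A (\<lambda>g. f g - h g) = (\<lambda>g. star ?A f g - star ?A h g)"
    using f h b[OF f] b[OF h] compact_span_convolution[OF invariant_set_Omega invariant_set_Omega f h]
    by (simp_all add: reduced_Cc_def Cc_groupoid_P bisection_span_add reduced_norm_add
        reduced_norm_convolution involution_diff)
  assume "k \<in> carrier ?A"
  then have k: "k \<in> bisection_span (compact_generator Omega)" by (simp add: reduced_Cc_def Cc_groupoid_P)
  show "mult ?A (\<lambda>g. f g - h g) k = (\<lambda>g. mult ?A f k g - mult ?A h k g)"
    "mult ?A k (\<lambda>g. f g - h g) = (\<lambda>g. mult ?A k f g - mult ?A k h g)"
    using b[OF f] b[OF h] b[OF k] by (simp_all add: reduced_Cc_def convolution_diff_left convolution_diff_right)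
qed

text \<open>Functions on a groupoid are total and vanish off its arrows, so that extension by zero
  is the identity, and the constant is 1 by the equality of norms.\<close>

interpretation ideal: bounded_function_map
  "reduced_Cc (off_boundary_groupoid :: ('a::left_cancellative_monoid germ, 'a character) groupoid)"
  "reduced_Cc (groupoid_P :: ('a germ, 'a character) groupoid)" "\<lambda>f. f" 1
proof
  let ?A = "reduced_Cc (off_boundary_groupoid :: ('a germ, 'a character) groupoid)"
  let ?G = "reduced_Cc (groupoid_P :: ('a germ, 'a character) groupoid)"
  note b = compact_span_bounded_span
  fix f h :: "'a germ \<Rightarrow> complex" and c :: complex
  show "zero ?A = (\<lambda>_. 0)" "add ?A f h = (\<lambda>g. f g + h g)" "scale ?A c f = (\<lambda>g. c * f g)"
    "(\<lambda>_. 0) \<in> carrier ?A" "anorm ?A (\<lambda>_. 0) = 0"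
    by (simp_all add: reduced_Cc_def Cc_off_boundary bisection_span.zero reduced_norm_off_boundary)
  assume "f \<in> carrier ?A"
  then have f: "f \<in> bisection_span (compact_generator (Omega - boundary_Omega))"
    by (simp add: reduced_Cc_def Cc_off_boundary)
  show "(\<lambda>g. c * f g) \<in> carrier ?A" "anorm ?A (\<lambda>g. c * f g) \<le> cmod c * anorm ?A f"
    "f \<in> carrier ?G" "anorm ?G f \<le> 1 * anorm ?A f"
    using f b[OF f] by (simp_all add: reduced_Cc_def Cc_off_boundary Cc_groupoid_P compact_span_scale
        reduced_norm_scale reduced_norm_off_boundary compact_span_off_boundary_subset)
  assume "h \<in> carrier ?A"
  then have h: "h \<in> bisection_span (compact_generator (Omega - boundary_Omega))"
    by (simp add: reduced_Cc_def Cc_off_boundary)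
  show "(\<lambda>g. f g + h g) \<in> carrier ?A" "anorm ?A (\<lambda>g. f g + h g) \<le> anorm ?A f + anorm ?A h"
    using f h b[OF f] b[OF h]
    by (simp_all add: reduced_Cc_def Cc_off_boundary bisection_span_add reduced_norm_add reduced_norm_off_boundary)
qed simp

lemma carrier_full: "carrier (reduced_Cc groupoid_P) = bisection_span (compact_generator Omega)"
  by (simp add: reduced_Cc_def Cc_groupoid_P)

lemma full_in_bounded_span:
  "u \<in> cauchy_seqs (reduced_Cc groupoid_P) \<Longrightarrow> u n \<in> bounded_span"
  using full.cauchy_seqs_in carrier_full compact_span_bounded_span by blast

lemma reduced_Cc_simps [simp]:
  "anorm (reduced_Cc G) = reduced_norm G" "mult (reduced_Cc G) = convolution G" "star (reduced_Cc G) = involution G"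
  by (simp_all add: reduced_Cc_def)

lemma carrier_reduced_cstar: "carrier (reduced_cstar groupoid_P) = full.cls ` cauchy_seqs (reduced_Cc groupoid_P)"
  by (simp add: reduced_cstar_def full.completion_carrier)

text \<open>\<open>rho_e_Cc\<close> is bounded by the reduced norm, so that equivalent Cauchy
  sequences have images with the same limit, and one representative settles the definite
  description.\<close>

lemma rho_e_cls:
  assumes u: "u \<in> cauchy_seqs (reduced_Cc groupoid_P)" and T: "(\<lambda>n. rho_e_Cc (u n)) \<longlonglongrightarrow> T"
  shows "rho_e (full.cls u) = T"
  unfolding rho_e_def
proof (rule the_equality)
  show "\<forall>v\<in>full.cls u. (\<lambda>n. rho_e_Cc (v n)) \<longlonglongrightarrow> T"
  proof
    fix v assume "v \<in> full.cls u"
    then have v: "v \<in> cauchy_seqs (reduced_Cc groupoid_P)"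
      "(\<lambda>n. reduced_norm groupoid_P (\<lambda>g. v n g - u n g)) \<longlonglongrightarrow> 0"
      using full.cauchy_rel_sym by (auto simp: full.mem_cls full.cauchy_rel_iff)
    have "(\<lambda>n. rho_e_Cc (v n) - rho_e_Cc (u n)) \<longlonglongrightarrow> 0"
    proof (rule Lim_null_comparison[OF always_eventually v(2)], rule allI)
      fix n
      have "(\<lambda>g. v n g - u n g) \<in> bounded_span"
        using bisection_span_add[OF full_in_bounded_span[OF v(1), of n] bounded_span_scale[OF full_in_bounded_span[OF u, of n], of "- 1"]]
        by simp
      from norm_rho_e_Cc_le[OF this]
      show "norm (rho_e_Cc (v n) - rho_e_Cc (u n)) \<le> reduced_norm groupoid_P (\<lambda>g. v n g - u n g)"
        by (simp add: rho_e_Cc_diff full_in_bounded_span u v(1))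
    qed
    from tendsto_add[OF this T] show "(\<lambda>n. rho_e_Cc (v n)) \<longlonglongrightarrow> T" by simp
  qed
  fix S assume "\<forall>v\<in>full.cls u. (\<lambda>n. rho_e_Cc (v n)) \<longlonglongrightarrow> S"
  moreover have "u \<in> full.cls u" by (simp add: full.mem_cls full.cauchy_rel_refl u)
  ultimately show "S = T" using T LIMSEQ_unique by blast
qed

lemma rho_e_cls_limit:
  assumes u: "u \<in> cauchy_seqs (reduced_Cc groupoid_P)"
  shows "(\<lambda>n. rho_e_Cc (u n)) \<longlonglongrightarrow> rho_e (full.cls u)" "rho_e (full.cls u) \<in> operator_closure Omega"
proof -
  have "Cauchy (\<lambda>n. rho_e_Cc (u n))"
  proof (rule metric_CauchyI)
    fix e :: real assume "e > 0"
    then obtain M where M: "\<And>m n. m \<ge> M \<Longrightarrow> n \<ge> M \<Longrightarrow> reduced_norm groupoid_P (\<lambda>g. u m g - u n g) < e"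
      using full.cauchy_seqsD[OF u] by auto
    have "dist (rho_e_Cc (u m)) (rho_e_Cc (u n)) < e" if mn: "m \<ge> M" "n \<ge> M" for m n
    proof -
      have "(\<lambda>g. u m g - u n g) \<in> bounded_span"
        using bisection_span_add[OF full_in_bounded_span[OF u, of m] bounded_span_scale[OF full_in_bounded_span[OF u, of n], of "- 1"]]
        by simp
      from norm_rho_e_Cc_le[OF this] M[OF mn] show ?thesis
        by (simp add: rho_e_Cc_diff full_in_bounded_span u dist_norm)
    qed
    then show "\<exists>M. \<forall>m\<ge>M. \<forall>n\<ge>M. dist (rho_e_Cc (u m)) (rho_e_Cc (u n)) < e" by blast
  qed
  then obtain T where T: "(\<lambda>n. rho_e_Cc (u n)) \<longlonglongrightarrow> T"
    using Cauchy_convergent convergent_def by blast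
  then show lim: "(\<lambda>n. rho_e_Cc (u n)) \<longlonglongrightarrow> rho_e (full.cls u)"
    using rho_e_cls[OF u T] by simp
  show "rho_e (full.cls u) \<in> operator_closure Omega"
    by (rule operator_closure_lim[OF _ lim]) (use full.cauchy_seqs_in[OF u] carrier_full in blast)
qed

section \<open>The quotient by the foundation ideal\<close>

lemma coset_eq_iff:
  "coset monoid_cstar foundation_ideal S = coset monoid_cstar foundation_ideal T
    \<longleftrightarrow> S - T \<in> foundation_ideal"
proof -
  let ?I = "operator_closure (Omega - boundary_Omega)"
  have neg: "- k \<in> ?I" if "k \<in> ?I" for k :: "'a ell2 \<Rightarrow>\<^sub>L 'a ell2"
  proof -
    have "scale bounded_operators (- 1) k = - k"
      by (rule blinfun_eqI) (simp only: scale_bounded_operators_apply ell2_scale_minus_one blinfun.minus_left)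
    with operator_closure_scale[OF that, of "- 1"] show ?thesis by simp
  qed
  have sub: "coset monoid_cstar ?I S \<subseteq> coset monoid_cstar ?I T" if "S - T \<in> ?I" for S T :: "'a ell2 \<Rightarrow>\<^sub>L 'a ell2"
  proof
    fix x assume "x \<in> coset monoid_cstar ?I S"
    then obtain k where k: "x = S + k" "k \<in> ?I" by (auto simp: coset_def)
    then have "x = T + ((S - T) + k)" "(S - T) + k \<in> ?I"
      using operator_closure_add[OF that k(2)] by simp_all
    then show "x \<in> coset monoid_cstar ?I T" unfolding coset_def monoid_cstar_simps by blast
  qed
  show ?thesis
    unfolding foundation_ideal_eq
  proof
    assume eq: "coset monoid_cstar ?I S = coset monoid_cstar ?I T"
    have "S + 0 \<in> coset monoid_cstar ?I S"
      unfolding coset_def monoid_cstar_simps using operator_closure_zero by blast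
    then have "S + 0 \<in> coset monoid_cstar ?I T" unfolding eq .
    then obtain k where "S = T + k" "k \<in> ?I" by (auto simp: coset_def)
    then show "S - T \<in> ?I" by simp
  next
    assume ST: "S - T \<in> ?I"
    with neg[OF ST] show "coset monoid_cstar ?I S = coset monoid_cstar ?I T"
      using sub[of S T] sub[of T S] by auto
  qed
qed

lemma quotient_proj_eq_iff: "quotient_proj S = quotient_proj T \<longleftrightarrow> S - T \<in> foundation_ideal"
  by (simp add: quotient_proj_def coset_eq_iff)

lemma mem_quotient_proj: "x \<in> quotient_proj S \<longleftrightarrow> x - S \<in> foundation_ideal"
proof -
  have "x \<in> quotient_proj S \<longleftrightarrow> (\<exists>k\<in>foundation_ideal. x = S + k)"
    by (auto simp: quotient_proj_def coset_def)
  also have "\<dots> \<longleftrightarrow> x - S \<in> foundation_ideal" by (metis add_diff_cancel_left' add.commute diff_add_cancel)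
  finally show ?thesis .
qed

lemma foundation_ideal_closed:
  assumes "k \<in> foundation_ideal"
  shows foundation_ideal_add: "l \<in> foundation_ideal \<Longrightarrow> k + l \<in> foundation_ideal"
    and foundation_ideal_scale: "scale bounded_operators c k \<in> foundation_ideal"
    and foundation_ideal_mult: "S \<in> operator_closure Omega \<Longrightarrow> S o\<^sub>L k \<in> foundation_ideal"
      "S \<in> operator_closure Omega \<Longrightarrow> k o\<^sub>L S \<in> foundation_ideal"
    and foundation_ideal_star: "star bounded_operators k \<in> foundation_ideal"
  using assms closed_ideal_off_boundary operator_closure_star[OF invariant_set_off_boundary]
  by (auto simp: foundation_ideal_eq operator_closure_add operator_closure_scale closed_ideal_def monoid_cstar_carrier)

lemma star_bounded_operators_diff:
  assumes "S \<in> operator_closure Omega" "T \<in> operator_closure Omega"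
  shows "star bounded_operators (S - T) = star bounded_operators S - star bounded_operators T"
proof -
  obtain S' where S': "adjoint_pair (blinfun_apply S) (blinfun_apply S')"
    using operator_closure_adjoint[OF invariant_set_Omega assms(1)] by metis
  obtain T' where T': "adjoint_pair (blinfun_apply T) (blinfun_apply T')"
    using operator_closure_adjoint[OF invariant_set_Omega assms(2)] by metis
  show ?thesis
    using star_bounded_operators[OF S'] star_bounded_operators[OF T']
      star_bounded_operators[OF adjoint_pair_blinfun_diff[OF S' T']] by simp
qed

lemma union_coset:
  assumes "\<And>x. x \<in> quotient_proj S \<Longrightarrow> G x = G S"
  shows "(\<Union>x\<in>quotient_proj S. G x) = G S"
proof -
  have "S \<in> quotient_proj S" by (simp add: mem_quotient_proj foundation_ideal_eq operator_closure_zero)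
  with assms show ?thesis by blast
qed

lemma quotient_proj_in_closure:
  assumes "x \<in> quotient_proj S" "S \<in> operator_closure Omega"
  shows "x \<in> operator_closure Omega"
proof -
  have "x - S \<in> operator_closure Omega"
    using assms(1) operator_closure_mono by (auto simp: mem_quotient_proj foundation_ideal_eq)
  from operator_closure_add[OF this assms(2)] show ?thesis by simp
qed

lemma monoid_quotient_zero: "zero monoid_quotient = quotient_proj 0"
  by (simp add: monoid_quotient_def quotient_algebra_def quotient_proj_def)

lemma monoid_quotient_carrier: "carrier monoid_quotient = quotient_proj ` operator_closure Omega"
  by (simp add: monoid_quotient_def quotient_algebra_def quotient_proj_def monoid_cstar_carrier)

lemma monoid_quotient_add: "add monoid_quotient (quotient_proj S) (quotient_proj T) = quotient_proj (S + T)"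
proof -
  have "quotient_proj (x + y) = quotient_proj (S + T)" if "x \<in> quotient_proj S" "y \<in> quotient_proj T" for x y
  proof -
    have e: "(x + y) - (S + T) = (x - S) + (y - T)" by simp
    show ?thesis
      using that unfolding quotient_proj_eq_iff mem_quotient_proj e by (rule foundation_ideal_add)
  qed
  moreover have "S \<in> quotient_proj S" "T \<in> quotient_proj T"
    by (simp_all add: mem_quotient_proj foundation_ideal_eq operator_closure_zero)
  ultimately have "(\<Union>x\<in>quotient_proj S. \<Union>y\<in>quotient_proj T. quotient_proj (x + y)) = quotient_proj (S + T)"
    by blast
  then show ?thesis by (simp add: monoid_quotient_def quotient_algebra_def quotient_proj_def)
qed

lemma monoid_quotient_scale:
  "scale monoid_quotient c (quotient_proj S) = quotient_proj (scale bounded_operators c S)"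
proof -
  have "(\<Union>x\<in>quotient_proj S. quotient_proj (scale bounded_operators c x)) = quotient_proj (scale bounded_operators c S)"
  proof (rule union_coset)
    fix x assume "x \<in> quotient_proj S"
    moreover have "scale bounded_operators c x - scale bounded_operators c S = scale bounded_operators c (x - S)"
      by (rule blinfun_eqI) (simp add: blinfun.diff_left ell2_scale_diff)
    ultimately show "quotient_proj (scale bounded_operators c x) = quotient_proj (scale bounded_operators c S)"
      using foundation_ideal_scale[of "x - S" c] by (simp add: mem_quotient_proj quotient_proj_eq_iff)
  qed
  then show ?thesis by (simp add: monoid_quotient_def quotient_algebra_def quotient_proj_def)
qed

lemma monoid_quotient_mult:
  assumes S: "S \<in> operator_closure Omega" and T: "T \<in> operator_closure Omega"
  shows "mult monoid_quotient (quotient_proj S) (quotient_proj T) = quotient_proj (S o\<^sub>L T)"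
proof -
  have "quotient_proj (x o\<^sub>L y) = quotient_proj (S o\<^sub>L T)" if x: "x \<in> quotient_proj S" and y: "y \<in> quotient_proj T" for x y
  proof -
    have "(x o\<^sub>L y) - (S o\<^sub>L T) = ((x - S) o\<^sub>L y) + (S o\<^sub>L (y - T))"
      by (rule blinfun_eqI) (simp add: blinfun.diff_left blinfun.add_left blinfun.diff_right)
    moreover have "((x - S) o\<^sub>L y) + (S o\<^sub>L (y - T)) \<in> foundation_ideal"
      using x y quotient_proj_in_closure[OF y T] S
      by (intro foundation_ideal_add foundation_ideal_mult) (simp_all add: mem_quotient_proj)
    ultimately show ?thesis by (simp add: quotient_proj_eq_iff)
  qed
  moreover have "S \<in> quotient_proj S" "T \<in> quotient_proj T"
    by (simp_all add: mem_quotient_proj foundation_ideal_eq operator_closure_zero)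
  ultimately have "(\<Union>x\<in>quotient_proj S. \<Union>y\<in>quotient_proj T. quotient_proj (x o\<^sub>L y)) = quotient_proj (S o\<^sub>L T)"
    by blast
  then show ?thesis by (simp add: monoid_quotient_def quotient_algebra_def quotient_proj_def)
qed

lemma monoid_quotient_star:
  assumes S: "S \<in> operator_closure Omega"
  shows "star monoid_quotient (quotient_proj S) = quotient_proj (star bounded_operators S)"
proof -
  have "(\<Union>x\<in>quotient_proj S. quotient_proj (star bounded_operators x)) = quotient_proj (star bounded_operators S)"
  proof (rule union_coset)
    fix x assume x: "x \<in> quotient_proj S"
    have "star bounded_operators (x - S) = star bounded_operators x - star bounded_operators S"
      by (rule star_bounded_operators_diff[OF quotient_proj_in_closure[OF x S] S])
    then show "quotient_proj (star bounded_operators x) = quotient_proj (star bounded_operators S)"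
      using x foundation_ideal_star[of "x - S"] by (simp add: mem_quotient_proj quotient_proj_eq_iff)
  qed
  then show ?thesis by (simp add: monoid_quotient_def quotient_algebra_def quotient_proj_def)
qed

section \<open>The homomorphisms\<close>

abbreviation (input) full_seqs :: "(nat \<Rightarrow> 'a::left_cancellative_monoid germ \<Rightarrow> complex) set" where
  "full_seqs \<equiv> cauchy_seqs (reduced_Cc groupoid_P)"

lemma rho_e_add:
  assumes u: "u \<in> full_seqs" and v: "v \<in> full_seqs"
  shows "rho_e (full.cls (\<lambda>n g. u n g + v n g)) = rho_e (full.cls u) + rho_e (full.cls v)"
proof (rule rho_e_cls[OF full.cauchy_seqs_add[OF u v]])
  show "(\<lambda>n. rho_e_Cc (\<lambda>g. u n g + v n g)) \<longlonglongrightarrow> rho_e (full.cls u) + rho_e (full.cls v)"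
    using tendsto_add[OF rho_e_cls_limit(1)[OF u] rho_e_cls_limit(1)[OF v]]
    by (simp add: rho_e_Cc_add full_in_bounded_span u v)
qed

lemma rho_e_scale:
  assumes u: "u \<in> full_seqs"
  shows "rho_e (full.cls (\<lambda>n g. c * u n g)) = scale bounded_operators c (rho_e (full.cls u))"
proof (rule rho_e_cls[OF full.cauchy_seqs_scale[OF u]])
  show "(\<lambda>n. rho_e_Cc (\<lambda>g. c * u n g)) \<longlonglongrightarrow> scale bounded_operators c (rho_e (full.cls u))"
    using tendsto_scale_bounded_operators[OF rho_e_cls_limit(1)[OF u], of c]
    by (simp add: rho_e_Cc_scale_eq full_in_bounded_span u)
qed

lemma rho_e_mult:
  assumes u: "u \<in> full_seqs" and v: "v \<in> full_seqs"
  shows "rho_e (full.cls (\<lambda>n. convolution groupoid_P (u n) (v n))) = rho_e (full.cls u) o\<^sub>L rho_e (full.cls v)"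
proof (rule rho_e_cls)
  show "(\<lambda>n. convolution groupoid_P (u n) (v n)) \<in> full_seqs"
    using full.cauchy_seqs_mult[OF u v] by simp
  show "(\<lambda>n. rho_e_Cc (convolution groupoid_P (u n) (v n))) \<longlonglongrightarrow> (rho_e (full.cls u) o\<^sub>L rho_e (full.cls v))"
    using bounded_bilinear.tendsto[OF bounded_bilinear_blinfun_compose rho_e_cls_limit(1)[OF u] rho_e_cls_limit(1)[OF v]]
    by (simp add: rho_e_Cc_convolution full_in_bounded_span u v)
qed

lemma rho_e_star:
  assumes u: "u \<in> full_seqs"
  shows "rho_e (full.cls (\<lambda>n. involution groupoid_P (u n))) = star bounded_operators (rho_e (full.cls u))"
proof -
  obtain T where T: "(\<lambda>n. rho_e_Cc (involution groupoid_P (u n))) \<longlonglongrightarrow> T"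
    "adjoint_pair (blinfun_apply (rho_e (full.cls u))) (blinfun_apply T)"
    using adjoint_limit[OF rho_e_Cc_adjoint[OF full_in_bounded_span[OF u]] rho_e_cls_limit(1)[OF u]] by blast
  have "(\<lambda>n. involution groupoid_P (u n)) \<in> full_seqs"
    using full.cauchy_seqs_star[OF u] by simp
  from rho_e_cls[OF this T(1)] star_bounded_operators[OF T(2)] show ?thesis by simp
qed

lemma star_hom_quotient:
  "star_hom (reduced_cstar (groupoid_P :: ('a::left_cancellative_monoid germ, 'a character) groupoid))
    monoid_quotient (quotient_proj \<circ> rho_e)"
  unfolding star_hom_def carrier_reduced_cstar
proof (intro conjI ballI allI)
  show "quotient_proj \<circ> rho_e \<in> full.cls ` full_seqs \<rightarrow> carrier monoid_quotient"
    by (auto simp: monoid_quotient_carrier intro!: imageI rho_e_cls_limit(2))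
  fix x :: "(nat \<Rightarrow> 'a germ \<Rightarrow> complex) set" assume "x \<in> full.cls ` full_seqs"
  then obtain u where u: "u \<in> full_seqs" "x = full.cls u" by blast
  show "(quotient_proj \<circ> rho_e) (scale (reduced_cstar groupoid_P) c x)
      = scale monoid_quotient c ((quotient_proj \<circ> rho_e) x)" for c
    by (simp add: u reduced_cstar_def full.completion_scale rho_e_scale monoid_quotient_scale)
  show "(quotient_proj \<circ> rho_e) (star (reduced_cstar groupoid_P) x)
      = star monoid_quotient ((quotient_proj \<circ> rho_e) x)"
    by (simp add: u reduced_cstar_def full.completion_star rho_e_star monoid_quotient_star rho_e_cls_limit(2))
  fix y :: "(nat \<Rightarrow> 'a germ \<Rightarrow> complex) set" assume "y \<in> full.cls ` full_seqs"
  then obtain v where v: "v \<in> full_seqs" "y = full.cls v" by blast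
  show "(quotient_proj \<circ> rho_e) (add (reduced_cstar groupoid_P) x y)
      = add monoid_quotient ((quotient_proj \<circ> rho_e) x) ((quotient_proj \<circ> rho_e) y)"
    by (simp add: u v reduced_cstar_def full.completion_add rho_e_add monoid_quotient_add)
  show "(quotient_proj \<circ> rho_e) (mult (reduced_cstar groupoid_P) x y)
      = mult monoid_quotient ((quotient_proj \<circ> rho_e) x) ((quotient_proj \<circ> rho_e) y)"
    by (simp add: u v reduced_cstar_def full.completion_mult rho_e_mult monoid_quotient_mult rho_e_cls_limit(2))
qed

text \<open>A class of the complement goes to the class of the same sequence in the whole groupoid,
  which allows the ideal to be handled through its sequences.\<close>

lemma ext_zero_map_image:
  "ext_zero_map groupoid_P ` carrier (reduced_cstar off_boundary_groupoid)
    = full.cls ` cauchy_seqs (reduced_Cc off_boundary_groupoid)"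
proof -
  have "ext_zero_map groupoid_P (ideal.A.cls v) = full.cls v"
    if "v \<in> cauchy_seqs (reduced_Cc off_boundary_groupoid)" for v :: "nat \<Rightarrow> 'a germ \<Rightarrow> complex"
    using ideal.completion_map_cls[OF that] by (simp add: ext_zero_map_def)
  then show ?thesis
    unfolding reduced_cstar_def ideal.A.completion_carrier image_image by (rule image_cong[OF refl])
qed

lemma rho_e_off_boundary:
  assumes "v \<in> cauchy_seqs (reduced_Cc off_boundary_groupoid)"
  shows "v \<in> full_seqs" "rho_e (full.cls v) \<in> foundation_ideal"
proof -
  show v: "v \<in> full_seqs" using ideal.map_cauchy_seqs[OF assms] .
  have "v n \<in> bisection_span (compact_generator (Omega - boundary_Omega))" for n
    using ideal.A.cauchy_seqs_in[OF assms, of n] by (simp add: reduced_Cc_def Cc_off_boundary)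
  from operator_closure_lim[OF this rho_e_cls_limit(1)[OF v]]
  show "rho_e (full.cls v) \<in> foundation_ideal" by (simp add: foundation_ideal_eq)
qed

text \<open>The lifted sequence is Cauchy for the reduced norm of the whole groupoid. This norm
  agrees with that of the complement on functions supported there, so that the sequence represents
  an element of the ideal.\<close>

lemma foundation_ideal_lift:
  assumes "T \<in> (foundation_ideal :: ('a::left_cancellative_monoid ell2 \<Rightarrow>\<^sub>L 'a ell2) set)"
  obtains v where "v \<in> cauchy_seqs (reduced_Cc off_boundary_groupoid)" "rho_e (full.cls v) = T"
proof -
  have T: "T \<in> operator_closure (Omega - boundary_Omega)" using assms by (simp add: foundation_ideal_eq)
  obtain v where v: "\<And>n::nat. v n \<in> bisection_span (compact_generator (Omega - boundary_Omega))"
    "\<And>e. 0 < e \<Longrightarrow> \<exists>M. \<forall>m\<ge>M. \<forall>n\<ge>M. reduced_norm groupoid_P (\<lambda>a. v m a - v n a) < e"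
    "(\<lambda>n. rho_e_Cc (v n)) \<longlonglongrightarrow> T"
    by (rule operator_closure_lift[OF invariant_set_off_boundary T]) blast
  have "(\<lambda>a. v m a - v n a) \<in> bisection_span (compact_generator (Omega - boundary_Omega))" for m n
    using bisection_span_add[OF v(1)[of m] compact_span_scale[OF v(1)[of n], of "- 1"]] by simp
  then have v': "v \<in> cauchy_seqs (reduced_Cc off_boundary_groupoid)"
    using v(1,2) unfolding ideal.A.cauchy_seqs_iff
    by (simp add: reduced_norm_off_boundary) (simp add: reduced_Cc_def Cc_off_boundary)
  with rho_e_cls[OF rho_e_off_boundary(1)[OF v'] v(3)] show thesis by (rule that[rotated])
qed

text \<open>If \<rho>(x) lies in the foundation ideal, there is some v from the complement with
  \<rho>(v) = \<rho>(x), and x is the sum of x - v and v. The other inclusion holds because \<rho>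
  maps the complement into the ideal.\<close>

lemma ker_quotient:
  "ker (reduced_cstar (groupoid_P :: ('a::left_cancellative_monoid germ, 'a character) groupoid))
      monoid_quotient (quotient_proj \<circ> rho_e)
    = set_sum (reduced_cstar groupoid_P) (ker (reduced_cstar groupoid_P) monoid_cstar rho_e)
        (ext_zero_map groupoid_P ` carrier (reduced_cstar off_boundary_groupoid))"
proof (intro equalityI subsetI)
  fix x :: "(nat \<Rightarrow> 'a germ \<Rightarrow> complex) set"
  assume "x \<in> ker (reduced_cstar groupoid_P) monoid_quotient (quotient_proj \<circ> rho_e)"
  then obtain u where u: "u \<in> full_seqs" "x = full.cls u" "rho_e (full.cls u) \<in> foundation_ideal"
    by (auto simp: ker_def carrier_reduced_cstar monoid_quotient_zero quotient_proj_eq_iff)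
  obtain v where v: "v \<in> cauchy_seqs (reduced_Cc off_boundary_groupoid)" "rho_e (full.cls v) = rho_e (full.cls u)"
    using foundation_ideal_lift[OF u(3)] .
  have v': "v \<in> full_seqs" by (rule rho_e_off_boundary(1)[OF v(1)])
  let ?w = "\<lambda>n g. u n g + - 1 * v n g"
  have w: "?w \<in> full_seqs" by (intro full.cauchy_seqs_add u(1) full.cauchy_seqs_scale v')
  have neg: "scale bounded_operators (- 1) T = - T" for T :: "'a ell2 \<Rightarrow>\<^sub>L 'a ell2"
    by (rule blinfun_eqI) (simp only: scale_bounded_operators_apply ell2_scale_minus_one blinfun.minus_left)
  have "rho_e (full.cls ?w) = rho_e (full.cls u) + scale bounded_operators (- 1) (rho_e (full.cls v))"
    by (simp only: rho_e_add[OF u(1) full.cauchy_seqs_scale[OF v']] rho_e_scale[OF v'])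
  then have "full.cls ?w \<in> ker (reduced_cstar groupoid_P) monoid_cstar rho_e"
    using w v(2) by (simp add: ker_def carrier_reduced_cstar neg)
  moreover have "x = add (reduced_cstar groupoid_P) (full.cls ?w) (full.cls v)"
    unfolding reduced_cstar_def full.completion_add[OF w v'] by (simp add: u(2))
  ultimately show "x \<in> set_sum (reduced_cstar groupoid_P) (ker (reduced_cstar groupoid_P) monoid_cstar rho_e)
        (ext_zero_map groupoid_P ` carrier (reduced_cstar off_boundary_groupoid))"
    unfolding set_sum_def ext_zero_map_image using v(1) by blast
next
  fix x :: "(nat \<Rightarrow> 'a germ \<Rightarrow> complex) set"
  assume "x \<in> set_sum (reduced_cstar groupoid_P) (ker (reduced_cstar groupoid_P) monoid_cstar rho_e)
        (ext_zero_map groupoid_P ` carrier (reduced_cstar off_boundary_groupoid))"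
  then obtain u v where uv: "u \<in> full_seqs" "rho_e (full.cls u) = 0"
    "v \<in> cauchy_seqs (reduced_Cc off_boundary_groupoid)"
    "x = add (reduced_cstar groupoid_P) (full.cls u) (full.cls v)"
    unfolding set_sum_def ext_zero_map_image by (auto simp: ker_def carrier_reduced_cstar)
  note v' = rho_e_off_boundary[OF uv(3)]
  have x: "x = full.cls (\<lambda>n g. u n g + v n g)"
    unfolding uv(4) reduced_cstar_def by (rule full.completion_add[OF uv(1) v'(1)])
  have "rho_e x = rho_e (full.cls v)"
    unfolding x by (simp add: rho_e_add[OF uv(1) v'(1)] uv(2))
  moreover have "x \<in> carrier (reduced_cstar groupoid_P)"
    unfolding x carrier_reduced_cstar by (intro imageI full.cauchy_seqs_add uv(1) v'(1))
  ultimately show "x \<in> ker (reduced_cstar groupoid_P) monoid_quotient (quotient_proj \<circ> rho_e)"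
    using v'(2) by (simp add: ker_def monoid_quotient_zero quotient_proj_eq_iff)
qed

section \<open>Restriction to the boundary groupoid\<close>

lemma arrows_boundary: "arrows boundary_groupoid_P = arrows_over boundary_Omega"
  by (simp add: boundary_groupoid_P_def arrows_reduction[OF invariant_set_boundary])

lemma boundary_simps [simp]:
  "src boundary_groupoid_P = src groupoid_P" "rng boundary_groupoid_P = rng groupoid_P"
  "gmult boundary_groupoid_P = gmult groupoid_P" "ginv boundary_groupoid_P = ginv groupoid_P"
  by (simp_all add: boundary_groupoid_P_def)

lemma restrict_fun_span:
  assumes "f \<in> bisection_span (compact_generator Omega)"
  shows "restrict_fun boundary_groupoid_P f \<in> bisection_span (compact_generator boundary_Omega)"
  using assms
proof (induction rule: bisection_span.induct)
  case zero
  show ?case by (simp add: restrict_fun_def[abs_def] bisection_span.zero)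
next
  case (step f g \<phi>)
  obtain K where K: "compact K" "K \<subseteq> Omega" "\<forall>\<omega>\<in>K. \<omega> (dom g)" "\<forall>\<omega>\<in>Omega. \<omega> \<notin> K \<longrightarrow> \<phi> \<omega> = 0"
    and g: "g \<in> left_inverse_hull" and \<phi>: "continuous_on Omega \<phi>"
    using step(2) by (auto simp: compact_generator_def)
  \<comment> \<open>Weights over the boundary have to vanish on the rest of \<open>Omega\<close>;
    the compact set shrinks accordingly to its intersection with the closed boundary.\<close>
  let ?\<psi> = "\<lambda>\<omega>. if \<omega> \<in> boundary_Omega then \<phi> \<omega> else 0"
  have "continuous_on boundary_Omega \<phi>"
    by (rule continuous_on_subset[OF \<phi> invariant_setD(1)[OF invariant_set_boundary]])
  then have "continuous_on boundary_Omega ?\<psi>" by (rule continuous_on_eq) simp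
  then have \<psi>: "compact_generator boundary_Omega g ?\<psi>"
    unfolding compact_generator_def
    using g K by (intro conjI exI[of _ "K \<inter> boundary_Omega"] compact_Int_closed closed_boundary) auto
  have "restrict_fun boundary_groupoid_P (\<lambda>a. bisection_fun g \<phi> a + f a)
      = (\<lambda>a. bisection_fun g ?\<psi> a + restrict_fun boundary_groupoid_P f a)"
  proof
    fix a
    show "restrict_fun boundary_groupoid_P (\<lambda>a. bisection_fun g \<phi> a + f a) a
      = bisection_fun g ?\<psi> a + restrict_fun boundary_groupoid_P f a"
      unfolding restrict_fun_def arrows_boundary arrows_over_def
      by (cases "a \<in> arrows groupoid_P") (auto simp: bisection_fun_def)
  qed
  with bisection_span.step[OF step(3) \<psi>] show ?case by simp
qed

text \<open>Functions supported over the boundary have the same convolution in both groupoids, so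
  that identities proved for the whole groupoid carry over.\<close>

lemma convolution_boundary:
  assumes "f \<in> bisection_span (compact_generator boundary_Omega)"
    "f' \<in> bisection_span (compact_generator boundary_Omega)"
  shows "convolution boundary_groupoid_P f f' = convolution groupoid_P f f'"
proof
  fix a
  note inv = invariant_set_boundary
  have span: "convolution groupoid_P f f' \<in> bisection_span (compact_generator boundary_Omega)"
    using compact_span_convolution[OF inv inv assms] by simp
  show "convolution boundary_groupoid_P f f' a = convolution groupoid_P f f' a"
  proof (cases "a \<in> arrows_over boundary_Omega")
    case True
    then show ?thesis
      unfolding convolution_def arrows_boundary boundary_simps range_fibre_invariant[OF inv True]
      by (simp add: arrows_over_def)
  next
    case False
    from compact_span_arrows_over[OF invariant_setD(1)[OF inv] False span]
    show ?thesis using False by (simp add: convolution_def[of boundary_groupoid_P] arrows_boundary)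
  qed
qed

lemma involution_boundary:
  assumes "f \<in> bisection_span (compact_generator boundary_Omega)"
  shows "involution boundary_groupoid_P f = involution groupoid_P f"
proof
  fix a
  note inv = invariant_set_boundary
  show "involution boundary_groupoid_P f a = involution groupoid_P f a"
  proof (cases "a \<in> arrows_over boundary_Omega")
    case True
    then show ?thesis by (simp add: involution_def arrows_boundary arrows_over_def)
  next
    case False
    from compact_span_arrows_over[OF invariant_setD(1)[OF inv] False compact_span_involution[OF inv assms]]
    show ?thesis using False by (simp add: involution_def[of boundary_groupoid_P] arrows_boundary)
  qed
qed

lemma src_left_quotient:
  assumes "a \<in> arrows groupoid_P" "h \<in> arrows groupoid_P" "rng groupoid_P h = rng groupoid_P a"
  shows "gmult groupoid_P (ginv groupoid_P h) a \<in> arrows groupoid_P"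
    "src groupoid_P (gmult groupoid_P (ginv groupoid_P h) a) = src groupoid_P a"
proof -
  obtain k \<omega> where k: "h = germ k \<omega>" "(k, \<omega>) \<in> germ_pairs" using assms(2) by (rule arrows_cases)
  have kk: "partial_inv k \<in> left_inverse_hull" using k by (intro left_inverse_hull.intros) (simp add: germ_pairs_iff)
  have r: "rng groupoid_P a = push_character k \<omega>" using assms(3) k by simp
  then have "rng groupoid_P a (dom (partial_inv k))" using k by (simp add: germ_pairs_iff push_character_ran)
  moreover have "gmult groupoid_P (ginv groupoid_P h) a = germ_act (partial_inv k) a"
    using k r by (simp add: germ_act_def)
  ultimately show "gmult groupoid_P (ginv groupoid_P h) a \<in> arrows groupoid_P"
    "src groupoid_P (gmult groupoid_P (ginv groupoid_P h) a) = src groupoid_P a"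
    using germ_act_arrow[OF assms(1) kk] src_germ_act[OF assms(1) kk] by simp_all
qed

text \<open>Restriction is multiplicative because the boundary is invariant: if \<open>a\<close>
  lies over it, so do all \<open>h\<close> with the same range and the quotients of \<open>a\<close>
  by them, and every summand stays the same.\<close>

lemma restrict_fun_convolution:
  "restrict_fun boundary_groupoid_P (convolution groupoid_P f f')
    = convolution boundary_groupoid_P (restrict_fun boundary_groupoid_P f) (restrict_fun boundary_groupoid_P f')"
proof
  fix a
  note inv = invariant_set_boundary
  show "restrict_fun boundary_groupoid_P (convolution groupoid_P f f') a
    = convolution boundary_groupoid_P (restrict_fun boundary_groupoid_P f) (restrict_fun boundary_groupoid_P f') a"
  proof (cases "a \<in> arrows_over boundary_Omega")
    case True
    have a: "a \<in> arrows groupoid_P" "src groupoid_P a \<in> boundary_Omega" using True by (auto simp: arrows_over_def)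
    have "(\<Sum>\<^sub>\<infinity>h\<in>{h \<in> arrows groupoid_P. rng groupoid_P h = rng groupoid_P a}.
          f h * f' (gmult groupoid_P (ginv groupoid_P h) a))
      = (\<Sum>\<^sub>\<infinity>h\<in>{h \<in> arrows_over boundary_Omega. rng groupoid_P h = rng groupoid_P a}.
          restrict_fun boundary_groupoid_P f h * restrict_fun boundary_groupoid_P f' (gmult groupoid_P (ginv groupoid_P h) a))"
      unfolding range_fibre_invariant[OF inv True, symmetric]
    proof (rule infsum_cong)
      fix h assume h: "h \<in> {h \<in> arrows_over boundary_Omega. rng groupoid_P h = rng groupoid_P a}"
      then have h': "h \<in> arrows groupoid_P" "rng groupoid_P h = rng groupoid_P a" by (auto simp: arrows_over_def)
      have "gmult groupoid_P (ginv groupoid_P h) a \<in> arrows_over boundary_Omega"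
        using src_left_quotient[OF a(1) h'] a(2) by (simp add: arrows_over_def)
      then show "f h * f' (gmult groupoid_P (ginv groupoid_P h) a)
        = restrict_fun boundary_groupoid_P f h * restrict_fun boundary_groupoid_P f' (gmult groupoid_P (ginv groupoid_P h) a)"
        using h by (simp add: restrict_fun_def arrows_boundary)
    qed
    moreover have "restrict_fun boundary_groupoid_P (convolution groupoid_P f f') a = convolution groupoid_P f f' a"
      using True by (simp add: restrict_fun_def arrows_boundary)
    moreover have "convolution groupoid_P f f' a = (\<Sum>\<^sub>\<infinity>h\<in>{h \<in> arrows groupoid_P. rng groupoid_P h = rng groupoid_P a}.
          f h * f' (gmult groupoid_P (ginv groupoid_P h) a))"
      using a by (simp add: convolution_def)
    moreover have "convolution boundary_groupoid_P (restrict_fun boundary_groupoid_P f) (restrict_fun boundary_groupoid_P f') a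
      = (\<Sum>\<^sub>\<infinity>h\<in>{h \<in> arrows_over boundary_Omega. rng groupoid_P h = rng groupoid_P a}.
          restrict_fun boundary_groupoid_P f h * restrict_fun boundary_groupoid_P f' (gmult groupoid_P (ginv groupoid_P h) a))"
      using True by (simp add: convolution_def arrows_boundary)
    ultimately show ?thesis by (simp only:)
  qed (simp add: restrict_fun_def convolution_def arrows_boundary)
qed

lemma restrict_fun_involution:
  "restrict_fun boundary_groupoid_P (involution groupoid_P f)
    = involution boundary_groupoid_P (restrict_fun boundary_groupoid_P f)"
proof
  fix a
  show "restrict_fun boundary_groupoid_P (involution groupoid_P f) a
    = involution boundary_groupoid_P (restrict_fun boundary_groupoid_P f) a"
  proof (cases "a \<in> arrows_over boundary_Omega")
    case True
    then have a: "a \<in> arrows groupoid_P" "src groupoid_P a \<in> boundary_Omega" by (auto simp: arrows_over_def)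
    have "ginv groupoid_P a \<in> arrows_over boundary_Omega"
      using ginv_arrow(1,3)[OF a(1)] a rng_invariant_iff[OF invariant_set_boundary a(1)] by (simp add: arrows_over_def)
    with True a show ?thesis by (simp add: restrict_fun_def involution_def arrows_boundary)
  qed (simp add: restrict_fun_def involution_def arrows_boundary)
qed

lemma boundary_algebra:
  fixes N :: "('a::left_cancellative_monoid germ \<Rightarrow> complex) \<Rightarrow> real"
  assumes N: "cstar_norm (convolution_algebra boundary_groupoid_P N)"
  shows "seminormed_function_algebra (convolution_algebra boundary_groupoid_P N)"
proof
  note b = compact_span_bounded_span
  note inv = invariant_set_boundary
  let ?S = "bisection_span (compact_generator boundary_Omega) :: ('a germ \<Rightarrow> complex) set"
  have conv: "convolution boundary_groupoid_P f h \<in> ?S" if "f \<in> ?S" "h \<in> ?S" for f h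
    using compact_span_convolution[OF inv inv that] by (simp add: convolution_boundary that)
  have star: "involution boundary_groupoid_P f \<in> ?S" if "f \<in> ?S" for f
    using compact_span_involution[OF inv that] by (simp add: involution_boundary that)
  have inv2: "involution boundary_groupoid_P (involution boundary_groupoid_P f) = f" if "f \<in> ?S" for f
    using involution_boundary[OF that] involution_boundary[OF star[OF that]]
      involution_involution[OF b[OF that]] by simp
  have N': "\<And>f. f \<in> ?S \<Longrightarrow> 0 \<le> N f \<and> (N f = 0 \<longleftrightarrow> f = (\<lambda>_. 0))"
    "\<And>c f. f \<in> ?S \<Longrightarrow> N (\<lambda>g. c * f g) = cmod c * N f"
    "\<And>f h. f \<in> ?S \<Longrightarrow> h \<in> ?S \<Longrightarrow> N (\<lambda>g. f g + h g) \<le> N f + N h"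
    "\<And>f h. f \<in> ?S \<Longrightarrow> h \<in> ?S \<Longrightarrow> N (convolution boundary_groupoid_P f h) \<le> N f * N h"
    "\<And>f. f \<in> ?S \<Longrightarrow> N (convolution boundary_groupoid_P (involution boundary_groupoid_P f) f) = (N f)\<^sup>2"
    using N unfolding cstar_norm_def by (simp_all add: Cc_boundary)
  \<comment> \<open>The C*-identity and submultiplicativity bound the square of the norm of
    \<open>f\<close> by its product with the norm of the adjoint, and one factor cancels. Applied to
    the adjoint, this gives the bound for the involution that completions need.\<close>
  have le_star: "N f \<le> N (involution boundary_groupoid_P f)" if f: "f \<in> ?S" for f
  proof (cases "N f = 0")
    case True
    then show ?thesis using N'(1)[OF star[OF f]] by simp
  next
    case False
    have "N f * N f \<le> N (involution boundary_groupoid_P f) * N f"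
      using N'(4)[OF star[OF f] f] N'(5)[OF f] by (simp add: power2_eq_square)
    then show ?thesis using False N'(1)[OF f] by simp
  qed
  let ?A = "convolution_algebra boundary_groupoid_P N"
  fix f h k :: "'a germ \<Rightarrow> complex" and c :: complex
  show "zero ?A = (\<lambda>_. 0)" "add ?A f h = (\<lambda>g. f g + h g)" "scale ?A c f = (\<lambda>g. c * f g)"
    "(\<lambda>_. 0) \<in> carrier ?A" "anorm ?A (\<lambda>_. 0) = 0"
    using N'(1)[OF bisection_span.zero] by (simp_all add: Cc_boundary bisection_span.zero)
  assume "f \<in> carrier ?A"
  then have f: "f \<in> ?S" by (simp add: Cc_boundary)
  show "(\<lambda>g. c * f g) \<in> carrier ?A" "anorm ?A (\<lambda>g. c * f g) \<le> cmod c * anorm ?A f"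
    "star ?A f \<in> carrier ?A" "anorm ?A (star ?A f) \<le> anorm ?A f"
    using f star[OF f] N'(2)[OF f] le_star[OF star[OF f]] inv2[OF f]
    by (simp_all add: Cc_boundary compact_span_scale)
  assume "h \<in> carrier ?A"
  then have h: "h \<in> ?S" by (simp add: Cc_boundary)
  show "(\<lambda>g. f g + h g) \<in> carrier ?A" "anorm ?A (\<lambda>g. f g + h g) \<le> anorm ?A f + anorm ?A h"
    "mult ?A f h \<in> carrier ?A" "anorm ?A (mult ?A f h) \<le> anorm ?A f * anorm ?A h"
    "star ?A (\<lambda>g. f g - h g) = (\<lambda>g. star ?A f g - star ?A h g)"
    using f h conv[OF f h] N'(3,4)[OF f h] by (simp_all add: Cc_boundary bisection_span_add involution_diff)
  have fh: "(\<lambda>g. f g - h g) \<in> ?S"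
    using bisection_span_add[OF f compact_span_scale[OF h, of "- 1"]] by simp
  assume "k \<in> carrier ?A"
  then have k: "k \<in> ?S" by (simp add: Cc_boundary)
  show "mult ?A (\<lambda>g. f g - h g) k = (\<lambda>g. mult ?A f k g - mult ?A h k g)"
    "mult ?A k (\<lambda>g. f g - h g) = (\<lambda>g. mult ?A k f g - mult ?A k h g)"
    using b[OF f] b[OF h] b[OF k]
    by (simp_all add: convolution_boundary f h k fh convolution_diff_left convolution_diff_right)
qed

lemma restriction_bounded_map:
  fixes N :: "('a::left_cancellative_monoid germ \<Rightarrow> complex) \<Rightarrow> real"
  assumes N: "cstar_norm (convolution_algebra boundary_groupoid_P N)"
    and c: "\<And>f. f \<in> Cc groupoid_P \<Longrightarrow> N (restrict_fun boundary_groupoid_P f) \<le> c * reduced_norm groupoid_P f"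
  shows "bounded_function_map (reduced_Cc groupoid_P) (convolution_algebra boundary_groupoid_P N)
    (restrict_fun boundary_groupoid_P) c"
proof -
  interpret B: seminormed_function_algebra "convolution_algebra boundary_groupoid_P N"
    by (rule boundary_algebra[OF N])
  show ?thesis
  proof
    fix f f' :: "'a germ \<Rightarrow> complex"
    assume "f \<in> carrier (reduced_Cc groupoid_P)"
    then have f: "f \<in> bisection_span (compact_generator Omega)" by (simp add: carrier_full)
    show "restrict_fun boundary_groupoid_P f \<in> carrier (convolution_algebra boundary_groupoid_P N)"
      using restrict_fun_span[OF f] by (simp add: Cc_boundary)
    show "anorm (convolution_algebra boundary_groupoid_P N) (restrict_fun boundary_groupoid_P f)
        \<le> c * anorm (reduced_Cc groupoid_P) f"
      using c f by (simp add: Cc_groupoid_P)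
    show "restrict_fun boundary_groupoid_P (\<lambda>g. f g - f' g)
        = (\<lambda>g. restrict_fun boundary_groupoid_P f g - restrict_fun boundary_groupoid_P f' g)"
      by (auto simp: restrict_fun_def)
  qed
qed

lemma star_hom_restriction:
  fixes N :: "('a::left_cancellative_monoid germ \<Rightarrow> complex) \<Rightarrow> real"
  assumes N: "cstar_norm (convolution_algebra boundary_groupoid_P N)"
    and c: "\<And>f. f \<in> Cc groupoid_P \<Longrightarrow> N (restrict_fun boundary_groupoid_P f) \<le> c * reduced_norm groupoid_P f"
  shows "star_hom (reduced_cstar groupoid_P) (cstar_completion (convolution_algebra boundary_groupoid_P N))
    (restriction_map boundary_groupoid_P N)"
proof -
  interpret B: seminormed_function_algebra "convolution_algebra boundary_groupoid_P N"
    by (rule boundary_algebra[OF N])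
  interpret R: bounded_function_map "reduced_Cc groupoid_P" "convolution_algebra boundary_groupoid_P N"
    "restrict_fun boundary_groupoid_P" c
    by (rule restriction_bounded_map[OF N c])
  let ?r = "restrict_fun boundary_groupoid_P :: ('a germ \<Rightarrow> complex) \<Rightarrow> _"
  have r: "restriction_map boundary_groupoid_P N (full.cls u) = B.cls (\<lambda>n. ?r (u n))" if "u \<in> full_seqs" for u
    using R.completion_map_cls[OF that] by (simp add: restriction_map_def)
  show ?thesis
    unfolding star_hom_def carrier_reduced_cstar
  proof (intro conjI ballI allI)
    show "restriction_map boundary_groupoid_P N \<in> full.cls ` full_seqs
        \<rightarrow> carrier (cstar_completion (convolution_algebra boundary_groupoid_P N))"
      using R.map_cauchy_seqs by (auto simp: r B.completion_carrier)
    fix x :: "(nat \<Rightarrow> 'a germ \<Rightarrow> complex) set" assume "x \<in> full.cls ` full_seqs"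
    then obtain u where u: "u \<in> full_seqs" "x = full.cls u" by blast
    note u' = R.map_cauchy_seqs[OF u(1)]
    have sc: "?r (\<lambda>g. c * f g) = (\<lambda>g. c * ?r f g)" for c f by (auto simp: restrict_fun_def)
    show "restriction_map boundary_groupoid_P N (scale (reduced_cstar groupoid_P) c x)
      = scale (cstar_completion (convolution_algebra boundary_groupoid_P N)) c (restriction_map boundary_groupoid_P N x)" for c
      by (simp add: u r reduced_cstar_def full.completion_scale full.cauchy_seqs_scale B.completion_scale[OF u'] sc)
    have "(\<lambda>n. involution groupoid_P (u n)) \<in> full_seqs" using full.cauchy_seqs_star[OF u(1)] by simp
    then show "restriction_map boundary_groupoid_P N (star (reduced_cstar groupoid_P) x)
      = star (cstar_completion (convolution_algebra boundary_groupoid_P N)) (restriction_map boundary_groupoid_P N x)"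
      by (simp add: u r reduced_cstar_def full.completion_star B.completion_star[OF u'] restrict_fun_involution)
    fix y :: "(nat \<Rightarrow> 'a germ \<Rightarrow> complex) set" assume "y \<in> full.cls ` full_seqs"
    then obtain v where v: "v \<in> full_seqs" "y = full.cls v" by blast
    note v' = R.map_cauchy_seqs[OF v(1)]
    have ad: "?r (\<lambda>g. f g + f' g) = (\<lambda>g. ?r f g + ?r f' g)" for f f' by (auto simp: restrict_fun_def)
    show "restriction_map boundary_groupoid_P N (add (reduced_cstar groupoid_P) x y)
      = add (cstar_completion (convolution_algebra boundary_groupoid_P N))
          (restriction_map boundary_groupoid_P N x) (restriction_map boundary_groupoid_P N y)"
      by (simp add: u v r reduced_cstar_def full.completion_add full.cauchy_seqs_add B.completion_add[OF u' v'] ad)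
    have "(\<lambda>n. convolution groupoid_P (u n) (v n)) \<in> full_seqs" using full.cauchy_seqs_mult[OF u(1) v(1)] by simp
    then show "restriction_map boundary_groupoid_P N (mult (reduced_cstar groupoid_P) x y)
      = mult (cstar_completion (convolution_algebra boundary_groupoid_P N))
          (restriction_map boundary_groupoid_P N x) (restriction_map boundary_groupoid_P N y)"
      by (simp add: u v r reduced_cstar_def full.completion_mult B.completion_mult[OF u' v'] restrict_fun_convolution)
  qed
qed

text \<open>The records carry no algebraic laws, so the fibres of \<phi> are used in place of its
  kernel: \<open>eq\<close> makes the value independent of the chosen preimage, and surjectivity
  transfers the homomorphism laws to all of \<open>E\<close>.\<close>

lemma star_hom_factor:
  assumes \<phi>: "star_hom A E \<phi>" and \<psi>: "star_hom A Q \<psi>"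
    and surj: "\<phi> ` carrier A = carrier E"
    and eq: "\<And>x y. x \<in> carrier A \<Longrightarrow> y \<in> carrier A \<Longrightarrow> \<phi> x = \<phi> y \<Longrightarrow> \<psi> x = \<psi> y"
    and closed: "\<And>x y. x \<in> carrier A \<Longrightarrow> y \<in> carrier A \<Longrightarrow> add A x y \<in> carrier A"
      "\<And>x y. x \<in> carrier A \<Longrightarrow> y \<in> carrier A \<Longrightarrow> mult A x y \<in> carrier A"
      "\<And>x c. x \<in> carrier A \<Longrightarrow> scale A c x \<in> carrier A" "\<And>x. x \<in> carrier A \<Longrightarrow> star A x \<in> carrier A"
  shows "\<exists>\<theta>. star_hom E Q \<theta> \<and> (\<forall>x\<in>carrier A. \<theta> (\<phi> x) = \<psi> x)"
proof -
  define \<theta> where "\<theta> b = \<psi> (SOME x. x \<in> carrier A \<and> \<phi> x = b)" for b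
  have \<theta>: "\<theta> (\<phi> x) = \<psi> x" if x: "x \<in> carrier A" for x
  proof -
    have "(SOME y. y \<in> carrier A \<and> \<phi> y = \<phi> x) \<in> carrier A \<and> \<phi> (SOME y. y \<in> carrier A \<and> \<phi> y = \<phi> x) = \<phi> x"
      by (rule someI[of "\<lambda>y. y \<in> carrier A \<and> \<phi> y = \<phi> x" x]) (use x in simp)
    then show ?thesis unfolding \<theta>_def using eq x by blast
  qed
  have \<phi>h: "\<And>x y. x \<in> carrier A \<Longrightarrow> y \<in> carrier A \<Longrightarrow> \<phi> (add A x y) = add E (\<phi> x) (\<phi> y)"
    "\<And>x c. x \<in> carrier A \<Longrightarrow> \<phi> (scale A c x) = scale E c (\<phi> x)"
    "\<And>x y. x \<in> carrier A \<Longrightarrow> y \<in> carrier A \<Longrightarrow> \<phi> (mult A x y) = mult E (\<phi> x) (\<phi> y)"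
    "\<And>x. x \<in> carrier A \<Longrightarrow> \<phi> (star A x) = star E (\<phi> x)"
    using \<phi> by (simp_all add: star_hom_def)
  have \<psi>h: "\<And>x. x \<in> carrier A \<Longrightarrow> \<psi> x \<in> carrier Q"
    "\<And>x y. x \<in> carrier A \<Longrightarrow> y \<in> carrier A \<Longrightarrow> \<psi> (add A x y) = add Q (\<psi> x) (\<psi> y)"
    "\<And>x c. x \<in> carrier A \<Longrightarrow> \<psi> (scale A c x) = scale Q c (\<psi> x)"
    "\<And>x y. x \<in> carrier A \<Longrightarrow> y \<in> carrier A \<Longrightarrow> \<psi> (mult A x y) = mult Q (\<psi> x) (\<psi> y)"
    "\<And>x. x \<in> carrier A \<Longrightarrow> \<psi> (star A x) = star Q (\<psi> x)"
    using \<psi> by (auto simp: star_hom_def)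
  have "star_hom E Q \<theta>"
    unfolding star_hom_def
  proof (intro conjI ballI allI)
    show "\<theta> \<in> carrier E \<rightarrow> carrier Q" unfolding surj[symmetric] using \<theta> \<psi>h(1) by auto
    fix b assume "b \<in> carrier E"
    then obtain x where x: "x \<in> carrier A" "b = \<phi> x" unfolding surj[symmetric] by blast
    show "\<theta> (scale E c b) = scale Q c (\<theta> b)" for c
      using \<theta>[OF closed(3)[OF x(1), of c]] by (simp add: x \<theta> \<phi>h \<psi>h)
    show "\<theta> (star E b) = star Q (\<theta> b)"
      using \<theta>[OF closed(4)[OF x(1)]] by (simp add: x \<theta> \<phi>h \<psi>h)
    fix b' assume "b' \<in> carrier E"
    then obtain y where y: "y \<in> carrier A" "b' = \<phi> y" unfolding surj[symmetric] by blast
    show "\<theta> (add E b b') = add Q (\<theta> b) (\<theta> b')"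
      using \<theta>[OF closed(1)[OF x(1) y(1)]] by (simp add: x y \<theta> \<phi>h \<psi>h)
    show "\<theta> (mult E b b') = mult Q (\<theta> b) (\<theta> b')"
      using \<theta>[OF closed(2)[OF x(1) y(1)]] by (simp add: x y \<theta> \<phi>h \<psi>h)
  qed
  with \<theta> show ?thesis by blast
qed

theorem proposition2p4:
  shows
    "ker (reduced_cstar (groupoid_P :: ('a::left_cancellative_monoid germ, 'a character) groupoid))
        monoid_quotient (quotient_proj \<circ> rho_e)
      = set_sum (reduced_cstar groupoid_P)
          (ker (reduced_cstar groupoid_P) monoid_cstar rho_e)
          (ext_zero_map groupoid_P `
            carrier (reduced_cstar (groupoid_diff groupoid_P boundary_groupoid_P)))
    \<and> (\<forall>norm_e. exact_norm (groupoid_P :: ('a germ, 'a character) groupoid)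
          boundary_groupoid_P norm_e \<longrightarrow>
        (\<exists>\<theta>. star_hom (cstar_completion (convolution_algebra boundary_groupoid_P norm_e))
              (monoid_quotient :: ('a ell2 \<Rightarrow>\<^sub>L 'a ell2) set star_algebra) \<theta> \<and>
          (\<forall>a\<in>carrier (reduced_cstar groupoid_P).
            (\<theta> \<circ> restriction_map boundary_groupoid_P norm_e) a = (quotient_proj \<circ> rho_e) a)))"
proof (intro conjI allI impI)
  fix N :: "('a germ \<Rightarrow> complex) \<Rightarrow> real"
  assume ex: "exact_norm groupoid_P boundary_groupoid_P N"
  let ?A = "reduced_cstar (groupoid_P :: ('a germ, 'a character) groupoid)"
  let ?E = "cstar_completion (convolution_algebra boundary_groupoid_P N)"
  let ?\<phi> = "restriction_map boundary_groupoid_P N" and ?\<psi> = "quotient_proj \<circ> rho_e"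
  have N: "cstar_norm (convolution_algebra boundary_groupoid_P N)"
    and ker: "ext_zero_map groupoid_P ` carrier (reduced_cstar off_boundary_groupoid) = ker ?A ?E ?\<phi>"
    and surj: "?\<phi> ` carrier ?A = carrier ?E"
    using ex by (auto simp: exact_norm_def)
  obtain c where c: "\<And>f. f \<in> Cc groupoid_P \<Longrightarrow> N (restrict_fun boundary_groupoid_P f) \<le> c * reduced_norm groupoid_P f"
    using ex by (auto simp: exact_norm_def)
  interpret B: seminormed_function_algebra "convolution_algebra boundary_groupoid_P N"
    by (rule boundary_algebra[OF N])
  have \<phi>: "star_hom ?A ?E ?\<phi>" by (rule star_hom_restriction[OF N c])
  \<comment> \<open>The difference of \<open>x\<close> and \<open>y\<close> lies in the kernel of
    the restriction map. By exactness it comes from the complement of the boundary, which \<rho>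
    maps into the foundation ideal.\<close>
  have "?\<psi> x = ?\<psi> y" if x: "x \<in> carrier ?A" and y: "y \<in> carrier ?A" and xy: "?\<phi> x = ?\<phi> y" for x y
  proof -
    obtain u v where u: "u \<in> full_seqs" "x = full.cls u" and v: "v \<in> full_seqs" "y = full.cls v"
      using x y by (auto simp: carrier_reduced_cstar)
    let ?d = "add ?A x (scale ?A (- 1) y)"
    have sy: "scale ?A (- 1) y = full.cls (\<lambda>n g. - 1 * v n g)" "(\<lambda>n g. - 1 * v n g) \<in> full_seqs"
      using full.completion_scale[OF v(1)] full.cauchy_seqs_scale[OF v(1)] by (simp_all only: reduced_cstar_def v(2))
    have d: "?d = full.cls (\<lambda>n g. u n g + - 1 * v n g)" "(\<lambda>n g. u n g + - 1 * v n g) \<in> full_seqs"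
      using full.completion_add[OF u(1) sy(2)] full.cauchy_seqs_add[OF u(1) sy(2)]
      by (simp_all only: reduced_cstar_def u(2) sy(1)[unfolded reduced_cstar_def])
    have "?\<phi> ?d = add ?E (?\<phi> y) (scale ?E (- 1) (?\<phi> y))"
    proof -
      have "scale ?A (- 1) y \<in> carrier ?A" using sy by (simp add: carrier_reduced_cstar)
      then show ?thesis using \<phi> x y by (simp add: star_hom_def xy)
    qed
    \<comment> \<open>That -1 times an element is its additive inverse is read off from a
      representing sequence: the termwise sum is the zero sequence.\<close>
    also have "\<dots> = zero ?E"
    proof -
      have "?\<phi> y \<in> carrier ?E" using \<phi> y by (auto simp: star_hom_def)
      then obtain w where w: "w \<in> cauchy_seqs (convolution_algebra boundary_groupoid_P N)" "?\<phi> y = B.cls w"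
        by (auto simp: B.completion_carrier)
      show ?thesis
        unfolding w(2) B.completion_scale[OF w(1)] B.completion_add[OF w(1) B.cauchy_seqs_scale[OF w(1)]]
          B.completion_zero by simp
    qed
    finally have "?d \<in> ker ?A ?E ?\<phi>"
      using d by (simp add: ker_def carrier_reduced_cstar)
    then obtain z where z: "z \<in> cauchy_seqs (reduced_Cc off_boundary_groupoid)" "?d = full.cls z"
      unfolding ker[symmetric] ext_zero_map_image by blast
    have "rho_e ?d = rho_e (full.cls (\<lambda>n g. u n g + - 1 * v n g))" by (rule arg_cong[OF d(1)])
    also have "\<dots> = rho_e x + scale bounded_operators (- 1) (rho_e y)"
      unfolding u(2) v(2) by (simp only: rho_e_add[OF u(1) sy(2)] rho_e_scale[OF v(1)])
    finally have "rho_e ?d = rho_e x + scale bounded_operators (- 1) (rho_e y)" .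
    moreover have "scale bounded_operators (- 1) (rho_e y) = - rho_e y"
      by (rule blinfun_eqI) (simp only: scale_bounded_operators_apply ell2_scale_minus_one blinfun.minus_left)
    ultimately have "rho_e x - rho_e y \<in> foundation_ideal"
      using rho_e_off_boundary(2)[OF z(1)] z(2) by simp
    then show ?thesis by (simp add: quotient_proj_eq_iff)
  qed
  note eq = this
  have "\<exists>\<theta>. star_hom ?E monoid_quotient \<theta> \<and> (\<forall>x\<in>carrier ?A. \<theta> (?\<phi> x) = ?\<psi> x)"
  proof (rule star_hom_factor[OF \<phi> star_hom_quotient surj eq])
    fix x y assume "x \<in> carrier ?A" "y \<in> carrier ?A"
    then obtain u v where u: "u \<in> full_seqs" "x = full.cls u" and v: "v \<in> full_seqs" "y = full.cls v"
      by (auto simp: carrier_reduced_cstar)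
    show "add ?A x y \<in> carrier ?A" "mult ?A x y \<in> carrier ?A"
      using full.cauchy_seqs_add[OF u(1) v(1)] full.cauchy_seqs_mult[OF u(1) v(1)]
      by (simp_all add: reduced_cstar_def u v full.completion_add full.completion_mult full.completion_carrier)
  next
    fix x c assume "x \<in> carrier ?A"
    then obtain u where u: "u \<in> full_seqs" "x = full.cls u" by (auto simp: carrier_reduced_cstar)
    show "scale ?A c x \<in> carrier ?A" "star ?A x \<in> carrier ?A"
      using full.cauchy_seqs_scale[OF u(1), of c] full.cauchy_seqs_star[OF u(1)]
      by (simp_all add: reduced_cstar_def u full.completion_scale full.completion_star full.completion_carrier)
  qed
  then show "\<exists>\<theta>. star_hom ?E monoid_quotient \<theta> \<and> (\<forall>a\<in>carrier ?A. (\<theta> \<circ> ?\<phi>) a = ?\<psi> a)"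
    by (simp only: o_apply)
qed (rule ker_quotient)

end
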